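(* Let $\mathfrak{g}$ be a finite-dimensional complex Lie algebra with a symmetric nondegenerate $\mathrm{ad}$-invariant bilinear form, let $U=U_h\mathfrak{g}$ be the corresponding Drinfeld-Jimbo quantum group and let $C=Z(U)$ be the center of $U$. Let $M$ and $V$ be $U$-modules. Then $M\otimes V^{\otimes k}$ is a $CB_k$-module, where $CB_k$ is the group algebra over $C$ of the affine braid group $B_k$, with action given by $$\Phi: CB_k\to \mathrm{End}_U(M\otimes V^{\otimes k}),\qquad T_i\mapsto \check R_i\ (1\le i\le k-1),\qquad X^{\varepsilon_1}\mapsto \check R_0^2,\qquad z\mapsto z_M\ (z\in C),$$ where $z_M=z\otimes \mathrm{id}_V^{\otimes k}$, $$\check R_i=\mathrm{id}_M\otimes \mathrm{id}_V^{\otimes(i-1)}\otimes\check R_{VV}\otimes \mathrm{id}_V^{\otimes(k-i-1)}\qquad\text{and}\qquad \check R_0^2=(\check R_{MV}\check R_{VM})\otimes \mathrm{id}_V^{\otimes(k-1)}.$$ The $CB_k$-action commutes with the $U$-action on $M\otimes V^{\otimes k}$.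
   Context: The affine braid group $B_k$ is the group with generators $T_1,\dots,T_{k-1}$ and $X^{\varepsilon_1}$ and relations $T_iT_j=T_jT_i$ for $j\neq i\pm1$; $T_iT_{i+1}T_i=T_{i+1}T_iT_{i+1}$ for $1\le i\le k-2$; $X^{\varepsilon_1}T_1X^{\varepsilon_1}T_1=T_1X^{\varepsilon_1}T_1X^{\varepsilon_1}$; $X^{\varepsilon_1}T_i=T_iX^{\varepsilon_1}$ for $2\le i\le k-1$. $U=U_h\mathfrak g$ is a ribbon (quasitriangular) Hopf algebra with invertible $R$-matrix $\mathcal{R}=\sum_{\mathcal R}R_1\otimes R_2$ in $U\otimes U$ (suitably completed). For $U$-modules $M,N$ the map $$\check R_{MN}:M\otimes N\to N\otimes M,\qquad m\otimes n\mapsto \sum_{\mathcal R}R_2n\otimes R_1m$$ is a $U$-module isomorphism. Compositions of these maps are written with the map applied first on the left, so $\check R_{MV}\check R_{VM}$ is the endomorphism $M\otimes V\xrightarrow{\check R_{MV}}V\otimes M\xrightarrow{\check R_{VM}}M\otimes V$ of $M\otimes V$. *)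

theory Defs
  imports
    "HOL-Library.Poly_Mapping"
    "HOL-Computational_Algebra.Formal_Power_Series"
    "HOL-Analysis.Elementary_Topology"
    "HOL-Algebra.Algebraic_Closure_Type"
    "HOL-Algebra.QuotRing"
begin

section \<open>Modules over \<open>\<complex>[[h]]\<close> and completed tensor products\<close>

abbreviation KK :: "complex fps ring" where
  "KK \<equiv> ring_of_type_algebra"

definition linear_maps ::
    "('r, 'a) module \<Rightarrow> ('r, 'b) module \<Rightarrow> 'r set \<Rightarrow> ('a \<Rightarrow> 'b) set" where
  "linear_maps N W S = {f \<in> carrier N \<rightarrow> carrier W.
     (\<forall>x\<in>carrier N. \<forall>y\<in>carrier N. f (x \<oplus>\<^bsub>N\<^esub> y) = f x \<oplus>\<^bsub>W\<^esub> f y) \<and>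
     (\<forall>c\<in>S. \<forall>x\<in>carrier N. f (c \<odot>\<^bsub>N\<^esub> x) = c \<odot>\<^bsub>W\<^esub> f x)}"

definition quotient_module ::
    "('r, 'a) module \<Rightarrow> 'a set \<Rightarrow> ('r, 'a set) module" where
  "quotient_module N S =
     \<lparr>carrier = a_rcosets\<^bsub>N\<^esub> S, monoid.mult = undefined, one = undefined,
      zero = S, add = set_add N,
      module.smult = (\<lambda>c A. \<Union>a\<in>A. S +>\<^bsub>N\<^esub> (c \<odot>\<^bsub>N\<^esub> a))\<rparr>"

definition h_multiples :: "(complex fps, 'a) module \<Rightarrow> nat \<Rightarrow> 'a set" where
  "h_multiples N n = (\<lambda>x. (fps_X ^ n) \<odot>\<^bsub>N\<^esub> x) ` carrier N"

text \<open>The inverse limit of the quotients \<open>N / h\<^sup>n N\<close>; compatible sequences of cosets are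
  exactly the decreasing ones.\<close>

definition h_completion ::
    "(complex fps, 'a) module \<Rightarrow> (complex fps, nat \<Rightarrow> 'a set) module" where
  "h_completion N =
     \<lparr>carrier = {w. (\<forall>n. w n \<in> carrier (quotient_module N (h_multiples N n))) \<and>
                    (\<forall>n. w (Suc n) \<subseteq> w n)},
      monoid.mult = undefined, one = undefined,
      zero = (\<lambda>n. h_multiples N n),
      add = (\<lambda>w w' n. w n \<oplus>\<^bsub>quotient_module N (h_multiples N n)\<^esub> w' n),
      module.smult = (\<lambda>c w n. c \<odot>\<^bsub>quotient_module N (h_multiples N n)\<^esub> w n)\<rparr>"

definition to_completion :: "(complex fps, 'a) module \<Rightarrow> 'a \<Rightarrow> nat \<Rightarrow> 'a set" where
  "to_completion N x = (\<lambda>n. h_multiples N n +>\<^bsub>N\<^esub> x)"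

definition h_complete :: "(complex fps, 'a) module \<Rightarrow> bool" where
  "h_complete N \<longleftrightarrow>
     bij_betw (to_completion N) (carrier N) (carrier (h_completion N))"

definition h_torsion_free :: "(complex fps, 'a) module \<Rightarrow> bool" where
  "h_torsion_free N \<longleftrightarrow>
     (\<forall>x\<in>carrier N. fps_X \<odot>\<^bsub>N\<^esub> x = \<zero>\<^bsub>N\<^esub> \<longrightarrow> x = \<zero>\<^bsub>N\<^esub>)"

definition free_module :: "'b set \<Rightarrow> (complex fps, 'b \<Rightarrow>\<^sub>0 complex fps) module" where
  "free_module B =
     \<lparr>carrier = {p. Poly_Mapping.keys p \<subseteq> B}, monoid.mult = undefined, one = undefined,
      zero = 0, add = (+), module.smult = (\<lambda>c. Poly_Mapping.map ((*) c))\<rparr>"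

abbreviation tuples :: "('r, 'a) module list \<Rightarrow> 'a list set" where
  "tuples Ns \<equiv> listset (map carrier Ns)"

inductive_set multilinear_relations ::
    "(complex fps, 'a) module list \<Rightarrow> ('a list \<Rightarrow>\<^sub>0 complex fps) set"
  for Ns where
  zero: "0 \<in> multilinear_relations Ns"
| add: "p \<in> multilinear_relations Ns \<Longrightarrow> q \<in> multilinear_relations Ns \<Longrightarrow>
    p + q \<in> multilinear_relations Ns"
| smult: "p \<in> multilinear_relations Ns \<Longrightarrow>
    Poly_Mapping.map ((*) c) p \<in> multilinear_relations Ns"
| additive: "xs \<in> tuples Ns \<Longrightarrow> i < length Ns \<Longrightarrow>
    x \<in> carrier (Ns ! i) \<Longrightarrow> y \<in> carrier (Ns ! i) \<Longrightarrow>
    Poly_Mapping.single (xs[i := x \<oplus>\<^bsub>Ns ! i\<^esub> y]) 1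
      - Poly_Mapping.single (xs[i := x]) 1 - Poly_Mapping.single (xs[i := y]) 1
    \<in> multilinear_relations Ns"
| homogeneous: "xs \<in> tuples Ns \<Longrightarrow> i < length Ns \<Longrightarrow> x \<in> carrier (Ns ! i) \<Longrightarrow>
    Poly_Mapping.single (xs[i := c \<odot>\<^bsub>Ns ! i\<^esub> x]) 1 - Poly_Mapping.single (xs[i := x]) c
    \<in> multilinear_relations Ns"

definition tensor_module ::
    "(complex fps, 'a) module list \<Rightarrow> (complex fps, ('a list \<Rightarrow>\<^sub>0 complex fps) set) module" where
  "tensor_module Ns = quotient_module (free_module (tuples Ns)) (multilinear_relations Ns)"

type_synonym 'a tensor = "nat \<Rightarrow> ('a list \<Rightarrow>\<^sub>0 complex fps) set set"

text \<open>The completed tensor product of a list of modules.  Working with lists makes the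
  identifications \<open>(A \<otimes> B) \<otimes> C = A \<otimes> (B \<otimes> C)\<close> and \<open>A \<otimes> \<complex>[[h]] = A\<close> strict.
  The factors share one element type but have arbitrary carriers, so this does not restrict
  which modules may be tensored with one another.\<close>

definition ctensor ::
    "(complex fps, 'a) module list \<Rightarrow> (complex fps, 'a tensor) module" where
  "ctensor Ns = h_completion (tensor_module Ns)"

definition pure :: "(complex fps, 'a) module list \<Rightarrow> 'a list \<Rightarrow> 'a tensor" where
  "pure Ns xs = to_completion (tensor_module Ns)
     (multilinear_relations Ns +>\<^bsub>free_module (tuples Ns)\<^esub> Poly_Mapping.single xs 1)"

text \<open>The universal property: for \<open>W\<close> complete and \<open>f\<close> multilinear there is exactly one
  \<open>\<complex>[[h]]\<close>-linear map with \<open>x\<^sub>1 \<otimes> \<dots> \<otimes> x\<^sub>r \<mapsto> f [x\<^sub>1, \<dots>, x\<^sub>r]\<close> (linear maps are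
  automatically h-adically continuous).  Applied to an element \<open>R = \<Sum> R\<^sub>1 \<otimes> R\<^sub>2\<close> of a
  completed tensor product, the lift of \<open>f\<close> is the Sweedler-type sum \<open>\<Sum> f [R\<^sub>1, R\<^sub>2]\<close>.\<close>

definition lift ::
    "(complex fps, 'a) module list \<Rightarrow> (complex fps, 'b) module \<Rightarrow> ('a list \<Rightarrow> 'b) \<Rightarrow>
     'a tensor \<Rightarrow> 'b" where
  "lift Ns W f = (THE g. g \<in> extensional (carrier (ctensor Ns)) \<and>
     g \<in> linear_maps (ctensor Ns) W UNIV \<and>
     (\<forall>xs\<in>tuples Ns. g (pure Ns xs) = f xs))"

definition juxtapose ::
    "(complex fps, 'a) module list \<Rightarrow> (complex fps, 'a) module list \<Rightarrow>
     'a tensor \<Rightarrow> 'a tensor \<Rightarrow> 'a tensor" where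
  "juxtapose As Bs x y =
     lift As (ctensor (As @ Bs))
       (\<lambda>as. lift Bs (ctensor (As @ Bs)) (\<lambda>bs. pure (As @ Bs) (as @ bs)) y) x"

text \<open>The map \<open>id\<^sub>A \<otimes> f \<otimes> id\<^sub>C\<close> for \<open>f\<close> from the tensor product of \<open>Bs\<close> to that of \<open>Bs'\<close>.\<close>

definition id_tensor_id ::
    "(complex fps, 'a) module list \<Rightarrow> (complex fps, 'a) module list \<Rightarrow>
     (complex fps, 'a) module list \<Rightarrow> (complex fps, 'a) module list \<Rightarrow>
     ('a tensor \<Rightarrow> 'a tensor) \<Rightarrow> 'a tensor \<Rightarrow> 'a tensor" where
  "id_tensor_id As Bs Bs' Cs f =
     lift (As @ Bs @ Cs) (ctensor (As @ Bs' @ Cs))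
       (\<lambda>xs. juxtapose As (Bs' @ Cs)
          (pure As (take (length As) xs))
          (juxtapose Bs' Cs
             (f (pure Bs (take (length Bs) (drop (length As) xs))))
             (pure Cs (drop (length As + length Bs) xs))))"


section \<open>Topological ribbon Hopf algebras and their modules\<close>

locale h_algebra =
  fixes U :: "(complex fps, 'u) module"
  assumes ring: "ring U"
    and kmodule: "Module.module KK U"
    and smult_mult_left: "\<And>c a b. a \<in> carrier U \<Longrightarrow> b \<in> carrier U \<Longrightarrow>
          (c \<odot>\<^bsub>U\<^esub> a) \<otimes>\<^bsub>U\<^esub> b = c \<odot>\<^bsub>U\<^esub> (a \<otimes>\<^bsub>U\<^esub> b)"
    and smult_mult_right: "\<And>c a b. a \<in> carrier U \<Longrightarrow> b \<in> carrier U \<Longrightarrow>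
          a \<otimes>\<^bsub>U\<^esub> (c \<odot>\<^bsub>U\<^esub> b) = c \<odot>\<^bsub>U\<^esub> (a \<otimes>\<^bsub>U\<^esub> b)"
    and complete: "h_complete U"
    and torsion_free: "h_torsion_free U"

definition tensor_mult ::
    "(complex fps, 'u) module \<Rightarrow> nat \<Rightarrow> 'u tensor \<Rightarrow> 'u tensor \<Rightarrow> 'u tensor" where
  "tensor_mult U r x y =
     (let Us = replicate r U in
      lift Us (ctensor Us) (\<lambda>as. lift Us (ctensor Us)
        (\<lambda>bs. pure Us (map2 (monoid.mult U) as bs)) y) x)"

definition tensor_algebra_power ::
    "(complex fps, 'u) module \<Rightarrow> nat \<Rightarrow> (complex fps, 'u tensor) module" where
  "tensor_algebra_power U r = (ctensor (replicate r U))
     \<lparr>monoid.mult := tensor_mult U r, one := pure (replicate r U) (replicate r \<one>\<^bsub>U\<^esub>)\<rparr>"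

locale hopf_algebra = h_algebra U
  for U :: "(complex fps, 'u) module"
    and \<Delta> :: "'u \<Rightarrow> 'u tensor"
    and \<epsilon> :: "'u \<Rightarrow> complex fps"
    and S :: "'u \<Rightarrow> 'u" +
  assumes comult_hom: "\<Delta> \<in> ring_hom U (tensor_algebra_power U 2)"
    and comult_linear: "\<Delta> \<in> linear_maps U (ctensor [U, U]) UNIV"
    and counit_hom: "\<epsilon> \<in> ring_hom U KK"
    and counit_linear: "\<And>c a. a \<in> carrier U \<Longrightarrow> \<epsilon> (c \<odot>\<^bsub>U\<^esub> a) = c * \<epsilon> a"
    and antipode_linear: "S \<in> linear_maps U U UNIV"
    and coassoc: "\<And>a. a \<in> carrier U \<Longrightarrow>
          lift [U, U] (ctensor [U, U, U])
            (\<lambda>bs. juxtapose [U, U] [U] (\<Delta> (bs ! 0)) (pure [U] [bs ! 1])) (\<Delta> a) =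
          lift [U, U] (ctensor [U, U, U])
            (\<lambda>bs. juxtapose [U] [U, U] (pure [U] [bs ! 0]) (\<Delta> (bs ! 1))) (\<Delta> a)"
    and counit_left: "\<And>a. a \<in> carrier U \<Longrightarrow>
          lift [U, U] U (\<lambda>bs. \<epsilon> (bs ! 0) \<odot>\<^bsub>U\<^esub> bs ! 1) (\<Delta> a) = a"
    and counit_right: "\<And>a. a \<in> carrier U \<Longrightarrow>
          lift [U, U] U (\<lambda>bs. \<epsilon> (bs ! 1) \<odot>\<^bsub>U\<^esub> bs ! 0) (\<Delta> a) = a"
    and antipode_left: "\<And>a. a \<in> carrier U \<Longrightarrow>
          lift [U, U] U (\<lambda>bs. S (bs ! 0) \<otimes>\<^bsub>U\<^esub> bs ! 1) (\<Delta> a) = \<epsilon> a \<odot>\<^bsub>U\<^esub> \<one>\<^bsub>U\<^esub>"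
    and antipode_right: "\<And>a. a \<in> carrier U \<Longrightarrow>
          lift [U, U] U (\<lambda>bs. bs ! 0 \<otimes>\<^bsub>U\<^esub> S (bs ! 1)) (\<Delta> a) = \<epsilon> a \<odot>\<^bsub>U\<^esub> \<one>\<^bsub>U\<^esub>"

definition flip :: "(complex fps, 'u) module \<Rightarrow> 'u tensor \<Rightarrow> 'u tensor" where
  "flip U = lift [U, U] (ctensor [U, U]) (\<lambda>bs. pure [U, U] [bs ! 1, bs ! 0])"

definition leg12 :: "(complex fps, 'u) module \<Rightarrow> 'u tensor \<Rightarrow> 'u tensor" where
  "leg12 U = lift [U, U] (ctensor [U, U, U]) (\<lambda>bs. pure [U, U, U] [bs ! 0, bs ! 1, \<one>\<^bsub>U\<^esub>])"

definition leg13 :: "(complex fps, 'u) module \<Rightarrow> 'u tensor \<Rightarrow> 'u tensor" where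
  "leg13 U = lift [U, U] (ctensor [U, U, U]) (\<lambda>bs. pure [U, U, U] [bs ! 0, \<one>\<^bsub>U\<^esub>, bs ! 1])"

definition leg23 :: "(complex fps, 'u) module \<Rightarrow> 'u tensor \<Rightarrow> 'u tensor" where
  "leg23 U = lift [U, U] (ctensor [U, U, U]) (\<lambda>bs. pure [U, U, U] [\<one>\<^bsub>U\<^esub>, bs ! 0, bs ! 1])"

locale quasitriangular_hopf_algebra = hopf_algebra U \<Delta> \<epsilon> S
  for U :: "(complex fps, 'u) module" and \<Delta> \<epsilon> S +
  fixes R :: "'u tensor"
  assumes R_unit: "R \<in> Units (tensor_algebra_power U 2)"
    and R_intertwines: "\<And>a. a \<in> carrier U \<Longrightarrow>
          R \<otimes>\<^bsub>tensor_algebra_power U 2\<^esub> \<Delta> a =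
          flip U (\<Delta> a) \<otimes>\<^bsub>tensor_algebra_power U 2\<^esub> R"
    and hexagon_left:
          "lift [U, U] (ctensor [U, U, U])
             (\<lambda>bs. juxtapose [U, U] [U] (\<Delta> (bs ! 0)) (pure [U] [bs ! 1])) R =
           leg13 U R \<otimes>\<^bsub>tensor_algebra_power U 3\<^esub> leg23 U R"
    and hexagon_right:
          "lift [U, U] (ctensor [U, U, U])
             (\<lambda>bs. juxtapose [U] [U, U] (pure [U] [bs ! 0]) (\<Delta> (bs ! 1))) R =
           leg13 U R \<otimes>\<^bsub>tensor_algebra_power U 3\<^esub> leg12 U R"

definition center :: "('r, 'u) module \<Rightarrow> ('r, 'u) module" where
  "center U = U\<lparr>carrier := {z \<in> carrier U. \<forall>a\<in>carrier U. z \<otimes>\<^bsub>U\<^esub> a = a \<otimes>\<^bsub>U\<^esub> z}\<rparr>"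

definition drinfeld_element ::
    "(complex fps, 'u) module \<Rightarrow> ('u \<Rightarrow> 'u) \<Rightarrow> 'u tensor \<Rightarrow> 'u" where
  "drinfeld_element U S R = lift [U, U] U (\<lambda>bs. S (bs ! 1) \<otimes>\<^bsub>U\<^esub> bs ! 0) R"

locale ribbon_hopf_algebra = quasitriangular_hopf_algebra U \<Delta> \<epsilon> S R
  for U :: "(complex fps, 'u) module" and \<Delta> \<epsilon> S R +
  fixes v :: 'u
  assumes ribbon_central: "v \<in> carrier (center U)"
    and ribbon_square: "v \<otimes>\<^bsub>U\<^esub> v = drinfeld_element U S R \<otimes>\<^bsub>U\<^esub> S (drinfeld_element U S R)"
    and ribbon_antipode: "S v = v"
    and ribbon_counit: "\<epsilon> v = 1"
    and ribbon_comult: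
          "(flip U R \<otimes>\<^bsub>tensor_algebra_power U 2\<^esub> R) \<otimes>\<^bsub>tensor_algebra_power U 2\<^esub> \<Delta> v =
           pure [U, U] [v, v]"

text \<open>The library's locale \<^locale>\<open>module\<close> requires a commutative ring of scalars.\<close>

locale left_module = A: ring A + N: abelian_group N
  for A :: "('u, 'b) ring_scheme" (structure) and N :: "('u, 'a) module" (structure) +
  assumes act_closed: "a \<in> carrier A \<Longrightarrow> x \<in> carrier N \<Longrightarrow> a \<odot>\<^bsub>N\<^esub> x \<in> carrier N"
    and act_add_left: "a \<in> carrier A \<Longrightarrow> b \<in> carrier A \<Longrightarrow> x \<in> carrier N \<Longrightarrow>
          (a \<oplus>\<^bsub>A\<^esub> b) \<odot>\<^bsub>N\<^esub> x = a \<odot>\<^bsub>N\<^esub> x \<oplus>\<^bsub>N\<^esub> b \<odot>\<^bsub>N\<^esub> x"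
    and act_add_right: "a \<in> carrier A \<Longrightarrow> x \<in> carrier N \<Longrightarrow> y \<in> carrier N \<Longrightarrow>
          a \<odot>\<^bsub>N\<^esub> (x \<oplus>\<^bsub>N\<^esub> y) = a \<odot>\<^bsub>N\<^esub> x \<oplus>\<^bsub>N\<^esub> a \<odot>\<^bsub>N\<^esub> y"
    and act_mult: "a \<in> carrier A \<Longrightarrow> b \<in> carrier A \<Longrightarrow> x \<in> carrier N \<Longrightarrow>
          (a \<otimes>\<^bsub>A\<^esub> b) \<odot>\<^bsub>N\<^esub> x = a \<odot>\<^bsub>N\<^esub> (b \<odot>\<^bsub>N\<^esub> x)"
    and act_one: "x \<in> carrier N \<Longrightarrow> \<one>\<^bsub>A\<^esub> \<odot>\<^bsub>N\<^esub> x = x"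

definition with_action ::
    "('r, 'a) module \<Rightarrow> ('u \<Rightarrow> 'a \<Rightarrow> 'a) \<Rightarrow> ('u, 'a) module" where
  "with_action N act =
     \<lparr>carrier = carrier N, monoid.mult = monoid.mult N, one = one N, zero = zero N, add = add N,
      module.smult = act\<rparr>"

definition restrict_scalars ::
    "(complex fps, 'u) module \<Rightarrow> ('u, 'a) module \<Rightarrow> (complex fps, 'a) module" where
  "restrict_scalars U N = with_action N (\<lambda>c x. (c \<odot>\<^bsub>U\<^esub> \<one>\<^bsub>U\<^esub>) \<odot>\<^bsub>N\<^esub> x)"

definition factorwise_action ::
    "(complex fps, 'u) module \<Rightarrow> ('u, 'a) module list \<Rightarrow> 'u tensor \<Rightarrow> 'a tensor \<Rightarrow> 'a tensor" where
  "factorwise_action U Ns t w =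
     (let Us = replicate (length Ns) U; Ks = map (restrict_scalars U) Ns in
      lift Us (ctensor Ks)
        (\<lambda>as. lift Ks (ctensor Ks)
          (\<lambda>xs. pure Ks (map (\<lambda>i. (as ! i) \<odot>\<^bsub>Ns ! i\<^esub> (xs ! i)) [0..<length Ns])) w) t)"

primrec iterated_comult ::
    "(complex fps, 'u) module \<Rightarrow> ('u \<Rightarrow> 'u tensor) \<Rightarrow> ('u \<Rightarrow> complex fps) \<Rightarrow> nat \<Rightarrow>
     'u \<Rightarrow> 'u tensor" where
  "iterated_comult U \<Delta> \<epsilon> 0 a = \<epsilon> a \<odot>\<^bsub>ctensor []\<^esub> pure [] []"
| "iterated_comult U \<Delta> \<epsilon> (Suc r) a =
     lift [U, U] (ctensor (replicate (Suc r) U))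
       (\<lambda>bs. juxtapose [U] (replicate r U) (pure [U] [bs ! 0])
          (iterated_comult U \<Delta> \<epsilon> r (bs ! 1))) (\<Delta> a)"

definition tensor_umodule ::
    "(complex fps, 'u) module \<Rightarrow> ('u \<Rightarrow> 'u tensor) \<Rightarrow> ('u \<Rightarrow> complex fps) \<Rightarrow>
     ('u, 'a) module list \<Rightarrow> ('u, 'a tensor) module" where
  "tensor_umodule U \<Delta> \<epsilon> Ns =
     with_action (ctensor (map (restrict_scalars U) Ns))
       (\<lambda>a. factorwise_action U Ns (iterated_comult U \<Delta> \<epsilon> (length Ns) a))"

definition R_check ::
    "(complex fps, 'u) module \<Rightarrow> 'u tensor \<Rightarrow> ('u, 'a) module \<Rightarrow> ('u, 'a) module \<Rightarrow>
     'a tensor \<Rightarrow> 'a tensor" where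
  "R_check U R M N =
     (let M' = restrict_scalars U M; N' = restrict_scalars U N in
      lift [M', N'] (ctensor [N', M'])
        (\<lambda>xs. lift [U, U] (ctensor [N', M'])
          (\<lambda>bs. pure [N', M'] [(bs ! 1) \<odot>\<^bsub>N\<^esub> (xs ! 1), (bs ! 0) \<odot>\<^bsub>M\<^esub> (xs ! 0)]) R))"

definition End_ring :: "('u, 'b) ring_scheme \<Rightarrow> ('u, 'a) module \<Rightarrow> ('a \<Rightarrow> 'a) ring" where
  "End_ring A W =
     \<lparr>carrier = linear_maps W W (carrier A) \<inter> extensional (carrier W),
      monoid.mult = compose (carrier W),
      one = (\<lambda>x\<in>carrier W. x),
      zero = (\<lambda>x\<in>carrier W. \<zero>\<^bsub>W\<^esub>),
      add = (\<lambda>f g. \<lambda>x\<in>carrier W. f x \<oplus>\<^bsub>W\<^esub> g x)\<rparr>"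


section \<open>Affine braid groups and group algebras\<close>

text \<open>Groups given by generators and relations.  The letter \<open>(s, True)\<close> stands for the
  generator \<open>s\<close>, and \<open>(s, False)\<close> for its inverse.\<close>

inductive presented_eq ::
    "'s set \<Rightarrow> ('s list \<times> 's list) set \<Rightarrow> ('s \<times> bool) list \<Rightarrow> ('s \<times> bool) list \<Rightarrow> bool"
  for S Rel where
  refl: "w \<in> lists (S \<times> UNIV) \<Longrightarrow> presented_eq S Rel w w"
| sym: "presented_eq S Rel u w \<Longrightarrow> presented_eq S Rel w u"
| trans: "presented_eq S Rel u w \<Longrightarrow> presented_eq S Rel w x \<Longrightarrow> presented_eq S Rel u x"
| append: "presented_eq S Rel u u' \<Longrightarrow> presented_eq S Rel w w' \<Longrightarrow>
    presented_eq S Rel (u @ w) (u' @ w')"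
| cancel: "s \<in> S \<Longrightarrow> presented_eq S Rel [(s, b), (s, \<not> b)] []"
| rel: "(u, w) \<in> Rel \<Longrightarrow>
    presented_eq S Rel (map (\<lambda>s. (s, True)) u) (map (\<lambda>s. (s, True)) w)"

definition word_class ::
    "'s set \<Rightarrow> ('s list \<times> 's list) set \<Rightarrow> ('s \<times> bool) list \<Rightarrow> ('s \<times> bool) list set" where
  "word_class S Rel w = {u. presented_eq S Rel w u}"

definition presented_group ::
    "'s set \<Rightarrow> ('s list \<times> 's list) set \<Rightarrow> ('s \<times> bool) list set monoid" where
  "presented_group S Rel =
     \<lparr>carrier = word_class S Rel ` lists (S \<times> UNIV),
      monoid.mult = (\<lambda>A B. \<Union>u\<in>A. \<Union>w\<in>B. word_class S Rel (u @ w)),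
      one = word_class S Rel []\<rparr>"

datatype braid_gen = T nat | X1

definition affine_braid_gens :: "nat \<Rightarrow> braid_gen set" where
  "affine_braid_gens k = insert X1 (T ` {1..k - 1})"

definition affine_braid_rels :: "nat \<Rightarrow> (braid_gen list \<times> braid_gen list) set" where
  "affine_braid_rels k =
     {([T i, T j], [T j, T i]) | i j.
        i \<in> {1..k - 1} \<and> j \<in> {1..k - 1} \<and> j \<noteq> i + 1 \<and> i \<noteq> j + 1} \<union>
     {([T i, T (i + 1), T i], [T (i + 1), T i, T (i + 1)]) | i. 1 \<le> i \<and> i + 2 \<le> k} \<union>
     {([X1, T 1, X1, T 1], [T 1, X1, T 1, X1]) |_::unit. 2 \<le> k} \<union>
     {([X1, T i], [T i, X1]) | i. 2 \<le> i \<and> i + 1 \<le> k}"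

abbreviation affine_braid_group :: "nat \<Rightarrow> (braid_gen \<times> bool) list set monoid" where
  "affine_braid_group k \<equiv> presented_group (affine_braid_gens k) (affine_braid_rels k)"

definition braid_generator :: "nat \<Rightarrow> braid_gen \<Rightarrow> (braid_gen \<times> bool) list set" where
  "braid_generator k s = word_class (affine_braid_gens k) (affine_braid_rels k) [(s, True)]"

definition group_algebra ::
    "('c, 'b) ring_scheme \<Rightarrow> 'g monoid \<Rightarrow> ('g \<Rightarrow> 'c) ring" where
  "group_algebra C G =
     \<lparr>carrier = {x \<in> carrier G \<rightarrow>\<^sub>E carrier C. finite {g \<in> carrier G. x g \<noteq> \<zero>\<^bsub>C\<^esub>}},
      monoid.mult = (\<lambda>x y. \<lambda>g\<in>carrier G.
        \<Oplus>\<^bsub>C\<^esub>h\<in>{h \<in> carrier G. x h \<noteq> \<zero>\<^bsub>C\<^esub>}. x h \<otimes>\<^bsub>C\<^esub> y (inv\<^bsub>G\<^esub> h \<otimes>\<^bsub>G\<^esub> g)),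
      one = (\<lambda>g\<in>carrier G. if g = \<one>\<^bsub>G\<^esub> then \<one>\<^bsub>C\<^esub> else \<zero>\<^bsub>C\<^esub>),
      zero = (\<lambda>g\<in>carrier G. \<zero>\<^bsub>C\<^esub>),
      add = (\<lambda>x y. \<lambda>g\<in>carrier G. x g \<oplus>\<^bsub>C\<^esub> y g)\<rparr>"

definition group_algebra_monom ::
    "('c, 'b) ring_scheme \<Rightarrow> 'g monoid \<Rightarrow> 'c \<Rightarrow> 'g \<Rightarrow> 'g \<Rightarrow> 'c" where
  "group_algebra_monom C G c g = (\<lambda>x\<in>carrier G. if x = g then c else \<zero>\<^bsub>C\<^esub>)"


section \<open>Drinfeld-Jimbo quantum groups\<close>

locale quadratic_lie_algebra =
  fixes sc :: "complex \<Rightarrow> 'g \<Rightarrow> 'g::ab_group_add"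
    and br :: "'g \<Rightarrow> 'g \<Rightarrow> 'g"
    and form :: "'g \<Rightarrow> 'g \<Rightarrow> complex"
  assumes vector_space: "vector_space sc"
    and finite_dim: "\<exists>B. finite B \<and> module.span sc B = UNIV"
    and br_add_left: "br (x + y) z = br x z + br y z"
    and br_scale_left: "br (sc c x) y = sc c (br x y)"
    and br_alternating: "br x x = 0"
    and br_add_right: "br x (y + z) = br x y + br x z"
    and br_scale_right: "br x (sc c y) = sc c (br x y)"
    and jacobi: "br x (br y z) + br y (br z x) + br z (br x y) = 0"
    and form_add: "form (x + y) z = form x z + form y z"
    and form_scale: "form (sc c x) y = c * form x y"
    and form_sym: "form x y = form y x"
    and form_nondegenerate: "(\<forall>y. form x y = 0) \<Longrightarrow> x = 0"
    and form_invariant: "form (br x y) z = form x (br y z)"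

text \<open>The choice of a Cartan subalgebra \<open>H\<close> and of Chevalley generators
  \<open>e i, f i\<close> (\<open>i < l\<close>) with simple roots \<open>\<alpha> i\<close> and simple coroots \<open>[e i, f i]\<close>, on which
  the Drinfeld-Jimbo presentation is based.  The centre of the Lie algebra may be nonzero; it
  is contained in \<open>H\<close>.\<close>

locale chevalley_generators = quadratic_lie_algebra sc br form
  for sc :: "complex \<Rightarrow> 'g \<Rightarrow> 'g::ab_group_add" and br form +
  fixes H :: "'g set" and l :: nat and e f :: "nat \<Rightarrow> 'g"
    and \<alpha> :: "nat \<Rightarrow> 'g \<Rightarrow> complex"
  assumes cartan_subspace: "module.subspace sc H"
    and cartan_abelian: "a \<in> H \<Longrightarrow> b \<in> H \<Longrightarrow> br a b = 0"
    and br_cartan_e: "a \<in> H \<Longrightarrow> i < l \<Longrightarrow> br a (e i) = sc (\<alpha> i a) (e i)"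
    and br_cartan_f: "a \<in> H \<Longrightarrow> i < l \<Longrightarrow> br a (f i) = sc (- \<alpha> i a) (f i)"
    and coroot_in_cartan: "i < l \<Longrightarrow> br (e i) (f i) \<in> H"
    and br_e_f: "i < l \<Longrightarrow> j < l \<Longrightarrow> i \<noteq> j \<Longrightarrow> br (e i) (f j) = 0"
    and root_on_coroot: "i < l \<Longrightarrow> \<alpha> i (br (e i) (f i)) = 2"
    and roots_independent:
          "(\<forall>a\<in>H. (\<Sum>i<l. c i * \<alpha> i a) = 0) \<Longrightarrow> i < l \<Longrightarrow> c i = 0"
    and generated: "module.subspace sc L \<Longrightarrow> (\<forall>x\<in>L. \<forall>y\<in>L. br x y \<in> L) \<Longrightarrow>
          H \<subseteq> L \<Longrightarrow> e ` {..<l} \<subseteq> L \<Longrightarrow> f ` {..<l} \<subseteq> L \<Longrightarrow> L = UNIV"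

datatype 's free_word = FWord (letters: "'s list")

instantiation free_word :: (type) monoid_add
begin
definition zero_free_word :: "'a free_word" where
  "zero_free_word = FWord []"
definition plus_free_word :: "'a free_word \<Rightarrow> 'a free_word \<Rightarrow> 'a free_word" where
  "plus_free_word u w = FWord (letters u @ letters w)"
instance
  by standard (simp_all add: zero_free_word_def plus_free_word_def)
end

datatype 'g qg_gen = QH 'g | QE nat | QF nat

type_synonym 'g free_alg = "'g qg_gen free_word \<Rightarrow>\<^sub>0 complex"

text \<open>The h-adically completed free \<open>\<complex>[[h]]\<close>-algebra on the generators is the algebra of power
  series over the free \<open>\<complex>\<close>-algebra; \<^const>\<open>fps_X\<close> is \<open>h\<close>.\<close>

type_synonym 'g free_h_alg = "'g free_alg fps"

definition qgen :: "'g qg_gen \<Rightarrow> 'g free_h_alg" where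
  "qgen s = fps_const (Poly_Mapping.single (FWord [s]) 1)"

definition qscalar :: "complex fps \<Rightarrow> 'g free_h_alg" where
  "qscalar c = Abs_fps (\<lambda>n. Poly_Mapping.single 0 (fps_nth c n))"

text \<open>The series \<open>exp (h a)\<close>.\<close>

definition h_exp :: "'g free_alg \<Rightarrow> 'g free_h_alg" where
  "h_exp a = Abs_fps (\<lambda>n. Poly_Mapping.single 0 (1 / fact n) * a ^ n)"

text \<open>With \<open>q = exp (h c)\<close>, the symmetric q-integer \<open>(q\<^sup>m - q\<^sup>-\<^sup>m) / (q - q\<^sup>-\<^sup>1)\<close>, as an
  element of \<open>\<complex>[[h]]\<close>.\<close>

definition q_int :: "complex \<Rightarrow> nat \<Rightarrow> complex fps" where
  "q_int c m = (\<Sum>r<m. fps_exp (c * (of_nat m - 1 - 2 * of_nat r)))"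

definition q_fact :: "complex \<Rightarrow> nat \<Rightarrow> complex fps" where
  "q_fact c n = (\<Prod>m=1..n. q_int c m)"

definition q_binom :: "complex \<Rightarrow> nat \<Rightarrow> nat \<Rightarrow> complex fps" where
  "q_binom c n s = q_fact c n / (q_fact c s * q_fact c (n - s))"

definition q_serre :: "complex \<Rightarrow> nat \<Rightarrow> 'g free_h_alg \<Rightarrow> 'g free_h_alg \<Rightarrow> 'g free_h_alg" where
  "q_serre c n x y =
     (\<Sum>s\<le>n. qscalar ((- 1) ^ s * q_binom c n s) * (x ^ s * y * x ^ (n - s)))"

text \<open>Under the isomorphism of \<open>H\<close> with its dual given by the form, the simple root \<open>\<alpha> i\<close>
  corresponds to \<open>d i\<close> times the coroot, where \<open>d i = 1 / \<langle>e i, f i\<rangle> = \<langle>\<alpha> i, \<alpha> i\<rangle> / 2\<close>.  The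
  element \<open>qexp t i\<close> is \<open>exp (t h d\<^sub>i H\<^sub>i)\<close>.\<close>

definition d_coeff :: "('g \<Rightarrow> 'g \<Rightarrow> complex) \<Rightarrow> (nat \<Rightarrow> 'g) \<Rightarrow> (nat \<Rightarrow> 'g) \<Rightarrow> nat \<Rightarrow> complex" where
  "d_coeff form e f i = 1 / form (e i) (f i)"

definition qexp ::
    "('g \<Rightarrow> 'g \<Rightarrow> 'g) \<Rightarrow> ('g \<Rightarrow> 'g \<Rightarrow> complex) \<Rightarrow> (nat \<Rightarrow> 'g) \<Rightarrow> (nat \<Rightarrow> 'g) \<Rightarrow>
     complex \<Rightarrow> nat \<Rightarrow> 'g free_h_alg" where
  "qexp br form e f t i =
     h_exp (Poly_Mapping.single (FWord [QH (br (e i) (f i))]) (t * d_coeff form e f i))"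

text \<open>The element \<open>(exp (h d\<^sub>i H\<^sub>i / 2) - exp (- h d\<^sub>i H\<^sub>i / 2)) / (exp (h d\<^sub>i / 2) - exp (- h d\<^sub>i / 2))\<close>,
  in which both numerator and denominator are divided by \<open>h\<close> before taking the quotient.\<close>

definition qcartan ::
    "('g \<Rightarrow> 'g \<Rightarrow> 'g) \<Rightarrow> ('g \<Rightarrow> 'g \<Rightarrow> complex) \<Rightarrow> (nat \<Rightarrow> 'g) \<Rightarrow> (nat \<Rightarrow> 'g) \<Rightarrow>
     nat \<Rightarrow> 'g free_h_alg" where
  "qcartan br form e f i =
     qscalar (inverse (fps_shift 1 (fps_exp (d_coeff form e f i / 2)
                                    - fps_exp (- d_coeff form e f i / 2)))) *
     fps_shift 1 (qexp br form e f (1/2) i - qexp br form e f (- 1/2) i)"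

text \<open>The generators \<open>QH a\<close> with \<open>a \<notin> H\<close> and \<open>QE i, QF i\<close> with \<open>i \<ge> l\<close> are present in the type
  only and are set to zero.\<close>

inductive_set quantum_relations ::
    "(complex \<Rightarrow> 'g \<Rightarrow> 'g::ab_group_add) \<Rightarrow> ('g \<Rightarrow> 'g \<Rightarrow> 'g) \<Rightarrow> ('g \<Rightarrow> 'g \<Rightarrow> complex) \<Rightarrow>
     'g set \<Rightarrow> nat \<Rightarrow> (nat \<Rightarrow> 'g) \<Rightarrow> (nat \<Rightarrow> 'g) \<Rightarrow> (nat \<Rightarrow> 'g \<Rightarrow> complex) \<Rightarrow> 'g free_h_alg set"
  for sc br form H l e f \<alpha> where
  no_H: "a \<notin> H \<Longrightarrow> qgen (QH a) \<in> quantum_relations sc br form H l e f \<alpha>"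
| no_E: "i \<ge> l \<Longrightarrow> qgen (QE i) \<in> quantum_relations sc br form H l e f \<alpha>"
| no_F: "i \<ge> l \<Longrightarrow> qgen (QF i) \<in> quantum_relations sc br form H l e f \<alpha>"
| H_add: "a \<in> H \<Longrightarrow> b \<in> H \<Longrightarrow> qgen (QH (a + b)) - qgen (QH a) - qgen (QH b)
    \<in> quantum_relations sc br form H l e f \<alpha>"
| H_scale: "a \<in> H \<Longrightarrow> qgen (QH (sc c a)) - qscalar (fps_const c) * qgen (QH a)
    \<in> quantum_relations sc br form H l e f \<alpha>"
| H_H: "a \<in> H \<Longrightarrow> b \<in> H \<Longrightarrow> qgen (QH a) * qgen (QH b) - qgen (QH b) * qgen (QH a)
    \<in> quantum_relations sc br form H l e f \<alpha>"
| H_E: "a \<in> H \<Longrightarrow> i < l \<Longrightarrow>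
    qgen (QH a) * qgen (QE i) - qgen (QE i) * qgen (QH a)
      - qscalar (fps_const (\<alpha> i a)) * qgen (QE i)
    \<in> quantum_relations sc br form H l e f \<alpha>"
| H_F: "a \<in> H \<Longrightarrow> i < l \<Longrightarrow>
    qgen (QH a) * qgen (QF i) - qgen (QF i) * qgen (QH a)
      + qscalar (fps_const (\<alpha> i a)) * qgen (QF i)
    \<in> quantum_relations sc br form H l e f \<alpha>"
| E_F: "i < l \<Longrightarrow> j < l \<Longrightarrow>
    qgen (QE i) * qgen (QF j) - qgen (QF j) * qgen (QE i)
      - (if i = j then qcartan br form e f i else 0)
    \<in> quantum_relations sc br form H l e f \<alpha>"
| serre_E: "i < l \<Longrightarrow> j < l \<Longrightarrow> i \<noteq> j \<Longrightarrow> of_nat n = 1 - \<alpha> j (br (e i) (f i)) \<Longrightarrow>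
    q_serre (d_coeff form e f i / 2) n (qgen (QE i)) (qgen (QE j))
    \<in> quantum_relations sc br form H l e f \<alpha>"
| serre_F: "i < l \<Longrightarrow> j < l \<Longrightarrow> i \<noteq> j \<Longrightarrow> of_nat n = 1 - \<alpha> j (br (e i) (f i)) \<Longrightarrow>
    q_serre (d_coeff form e f i / 2) n (qgen (QF i)) (qgen (QF j))
    \<in> quantum_relations sc br form H l e f \<alpha>"

text \<open>The h-adically closed two-sided ideal generated by the relations: the metric of the type
  \<^typ>\<open>'a fps\<close> is the h-adic one.\<close>

definition quantum_ideal ::
    "(complex \<Rightarrow> 'g \<Rightarrow> 'g::ab_group_add) \<Rightarrow> ('g \<Rightarrow> 'g \<Rightarrow> 'g) \<Rightarrow> ('g \<Rightarrow> 'g \<Rightarrow> complex) \<Rightarrow>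
     'g set \<Rightarrow> nat \<Rightarrow> (nat \<Rightarrow> 'g) \<Rightarrow> (nat \<Rightarrow> 'g) \<Rightarrow> (nat \<Rightarrow> 'g \<Rightarrow> complex) \<Rightarrow> 'g free_h_alg set" where
  "quantum_ideal sc br form H l e f \<alpha> =
     closure (Idl\<^bsub>ring_of_type_algebra\<^esub> (quantum_relations sc br form H l e f \<alpha>))"

definition quantum_class ::
    "(complex \<Rightarrow> 'g \<Rightarrow> 'g::ab_group_add) \<Rightarrow> ('g \<Rightarrow> 'g \<Rightarrow> 'g) \<Rightarrow> ('g \<Rightarrow> 'g \<Rightarrow> complex) \<Rightarrow>
     'g set \<Rightarrow> nat \<Rightarrow> (nat \<Rightarrow> 'g) \<Rightarrow> (nat \<Rightarrow> 'g) \<Rightarrow> (nat \<Rightarrow> 'g \<Rightarrow> complex) \<Rightarrow>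
     'g free_h_alg \<Rightarrow> 'g free_h_alg set" where
  "quantum_class sc br form H l e f \<alpha> x =
     quantum_ideal sc br form H l e f \<alpha> +>\<^bsub>ring_of_type_algebra\<^esub> x"

definition quantum_group ::
    "(complex \<Rightarrow> 'g \<Rightarrow> 'g::ab_group_add) \<Rightarrow> ('g \<Rightarrow> 'g \<Rightarrow> 'g) \<Rightarrow> ('g \<Rightarrow> 'g \<Rightarrow> complex) \<Rightarrow>
     'g set \<Rightarrow> nat \<Rightarrow> (nat \<Rightarrow> 'g) \<Rightarrow> (nat \<Rightarrow> 'g) \<Rightarrow> (nat \<Rightarrow> 'g \<Rightarrow> complex) \<Rightarrow>
     (complex fps, 'g free_h_alg set) module" where
  "quantum_group sc br form H l e f \<alpha> =
     (let Q = ring_of_type_algebra Quot quantum_ideal sc br form H l e f \<alpha> in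
      \<lparr>carrier = carrier Q, monoid.mult = monoid.mult Q, one = one Q, zero = zero Q, add = add Q,
       module.smult = (\<lambda>c A. quantum_class sc br form H l e f \<alpha> (qscalar c) \<otimes>\<^bsub>Q\<^esub> A)\<rparr>)"

text \<open>Drinfeld's comultiplication, on generators:
  \<open>\<Delta>(a) = a \<otimes> 1 + 1 \<otimes> a\<close>, \<open>\<Delta>(E\<^sub>i) = E\<^sub>i \<otimes> exp (h d\<^sub>i H\<^sub>i / 4) + exp (- h d\<^sub>i H\<^sub>i / 4) \<otimes> E\<^sub>i\<close>,
  and likewise for \<open>F\<^sub>i\<close>.  The counit and the antipode are determined by it.\<close>

definition quantum_group_comult ::
    "(complex \<Rightarrow> 'g \<Rightarrow> 'g::ab_group_add) \<Rightarrow> ('g \<Rightarrow> 'g \<Rightarrow> 'g) \<Rightarrow> ('g \<Rightarrow> 'g \<Rightarrow> complex) \<Rightarrow>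
     'g set \<Rightarrow> nat \<Rightarrow> (nat \<Rightarrow> 'g) \<Rightarrow> (nat \<Rightarrow> 'g) \<Rightarrow> (nat \<Rightarrow> 'g \<Rightarrow> complex) \<Rightarrow>
     ('g free_h_alg set \<Rightarrow> 'g free_h_alg set tensor) \<Rightarrow> bool" where
  "quantum_group_comult sc br form H l e f \<alpha> \<Delta> \<longleftrightarrow>
     (let U = quantum_group sc br form H l e f \<alpha>;
          UU = ctensor [U, U];
          cl = quantum_class sc br form H l e f \<alpha>;
          q = qexp br form e f in
      (\<forall>a\<in>H. \<Delta> (cl (qgen (QH a))) =
         pure [U, U] [cl (qgen (QH a)), \<one>\<^bsub>U\<^esub>] \<oplus>\<^bsub>UU\<^esub> pure [U, U] [\<one>\<^bsub>U\<^esub>, cl (qgen (QH a))]) \<and>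
      (\<forall>i<l. \<forall>s\<in>{QE i, QF i}. \<Delta> (cl (qgen s)) =
         pure [U, U] [cl (qgen s), cl (q (1/4) i)] \<oplus>\<^bsub>UU\<^esub>
         pure [U, U] [cl (q (- 1/4) i), cl (qgen s)]))"

end

theory Submission
  imports Defs
begin

text \<open>The proof has two halves: a calculus of operators on completed tensor products, in which the
relations of the affine braid group become identities between a few operators, and a formal part,
in which units of a ring satisfying the relations of a presentation are extended to a homomorphism
of the group algebra.

The tensor product \<open>M \<otimes> V \<otimes> \<dots> \<otimes> V\<close> is completed in the h-adic topology. Its
universal property is that of an algebraic tensor product followed by a completion: a multilinear
map into an h-adically complete module factors in a unique way through \<open>pure\<close>
(\<open>lift_lin\<close>, \<open>lift_pure\<close>, \<open>ctensor_ext\<close>). Hence linear maps may be compared on pure tensors.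
The rules for computing with these operators are linear in each vector and in each element of
\<open>U \<otimes> U\<close>, so they are verified on pure tensors and then applied to \<open>R\<close> and \<open>\<Delta>(a)\<close>, which
need not be finite sums of pure tensors.

For \<open>U\<close>-modules \<open>A, B\<close> the operator of \<open>R\<close> is the flip after the factorwise action of \<open>R\<close>.
From \<open>R \<Delta>(a) = \<Delta>\<^sup>o\<^sup>p(a) R\<close> it is \<open>U\<close>-linear
(\<open>Rc_intertwines\<close>) and from the invertibility of \<open>R\<close> it is invertible (\<open>Rc_inverse\<close>). The
identity \<open>(\<Delta> \<otimes> id)(R) = R\<^sub>1\<^sub>3 R\<^sub>2\<^sub>3\<close> says that moving \<open>C\<close> past \<open>A \<otimes> B\<close> is
moving it past \<open>B\<close> and then past \<open>A\<close> (\<open>hexagon\<close>). Since the composite move is expressed by the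
action of \<open>\<Delta>\<close> on \<open>A \<otimes> B\<close>, it commutes with the operator on \<open>A \<otimes> B\<close>; this is the
Yang-Baxter equation for three arbitrary modules (\<open>yang_baxter\<close>). It gives the braid relation of
\<open>T\<^sub>i\<close> and \<open>T\<^sub>i\<^sub>+\<^sub>1\<close>, and three instances of it, for the orders \<open>M V V\<close>, \<open>V M V\<close> and
\<open>V V M\<close>, give \<open>X T\<^sub>1 X T\<^sub>1 = T\<^sub>1 X T\<^sub>1 X\<close> for the double braiding \<open>X\<close> of \<open>M\<close> and \<open>V\<close>
(\<open>reflection_equation\<close>). The remaining relations concern operators on disjoint sets of factors
(\<open>idt_commute\<close>). A map \<open>id \<otimes> f \<otimes> id\<close> with \<open>f\<close> being \<open>U\<close>-linear is \<open>U\<close>-linear by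
coassociativity (\<open>ulin_idt\<close>).

A central element \<open>z\<close> acts on the factor \<open>M\<close> as \<open>z \<otimes> 1 \<otimes> \<dots> \<otimes> 1\<close>, an element that is
central in the tensor power of \<open>U\<close>. Therefore this operator is \<open>U\<close>-linear, depends
multiplicatively on \<open>z\<close> (\<open>central_hom\<close>), and is carried along by the braidings
(\<open>braiding_center\<close>), so that it commutes with the operators of the braid group.

In the formal part, units subject to the relations define a homomorphism of the presented group
(locale \<open>presentation_rep\<close>), which together with a commuting ring homomorphism of the coefficients
extends to the group algebra (\<open>GA_extend\<close>). The extension is the only one because the group algebra
is spanned by monomials and the image of a generator determines that of its inverse
(\<open>presented_group_algebra_hom\<close>). Taking the ring of \<open>U\<close>-endomorphisms as the target yields the
module structure and its compatibility with the action of \<open>U\<close> at the same time.\<close>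

section \<open>Modules over \<open>\<complex>[[h]]\<close>\<close>

abbreviation kmod :: "(complex fps, 'a) module \<Rightarrow> bool" where
  "kmod N \<equiv> Module.module KK N"

abbreviation lin ::
    "(complex fps, 'a) module \<Rightarrow> (complex fps, 'b) module \<Rightarrow> ('a \<Rightarrow> 'b) set" where
  "lin N W \<equiv> linear_maps N W UNIV"

abbreviation tensors :: "(complex fps, 'a) module list \<Rightarrow> 'a tensor set" where
  "tensors Ns \<equiv> carrier (ctensor Ns)"

abbreviation tlin ::
    "(complex fps, 'a) module list \<Rightarrow> (complex fps, 'b) module list \<Rightarrow> ('a tensor \<Rightarrow> 'b tensor) set" where
  "tlin Ns Ms \<equiv> lin (ctensor Ns) (ctensor Ms)"

abbreviation "idt \<equiv> id_tensor_id"

lemma KK_simps [simp]: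
  "carrier KK = UNIV" "x \<oplus>\<^bsub>KK\<^esub> y = x + y" "x \<otimes>\<^bsub>KK\<^esub> y = x * y"
  "\<one>\<^bsub>KK\<^esub> = 1" "\<zero>\<^bsub>KK\<^esub> = 0"
  by (simp_all add: ring_of_type_algebra_def)

lemma cring_KK: "cring KK"
  by (rule cring_from_type_algebra)

lemma kmod_abelian_group: "kmod N \<Longrightarrow> abelian_group N"
  unfolding Module.module_def by blast

lemma kmodI:
  assumes "abelian_group N"
    and "\<And>c x. x \<in> carrier N \<Longrightarrow> c \<odot>\<^bsub>N\<^esub> x \<in> carrier N"
    and "\<And>a b x. x \<in> carrier N \<Longrightarrow> (a + b) \<odot>\<^bsub>N\<^esub> x = a \<odot>\<^bsub>N\<^esub> x \<oplus>\<^bsub>N\<^esub> b \<odot>\<^bsub>N\<^esub> x"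
    and "\<And>a x y. x \<in> carrier N \<Longrightarrow> y \<in> carrier N \<Longrightarrow>
      a \<odot>\<^bsub>N\<^esub> (x \<oplus>\<^bsub>N\<^esub> y) = a \<odot>\<^bsub>N\<^esub> x \<oplus>\<^bsub>N\<^esub> a \<odot>\<^bsub>N\<^esub> y"
    and "\<And>a b x. x \<in> carrier N \<Longrightarrow> (a * b) \<odot>\<^bsub>N\<^esub> x = a \<odot>\<^bsub>N\<^esub> (b \<odot>\<^bsub>N\<^esub> x)"
    and "\<And>x. x \<in> carrier N \<Longrightarrow> 1 \<odot>\<^bsub>N\<^esub> x = x"
  shows "kmod N"
  by (rule moduleI) (use assms cring_KK in auto)

context
  fixes N :: "(complex fps, 'a) module"
  assumes N: "kmod N"
begin

interpretation N: Module.module KK N by (rule N)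

lemma kmod_smult [simp]: "x \<in> carrier N \<Longrightarrow> c \<odot>\<^bsub>N\<^esub> x \<in> carrier N"
  by simp

lemma kmod_add [simp]:
  "x \<in> carrier N \<Longrightarrow> y \<in> carrier N \<Longrightarrow> x \<oplus>\<^bsub>N\<^esub> y \<in> carrier N"
  by simp

lemma kmod_zero [simp]: "\<zero>\<^bsub>N\<^esub> \<in> carrier N"
  by simp

lemma kmod_add_zero [simp]:
  "x \<in> carrier N \<Longrightarrow> x \<oplus>\<^bsub>N\<^esub> \<zero>\<^bsub>N\<^esub> = x" "x \<in> carrier N \<Longrightarrow> \<zero>\<^bsub>N\<^esub> \<oplus>\<^bsub>N\<^esub> x = x"
  by simp_all

lemma kmod_add_ac:
  assumes "x \<in> carrier N" "y \<in> carrier N"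
  shows "x \<oplus>\<^bsub>N\<^esub> y = y \<oplus>\<^bsub>N\<^esub> x"
    and "z \<in> carrier N \<Longrightarrow> x \<oplus>\<^bsub>N\<^esub> y \<oplus>\<^bsub>N\<^esub> z = x \<oplus>\<^bsub>N\<^esub> (y \<oplus>\<^bsub>N\<^esub> z)"
    and "z \<in> carrier N \<Longrightarrow> x \<oplus>\<^bsub>N\<^esub> (y \<oplus>\<^bsub>N\<^esub> z) = y \<oplus>\<^bsub>N\<^esub> (x \<oplus>\<^bsub>N\<^esub> z)"
  using assms by (simp_all add: N.a_ac)

lemma kmod_distr_left:
  "x \<in> carrier N \<Longrightarrow> (a + b) \<odot>\<^bsub>N\<^esub> x = a \<odot>\<^bsub>N\<^esub> x \<oplus>\<^bsub>N\<^esub> b \<odot>\<^bsub>N\<^esub> x"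
  using N.smult_l_distr[of a b x] by simp

lemma kmod_distr_right:
  "x \<in> carrier N \<Longrightarrow> y \<in> carrier N \<Longrightarrow>
    a \<odot>\<^bsub>N\<^esub> (x \<oplus>\<^bsub>N\<^esub> y) = a \<odot>\<^bsub>N\<^esub> x \<oplus>\<^bsub>N\<^esub> a \<odot>\<^bsub>N\<^esub> y"
  using N.smult_r_distr[of a x y] by simp

lemma kmod_assoc: "x \<in> carrier N \<Longrightarrow> a \<odot>\<^bsub>N\<^esub> (b \<odot>\<^bsub>N\<^esub> x) = (a * b) \<odot>\<^bsub>N\<^esub> x"
  using N.smult_assoc1[of a b x] by simp

lemma kmod_one [simp]: "x \<in> carrier N \<Longrightarrow> 1 \<odot>\<^bsub>N\<^esub> x = x"
  using N.smult_one[of x] by simp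

lemma kmod_zero_smult [simp]: "x \<in> carrier N \<Longrightarrow> 0 \<odot>\<^bsub>N\<^esub> x = \<zero>\<^bsub>N\<^esub>"
  using N.smult_l_null[of x] by simp

lemma kmod_smult_zero [simp]: "c \<odot>\<^bsub>N\<^esub> \<zero>\<^bsub>N\<^esub> = \<zero>\<^bsub>N\<^esub>"
  using N.smult_r_null[of c] by simp

lemma kmod_cancel_minus:
  assumes "x \<in> carrier N"
  shows "x \<oplus>\<^bsub>N\<^esub> (-1) \<odot>\<^bsub>N\<^esub> x = \<zero>\<^bsub>N\<^esub>"
  using kmod_distr_left[OF assms, of 1 "-1"] assms by simp

lemma kmod_diff_exists:
  assumes "x \<in> carrier N" "y \<in> carrier N"
  shows "y = x \<oplus>\<^bsub>N\<^esub> (y \<oplus>\<^bsub>N\<^esub> (-1) \<odot>\<^bsub>N\<^esub> x)"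
proof -
  have "x \<oplus>\<^bsub>N\<^esub> (y \<oplus>\<^bsub>N\<^esub> (-1) \<odot>\<^bsub>N\<^esub> x) = y \<oplus>\<^bsub>N\<^esub> (x \<oplus>\<^bsub>N\<^esub> (-1) \<odot>\<^bsub>N\<^esub> x)"
    using assms by (simp add: kmod_add_ac)
  then show ?thesis using assms by (simp add: kmod_cancel_minus)
qed

end

text \<open>Operations on cosets and on compatible families of cosets are computed on representatives. Such
  a structure is the image of the structure of representatives, whose module axioms it inherits.\<close>

lemma kmod_image:
  assumes N: "kmod N" and W: "carrier W = p ` carrier N" "\<zero>\<^bsub>W\<^esub> = p \<zero>\<^bsub>N\<^esub>"
    and add: "\<And>x y. x \<in> carrier N \<Longrightarrow> y \<in> carrier N \<Longrightarrow> p x \<oplus>\<^bsub>W\<^esub> p y = p (x \<oplus>\<^bsub>N\<^esub> y)"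
    and smult: "\<And>c x. x \<in> carrier N \<Longrightarrow> c \<odot>\<^bsub>W\<^esub> p x = p (c \<odot>\<^bsub>N\<^esub> x)"
  shows "kmod W"
proof (rule kmodI)
  show "abelian_group W"
  proof (rule abelian_groupI)
    fix A assume "A \<in> carrier W"
    then obtain x where x: "x \<in> carrier N" "A = p x" unfolding W by blast
    have "p ((-1) \<odot>\<^bsub>N\<^esub> x) \<oplus>\<^bsub>W\<^esub> A = \<zero>\<^bsub>W\<^esub>"
      using x N by (simp add: add W kmod_add_ac(1)[OF N _ x(1)] kmod_cancel_minus)
    then show "\<exists>B\<in>carrier W. B \<oplus>\<^bsub>W\<^esub> A = \<zero>\<^bsub>W\<^esub>"
      by (rule bexI) (use x N in \<open>simp add: W\<close>)
  qed (use N in \<open>auto simp: W add kmod_add_ac\<close>)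
qed (use N in \<open>auto simp: W add smult kmod_distr_left kmod_distr_right kmod_assoc\<close>)

section \<open>Linear maps\<close>

lemma linI:
  assumes "\<And>x. x \<in> carrier N \<Longrightarrow> f x \<in> carrier W"
    and "\<And>x y. x \<in> carrier N \<Longrightarrow> y \<in> carrier N \<Longrightarrow> f (x \<oplus>\<^bsub>N\<^esub> y) = f x \<oplus>\<^bsub>W\<^esub> f y"
    and "\<And>c x. x \<in> carrier N \<Longrightarrow> f (c \<odot>\<^bsub>N\<^esub> x) = c \<odot>\<^bsub>W\<^esub> f x"
  shows "f \<in> lin N W"
  using assms unfolding linear_maps_def by auto

lemma lin_closed: "f \<in> lin N W \<Longrightarrow> x \<in> carrier N \<Longrightarrow> f x \<in> carrier W"
  and lin_add: "f \<in> lin N W \<Longrightarrow> x \<in> carrier N \<Longrightarrow> y \<in> carrier N \<Longrightarrow>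
    f (x \<oplus>\<^bsub>N\<^esub> y) = f x \<oplus>\<^bsub>W\<^esub> f y"
  and lin_smult: "f \<in> lin N W \<Longrightarrow> x \<in> carrier N \<Longrightarrow> f (c \<odot>\<^bsub>N\<^esub> x) = c \<odot>\<^bsub>W\<^esub> f x"
  unfolding linear_maps_def by auto

lemma lin_zero:
  assumes "kmod N" "kmod W" "f \<in> lin N W"
  shows "f \<zero>\<^bsub>N\<^esub> = \<zero>\<^bsub>W\<^esub>"
  using lin_smult[OF assms(3), of "\<zero>\<^bsub>N\<^esub>" 0] lin_closed[OF assms(3), of "\<zero>\<^bsub>N\<^esub>"] assms by simp

lemma lin_comp: "f \<in> lin N W \<Longrightarrow> g \<in> lin W Z \<Longrightarrow> (\<lambda>x. g (f x)) \<in> lin N Z"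
  unfolding linear_maps_def by (auto simp: Pi_iff)

lemma lin_ident: "(\<lambda>x. x) \<in> lin N N"
  unfolding linear_maps_def by auto

lemma lin_cong: "f \<in> lin N W \<Longrightarrow> kmod N \<Longrightarrow> (\<And>x. x \<in> carrier N \<Longrightarrow> f x = g x) \<Longrightarrow> g \<in> lin N W"
  unfolding linear_maps_def by (auto simp: Pi_iff)

lemma lin_restrict: "f \<in> lin N W \<Longrightarrow> kmod N \<Longrightarrow> restrict f (carrier N) \<in> lin N W"
  by (erule lin_cong) auto

section \<open>Quotient modules\<close>

definition ksub :: "(complex fps, 'a) module \<Rightarrow> 'a set \<Rightarrow> bool" where
  "ksub N S \<longleftrightarrow> S \<subseteq> carrier N \<and> \<zero>\<^bsub>N\<^esub> \<in> S \<and> (\<forall>x\<in>S. \<forall>y\<in>S. x \<oplus>\<^bsub>N\<^esub> y \<in> S) \<and>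
     (\<forall>c. \<forall>x\<in>S. c \<odot>\<^bsub>N\<^esub> x \<in> S)"

lemma ksub_abelian_subgroup:
  assumes N: "kmod N" and S: "ksub N S"
  shows "abelian_subgroup S N"
proof -
  interpret N: Module.module KK N by (rule N)
  have inv: "\<ominus>\<^bsub>N\<^esub> x \<in> S" if "x \<in> S" for x
  proof -
    have x: "x \<in> carrier N" and m: "(-1) \<odot>\<^bsub>N\<^esub> x \<in> S" using S that unfolding ksub_def by auto
    have "\<ominus>\<^bsub>N\<^esub> x = (-1) \<odot>\<^bsub>N\<^esub> x"
      using kmod_cancel_minus[OF N x] x m N.minus_equality[of "(-1) \<odot>\<^bsub>N\<^esub> x" x]
      by (simp add: N N.a_comm)
    then show ?thesis using m by simp
  qed
  have "subgroup S (add_monoid N)"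
    by (rule N.add.subgroupI) (use S inv in \<open>auto simp: ksub_def a_inv_def\<close>)
  then show ?thesis
    by (intro abelian_subgroupI3 additive_subgroupI N.abelian_group_axioms)
qed

context
  fixes N :: "(complex fps, 'a) module" and S
  assumes N: "kmod N" and S: "ksub N S"
begin

interpretation N: Module.module KK N by (rule N)
interpretation S: abelian_subgroup S N by (rule ksub_abelian_subgroup[OF N S])

lemma coset_iff:
  assumes "x \<in> carrier N"
  shows "y \<in> S +>\<^bsub>N\<^esub> x \<longleftrightarrow> (\<exists>s\<in>S. y = x \<oplus>\<^bsub>N\<^esub> s)"
  using assms S.a_subset unfolding a_r_coset_def' by (auto simp: N.a_comm subset_iff)

lemma coset_eq_iff:
  assumes "x \<in> carrier N" "y \<in> carrier N"
  shows "S +>\<^bsub>N\<^esub> x = S +>\<^bsub>N\<^esub> y \<longleftrightarrow> (\<exists>s\<in>S. y = x \<oplus>\<^bsub>N\<^esub> s)"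
  using assms coset_iff[OF assms(1)] S.a_repr_independence' S.a_repr_independenceD by blast

lemma coset_zero: "S +>\<^bsub>N\<^esub> \<zero>\<^bsub>N\<^esub> = S"
  by (simp add: S.a_subset)

lemma quotient_carrier:
  "carrier (quotient_module N S) = (\<lambda>x. S +>\<^bsub>N\<^esub> x) ` carrier N"
  by (auto simp: quotient_module_def A_RCOSETS_def')

lemma quotient_zero: "\<zero>\<^bsub>quotient_module N S\<^esub> = S"
  by (simp add: quotient_module_def)

lemma quotient_add:
  "x \<in> carrier N \<Longrightarrow> y \<in> carrier N \<Longrightarrow>
    (S +>\<^bsub>N\<^esub> x) \<oplus>\<^bsub>quotient_module N S\<^esub> (S +>\<^bsub>N\<^esub> y) = S +>\<^bsub>N\<^esub> (x \<oplus>\<^bsub>N\<^esub> y)"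
  by (simp add: quotient_module_def S.a_rcos_sum)

lemma coset_smult:
  assumes x: "x \<in> carrier N" and a: "a \<in> S +>\<^bsub>N\<^esub> x"
  shows "S +>\<^bsub>N\<^esub> (c \<odot>\<^bsub>N\<^esub> a) = S +>\<^bsub>N\<^esub> (c \<odot>\<^bsub>N\<^esub> x)"
proof -
  obtain s where s: "s \<in> S" "a = x \<oplus>\<^bsub>N\<^esub> s" using a unfolding coset_iff[OF x] by blast
  have sN: "s \<in> carrier N" using S s(1) unfolding ksub_def by blast
  have cs: "c \<odot>\<^bsub>N\<^esub> s \<in> S" using S s(1) unfolding ksub_def by blast
  have eq: "c \<odot>\<^bsub>N\<^esub> a = c \<odot>\<^bsub>N\<^esub> x \<oplus>\<^bsub>N\<^esub> c \<odot>\<^bsub>N\<^esub> s"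
    unfolding s(2) by (rule kmod_distr_right[OF N x sN])
  have aN: "a \<in> carrier N" unfolding s(2) by (rule kmod_add[OF N x sN])
  have "S +>\<^bsub>N\<^esub> (c \<odot>\<^bsub>N\<^esub> x) = S +>\<^bsub>N\<^esub> (c \<odot>\<^bsub>N\<^esub> a)"
    unfolding coset_eq_iff[OF kmod_smult[OF N x] kmod_smult[OF N aN]] using eq cs by (rule bexI)
  then show ?thesis by (rule HOL.sym)
qed

lemma quotient_smult:
  assumes x: "x \<in> carrier N"
  shows "c \<odot>\<^bsub>quotient_module N S\<^esub> (S +>\<^bsub>N\<^esub> x) = S +>\<^bsub>N\<^esub> (c \<odot>\<^bsub>N\<^esub> x)"
  unfolding quotient_module_def module.select_convs
  by (rule UN_constant_eq[OF S.a_rcos_self[OF x]]) (rule ballI, rule coset_smult[OF x])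

lemma quotient_kmod: "kmod (quotient_module N S)"
  by (rule kmod_image[OF N, where p = "\<lambda>x. S +>\<^bsub>N\<^esub> x"])
    (simp_all only: quotient_carrier quotient_zero coset_zero quotient_add quotient_smult)

lemma quotient_lin: "(\<lambda>x. S +>\<^bsub>N\<^esub> x) \<in> lin N (quotient_module N S)"
  by (rule linI) (unfold quotient_carrier, blast, simp_all add: quotient_add quotient_smult)

text \<open>The value on a coset is that on any representative, as \<open>f\<close> kills the difference of two of
  them.\<close>

lemma quotient_factor:
  assumes W: "kmod W" and f: "f \<in> lin N W" and z: "\<And>s. s \<in> S \<Longrightarrow> f s = \<zero>\<^bsub>W\<^esub>"
  obtains g where "g \<in> lin (quotient_module N S) W" "\<And>x. x \<in> carrier N \<Longrightarrow> g (S +>\<^bsub>N\<^esub> x) = f x"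
proof -
  define g where "g A = f (SOME x. x \<in> carrier N \<and> A = S +>\<^bsub>N\<^esub> x)" for A
  have g: "g (S +>\<^bsub>N\<^esub> x) = f x" if x: "x \<in> carrier N" for x
  proof -
    define y where "y = (SOME y. y \<in> carrier N \<and> S +>\<^bsub>N\<^esub> x = S +>\<^bsub>N\<^esub> y)"
    have "y \<in> carrier N \<and> S +>\<^bsub>N\<^esub> x = S +>\<^bsub>N\<^esub> y"
      unfolding y_def by (rule someI[where x = x]) (simp add: x)
    then obtain s where s: "s \<in> S" "y = x \<oplus>\<^bsub>N\<^esub> s" using coset_eq_iff[OF x] by blast
    have "s \<in> carrier N" using s S.a_subset by blast
    then have "f y = f x"
      using s x lin_closed[OF f x] by (simp add: lin_add[OF f] z W)
    then show ?thesis by (simp add: g_def y_def)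
  qed
  have "g \<in> lin (quotient_module N S) W"
  proof (rule linI)
    fix c A assume "A \<in> carrier (quotient_module N S)"
    then obtain x where x: "x \<in> carrier N" "A = S +>\<^bsub>N\<^esub> x" by (auto simp: quotient_carrier)
    show "g A \<in> carrier W" by (simp add: x g lin_closed[OF f])
    show "g (c \<odot>\<^bsub>quotient_module N S\<^esub> A) = c \<odot>\<^bsub>W\<^esub> g A"
      using x N by (simp add: g lin_smult[OF f] quotient_smult)
    fix B assume "B \<in> carrier (quotient_module N S)"
    then obtain y where y: "y \<in> carrier N" "B = S +>\<^bsub>N\<^esub> y" by (auto simp: quotient_carrier)
    show "g (A \<oplus>\<^bsub>quotient_module N S\<^esub> B) = g A \<oplus>\<^bsub>W\<^esub> g B"
      using x y N by (simp add: g lin_add[OF f] quotient_add)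
  qed
  then show thesis using g that by blast
qed

end

section \<open>Free modules\<close>

lemma lookup_scale [simp]:
  "Poly_Mapping.lookup (Poly_Mapping.map ((*) (c::complex fps)) p) k = c * Poly_Mapping.lookup p k"
  by (simp add: Poly_Mapping.map.rep_eq when_def)

lemma scale_single:
  "Poly_Mapping.map ((*) (c::complex fps)) (Poly_Mapping.single b d) = Poly_Mapping.single b (c * d)"
  by (rule poly_mapping_eqI) (simp add: lookup_single when_def)

lemma keys_subset_iff:
  "Poly_Mapping.keys p \<subseteq> B \<longleftrightarrow> (\<forall>k. k \<notin> B \<longrightarrow> Poly_Mapping.lookup p k = 0)"
  by (auto simp: in_keys_iff)

lemma free_simps:
  "p \<in> carrier (free_module B) \<longleftrightarrow> (\<forall>k. k \<notin> B \<longrightarrow> Poly_Mapping.lookup p k = 0)"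
  "\<zero>\<^bsub>free_module B\<^esub> = 0" "p \<oplus>\<^bsub>free_module B\<^esub> q = p + q"
  "c \<odot>\<^bsub>free_module B\<^esub> p = Poly_Mapping.map ((*) c) p"
  by (simp_all add: free_module_def keys_subset_iff)

lemma free_kmod: "kmod (free_module B)"
proof (rule kmodI)
  show "abelian_group (free_module B)"
  proof (rule abelian_groupI)
    fix p assume "p \<in> carrier (free_module B)"
    then show "\<exists>q\<in>carrier (free_module B). q \<oplus>\<^bsub>free_module B\<^esub> p = \<zero>\<^bsub>free_module B\<^esub>"
      by (intro bexI[of _ "- p"]) (auto simp: free_simps)
  qed (auto simp: free_simps lookup_add ac_simps)
qed (auto simp: free_simps lookup_add algebra_simps intro!: poly_mapping_eqI)

lemma single_in_free: "b \<in> B \<Longrightarrow> Poly_Mapping.single b c \<in> carrier (free_module B)"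
  by (auto simp: free_simps lookup_single when_def)

lemma free_extend:
  fixes W :: "(complex fps, 'w) module"
  assumes W: "kmod W" and F: "\<And>b. b \<in> B \<Longrightarrow> F b \<in> carrier W"
  obtains g where "g \<in> lin (free_module B) W"
    "\<And>b. b \<in> B \<Longrightarrow> g (Poly_Mapping.single b 1) = F b"
proof -
  interpret W: Module.module KK W by (rule W)
  define g where
    "g p = (\<Oplus>\<^bsub>W\<^esub>b\<in>Poly_Mapping.keys p. Poly_Mapping.lookup p b \<odot>\<^bsub>W\<^esub> F b)" for p
  have g: "g p = (\<Oplus>\<^bsub>W\<^esub>b\<in>A. Poly_Mapping.lookup p b \<odot>\<^bsub>W\<^esub> F b)"
    if "finite A" "A \<subseteq> B" "Poly_Mapping.keys p \<subseteq> A" for p A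
    unfolding g_def
    by (rule W.add.finprod_mono_neutral_cong_left) (use that F W in \<open>auto simp: in_keys_iff\<close>)
  have fin: "finite (Poly_Mapping.keys p)" for p :: "'b \<Rightarrow>\<^sub>0 complex fps" by simp
  have cl: "(\<lambda>b. Poly_Mapping.lookup p b \<odot>\<^bsub>W\<^esub> F b) \<in> A \<rightarrow> carrier W" if "A \<subseteq> B" for A p
    using that F W by auto
  have sub: "Poly_Mapping.keys p \<subseteq> B" if "p \<in> carrier (free_module B)" for p
    using that by (simp add: free_module_def)
  show thesis
  proof (rule that)
    show "g \<in> lin (free_module B) W"
    proof (rule linI)
      fix p assume p: "p \<in> carrier (free_module B)"
      show "g p \<in> carrier W" unfolding g_def by (rule W.finsum_closed[OF cl[OF sub[OF p]]])
      show "g (c \<odot>\<^bsub>free_module B\<^esub> p) = c \<odot>\<^bsub>W\<^esub> g p" for c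
      proof -
        have "g (c \<odot>\<^bsub>free_module B\<^esub> p) = (\<Oplus>\<^bsub>W\<^esub>b\<in>Poly_Mapping.keys p.
            Poly_Mapping.lookup (Poly_Mapping.map ((*) c) p) b \<odot>\<^bsub>W\<^esub> F b)"
          unfolding free_simps by (rule g[OF fin sub[OF p]]) (auto simp: in_keys_iff)
        also have "\<dots> = (\<Oplus>\<^bsub>W\<^esub>b\<in>Poly_Mapping.keys p. c \<odot>\<^bsub>W\<^esub> (Poly_Mapping.lookup p b \<odot>\<^bsub>W\<^esub> F b))"
          by (rule W.finsum_cong') (use sub[OF p] F W in \<open>auto simp: kmod_assoc\<close>)
        also have "\<dots> = c \<odot>\<^bsub>W\<^esub> g p"
          unfolding g_def using W.finsum_smult_ldistr[OF fin _ cl[OF sub[OF p]], of c] by simp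
        finally show ?thesis .
      qed
      fix q assume q: "q \<in> carrier (free_module B)"
      show "g (p \<oplus>\<^bsub>free_module B\<^esub> q) = g p \<oplus>\<^bsub>W\<^esub> g q"
      proof -
        let ?A = "Poly_Mapping.keys p \<union> Poly_Mapping.keys q"
        have A: "finite ?A" "?A \<subseteq> B" using sub[OF p] sub[OF q] by auto
        have "g (p \<oplus>\<^bsub>free_module B\<^esub> q) = (\<Oplus>\<^bsub>W\<^esub>b\<in>?A. Poly_Mapping.lookup (p + q) b \<odot>\<^bsub>W\<^esub> F b)"
          unfolding free_simps by (rule g[OF A]) (rule keys_add)
        also have "\<dots> = (\<Oplus>\<^bsub>W\<^esub>b\<in>?A. Poly_Mapping.lookup p b \<odot>\<^bsub>W\<^esub> F b \<oplus>\<^bsub>W\<^esub> Poly_Mapping.lookup q b \<odot>\<^bsub>W\<^esub> F b)"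
        proof (rule W.finsum_cong')
          fix b assume "b \<in> ?A"
          then have "F b \<in> carrier W" using A F by blast
          then show "Poly_Mapping.lookup (p + q) b \<odot>\<^bsub>W\<^esub> F b =
              Poly_Mapping.lookup p b \<odot>\<^bsub>W\<^esub> F b \<oplus>\<^bsub>W\<^esub> Poly_Mapping.lookup q b \<odot>\<^bsub>W\<^esub> F b"
            by (simp add: lookup_add kmod_distr_left[OF W])
        qed (use A F W in auto)
        also have "\<dots> = (\<Oplus>\<^bsub>W\<^esub>b\<in>?A. Poly_Mapping.lookup p b \<odot>\<^bsub>W\<^esub> F b) \<oplus>\<^bsub>W\<^esub>
            (\<Oplus>\<^bsub>W\<^esub>b\<in>?A. Poly_Mapping.lookup q b \<odot>\<^bsub>W\<^esub> F b)"
          by (rule W.finsum_addf[OF cl[OF A(2)] cl[OF A(2)]])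
        also have "\<dots> = g p \<oplus>\<^bsub>W\<^esub> g q"
          using g[OF A, of p] g[OF A, of q] by simp
        finally show ?thesis .
      qed
    qed
    fix b assume b: "b \<in> B"
    have "g (Poly_Mapping.single b 1) =
        (\<Oplus>\<^bsub>W\<^esub>b'\<in>{b}. Poly_Mapping.lookup (Poly_Mapping.single b 1) b' \<odot>\<^bsub>W\<^esub> F b')"
      by (rule g) (use b in auto)
    also have "\<dots> = F b" using F[OF b] W by simp
    finally show "g (Poly_Mapping.single b 1) = F b" .
  qed
qed

lemma free_ext:
  assumes f: "f \<in> lin (free_module B) W" and g: "g \<in> lin (free_module B) W" and W: "kmod W"
    and eq: "\<And>b. b \<in> B \<Longrightarrow> f (Poly_Mapping.single b 1) = g (Poly_Mapping.single b 1)"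
    and p: "p \<in> carrier (free_module B)"
  shows "f p = g p"
proof -
  have sub: "Poly_Mapping.keys p \<subseteq> B" using p by (simp add: free_module_def)
  have main: "f (\<Sum>b\<in>A. Poly_Mapping.single b (Poly_Mapping.lookup p b)) =
      g (\<Sum>b\<in>A. Poly_Mapping.single b (Poly_Mapping.lookup p b)) \<and>
      (\<Sum>b\<in>A. Poly_Mapping.single b (Poly_Mapping.lookup p b)) \<in> carrier (free_module B)"
    if "finite A" "A \<subseteq> B" for A using that
  proof (induction A rule: finite_induct)
    case empty
    show ?case
      using lin_zero[OF free_kmod W f] lin_zero[OF free_kmod W g] kmod_zero[OF free_kmod[of B]]
      by (simp add: free_simps)
  next
    case (insert b A)
    let ?s = "\<Sum>b\<in>A. Poly_Mapping.single b (Poly_Mapping.lookup p b)"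
    let ?b = "Poly_Mapping.single b (Poly_Mapping.lookup p b)"
    have IH: "f ?s = g ?s" "?s \<in> carrier (free_module B)" and b: "b \<in> B" using insert by auto
    have b1: "?b = Poly_Mapping.lookup p b \<odot>\<^bsub>free_module B\<^esub> Poly_Mapping.single b 1"
      by (simp add: free_simps scale_single)
    have fb: "f ?b = g ?b"
      unfolding b1 lin_smult[OF f single_in_free[OF b]] lin_smult[OF g single_in_free[OF b]] eq[OF b] ..
    have sb: "?b \<in> carrier (free_module B)" using b by (rule single_in_free)
    show ?case
      using insert(1,2) lin_add[OF f sb IH(2)] lin_add[OF g sb IH(2)] IH fb kmod_add[OF free_kmod sb IH(2)]
      by (simp add: free_simps(3))
  qed
  have "(\<Sum>b\<in>Poly_Mapping.keys p. Poly_Mapping.single b (Poly_Mapping.lookup p b)) = p"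
    by (rule poly_mapping_eqI) (simp add: lookup_sum lookup_single when_def in_keys_iff)
  with main[OF finite_keys sub] show ?thesis by (simp only:)
qed

section \<open>Multilinear maps and tensor products\<close>

abbreviation kmods :: "(complex fps, 'a) module list \<Rightarrow> bool" where
  "kmods Ns \<equiv> \<forall>N\<in>set Ns. kmod N"

lemma tuples_iff: "xs \<in> tuples Ns \<longleftrightarrow> list_all2 (\<lambda>x N. x \<in> carrier N) xs Ns"
  by (induction Ns arbitrary: xs) (auto simp: set_Cons_def list_all2_Cons2)

lemma tuples_update:
  "xs \<in> tuples Ns \<Longrightarrow> i < length Ns \<Longrightarrow> x \<in> carrier (Ns ! i) \<Longrightarrow> xs[i := x] \<in> tuples Ns"
  by (auto simp: tuples_iff list_all2_conv_all_nth nth_list_update)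

definition multilin ::
    "(complex fps, 'a) module list \<Rightarrow> (complex fps, 'b) module \<Rightarrow> ('a list \<Rightarrow> 'b) \<Rightarrow> bool" where
  "multilin Ns W f \<longleftrightarrow> (\<forall>xs\<in>tuples Ns. f xs \<in> carrier W) \<and>
     (\<forall>xs\<in>tuples Ns. \<forall>i<length Ns. (\<lambda>x. f (xs[i := x])) \<in> lin (Ns ! i) W)"

lemma multilin_closed: "multilin Ns W f \<Longrightarrow> xs \<in> tuples Ns \<Longrightarrow> f xs \<in> carrier W"
  by (simp add: multilin_def)

lemma multilin_lin:
  "multilin Ns W f \<Longrightarrow> xs \<in> tuples Ns \<Longrightarrow> i < length Ns \<Longrightarrow> (\<lambda>x. f (xs[i := x])) \<in> lin (Ns ! i) W"
  by (simp add: multilin_def)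

lemma relations_carrier:
  assumes Ns: "kmods Ns" and p: "p \<in> multilinear_relations Ns"
  shows "p \<in> carrier (free_module (tuples Ns))"
  using p
proof induction
  case zero show ?case by (simp add: free_simps)
next
  case (add p q) then show ?case by (simp add: free_simps lookup_add)
next
  case (smult p c) then show ?case by (simp add: free_simps)
next
  case (additive xs i x y)
  have "kmod (Ns ! i)" using Ns additive by auto
  then have "xs[i := x \<oplus>\<^bsub>Ns ! i\<^esub> y] \<in> tuples Ns" "xs[i := x] \<in> tuples Ns" "xs[i := y] \<in> tuples Ns"
    using additive by (auto intro!: tuples_update)
  then show ?case by (auto simp: free_simps lookup_minus lookup_single when_def)
next
  case (homogeneous xs i x c)
  have "kmod (Ns ! i)" using Ns homogeneous by auto
  then have "xs[i := c \<odot>\<^bsub>Ns ! i\<^esub> x] \<in> tuples Ns" "xs[i := x] \<in> tuples Ns"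
    using homogeneous by (auto intro!: tuples_update)
  then show ?case by (auto simp: free_simps lookup_minus lookup_single when_def)
qed

lemma relations_ksub: "kmods Ns \<Longrightarrow> ksub (free_module (tuples Ns)) (multilinear_relations Ns)"
  unfolding ksub_def free_simps(2-4)
  by (auto intro: relations_carrier multilinear_relations.intros)

lemma kmod_cancel_sum:
  assumes W: "kmod W" and x: "x \<in> carrier W" and y: "y \<in> carrier W"
  shows "x \<oplus>\<^bsub>W\<^esub> y \<oplus>\<^bsub>W\<^esub> (-1) \<odot>\<^bsub>W\<^esub> x \<oplus>\<^bsub>W\<^esub> (-1) \<odot>\<^bsub>W\<^esub> y = \<zero>\<^bsub>W\<^esub>"
proof -
  have "x \<oplus>\<^bsub>W\<^esub> y \<oplus>\<^bsub>W\<^esub> (-1) \<odot>\<^bsub>W\<^esub> x \<oplus>\<^bsub>W\<^esub> (-1) \<odot>\<^bsub>W\<^esub> y = x \<oplus>\<^bsub>W\<^esub> y \<oplus>\<^bsub>W\<^esub> (-1) \<odot>\<^bsub>W\<^esub> (x \<oplus>\<^bsub>W\<^esub> y)"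
    using W x y by (simp add: kmod_distr_right kmod_add_ac(2))
  also have "\<dots> = \<zero>\<^bsub>W\<^esub>" by (rule kmod_cancel_minus) (use W x y in auto)
  finally show ?thesis .
qed

text \<open>By induction on the generation of the relations; this is what lets a linear map on the free
  module descend to the tensor product.\<close>

lemma relations_killed:
  assumes Ns: "kmods Ns" and W: "kmod W" and g: "g \<in> lin (free_module (tuples Ns)) W"
    and m: "multilin Ns W (\<lambda>xs. g (Poly_Mapping.single xs 1))"
    and p: "p \<in> multilinear_relations Ns"
  shows "g p = \<zero>\<^bsub>W\<^esub>"
proof -
  let ?F = "free_module (tuples Ns)"
  have diff: "g (p - q) = g p \<oplus>\<^bsub>W\<^esub> (-1) \<odot>\<^bsub>W\<^esub> g q" "p - q \<in> carrier ?F"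
    if "p \<in> carrier ?F" "q \<in> carrier ?F" for p q
  proof -
    have e: "p - q = p \<oplus>\<^bsub>?F\<^esub> (-1) \<odot>\<^bsub>?F\<^esub> q"
      by (rule poly_mapping_eqI) (simp add: free_simps lookup_minus lookup_add)
    show "g (p - q) = g p \<oplus>\<^bsub>W\<^esub> (-1) \<odot>\<^bsub>W\<^esub> g q"
      unfolding e using that by (simp add: lin_add[OF g] lin_smult[OF g] free_kmod)
    show "p - q \<in> carrier ?F" unfolding e using that by (simp add: free_kmod)
  qed
  note carr = relations_carrier[OF Ns]
  from p show ?thesis
  proof induction
    case zero show ?case using lin_zero[OF free_kmod W g] by (simp add: free_simps)
  next
    case (add p q)
    then show ?case using lin_add[OF g carr carr, of p q] kmod_zero[OF W] W by (simp add: free_simps)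
  next
    case (smult p c)
    then show ?case using lin_smult[OF g carr, of p c] kmod_smult_zero[OF W] by (simp add: free_simps)
  next
    case (additive xs i x y)
    have Ni: "kmod (Ns ! i)" using Ns additive by auto
    have t: "xs[i := x \<oplus>\<^bsub>Ns ! i\<^esub> y] \<in> tuples Ns" "xs[i := x] \<in> tuples Ns" "xs[i := y] \<in> tuples Ns"
      using additive Ni by (auto intro!: tuples_update)
    note s = t[THEN single_in_free, of 1]
    note c = t[THEN multilin_closed[OF m]]
    have "g (Poly_Mapping.single (xs[i := x \<oplus>\<^bsub>Ns ! i\<^esub> y]) 1) =
        g (Poly_Mapping.single (xs[i := x]) 1) \<oplus>\<^bsub>W\<^esub> g (Poly_Mapping.single (xs[i := y]) 1)"
      by (rule lin_add[OF multilin_lin[OF m]]) (use additive in auto)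
    then show ?case
      unfolding diff(1)[OF diff(2)[OF s(1,2)] s(3)] diff(1)[OF s(1,2)]
      using kmod_cancel_sum[OF W c(2,3)] by (simp only:)
  next
    case (homogeneous xs i x c)
    have Ni: "kmod (Ns ! i)" using Ns homogeneous by auto
    have t: "xs[i := c \<odot>\<^bsub>Ns ! i\<^esub> x] \<in> tuples Ns" "xs[i := x] \<in> tuples Ns"
      using homogeneous Ni by (auto intro!: tuples_update)
    note s = t[THEN single_in_free]
    note cl = t[THEN multilin_closed[OF m]]
    have "g (Poly_Mapping.single (xs[i := c \<odot>\<^bsub>Ns ! i\<^esub> x]) 1) =
        c \<odot>\<^bsub>W\<^esub> g (Poly_Mapping.single (xs[i := x]) 1)"
      by (rule lin_smult[OF multilin_lin[OF m]]) (use homogeneous in auto)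
    moreover have "g (Poly_Mapping.single (xs[i := x]) c) = c \<odot>\<^bsub>W\<^esub> g (Poly_Mapping.single (xs[i := x]) 1)"
      using lin_smult[OF g s(2), of c 1] by (simp add: free_simps scale_single)
    ultimately show ?case
      unfolding diff(1)[OF s(1) s(2)[of c]]
      using cl W by (simp add: kmod_cancel_minus)
  qed
qed

definition tpure :: "(complex fps, 'a) module list \<Rightarrow> 'a list \<Rightarrow> ('a list \<Rightarrow>\<^sub>0 complex fps) set" where
  "tpure Ns xs = multilinear_relations Ns +>\<^bsub>free_module (tuples Ns)\<^esub> Poly_Mapping.single xs 1"

context
  fixes Ns :: "(complex fps, 'a) module list"
  assumes Ns: "kmods Ns"
begin

lemma tensor_kmod: "kmod (tensor_module Ns)"
  unfolding tensor_module_def by (rule quotient_kmod[OF free_kmod relations_ksub[OF Ns]])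

lemma tensor_extend:
  assumes W: "kmod W" and f: "multilin Ns W f"
  obtains g where "g \<in> lin (tensor_module Ns) W" "\<And>xs. xs \<in> tuples Ns \<Longrightarrow> g (tpure Ns xs) = f xs"
proof -
  obtain g where g: "g \<in> lin (free_module (tuples Ns)) W"
    "\<And>xs. xs \<in> tuples Ns \<Longrightarrow> g (Poly_Mapping.single xs 1) = f xs"
    by (rule free_extend[OF W multilin_closed[OF f]]) (assumption, rule that)
  have "multilin Ns W (\<lambda>xs. g (Poly_Mapping.single xs 1))"
    unfolding multilin_def
  proof (intro conjI ballI allI impI)
    fix xs assume xs: "xs \<in> tuples Ns"
    then show "g (Poly_Mapping.single xs 1) \<in> carrier W"
      using g(2)[OF xs] multilin_closed[OF f xs] by simp
    fix i assume i: "i < length Ns"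
    show "(\<lambda>x. g (Poly_Mapping.single (xs[i := x]) 1)) \<in> lin (Ns ! i) W"
      by (rule lin_cong[OF multilin_lin[OF f xs i]])
        (use Ns i in \<open>auto simp: g(2) tuples_update[OF xs i]\<close>)
  qed
  then have "g s = \<zero>\<^bsub>W\<^esub>" if "s \<in> multilinear_relations Ns" for s
    using relations_killed[OF Ns W g(1)] that by blast
  then obtain g' where "g' \<in> lin (quotient_module (free_module (tuples Ns)) (multilinear_relations Ns)) W"
    "\<And>p. p \<in> carrier (free_module (tuples Ns)) \<Longrightarrow>
      g' (multilinear_relations Ns +>\<^bsub>free_module (tuples Ns)\<^esub> p) = g p"
    by (rule quotient_factor[OF free_kmod relations_ksub[OF Ns] W g(1)]) (assumption, rule that)
  note g' = this
  show thesis
  proof (rule that[OF g'(1)[folded tensor_module_def]])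
    fix xs assume xs: "xs \<in> tuples Ns"
    show "g' (tpure Ns xs) = f xs"
      unfolding tpure_def g'(2)[OF single_in_free[OF xs]] by (rule g(2)[OF xs])
  qed
qed

lemma tensor_ext:
  assumes f: "f \<in> lin (tensor_module Ns) W" and g: "g \<in> lin (tensor_module Ns) W" and W: "kmod W"
    and eq: "\<And>xs. xs \<in> tuples Ns \<Longrightarrow> f (tpure Ns xs) = g (tpure Ns xs)"
    and t: "t \<in> carrier (tensor_module Ns)"
  shows "f t = g t"
proof -
  let ?q = "\<lambda>p. multilinear_relations Ns +>\<^bsub>free_module (tuples Ns)\<^esub> p"
  have q: "?q \<in> lin (free_module (tuples Ns)) (tensor_module Ns)"
    unfolding tensor_module_def by (rule quotient_lin[OF free_kmod relations_ksub[OF Ns]])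
  obtain p where p: "p \<in> carrier (free_module (tuples Ns))" "t = ?q p"
    using t unfolding tensor_module_def quotient_carrier[OF free_kmod relations_ksub[OF Ns]] by blast
  show ?thesis unfolding p(2)
    by (rule free_ext[OF lin_comp[OF q f] lin_comp[OF q g] W _ p(1)]) (rule eq[unfolded tpure_def])
qed

lemma tpure_multilin: "multilin Ns (tensor_module Ns) (tpure Ns)"
proof -
  let ?F = "free_module (tuples Ns)" and ?S = "multilinear_relations Ns"
  note K = free_kmod[of "tuples Ns"] relations_ksub[OF Ns]
  have closed: "tpure Ns xs \<in> carrier (tensor_module Ns)" if "xs \<in> tuples Ns" for xs
    unfolding tpure_def tensor_module_def quotient_carrier[OF K] using single_in_free[OF that] by blast
  moreover have "(\<lambda>x. tpure Ns (xs[i := x])) \<in> lin (Ns ! i) (tensor_module Ns)"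
    if xs: "xs \<in> tuples Ns" and i: "i < length Ns" for xs i
  proof (rule linI)
    have Ni: "kmod (Ns ! i)" using Ns i by auto
    fix x assume x: "x \<in> carrier (Ns ! i)"
    have tx: "xs[i := x] \<in> tuples Ns" using xs i x by (rule tuples_update)
    then show "tpure Ns (xs[i := x]) \<in> carrier (tensor_module Ns)" by (rule closed)
    show "tpure Ns (xs[i := c \<odot>\<^bsub>Ns ! i\<^esub> x]) = c \<odot>\<^bsub>tensor_module Ns\<^esub> tpure Ns (xs[i := x])" for c
    proof -
      have tc: "xs[i := c \<odot>\<^bsub>Ns ! i\<^esub> x] \<in> tuples Ns"
        using tuples_update[OF xs i] x Ni by simp
      have "c \<odot>\<^bsub>tensor_module Ns\<^esub> tpure Ns (xs[i := x]) = ?S +>\<^bsub>?F\<^esub> (Poly_Mapping.single (xs[i := x]) c)"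
        unfolding tpure_def tensor_module_def quotient_smult[OF K single_in_free[OF tx]]
        by (simp add: free_simps scale_single)
      also have "\<dots> = tpure Ns (xs[i := c \<odot>\<^bsub>Ns ! i\<^esub> x])"
        unfolding tpure_def coset_eq_iff[OF K single_in_free[OF tx] single_in_free[OF tc]]
        by (rule bexI[OF _ multilinear_relations.homogeneous[OF xs i x, of c]]) (simp add: free_simps)
      finally show ?thesis by simp
    qed
    fix y assume y: "y \<in> carrier (Ns ! i)"
    show "tpure Ns (xs[i := x \<oplus>\<^bsub>Ns ! i\<^esub> y]) =
        tpure Ns (xs[i := x]) \<oplus>\<^bsub>tensor_module Ns\<^esub> tpure Ns (xs[i := y])"
    proof -
      have ty: "xs[i := y] \<in> tuples Ns" using xs i y by (rule tuples_update)
      have tc: "xs[i := x \<oplus>\<^bsub>Ns ! i\<^esub> y] \<in> tuples Ns"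
        using tuples_update[OF xs i] x y Ni by simp
      have "tpure Ns (xs[i := x]) \<oplus>\<^bsub>tensor_module Ns\<^esub> tpure Ns (xs[i := y]) =
          ?S +>\<^bsub>?F\<^esub> (Poly_Mapping.single (xs[i := x]) 1 \<oplus>\<^bsub>?F\<^esub> Poly_Mapping.single (xs[i := y]) 1)"
        unfolding tpure_def tensor_module_def
        by (rule quotient_add[OF K single_in_free[OF tx] single_in_free[OF ty]])
      also have "\<dots> = tpure Ns (xs[i := x \<oplus>\<^bsub>Ns ! i\<^esub> y])"
        unfolding tpure_def
          coset_eq_iff[OF K kmod_add[OF free_kmod single_in_free[OF tx] single_in_free[OF ty]] single_in_free[OF tc]]
        by (rule bexI[OF _ multilinear_relations.additive[OF xs i x y]]) (simp add: free_simps)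
      finally show ?thesis by simp
    qed
  qed
  ultimately show ?thesis unfolding multilin_def by blast
qed

end

section \<open>The h-adic completion\<close>

definition hq :: "(complex fps, 'a) module \<Rightarrow> nat \<Rightarrow> 'a \<Rightarrow> 'a set" where
  "hq N n x = h_multiples N n +>\<^bsub>N\<^esub> x"

definition hquot :: "(complex fps, 'a) module \<Rightarrow> nat \<Rightarrow> (complex fps, 'a set) module" where
  "hquot N n = quotient_module N (h_multiples N n)"

lemma h_multiples_ksub:
  assumes N: "kmod N"
  shows "ksub N (h_multiples N n)"
  unfolding ksub_def h_multiples_def
proof (intro conjI ballI allI)
  let ?m = "\<lambda>x. (fps_X ^ n) \<odot>\<^bsub>N\<^esub> x"
  show "?m ` carrier N \<subseteq> carrier N" using N by auto
  show "\<zero>\<^bsub>N\<^esub> \<in> ?m ` carrier N" by (rule image_eqI[of _ _ "\<zero>\<^bsub>N\<^esub>"]) (use N in auto)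
  fix a assume "a \<in> ?m ` carrier N"
  then obtain x where x: "x \<in> carrier N" "a = ?m x" by blast
  show "c \<odot>\<^bsub>N\<^esub> a \<in> ?m ` carrier N" for c
    by (rule image_eqI[of _ _ "c \<odot>\<^bsub>N\<^esub> x"]) (use N x in \<open>simp_all add: kmod_assoc mult.commute\<close>)
  fix b assume "b \<in> ?m ` carrier N"
  then obtain y where y: "y \<in> carrier N" "b = ?m y" by blast
  show "a \<oplus>\<^bsub>N\<^esub> b \<in> ?m ` carrier N"
    by (rule image_eqI[of _ _ "x \<oplus>\<^bsub>N\<^esub> y"]) (use N x y in \<open>simp_all add: kmod_distr_right\<close>)
qed

context
  fixes N :: "(complex fps, 'a) module"
  assumes N: "kmod N"
begin

lemma hq_lin: "hq N n \<in> lin N (hquot N n)"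
  using quotient_lin[OF N h_multiples_ksub[OF N]] unfolding hquot_def hq_def[abs_def] .

lemma hquot_carrier: "carrier (hquot N n) = hq N n ` carrier N"
  using quotient_carrier[OF N h_multiples_ksub[OF N]] unfolding hquot_def hq_def[abs_def] .

lemma hq_eq_iff:
  assumes "x \<in> carrier N" "y \<in> carrier N"
  shows "hq N n x = hq N n y \<longleftrightarrow> (\<exists>z\<in>carrier N. y = x \<oplus>\<^bsub>N\<^esub> (fps_X ^ n) \<odot>\<^bsub>N\<^esub> z)"
  unfolding hq_def coset_eq_iff[OF N h_multiples_ksub[OF N] assms] unfolding h_multiples_def by blast

lemma hq_eqI: "x \<in> carrier N \<Longrightarrow> z \<in> carrier N \<Longrightarrow> hq N n (x \<oplus>\<^bsub>N\<^esub> (fps_X ^ n) \<odot>\<^bsub>N\<^esub> z) = hq N n x"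
  using hq_eq_iff[of x "x \<oplus>\<^bsub>N\<^esub> (fps_X ^ n) \<odot>\<^bsub>N\<^esub> z" n] N by auto

text \<open>Translates the inverse limit, defined by decreasing sequences of cosets, into sequences of
  elements of which consecutive ones are congruent modulo increasing powers of \<open>h\<close>.\<close>

lemma hq_subset_iff:
  assumes x: "x \<in> carrier N" and y: "y \<in> carrier N"
  shows "hq N (Suc n) y \<subseteq> hq N n x \<longleftrightarrow> hq N n y = hq N n x"
proof -
  note K = coset_iff[OF N h_multiples_ksub[OF N]]
  have mem: "a \<in> hq N n x \<longleftrightarrow> a \<in> carrier N \<and> hq N n a = hq N n x" if "x \<in> carrier N" for n a x
  proof -
    have "a \<in> hq N n x \<longleftrightarrow> (\<exists>z\<in>carrier N. a = x \<oplus>\<^bsub>N\<^esub> (fps_X ^ n) \<odot>\<^bsub>N\<^esub> z)"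
      unfolding hq_def K[OF that] unfolding h_multiples_def by blast
    also have "\<dots> \<longleftrightarrow> a \<in> carrier N \<and> hq N n a = hq N n x"
      using hq_eq_iff[OF that, of a n] N that by (auto 0 3)
    finally show ?thesis .
  qed
  show ?thesis
  proof
    assume "hq N (Suc n) y \<subseteq> hq N n x"
    then show "hq N n y = hq N n x" using mem[OF y, of y "Suc n"] mem[OF x, of y n] y by blast
  next
    assume eq: "hq N n y = hq N n x"
    show "hq N (Suc n) y \<subseteq> hq N n x"
    proof
      fix a assume "a \<in> hq N (Suc n) y"
      then have a: "a \<in> carrier N" "hq N (Suc n) y = hq N (Suc n) a" using mem[OF y] by auto
      then obtain z where z: "z \<in> carrier N" "a = y \<oplus>\<^bsub>N\<^esub> (fps_X ^ Suc n) \<odot>\<^bsub>N\<^esub> z"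
        using hq_eq_iff[OF y a(1)] by blast
      have "a = y \<oplus>\<^bsub>N\<^esub> (fps_X ^ n) \<odot>\<^bsub>N\<^esub> (fps_X \<odot>\<^bsub>N\<^esub> z)"
        using z N by (simp add: kmod_assoc mult.commute)
      then have "hq N n a = hq N n y" using hq_eqI[OF y, of "fps_X \<odot>\<^bsub>N\<^esub> z"] z N by simp
      then show "a \<in> hq N n x" using mem[OF x] a eq by simp
    qed
  qed
qed

lemma hq_mono:
  assumes "m \<le> n" "hq N n x = hq N n y" "x \<in> carrier N" "y \<in> carrier N"
  shows "hq N m x = hq N m y"
proof -
  obtain z where z: "z \<in> carrier N" "y = x \<oplus>\<^bsub>N\<^esub> (fps_X ^ n) \<odot>\<^bsub>N\<^esub> z"
    using assms hq_eq_iff[of x y n] by blast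
  have "y = x \<oplus>\<^bsub>N\<^esub> (fps_X ^ m) \<odot>\<^bsub>N\<^esub> (fps_X ^ (n - m) \<odot>\<^bsub>N\<^esub> z)"
    using z N assms(1) by (simp add: kmod_assoc power_add[symmetric])
  then show ?thesis using hq_eqI[of x "fps_X ^ (n - m) \<odot>\<^bsub>N\<^esub> z" m] z N assms by simp
qed

text \<open>Sequences of representatives of the elements of the completion. Only consecutive terms are
  compared; further terms then agree with the \<open>n\<close>-th modulo \<open>h\<^sup>n\<close> as well.\<close>

definition hseq :: "(nat \<Rightarrow> 'a) \<Rightarrow> bool" where
  "hseq x \<longleftrightarrow> (\<forall>n. x n \<in> carrier N) \<and> (\<forall>n. hq N n (x (Suc n)) = hq N n (x n))"

end

definition hseq_module :: "(complex fps, 'a) module \<Rightarrow> (complex fps, nat \<Rightarrow> 'a) module" where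
  "hseq_module N = \<lparr>carrier = {x. hseq N x}, monoid.mult = undefined, one = undefined,
     zero = (\<lambda>_. \<zero>\<^bsub>N\<^esub>), add = (\<lambda>x y n. x n \<oplus>\<^bsub>N\<^esub> y n), module.smult = (\<lambda>c x n. c \<odot>\<^bsub>N\<^esub> x n)\<rparr>"

abbreviation hcls :: "(complex fps, 'a) module \<Rightarrow> (nat \<Rightarrow> 'a) \<Rightarrow> nat \<Rightarrow> 'a set" where
  "hcls N x \<equiv> \<lambda>n. hq N n (x n)"

context
  fixes N :: "(complex fps, 'a) module"
  assumes N: "kmod N"
begin

lemma hseqD: "hseq N x \<Longrightarrow> x n \<in> carrier N" "hseq N x \<Longrightarrow> hq N n (x (Suc n)) = hq N n (x n)"
  by (simp_all add: hseq_def N)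

lemma hseqI: "(\<And>n. x n \<in> carrier N) \<Longrightarrow> (\<And>n. hq N n (x (Suc n)) = hq N n (x n)) \<Longrightarrow> hseq N x"
  by (simp add: hseq_def N)

lemma hseq_const: "x \<in> carrier N \<Longrightarrow> hseq N (\<lambda>_. x)"
  by (rule hseqI) auto

lemma hseq_add:
  assumes x: "hseq N x" and y: "hseq N y"
  shows "hseq N (\<lambda>n. x n \<oplus>\<^bsub>N\<^esub> y n)"
proof (rule hseqI)
  show "x n \<oplus>\<^bsub>N\<^esub> y n \<in> carrier N" for n using hseqD(1)[OF x] hseqD(1)[OF y] N by simp
  show "hq N n (x (Suc n) \<oplus>\<^bsub>N\<^esub> y (Suc n)) = hq N n (x n \<oplus>\<^bsub>N\<^esub> y n)" for n
    by (simp add: lin_add[OF hq_lin[OF N]] hseqD(1)[OF x] hseqD(1)[OF y] hseqD(2)[OF x] hseqD(2)[OF y])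
qed

lemma hseq_smult:
  assumes x: "hseq N x"
  shows "hseq N (\<lambda>n. c \<odot>\<^bsub>N\<^esub> x n)"
proof (rule hseqI)
  show "c \<odot>\<^bsub>N\<^esub> x n \<in> carrier N" for n using hseqD(1)[OF x] N by simp
  show "hq N n (c \<odot>\<^bsub>N\<^esub> x (Suc n)) = hq N n (c \<odot>\<^bsub>N\<^esub> x n)" for n
    by (simp add: lin_smult[OF hq_lin[OF N]] hseqD(1)[OF x] hseqD(2)[OF x])
qed

lemma compl_carrier: "w \<in> carrier (h_completion N) \<longleftrightarrow> (\<exists>x. hseq N x \<and> w = hcls N x)"
proof
  assume "w \<in> carrier (h_completion N)"
  then have w: "\<forall>n. w n \<in> hq N n ` carrier N" "\<forall>n. w (Suc n) \<subseteq> w n"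
    by (simp_all add: h_completion_def hquot_carrier[OF N, symmetric] hquot_def)
  have "\<forall>n. \<exists>x. x \<in> carrier N \<and> w n = hq N n x" using w(1) by blast
  then obtain x where x: "\<And>n. x n \<in> carrier N" "\<And>n. w n = hq N n (x n)" by metis
  have "hseq N x"
  proof (rule hseqI)
    fix n show "x n \<in> carrier N" by (rule x(1))
    have "w (Suc n) \<subseteq> w n" using w(2) by blast
    then show "hq N n (x (Suc n)) = hq N n (x n)" unfolding x(2) hq_subset_iff[OF N x(1) x(1)] .
  qed
  then show "\<exists>x. hseq N x \<and> w = hcls N x" using x(2) by blast
next
  assume "\<exists>x. hseq N x \<and> w = hcls N x"
  then obtain x where x: "hseq N x" and w: "w = hcls N x" by blast
  have "\<forall>n. w n \<in> hq N n ` carrier N" unfolding w using hseqD(1)[OF x] by blast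
  moreover have "\<forall>n. w (Suc n) \<subseteq> w n"
    unfolding w by (intro allI, subst hq_subset_iff[OF N]) (use hseqD[OF x] in auto)
  ultimately show "w \<in> carrier (h_completion N)"
    by (simp add: h_completion_def hquot_carrier[OF N, symmetric] hquot_def)
qed

lemma hcls_carrier: "hseq N x \<Longrightarrow> hcls N x \<in> carrier (h_completion N)"
  unfolding compl_carrier by (rule exI[of _ x], rule conjI[OF _ HOL.refl])

lemma compl_add:
  assumes "\<And>n. x n \<in> carrier N" "\<And>n. y n \<in> carrier N"
  shows "hcls N x \<oplus>\<^bsub>h_completion N\<^esub> hcls N y = hcls N (\<lambda>n. x n \<oplus>\<^bsub>N\<^esub> y n)"
  by (simp add: h_completion_def hquot_def[symmetric] lin_add[OF hq_lin[OF N]] assms)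

lemma compl_smult:
  assumes "\<And>n. x n \<in> carrier N"
  shows "c \<odot>\<^bsub>h_completion N\<^esub> hcls N x = hcls N (\<lambda>n. c \<odot>\<^bsub>N\<^esub> x n)"
  by (simp add: h_completion_def hquot_def[symmetric] lin_smult[OF hq_lin[OF N]] assms)

lemma compl_zero: "\<zero>\<^bsub>h_completion N\<^esub> = hcls N (\<lambda>_. \<zero>\<^bsub>N\<^esub>)"
  by (simp add: h_completion_def hq_def coset_zero[OF N h_multiples_ksub[OF N]])

lemma hseq_module_kmod: "kmod (hseq_module N)"
proof (rule kmodI)
  show "abelian_group (hseq_module N)"
  proof (rule abelian_groupI)
    fix x assume x: "x \<in> carrier (hseq_module N)"
    show "\<exists>y\<in>carrier (hseq_module N). y \<oplus>\<^bsub>hseq_module N\<^esub> x = \<zero>\<^bsub>hseq_module N\<^esub>"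
      by (rule bexI[of _ "\<lambda>n. (-1) \<odot>\<^bsub>N\<^esub> x n"])
        (use x hseqD(1) in \<open>simp_all add: hseq_module_def hseq_smult kmod_add_ac(1)[OF N kmod_smult[OF N]]
          kmod_cancel_minus N\<close>)
  qed (simp_all add: hseq_module_def hseq_add hseq_const hseqD(1) kmod_add_ac N)
qed (simp_all add: hseq_module_def hseq_smult hseqD(1) kmod_distr_left kmod_distr_right kmod_assoc N)

lemma compl_kmod: "kmod (h_completion N)"
  by (rule kmod_image[OF hseq_module_kmod, where p = "hcls N"])
    (auto simp: hseq_module_def compl_carrier compl_zero compl_add compl_smult hseqD(1))

lemma to_completion_hcls: "to_completion N x = hcls N (\<lambda>_. x)"
  by (simp add: to_completion_def hq_def)

lemma to_completion_lin: "to_completion N \<in> lin N (h_completion N)"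
proof (rule linI)
  fix x assume x: "x \<in> carrier N"
  show "to_completion N x \<in> carrier (h_completion N)"
    unfolding to_completion_hcls by (rule hcls_carrier[OF hseq_const[OF x]])
  show "to_completion N (c \<odot>\<^bsub>N\<^esub> x) = c \<odot>\<^bsub>h_completion N\<^esub> to_completion N x" for c
    unfolding to_completion_hcls compl_smult[of "\<lambda>_. x", OF x] ..
  fix y assume y: "y \<in> carrier N"
  show "to_completion N (x \<oplus>\<^bsub>N\<^esub> y) = to_completion N x \<oplus>\<^bsub>h_completion N\<^esub> to_completion N y"
    unfolding to_completion_hcls compl_add[of "\<lambda>_. x" "\<lambda>_. y", OF x y] ..
qed

text \<open>Injectivity of the canonical map means that limits are unique, surjectivity that compatible
  sequences converge.\<close>

lemma h_complete_iff:
  "h_complete N \<longleftrightarrow>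
     (\<forall>x\<in>carrier N. \<forall>y\<in>carrier N. (\<forall>n. hq N n x = hq N n y) \<longrightarrow> x = y) \<and>
     (\<forall>x. hseq N x \<longrightarrow> (\<exists>y\<in>carrier N. \<forall>n. hq N n y = hq N n (x n)))"
proof -
  have "inj_on (to_completion N) (carrier N) \<longleftrightarrow>
      (\<forall>x\<in>carrier N. \<forall>y\<in>carrier N. (\<forall>n. hq N n x = hq N n y) \<longrightarrow> x = y)"
    unfolding inj_on_def to_completion_hcls fun_eq_iff ..
  moreover have "to_completion N ` carrier N = carrier (h_completion N) \<longleftrightarrow>
     (\<forall>x. hseq N x \<longrightarrow> (\<exists>y\<in>carrier N. \<forall>n. hq N n y = hq N n (x n)))" (is "?l \<longleftrightarrow> ?r")
  proof
    assume l: ?l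
    show ?r
    proof (intro allI impI)
      fix x assume "hseq N x"
      then have "hcls N x \<in> to_completion N ` carrier N" unfolding l by (rule hcls_carrier)
      then show "\<exists>y\<in>carrier N. \<forall>n. hq N n y = hq N n (x n)"
        unfolding to_completion_hcls image_iff fun_eq_iff by (auto 0 3)
    qed
  next
    assume r: ?r
    have "to_completion N ` carrier N \<subseteq> carrier (h_completion N)"
      using lin_closed[OF to_completion_lin] by blast
    moreover have "w \<in> to_completion N ` carrier N" if "w \<in> carrier (h_completion N)" for w
    proof -
      obtain x where x: "hseq N x" "w = hcls N x" using \<open>w \<in> _\<close> unfolding compl_carrier by blast
      then obtain y where y: "y \<in> carrier N" "\<forall>n. hq N n y = hq N n (x n)" using r by blast
      then have "w = to_completion N y" unfolding to_completion_hcls x(2) fun_eq_iff by simp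
      then show ?thesis using y(1) by blast
    qed
    ultimately show ?l by blast
  qed
  ultimately show ?thesis unfolding h_complete_def bij_betw_def by blast
qed

text \<open>The kernel of the projection of the completion to \<open>N / h\<^sup>n N\<close> consists of the multiples of
  \<open>h\<^sup>n\<close>; this is the reason why the completion is complete. If \<open>x\<close> represents an element of the
  kernel, then \<open>x n = h\<^sup>n z\<close>, and the later increments \<open>x (Suc m) - x m = h\<^sup>m y m\<close> with \<open>m = n + j\<close>
  leave \<open>h\<^sup>j y (n + j)\<close> after division by \<open>h\<^sup>n\<close>. The quotient is therefore represented by the sequence
  that starts at \<open>z\<close> and has these increments.\<close>

lemma compl_divide:
  assumes w: "w \<in> carrier (h_completion N)" and w0: "w n = hq N n \<zero>\<^bsub>N\<^esub>"
  obtains v where "v \<in> carrier (h_completion N)" "w = (fps_X ^ n) \<odot>\<^bsub>h_completion N\<^esub> v"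
proof -
  obtain x where x: "hseq N x" and wx: "w = hcls N x" using w unfolding compl_carrier by blast
  note X = hseqD(1)[OF x]
  have "\<exists>z\<in>carrier N. x n = \<zero>\<^bsub>N\<^esub> \<oplus>\<^bsub>N\<^esub> (fps_X ^ n) \<odot>\<^bsub>N\<^esub> z"
    using w0 hq_eq_iff[OF N kmod_zero[OF N] X, of n n] unfolding wx by simp
  then obtain z where z: "z \<in> carrier N" "x n = (fps_X ^ n) \<odot>\<^bsub>N\<^esub> z" using N by auto
  have "\<exists>y\<in>carrier N. x (Suc m) = x m \<oplus>\<^bsub>N\<^esub> (fps_X ^ m) \<odot>\<^bsub>N\<^esub> y" for m
    using hseqD(2)[OF x, of m] hq_eq_iff[OF N X X, of m m "Suc m"] by simp
  then obtain y where y: "\<And>m. y m \<in> carrier N" "\<And>m. x (Suc m) = x m \<oplus>\<^bsub>N\<^esub> (fps_X ^ m) \<odot>\<^bsub>N\<^esub> y m"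
    by metis
  \<comment> \<open>partial sums of the increments that remain after division by \<open>h\<^sup>n\<close>\<close>
  define u where "u = rec_nat z (\<lambda>m a. a \<oplus>\<^bsub>N\<^esub> (fps_X ^ m) \<odot>\<^bsub>N\<^esub> y (n + m))"
  have u: "u 0 = z" "\<And>m. u (Suc m) = u m \<oplus>\<^bsub>N\<^esub> (fps_X ^ m) \<odot>\<^bsub>N\<^esub> y (n + m)"
    by (simp_all add: u_def)
  have uc: "u m \<in> carrier N" for m by (induction m) (use u z y N in auto)
  have us: "hseq N u" by (rule hseqI) (use uc u y hq_eqI[OF N] in auto)
  have eq: "(fps_X ^ n) \<odot>\<^bsub>N\<^esub> u m = x (n + m)" for m
  proof (induction m)
    case 0 then show ?case using u z by simp
  next
    case (Suc m)
    then show ?case using y(2)[of "n + m"] y(1) uc N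
      by (simp add: u kmod_distr_right kmod_assoc power_add[symmetric])
  qed
  \<comment> \<open>the divided sequence runs \<open>n\<close> steps ahead, which the cosets do not notice\<close>
  have shift: "hq N m (x (j + m)) = hq N m (x m)" for m j
  proof (induction j)
    case (Suc j)
    have "hq N (j + m) (x (Suc (j + m))) = hq N (j + m) (x (j + m))" by (rule hseqD(2)[OF x])
    then have "hq N m (x (Suc (j + m))) = hq N m (x (j + m))"
      by (rule hq_mono[OF N le_add2 _ X X])
    then show ?case using Suc by simp
  qed simp
  show thesis
  proof (rule that)
    show "hcls N u \<in> carrier (h_completion N)" by (rule hcls_carrier[OF us])
    show "w = (fps_X ^ n) \<odot>\<^bsub>h_completion N\<^esub> hcls N u"
      unfolding compl_smult[of u, OF uc] wx eq shift ..
  qed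
qed

text \<open>Congruence modulo \<open>h\<^sup>n\<close> in the completion is equality of the \<open>n\<close>-th coordinates: one
  direction is a computation with representatives, the other is \<open>compl_divide\<close>.\<close>

lemma compl_hq_eq_iff:
  assumes w: "w \<in> carrier (h_completion N)" and w': "w' \<in> carrier (h_completion N)"
  shows "hq (h_completion N) n w = hq (h_completion N) n w' \<longleftrightarrow> w n = w' n"
proof -
  let ?C = "h_completion N"
  note C = compl_kmod
  obtain x where x: "hseq N x" and wx: "w = hcls N x" using w unfolding compl_carrier by blast
  note X = hseqD(1)[OF x]
  show ?thesis
  proof
    assume "hq ?C n w = hq ?C n w'"
    then obtain v where v: "v \<in> carrier ?C" "w' = w \<oplus>\<^bsub>?C\<^esub> (fps_X ^ n) \<odot>\<^bsub>?C\<^esub> v"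
      using hq_eq_iff[OF C w w'] by blast
    obtain y where y: "hseq N y" and vy: "v = hcls N y" using v(1) unfolding compl_carrier by blast
    note Y = hseqD(1)[OF y]
    have "w' n = hq N n (x n \<oplus>\<^bsub>N\<^esub> (fps_X ^ n) \<odot>\<^bsub>N\<^esub> y n)"
      unfolding v(2) wx vy compl_smult[of y, OF Y]
        compl_add[of x "\<lambda>m. (fps_X ^ n) \<odot>\<^bsub>N\<^esub> y m", OF X kmod_smult[OF N Y]] ..
    then show "w n = w' n" unfolding wx hq_eqI[OF N X Y] by simp
  next
    assume eq: "w n = w' n"
    obtain y where y: "hseq N y" and wy: "w' = hcls N y" using w' unfolding compl_carrier by blast
    note Y = hseqD(1)[OF y]
    let ?d = "w' \<oplus>\<^bsub>?C\<^esub> (-1) \<odot>\<^bsub>?C\<^esub> w"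
    have d: "?d \<in> carrier ?C" by (intro kmod_add[OF C] kmod_smult[OF C] w w')
    have "?d n = hq N n (y n \<oplus>\<^bsub>N\<^esub> (-1) \<odot>\<^bsub>N\<^esub> x n)"
      unfolding wx wy compl_smult[of x, OF X]
        compl_add[of y "\<lambda>m. (-1) \<odot>\<^bsub>N\<^esub> x m", OF Y kmod_smult[OF N X]] ..
    also have "\<dots> = hq N n (x n \<oplus>\<^bsub>N\<^esub> (-1) \<odot>\<^bsub>N\<^esub> x n)"
      using eq unfolding wx wy by (simp add: lin_add[OF hq_lin[OF N]] X Y N)
    also have "\<dots> = hq N n \<zero>\<^bsub>N\<^esub>" unfolding kmod_cancel_minus[OF N X] ..
    finally obtain v where v: "v \<in> carrier ?C" "?d = (fps_X ^ n) \<odot>\<^bsub>?C\<^esub> v"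
      using compl_divide[OF d] by blast
    have "w' = w \<oplus>\<^bsub>?C\<^esub> (fps_X ^ n) \<odot>\<^bsub>?C\<^esub> v"
      using kmod_diff_exists[OF C w w'] unfolding v(2) .
    then show "hq ?C n w = hq ?C n w'" unfolding hq_eq_iff[OF C w w'] using v(1) by blast
  qed
qed

end

text \<open>Congruence modulo \<open>h\<^sup>n\<close> can be read off the \<open>n\<close>-th coordinate, so a compatible sequence
  in the completion converges to its diagonal.\<close>

lemma compl_complete:
  assumes N: "kmod N"
  shows "h_complete (h_completion N)"
proof -
  let ?C = "h_completion N"
  note C = compl_kmod[OF N]
  show ?thesis unfolding h_complete_iff[OF C]
  proof (intro conjI ballI allI impI)
    fix w w' assume w: "w \<in> carrier ?C" "w' \<in> carrier ?C" and "\<forall>n. hq ?C n w = hq ?C n w'"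
    then show "w = w'" unfolding compl_hq_eq_iff[OF N w] by blast
  next
    fix w assume w: "hseq ?C w"
    note W = hseqD(1)[OF C w]
    \<comment> \<open>one representative serves the coset of index \<open>n\<close> and the one below, which links it to its
      predecessor; for \<open>n = 0\<close> the two coincide\<close>
    have "\<exists>x. x \<in> carrier N \<and> w n n = hq N n x \<and> w n (n - 1) = hq N (n - 1) x" for n
    proof -
      obtain x where x: "hseq N x" "w n = hcls N x" using W[of n] unfolding compl_carrier[OF N] by blast
      have "hq N (n - 1) (x (n - 1)) = hq N (n - 1) (x n)"
        using hseqD(2)[OF N x(1), of "n - 1"] by (cases n) simp_all
      then show ?thesis using hseqD(1)[OF N x(1)] unfolding x(2) by blast
    qed
    then obtain x where x: "\<And>n. x n \<in> carrier N" "\<And>n. w n n = hq N n (x n)"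
      "\<And>n. w n (n - 1) = hq N (n - 1) (x n)" by metis
    have xs: "hseq N x"
    proof (rule hseqI[OF N x(1)])
      fix n
      have "w (Suc n) n = w n n" using hseqD(2)[OF C w, of n] unfolding compl_hq_eq_iff[OF N W W] .
      then show "hq N n (x (Suc n)) = hq N n (x n)" using x(3)[of "Suc n"] x(2)[of n] by simp
    qed
    then have y: "hcls N x \<in> carrier ?C" by (rule hcls_carrier[OF N])
    have "\<forall>n. hq ?C n (hcls N x) = hq ?C n (w n)"
      unfolding compl_hq_eq_iff[OF N y W] using x(2) by simp
    then show "\<exists>y\<in>carrier ?C. \<forall>n. hq ?C n y = hq ?C n (w n)" using y by blast
  qed
qed

lemma lin_hq:
  assumes N: "kmod N" and W: "kmod W" and f: "f \<in> lin N W"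
    and x: "x \<in> carrier N" and y: "y \<in> carrier N" and eq: "hq N n x = hq N n y"
  shows "hq W n (f x) = hq W n (f y)"
proof -
  obtain z where z: "z \<in> carrier N" "y = x \<oplus>\<^bsub>N\<^esub> (fps_X ^ n) \<odot>\<^bsub>N\<^esub> z"
    using eq hq_eq_iff[OF N x y] by blast
  have "f y = f x \<oplus>\<^bsub>W\<^esub> (fps_X ^ n) \<odot>\<^bsub>W\<^esub> f z"
    unfolding z(2) by (simp add: lin_add[OF f x kmod_smult[OF N z(1)]] lin_smult[OF f z(1)])
  then show ?thesis using hq_eqI[OF W lin_closed[OF f x] lin_closed[OF f z(1)], of n] by simp
qed

text \<open>A linear map preserves congruences modulo \<open>h\<^sup>n\<close>. So it maps compatible sequences to compatible
  sequences, which have unique limits in \<open>W\<close>, and equivalent sequences to ones with the same limit.\<close>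

lemma compl_extend:
  assumes N: "kmod N" and W: "kmod W" "h_complete W" and f: "f \<in> lin N W"
  obtains g where "g \<in> lin (h_completion N) W" "\<And>x. x \<in> carrier N \<Longrightarrow> g (to_completion N x) = f x"
proof -
  let ?C = "h_completion N"
  have sep: "\<And>x y. x \<in> carrier W \<Longrightarrow> y \<in> carrier W \<Longrightarrow> (\<And>n. hq W n x = hq W n y) \<Longrightarrow> x = y"
    and lim: "\<And>x. hseq W x \<Longrightarrow> \<exists>y\<in>carrier W. \<forall>n. hq W n y = hq W n (x n)"
    using W(2) unfolding h_complete_iff[OF W(1)] by blast+
  have fs: "hseq W (\<lambda>n. f (x n))" if "hseq N x" for x
    by (rule hseqI[OF W(1)])
      (use hseqD[OF N that] lin_closed[OF f] lin_hq[OF N W(1) f] in auto)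
  \<comment> \<open>\<open>y\<close> is a limit of the image of some sequence representing \<open>w\<close>\<close>
  define R where "R w y \<longleftrightarrow> y \<in> carrier W \<and> (\<exists>x. hseq N x \<and> w = hcls N x \<and> (\<forall>n. hq W n y = hq W n (f (x n))))"
    for w y
  have ex: "\<exists>y. R w y" if w: "w \<in> carrier ?C" for w
  proof -
    obtain x where x: "hseq N x" "w = hcls N x" using w unfolding compl_carrier[OF N] by blast
    then show ?thesis using lim[OF fs[OF x(1)]] unfolding R_def by blast
  qed
  have uniq: "y = y'" if R: "R w y" "R w y'" for w y y'
  proof -
    obtain x where x: "hseq N x" "w = hcls N x" "\<And>n. hq W n y = hq W n (f (x n))"
      using R(1) unfolding R_def by blast
    obtain x' where x': "hseq N x'" "w = hcls N x'" "\<And>n. hq W n y' = hq W n (f (x' n))"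
      using R(2) unfolding R_def by blast
    have "hq N n (x n) = hq N n (x' n)" for n using x(2) x'(2) by (metis (no_types))
    then have "hq W n (f (x n)) = hq W n (f (x' n))" for n
      by (rule lin_hq[OF N W(1) f hseqD(1)[OF N x(1)] hseqD(1)[OF N x'(1)]])
    then show ?thesis using sep[of y y'] R x(3) x'(3) unfolding R_def by simp
  qed
  define g where "g w = (THE y. R w y)" for w
  have gI: "g w = y" if "R w y" for w y
    unfolding g_def
  proof (rule the_equality)
    show "R w y" by (rule that)
    show "z = y" if "R w z" for z by (rule uniq[OF that \<open>R w y\<close>])
  qed
  have gR: "R w (g w)" if w: "w \<in> carrier ?C" for w
  proof -
    obtain y where "R w y" using ex[OF w] by blast
    then show ?thesis unfolding gI[OF \<open>R w y\<close>] .
  qed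
  show thesis
  proof (rule that)
    show "g \<in> lin ?C W"
    proof (rule linI)
      fix w assume w: "w \<in> carrier ?C"
      then show gw: "g w \<in> carrier W" using gR unfolding R_def by blast
      obtain x where x: "hseq N x" "w = hcls N x" "\<And>n. hq W n (g w) = hq W n (f (x n))"
        using gR[OF w] unfolding R_def by blast
      note X = hseqD(1)[OF N x(1)]
      show "g (c \<odot>\<^bsub>?C\<^esub> w) = c \<odot>\<^bsub>W\<^esub> g w" for c
      proof (rule gI, unfold R_def, intro conjI exI[of _ "\<lambda>n. c \<odot>\<^bsub>N\<^esub> x n"] allI)
        show "c \<odot>\<^bsub>W\<^esub> g w \<in> carrier W" using gw W by simp
        show "hseq N (\<lambda>n. c \<odot>\<^bsub>N\<^esub> x n)" by (rule hseq_smult[OF N x(1)])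
        show "c \<odot>\<^bsub>?C\<^esub> w = hcls N (\<lambda>n. c \<odot>\<^bsub>N\<^esub> x n)"
          unfolding x(2) by (rule compl_smult[OF N X])
        show "hq W n (c \<odot>\<^bsub>W\<^esub> g w) = hq W n (f (c \<odot>\<^bsub>N\<^esub> x n))" for n
          unfolding lin_smult[OF f X] lin_smult[OF hq_lin[OF W(1)] gw] x(3)
            lin_smult[OF hq_lin[OF W(1)] lin_closed[OF f X]] ..
      qed
      fix w' assume w': "w' \<in> carrier ?C"
      then have gw': "g w' \<in> carrier W" using gR unfolding R_def by blast
      obtain y where y: "hseq N y" "w' = hcls N y" "\<And>n. hq W n (g w') = hq W n (f (y n))"
        using gR[OF w'] unfolding R_def by blast
      note Y = hseqD(1)[OF N y(1)]
      show "g (w \<oplus>\<^bsub>?C\<^esub> w') = g w \<oplus>\<^bsub>W\<^esub> g w'"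
      proof (rule gI, unfold R_def, intro conjI exI[of _ "\<lambda>n. x n \<oplus>\<^bsub>N\<^esub> y n"] allI)
        show "g w \<oplus>\<^bsub>W\<^esub> g w' \<in> carrier W" using gw gw' W by simp
        show "hseq N (\<lambda>n. x n \<oplus>\<^bsub>N\<^esub> y n)" by (rule hseq_add[OF N x(1) y(1)])
        show "w \<oplus>\<^bsub>?C\<^esub> w' = hcls N (\<lambda>n. x n \<oplus>\<^bsub>N\<^esub> y n)"
          unfolding x(2) y(2) by (rule compl_add[OF N X Y])
        show "hq W n (g w \<oplus>\<^bsub>W\<^esub> g w') = hq W n (f (x n \<oplus>\<^bsub>N\<^esub> y n))" for n
          unfolding lin_add[OF f X Y] lin_add[OF hq_lin[OF W(1)] gw gw'] x(3) y(3)
            lin_add[OF hq_lin[OF W(1)] lin_closed[OF f X] lin_closed[OF f Y]] ..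
      qed
    qed
    fix x assume x: "x \<in> carrier N"
    show "g (to_completion N x) = f x"
      by (rule gI) (use hseq_const[OF N x] lin_closed[OF f x] in
          \<open>auto simp: R_def to_completion_hcls[OF N] intro!: exI[of _ "\<lambda>_. x"]\<close>)
  qed
qed

text \<open>Every element of the completion is congruent modulo \<open>h\<^sup>n\<close> to an element of \<open>N\<close>, so \<open>f\<close> and
  \<open>g\<close> agree modulo every power of \<open>h\<close>.\<close>

lemma compl_ext:
  assumes N: "kmod N" and W: "kmod W" "h_complete W"
    and f: "f \<in> lin (h_completion N) W" and g: "g \<in> lin (h_completion N) W"
    and eq: "\<And>x. x \<in> carrier N \<Longrightarrow> f (to_completion N x) = g (to_completion N x)"
    and w: "w \<in> carrier (h_completion N)"
  shows "f w = g w"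
proof -
  let ?C = "h_completion N"
  note C = compl_kmod[OF N]
  obtain x where x: "hseq N x" "w = hcls N x" using w unfolding compl_carrier[OF N] by blast
  note X = hseqD(1)[OF N x(1)]
  have "hq W n (f w) = hq W n (g w)" for n
  proof -
    have t: "to_completion N (x n) \<in> carrier ?C" by (rule lin_closed[OF to_completion_lin[OF N] X])
    have "hq ?C n w = hq ?C n (to_completion N (x n))"
      unfolding compl_hq_eq_iff[OF N w t] unfolding x(2) to_completion_hcls[OF N] ..
    then have "hq W n (f w) = hq W n (f (to_completion N (x n)))"
      "hq W n (g w) = hq W n (g (to_completion N (x n)))"
      by (rule lin_hq[OF C W(1) f w t], rule lin_hq[OF C W(1) g w t])
    then show ?thesis using eq[OF X] by simp
  qed
  then show ?thesis
    using W(2) lin_closed[OF f w] lin_closed[OF g w] unfolding h_complete_iff[OF W(1)] by blast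
qed

section \<open>The universal property of the completed tensor product\<close>

definition complete_kmod :: "(complex fps, 'a) module \<Rightarrow> bool" where
  "complete_kmod W \<longleftrightarrow> kmod W \<and> h_complete W"

lemma complete_kmod_kmod [simp]: "complete_kmod W \<Longrightarrow> kmod W"
  by (simp add: complete_kmod_def)

lemma ctensor_complete [simp]: "kmods Ns \<Longrightarrow> complete_kmod (ctensor Ns)"
  unfolding complete_kmod_def ctensor_def by (intro conjI compl_kmod compl_complete tensor_kmod)

lemma pure_tpure: "pure Ns xs = to_completion (tensor_module Ns) (tpure Ns xs)"
  by (simp add: pure_def tpure_def)

lemma multilin_comp:
  assumes f: "multilin Ns W f" and g: "g \<in> lin W Z"
  shows "multilin Ns Z (\<lambda>xs. g (f xs))"
  unfolding multilin_def
  by (intro conjI ballI allI impI lin_closed[OF g] multilin_closed[OF f] lin_comp[OF _ g] multilin_lin[OF f])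

lemma multilin_cong:
  assumes "multilin Ns W f" "kmods Ns" "\<And>xs. xs \<in> tuples Ns \<Longrightarrow> f xs = g xs"
  shows "multilin Ns W g"
  unfolding multilin_def
proof (intro conjI ballI allI impI)
  fix xs assume xs: "xs \<in> tuples Ns"
  show "g xs \<in> carrier W" using multilin_closed[OF assms(1) xs] assms(3)[OF xs] by simp
  fix i assume i: "i < length Ns"
  show "(\<lambda>x. g (xs[i := x])) \<in> lin (Ns ! i) W"
    by (rule lin_cong[OF multilin_lin[OF assms(1) xs i]])
      (use assms i in \<open>auto intro: tuples_update[OF xs i]\<close>)
qed

lemma pure_multilin: "kmods Ns \<Longrightarrow> multilin Ns (ctensor Ns) (pure Ns)"
  unfolding pure_tpure[abs_def] ctensor_def
  by (intro multilin_comp[OF tpure_multilin to_completion_lin] tensor_kmod)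

lemma pure_closed: "kmods Ns \<Longrightarrow> xs \<in> tuples Ns \<Longrightarrow> pure Ns xs \<in> tensors Ns"
  by (rule multilin_closed[OF pure_multilin])

lemma ctensor_ext:
  assumes Ns: "kmods Ns" and W: "complete_kmod W"
    and f: "f \<in> lin (ctensor Ns) W" and g: "g \<in> lin (ctensor Ns) W"
    and eq: "\<And>xs. xs \<in> tuples Ns \<Longrightarrow> f (pure Ns xs) = g (pure Ns xs)"
    and w: "w \<in> tensors Ns"
  shows "f w = g w"
proof -
  note T = tensor_kmod[OF Ns]
  have W': "kmod W" "h_complete W" using W by (simp_all add: complete_kmod_def)
  have eq': "f (to_completion (tensor_module Ns) x) = g (to_completion (tensor_module Ns) x)"
    if x: "x \<in> carrier (tensor_module Ns)" for x
    by (rule tensor_ext[OF Ns lin_comp[OF to_completion_lin[OF T]] lin_comp[OF to_completion_lin[OF T]] W'(1) _ x])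
      (use f g eq in \<open>auto simp: ctensor_def pure_tpure\<close>)
  show ?thesis
    by (rule compl_ext[OF T W' f[unfolded ctensor_def] g[unfolded ctensor_def] eq' w[unfolded ctensor_def]])
qed

text \<open>The universal properties of the tensor product and of the completion, composed.\<close>

lemma ctensor_extend:
  assumes Ns: "kmods Ns" and W: "complete_kmod W" and f: "multilin Ns W f"
  obtains g where "g \<in> lin (ctensor Ns) W" "\<And>xs. xs \<in> tuples Ns \<Longrightarrow> g (pure Ns xs) = f xs"
proof -
  note T = tensor_kmod[OF Ns]
  have W': "kmod W" "h_complete W" using W by (simp_all add: complete_kmod_def)
  obtain g where g: "g \<in> lin (tensor_module Ns) W" "\<And>xs. xs \<in> tuples Ns \<Longrightarrow> g (tpure Ns xs) = f xs"
    by (rule tensor_extend[OF Ns W'(1) f]) (rule that)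
  obtain g' where g': "g' \<in> lin (h_completion (tensor_module Ns)) W"
    "\<And>x. x \<in> carrier (tensor_module Ns) \<Longrightarrow> g' (to_completion (tensor_module Ns) x) = g x"
    by (rule compl_extend[OF T W' g(1)]) (rule that)
  show thesis
  proof (rule that)
    show "g' \<in> lin (ctensor Ns) W" using g'(1) by (simp add: ctensor_def)
    show "g' (pure Ns xs) = f xs" if "xs \<in> tuples Ns" for xs
      unfolding pure_tpure g'(2)[OF multilin_closed[OF tpure_multilin[OF Ns] that]] by (rule g(2)[OF that])
  qed
qed

lemma lift_spec:
  assumes Ns: "kmods Ns" and W: "complete_kmod W" and f: "multilin Ns W f"
  shows "lift Ns W f \<in> extensional (tensors Ns) \<and> lift Ns W f \<in> lin (ctensor Ns) W \<and>
     (\<forall>xs\<in>tuples Ns. lift Ns W f (pure Ns xs) = f xs)"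
proof -
  obtain g where g: "g \<in> lin (ctensor Ns) W" "\<And>xs. xs \<in> tuples Ns \<Longrightarrow> g (pure Ns xs) = f xs"
    by (rule ctensor_extend[OF Ns W f]) (rule that)
  have K: "kmod (ctensor Ns)" using Ns by simp
  have "\<exists>!g. g \<in> extensional (tensors Ns) \<and> g \<in> lin (ctensor Ns) W \<and>
     (\<forall>xs\<in>tuples Ns. g (pure Ns xs) = f xs)"
  proof (rule ex1I)
    show "restrict g (tensors Ns) \<in> extensional (tensors Ns) \<and>
      restrict g (tensors Ns) \<in> lin (ctensor Ns) W \<and>
      (\<forall>xs\<in>tuples Ns. restrict g (tensors Ns) (pure Ns xs) = f xs)"
      using lin_restrict[OF g(1) K] g(2) pure_closed[OF Ns] by simp
    fix h assume h: "h \<in> extensional (tensors Ns) \<and> h \<in> lin (ctensor Ns) W \<and>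
      (\<forall>xs\<in>tuples Ns. h (pure Ns xs) = f xs)"
    show "h = restrict g (tensors Ns)"
    proof (rule extensionalityI)
      show "h \<in> extensional (tensors Ns)" using h by simp
      fix w assume w: "w \<in> tensors Ns"
      have "h w = g w" by (rule ctensor_ext[OF Ns W _ g(1) _ w]) (use h g(2) in auto)
      then show "h w = restrict g (tensors Ns) w" using w by simp
    qed simp
  qed
  from theI'[OF this] show ?thesis unfolding lift_def .
qed

lemma lift_extensional:
  "kmods Ns \<Longrightarrow> complete_kmod W \<Longrightarrow> multilin Ns W f \<Longrightarrow> lift Ns W f \<in> extensional (tensors Ns)"
  using lift_spec by blast

lemma lift_lin: "kmods Ns \<Longrightarrow> complete_kmod W \<Longrightarrow> multilin Ns W f \<Longrightarrow> lift Ns W f \<in> lin (ctensor Ns) W"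
  using lift_spec by blast

lemma lift_pure:
  "kmods Ns \<Longrightarrow> complete_kmod W \<Longrightarrow> multilin Ns W f \<Longrightarrow> xs \<in> tuples Ns \<Longrightarrow> lift Ns W f (pure Ns xs) = f xs"
  using lift_spec by blast

lemma lift_cong: "(\<And>xs. xs \<in> tuples Ns \<Longrightarrow> f xs = g xs) \<Longrightarrow> lift Ns W f = lift Ns W g"
  unfolding lift_def by simp

lemma lift_comp:
  assumes Ns: "kmods Ns" and W: "complete_kmod W" and f: "multilin Ns W f" and Z: "complete_kmod Z"
    and g: "g \<in> lin W Z" and w: "w \<in> tensors Ns"
  shows "g (lift Ns W f w) = lift Ns Z (\<lambda>xs. g (f xs)) w"
proof -
  note m = multilin_comp[OF f g]
  show ?thesis
    by (rule ctensor_ext[OF Ns Z lin_comp[OF lift_lin[OF Ns W f] g] lift_lin[OF Ns Z m] _ w])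
      (simp add: lift_pure[OF Ns W f] lift_pure[OF Ns Z m])
qed

lemma lin_scale:
  assumes "kmod W" "f \<in> lin N W"
  shows "(\<lambda>x. c \<odot>\<^bsub>W\<^esub> f x) \<in> lin N W"
  by (rule linI)
    (use assms in \<open>simp_all add: lin_closed lin_add[OF assms(2)] lin_smult[OF assms(2)] kmod_distr_right
      kmod_assoc mult.commute\<close>)

lemma lin_plus:
  assumes W: "kmod W" and f: "f \<in> lin N W" and g: "g \<in> lin N W"
  shows "(\<lambda>x. f x \<oplus>\<^bsub>W\<^esub> g x) \<in> lin N W"
proof (rule linI)
  fix x assume x: "x \<in> carrier N"
  note c = lin_closed[OF f x] lin_closed[OF g x]
  show "f x \<oplus>\<^bsub>W\<^esub> g x \<in> carrier W" by (rule kmod_add[OF W c])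
  show "f (c \<odot>\<^bsub>N\<^esub> x) \<oplus>\<^bsub>W\<^esub> g (c \<odot>\<^bsub>N\<^esub> x) = c \<odot>\<^bsub>W\<^esub> (f x \<oplus>\<^bsub>W\<^esub> g x)" for c
    unfolding lin_smult[OF f x] lin_smult[OF g x] kmod_distr_right[OF W c] ..
  fix y assume y: "y \<in> carrier N"
  note d = lin_closed[OF f y] lin_closed[OF g y]
  have "f x \<oplus>\<^bsub>W\<^esub> f y \<oplus>\<^bsub>W\<^esub> (g x \<oplus>\<^bsub>W\<^esub> g y) = f x \<oplus>\<^bsub>W\<^esub> g x \<oplus>\<^bsub>W\<^esub> (f y \<oplus>\<^bsub>W\<^esub> g y)"
    using c d W by (simp add: kmod_add_ac)
  then show "f (x \<oplus>\<^bsub>N\<^esub> y) \<oplus>\<^bsub>W\<^esub> g (x \<oplus>\<^bsub>N\<^esub> y) = f x \<oplus>\<^bsub>W\<^esub> g x \<oplus>\<^bsub>W\<^esub> (f y \<oplus>\<^bsub>W\<^esub> g y)"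
    unfolding lin_add[OF f x y] lin_add[OF g x y] .
qed

text \<open>Linearity is inherited from the multilinear map because a lift is determined by its values on
  pure tensors. This turns iterated lifts into bilinear maps.\<close>

lemma lift_param:
  assumes Ns: "kmods Ns" and W: "complete_kmod W" and P: "kmod P"
    and F: "\<And>p. p \<in> carrier P \<Longrightarrow> multilin Ns W (F p)"
    and L: "\<And>xs. xs \<in> tuples Ns \<Longrightarrow> (\<lambda>p. F p xs) \<in> lin P W"
    and w: "w \<in> tensors Ns"
  shows "(\<lambda>p. lift Ns W (F p) w) \<in> lin P W"
proof (rule linI)
  fix p assume p: "p \<in> carrier P"
  note l = lift_lin[OF Ns W F] and lp = lift_pure[OF Ns W F]
  have W': "kmod W" using W by simp
  show "lift Ns W (F p) w \<in> carrier W" by (rule lin_closed[OF l[OF p] w])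
  show "lift Ns W (F (c \<odot>\<^bsub>P\<^esub> p)) w = c \<odot>\<^bsub>W\<^esub> lift Ns W (F p) w" for c
    by (rule ctensor_ext[OF Ns W l[OF kmod_smult[OF P p]] lin_scale[OF W' l[OF p]] _ w])
      (simp add: lp kmod_smult[OF P p] p lin_smult[OF L])
  fix q assume q: "q \<in> carrier P"
  show "lift Ns W (F (p \<oplus>\<^bsub>P\<^esub> q)) w = lift Ns W (F p) w \<oplus>\<^bsub>W\<^esub> lift Ns W (F q) w"
    by (rule ctensor_ext[OF Ns W l[OF kmod_add[OF P p q]] lin_plus[OF W' l[OF p] l[OF q]] _ w])
      (simp add: lp kmod_add[OF P p q] p q lin_add[OF L])
qed

definition bilin ::
    "(complex fps, 'a) module \<Rightarrow> (complex fps, 'b) module \<Rightarrow> (complex fps, 'c) module \<Rightarrow>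
      ('a \<Rightarrow> 'b \<Rightarrow> 'c) \<Rightarrow> bool" where
  "bilin A B W \<beta> \<longleftrightarrow> (\<forall>a\<in>carrier A. (\<lambda>b. \<beta> a b) \<in> lin B W) \<and> (\<forall>b\<in>carrier B. (\<lambda>a. \<beta> a b) \<in> lin A W)"

lemma bilinD1: "bilin A B W \<beta> \<Longrightarrow> b \<in> carrier B \<Longrightarrow> (\<lambda>a. \<beta> a b) \<in> lin A W"
  and bilinD2: "bilin A B W \<beta> \<Longrightarrow> a \<in> carrier A \<Longrightarrow> (\<lambda>b. \<beta> a b) \<in> lin B W"
  by (simp_all add: bilin_def)

lemma bilin_closed: "bilin A B W \<beta> \<Longrightarrow> a \<in> carrier A \<Longrightarrow> b \<in> carrier B \<Longrightarrow> \<beta> a b \<in> carrier W"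
  by (rule lin_closed[OF bilinD1])

definition bimultilin ::
    "(complex fps, 'a) module list \<Rightarrow> (complex fps, 'b) module list \<Rightarrow> (complex fps, 'c) module \<Rightarrow>
      ('a list \<Rightarrow> 'b list \<Rightarrow> 'c) \<Rightarrow> bool" where
  "bimultilin Us Ks W F \<longleftrightarrow> (\<forall>us\<in>tuples Us. multilin Ks W (F us)) \<and>
     (\<forall>xs\<in>tuples Ks. multilin Us W (\<lambda>us. F us xs))"

text \<open>The operations \<open>juxtapose\<close>, \<open>factorwise_action\<close>, \<open>tensor_mult\<close> and \<open>R_check\<close> are all of this
  form: one lift inside another. The inner lift depends linearly on the parameters of the outer one, by
  \<open>lift_param\<close>.\<close>

lemma bilift:
  assumes Us: "kmods Us" and Ks: "kmods Ks" and W: "complete_kmod W" and F: "bimultilin Us Ks W F"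
  shows bilift_bilin: "bilin (ctensor Us) (ctensor Ks) W (\<lambda>t w. lift Us W (\<lambda>us. lift Ks W (F us) w) t)"
    and bilift_pure: "us \<in> tuples Us \<Longrightarrow> xs \<in> tuples Ks \<Longrightarrow>
      lift Us W (\<lambda>us. lift Ks W (F us) (pure Ks xs)) (pure Us us) = F us xs"
    and bilift_multilin: "w \<in> tensors Ks \<Longrightarrow> multilin Us W (\<lambda>us. lift Ks W (F us) w)"
proof -
  have F1: "multilin Ks W (F us)" if "us \<in> tuples Us" for us
    using F that by (simp add: bimultilin_def)
  have F2: "multilin Us W (\<lambda>us. F us xs)" if "xs \<in> tuples Ks" for xs
    using F that by (simp add: bimultilin_def)
  have M: "multilin Us W (\<lambda>us. lift Ks W (F us) w)" if w: "w \<in> tensors Ks" for w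
    unfolding multilin_def
  proof (intro conjI ballI allI impI)
    fix us assume us: "us \<in> tuples Us"
    show "lift Ks W (F us) w \<in> carrier W" by (rule lin_closed[OF lift_lin[OF Ks W F1[OF us]] w])
    fix i assume i: "i < length Us"
    have "kmod (Us ! i)" using Us i by auto
    then show "(\<lambda>x. lift Ks W (F (us[i := x])) w) \<in> lin (Us ! i) W"
      by (rule lift_param[OF Ks W _ F1[OF tuples_update[OF us i]] multilin_lin[OF F2 us i] w])
  qed
  show "w \<in> tensors Ks \<Longrightarrow> multilin Us W (\<lambda>us. lift Ks W (F us) w)" by (rule M)
  show "bilin (ctensor Us) (ctensor Ks) W (\<lambda>t w. lift Us W (\<lambda>us. lift Ks W (F us) w) t)"
    unfolding bilin_def
  proof (intro conjI ballI)
    fix w assume "w \<in> tensors Ks"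
    then show "lift Us W (\<lambda>us. lift Ks W (F us) w) \<in> lin (ctensor Us) W"
      by (rule lift_lin[OF Us W M])
  next
    fix t assume t: "t \<in> tensors Us"
    show "(\<lambda>w. lift Us W (\<lambda>us. lift Ks W (F us) w) t) \<in> lin (ctensor Ks) W"
      by (rule lift_param[OF Us W complete_kmod_kmod[OF ctensor_complete[OF Ks]] M lift_lin[OF Ks W F1] t])
  qed
  show "lift Us W (\<lambda>us. lift Ks W (F us) (pure Ks xs)) (pure Us us) = F us xs"
    if us: "us \<in> tuples Us" and xs: "xs \<in> tuples Ks"
    by (simp add: lift_pure[OF Us W M[OF pure_closed[OF Ks xs]] us] lift_pure[OF Ks W F1[OF us] xs])
qed

section \<open>Juxtaposition of tensors\<close>

lemma tuples_append_iff:
  "xs \<in> tuples (As @ Bs) \<longleftrightarrow> (\<exists>as bs. xs = as @ bs \<and> as \<in> tuples As \<and> bs \<in> tuples Bs)"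
  unfolding tuples_iff by (auto simp: list_all2_append2 intro: list_all2_appendI dest: list_all2_lengthD)

lemma tuples_length: "xs \<in> tuples Ns \<Longrightarrow> length xs = length Ns"
  by (simp add: tuples_iff list_all2_lengthD)

text \<open>Multilinearity concerns one argument at a time, and every argument lies in one of the two
  blocks.\<close>

lemma multilin_append:
  "multilin (As @ Bs) W f \<longleftrightarrow>
    (\<forall>as\<in>tuples As. multilin Bs W (\<lambda>bs. f (as @ bs))) \<and>
    (\<forall>bs\<in>tuples Bs. multilin As W (\<lambda>as. f (as @ bs)))" (is "?l \<longleftrightarrow> ?r")
proof
  assume l: ?l
  have m: "f (as @ bs) \<in> carrier W" if "as \<in> tuples As" "bs \<in> tuples Bs" for as bs
    by (rule multilin_closed[OF l]) (use that tuples_append_iff in blast)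
  have i1: "(\<lambda>x. f (as[i := x] @ bs)) \<in> lin (As ! i) W"
    if "as \<in> tuples As" "bs \<in> tuples Bs" "i < length As" for as bs i
    using multilin_lin[OF l, of "as @ bs" i] that tuples_append_iff[of "as @ bs" As Bs]
    by (auto simp: tuples_length list_update_append nth_append)
  have i2: "(\<lambda>x. f (as @ bs[i := x])) \<in> lin (Bs ! i) W"
    if "as \<in> tuples As" "bs \<in> tuples Bs" "i < length Bs" for as bs i
    using multilin_lin[OF l, of "as @ bs" "length As + i"] that tuples_append_iff[of "as @ bs" As Bs]
    by (auto simp: tuples_length list_update_append nth_append)
  show ?r using m i1 i2 unfolding multilin_def by blast
next
  assume r: ?r
  have r1: "multilin Bs W (\<lambda>bs. f (as @ bs))" if "as \<in> tuples As" for as using r that by blast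
  have r2: "multilin As W (\<lambda>as. f (as @ bs))" if "bs \<in> tuples Bs" for bs using r that by blast
  show ?l unfolding multilin_def
  proof (intro conjI ballI allI impI)
    fix xs assume "xs \<in> tuples (As @ Bs)"
    then obtain as bs where xs: "xs = as @ bs" and as: "as \<in> tuples As" and bs: "bs \<in> tuples Bs"
      unfolding tuples_append_iff by blast
    show "f xs \<in> carrier W" unfolding xs by (rule multilin_closed[OF r1[OF as] bs])
    fix i assume i: "i < length (As @ Bs)"
    show "(\<lambda>x. f (xs[i := x])) \<in> lin ((As @ Bs) ! i) W"
    proof (cases "i < length As")
      case True
      then show ?thesis using multilin_lin[OF r2[OF bs] as True]
        by (simp add: xs list_update_append tuples_length[OF as] nth_append)
    next
      case False
      then have "i - length As < length Bs" using i by auto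
      then show ?thesis using multilin_lin[OF r1[OF as] bs, of "i - length As"] False
        by (simp add: xs list_update_append tuples_length[OF as] nth_append)
    qed
  qed
qed

context
  fixes As Bs :: "(complex fps, 'a) module list"
  assumes As: "kmods As" and Bs: "kmods Bs"
begin

lemma juxt_bimultilin: "bimultilin As Bs (ctensor (As @ Bs)) (\<lambda>as bs. pure (As @ Bs) (as @ bs))"
  using pure_multilin[of "As @ Bs"] As Bs unfolding multilin_append bimultilin_def by auto

lemma kmods_AB: "kmods (As @ Bs)" using As Bs by auto

lemma juxt_bilin: "bilin (ctensor As) (ctensor Bs) (ctensor (As @ Bs)) (juxtapose As Bs)"
  using bilift_bilin[OF As Bs ctensor_complete[OF kmods_AB] juxt_bimultilin]
  unfolding juxtapose_def[abs_def] .

lemma juxt_pure: "as \<in> tuples As \<Longrightarrow> bs \<in> tuples Bs \<Longrightarrow>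
    juxtapose As Bs (pure As as) (pure Bs bs) = pure (As @ Bs) (as @ bs)"
  using bilift_pure[OF As Bs ctensor_complete[OF kmods_AB] juxt_bimultilin]
  unfolding juxtapose_def .

lemma juxt_closed: "x \<in> tensors As \<Longrightarrow> y \<in> tensors Bs \<Longrightarrow>
    juxtapose As Bs x y \<in> tensors (As @ Bs)"
  by (rule bilin_closed[OF juxt_bilin])

lemma juxt_lin1: "y \<in> tensors Bs \<Longrightarrow>
    (\<lambda>x. juxtapose As Bs x y) \<in> tlin As (As @ Bs)"
  by (rule bilinD1[OF juxt_bilin])

lemma juxt_lin2: "x \<in> tensors As \<Longrightarrow>
    juxtapose As Bs x \<in> tlin Bs (As @ Bs)"
  using bilinD2[OF juxt_bilin] by simp

lemma juxt_ext:
  assumes W: "complete_kmod W" and f: "f \<in> lin (ctensor (As @ Bs)) W" and g: "g \<in> lin (ctensor (As @ Bs)) W"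
    and eq: "\<And>as bs. as \<in> tuples As \<Longrightarrow> bs \<in> tuples Bs \<Longrightarrow>
      f (juxtapose As Bs (pure As as) (pure Bs bs)) = g (juxtapose As Bs (pure As as) (pure Bs bs))"
    and w: "w \<in> tensors (As @ Bs)"
  shows "f w = g w"
proof (rule ctensor_ext[OF kmods_AB W f g _ w])
  fix xs assume "xs \<in> tuples (As @ Bs)"
  then obtain as bs where xs: "xs = as @ bs" "as \<in> tuples As" "bs \<in> tuples Bs"
    unfolding tuples_append_iff by blast
  show "f (pure (As @ Bs) xs) = g (pure (As @ Bs) xs)"
    using eq[OF xs(2,3)] unfolding juxt_pure[OF xs(2,3)] xs(1) .
qed

end

lemma juxt_assoc:
  assumes K: "kmods As" "kmods Bs" "kmods Cs"
    and x: "x \<in> tensors As" and y: "y \<in> tensors Bs" and z: "z \<in> tensors Cs"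
  shows "juxtapose (As @ Bs) Cs (juxtapose As Bs x y) z = juxtapose As (Bs @ Cs) x (juxtapose Bs Cs y z)"
proof -
  have K2: "kmods (As @ Bs)" "kmods (Bs @ Cs)" "kmods (As @ Bs @ Cs)" using K by auto
  note W = ctensor_complete[OF K2(3)]
  have t: "as @ bs \<in> tuples (As @ Bs)" if "as \<in> tuples As" "bs \<in> tuples Bs" for as bs As Bs
    using that tuples_append_iff by blast
  have l1: "(\<lambda>x. juxtapose (As @ Bs) Cs (juxtapose As Bs x y) z) \<in> tlin As (As @ Bs @ Cs)"
    if "y \<in> tensors Bs" "z \<in> tensors Cs" for y z
    using lin_comp[OF juxt_lin1[OF K(1,2) that(1)] juxt_lin1[OF K2(1) K(3) that(2)]] by simp
  have l2: "(\<lambda>y. juxtapose (As @ Bs) Cs (juxtapose As Bs x y) z) \<in> tlin Bs (As @ Bs @ Cs)"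
    if "x \<in> tensors As" "z \<in> tensors Cs" for x z
    using lin_comp[OF juxt_lin2[OF K(1,2) that(1)] juxt_lin1[OF K2(1) K(3) that(2)]] by simp
  have l3: "(\<lambda>z. juxtapose (As @ Bs) Cs (juxtapose As Bs x y) z) \<in> tlin Cs (As @ Bs @ Cs)"
    if "x \<in> tensors As" "y \<in> tensors Bs" for x y
    using juxt_lin2[OF K2(1) K(3) juxt_closed[OF K(1,2) that]] by simp
  have r1: "(\<lambda>x. juxtapose As (Bs @ Cs) x (juxtapose Bs Cs y z)) \<in> tlin As (As @ Bs @ Cs)"
    if "y \<in> tensors Bs" "z \<in> tensors Cs" for y z
    by (rule juxt_lin1[OF K(1) K2(2) juxt_closed[OF K(2,3) that]])
  have r2: "(\<lambda>y. juxtapose As (Bs @ Cs) x (juxtapose Bs Cs y z)) \<in> tlin Bs (As @ Bs @ Cs)"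
    if "x \<in> tensors As" "z \<in> tensors Cs" for x z
    by (rule lin_comp[OF juxt_lin1[OF K(2,3) that(2)] juxt_lin2[OF K(1) K2(2) that(1)]])
  have r3: "(\<lambda>z. juxtapose As (Bs @ Cs) x (juxtapose Bs Cs y z)) \<in> tlin Cs (As @ Bs @ Cs)"
    if "x \<in> tensors As" "y \<in> tensors Bs" for x y
    by (rule lin_comp[OF juxt_lin2[OF K(2,3) that(2)] juxt_lin2[OF K(1) K2(2) that(1)]])
  show ?thesis
  proof (rule ctensor_ext[OF K(1) W l1[OF y z] r1[OF y z] _ x])
    fix as assume as: "as \<in> tuples As"
    note pa = pure_closed[OF K(1) as]
    show "juxtapose (As @ Bs) Cs (juxtapose As Bs (pure As as) y) z =
      juxtapose As (Bs @ Cs) (pure As as) (juxtapose Bs Cs y z)"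
    proof (rule ctensor_ext[OF K(2) W l2[OF pa z] r2[OF pa z] _ y])
      fix bs assume bs: "bs \<in> tuples Bs"
      note pb = pure_closed[OF K(2) bs]
      show "juxtapose (As @ Bs) Cs (juxtapose As Bs (pure As as) (pure Bs bs)) z =
        juxtapose As (Bs @ Cs) (pure As as) (juxtapose Bs Cs (pure Bs bs) z)"
      proof (rule ctensor_ext[OF K(3) W l3[OF pa pb] r3[OF pa pb] _ z])
        fix cs assume cs: "cs \<in> tuples Cs"
        show "juxtapose (As @ Bs) Cs (juxtapose As Bs (pure As as) (pure Bs bs)) (pure Cs cs) =
          juxtapose As (Bs @ Cs) (pure As as) (juxtapose Bs Cs (pure Bs bs) (pure Cs cs))"
          unfolding juxt_pure[OF K(1,2) as bs] juxt_pure[OF K(2,3) bs cs]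
            juxt_pure[OF K2(1) K(3) t[OF as bs] cs] juxt_pure[OF K(1) K2(2) as t[OF bs cs]] by simp
      qed
    qed
  qed
qed

lemma juxt_Nil_left:
  assumes K: "kmods Bs" and y: "y \<in> tensors Bs"
  shows "juxtapose [] Bs (pure [] []) y = y"
proof -
  have N: "kmods []" by simp
  have p: "pure [] [] \<in> tensors []" by (rule pure_closed) auto
  show ?thesis
    by (rule ctensor_ext[OF K ctensor_complete[OF K] juxt_lin2[OF N K p, simplified] lin_ident _ y])
      (use juxt_pure[OF N K, of "[]"] in simp)
qed

lemma juxt_Nil_right:
  assumes K: "kmods As" and x: "x \<in> tensors As"
  shows "juxtapose As [] x (pure [] []) = x"
proof -
  have N: "kmods []" by simp
  have p: "pure [] [] \<in> tensors []" by (rule pure_closed) auto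
  show ?thesis
    by (rule ctensor_ext[OF K ctensor_complete[OF K] juxt_lin1[OF K N p, simplified] lin_ident _ x])
      (use juxt_pure[OF K N, of _ "[]"] in simp)
qed

section \<open>Maps acting on consecutive tensor factors\<close>

lemma tuples_append: "as \<in> tuples As \<Longrightarrow> bs \<in> tuples Bs \<Longrightarrow> as @ bs \<in> tuples (As @ Bs)"
  unfolding tuples_append_iff by blast

lemma juxt_ext3:
  assumes K: "kmods As" "kmods Bs" "kmods Cs"
    and W: "complete_kmod W" and f: "f \<in> lin (ctensor (As @ Bs @ Cs)) W" and g: "g \<in> lin (ctensor (As @ Bs @ Cs)) W"
    and eq: "\<And>x y z. x \<in> tensors As \<Longrightarrow> y \<in> tensors Bs \<Longrightarrow> z \<in> tensors Cs \<Longrightarrow>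
      f (juxtapose As (Bs @ Cs) x (juxtapose Bs Cs y z)) = g (juxtapose As (Bs @ Cs) x (juxtapose Bs Cs y z))"
    and w: "w \<in> tensors (As @ Bs @ Cs)"
  shows "f w = g w"
proof -
  have K2: "kmods (Bs @ Cs)" using K by auto
  show ?thesis
  proof (rule juxt_ext[OF K(1) K2 W f g _ w])
    fix as xs assume as: "as \<in> tuples As" and "xs \<in> tuples (Bs @ Cs)"
    then obtain bs cs where xs: "xs = bs @ cs" and bs: "bs \<in> tuples Bs" and cs: "cs \<in> tuples Cs"
      unfolding tuples_append_iff by blast
    show "f (juxtapose As (Bs @ Cs) (pure As as) (pure (Bs @ Cs) xs)) =
      g (juxtapose As (Bs @ Cs) (pure As as) (pure (Bs @ Cs) xs))"
      using eq[OF pure_closed[OF K(1) as] pure_closed[OF K(2) bs] pure_closed[OF K(3) cs]]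
      unfolding xs juxt_pure[OF K(2,3) bs cs] .
  qed
qed

context
  fixes As Bs Bs' Cs :: "(complex fps, 'a) module list"
  assumes K: "kmods As" "kmods Bs" "kmods Bs'" "kmods Cs"
begin

lemma idt_kmods: "kmods (As @ Bs @ Cs)" "kmods (As @ Bs' @ Cs)" "kmods (Bs' @ Cs)" "kmods (Bs @ Cs)"
  using K by auto

lemma idt_multilin:
  assumes f: "f \<in> tlin Bs Bs'"
  shows "multilin (As @ Bs @ Cs) (ctensor (As @ Bs' @ Cs)) (\<lambda>xs. juxtapose As (Bs' @ Cs)
          (pure As (take (length As) xs))
          (juxtapose Bs' Cs
             (f (pure Bs (take (length Bs) (drop (length As) xs))))
             (pure Cs (drop (length As + length Bs) xs))))"
    (is "multilin _ ?W ?F")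
proof -
  let ?G = "\<lambda>as bs cs. juxtapose As (Bs' @ Cs) (pure As as) (juxtapose Bs' Cs (f (pure Bs bs)) (pure Cs cs))"
  have F: "?F (as @ bs @ cs) = ?G as bs cs"
    if "as \<in> tuples As" "bs \<in> tuples Bs" for as bs cs
    using that[THEN tuples_length] by simp
  note pA = pure_closed[OF K(1)] and pB = pure_closed[OF K(2)] and pC = pure_closed[OF K(4)]
  note fB = lin_closed[OF f pB]
  have mA: "multilin As ?W (\<lambda>as. ?F (as @ bs @ cs))" if bs: "bs \<in> tuples Bs" and cs: "cs \<in> tuples Cs" for bs cs
    by (rule multilin_cong[OF multilin_comp[OF pure_multilin[OF K(1)]
          juxt_lin1[OF K(1) idt_kmods(3) juxt_closed[OF K(3,4) fB[OF bs] pC[OF cs]]]] K(1)])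
      (simp only: F[OF _ bs])
  have mB: "multilin Bs ?W (\<lambda>bs. ?F (as @ bs @ cs))" if as: "as \<in> tuples As" and cs: "cs \<in> tuples Cs" for as cs
    by (rule multilin_cong[OF multilin_comp[OF multilin_comp[OF multilin_comp[OF pure_multilin[OF K(2)] f]
          juxt_lin1[OF K(3,4) pC[OF cs]]] juxt_lin2[OF K(1) idt_kmods(3) pA[OF as]]] K(2)])
      (simp only: F[OF as])
  have mC: "multilin Cs ?W (\<lambda>cs. ?F (as @ bs @ cs))" if as: "as \<in> tuples As" and bs: "bs \<in> tuples Bs" for as bs
    by (rule multilin_cong[OF multilin_comp[OF multilin_comp[OF pure_multilin[OF K(4)]
          juxt_lin2[OF K(3,4) fB[OF bs]]] juxt_lin2[OF K(1) idt_kmods(3) pA[OF as]]] K(4)])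
      (simp only: F[OF as bs])
  show ?thesis
    unfolding multilin_append[of As] multilin_append[of Bs]
  proof (intro conjI ballI)
    fix ys assume "ys \<in> tuples (Bs @ Cs)"
    then obtain bs cs where ys: "ys = bs @ cs" and "bs \<in> tuples Bs" "cs \<in> tuples Cs"
      unfolding tuples_append_iff by blast
    then show "multilin As ?W (\<lambda>as. ?F (as @ ys))" unfolding ys by (intro mA)
  qed (rule mC mB; assumption)+
qed

context
  fixes f
  assumes f: "f \<in> tlin Bs Bs'"
begin

lemma idt_lin: "idt As Bs Bs' Cs f \<in> tlin (As @ Bs @ Cs) (As @ Bs' @ Cs)"
  unfolding id_tensor_id_def
  by (rule lift_lin[OF idt_kmods(1) ctensor_complete[OF idt_kmods(2)] idt_multilin[OF f]])

lemma idt_extensional: "idt As Bs Bs' Cs f \<in> extensional (tensors (As @ Bs @ Cs))"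
  unfolding id_tensor_id_def
  by (rule lift_extensional[OF idt_kmods(1) ctensor_complete[OF idt_kmods(2)] idt_multilin[OF f]])

lemma idt_pure:
  assumes "as \<in> tuples As" "bs \<in> tuples Bs" "cs \<in> tuples Cs"
  shows "idt As Bs Bs' Cs f (pure (As @ Bs @ Cs) (as @ bs @ cs)) =
    juxtapose As (Bs' @ Cs) (pure As as) (juxtapose Bs' Cs (f (pure Bs bs)) (pure Cs cs))"
  unfolding id_tensor_id_def
    lift_pure[OF idt_kmods(1) ctensor_complete[OF idt_kmods(2)] idt_multilin[OF f]
      tuples_append[OF assms(1) tuples_append[OF assms(2,3)]]]
  using assms(1,2)[THEN tuples_length] by simp

text \<open>The working description of \<open>id \<otimes> f \<otimes> id\<close>. Juxtapositions of three tensors determine a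
  linear map (\<open>juxt_ext3\<close>), so composition, nesting and commutation of such operators reduce to this
  formula.\<close>

lemma idt_juxt:
  assumes x: "x \<in> tensors As" and y: "y \<in> tensors Bs" and z: "z \<in> tensors Cs"
  shows "idt As Bs Bs' Cs f (juxtapose As (Bs @ Cs) x (juxtapose Bs Cs y z)) =
    juxtapose As (Bs' @ Cs) x (juxtapose Bs' Cs (f y) z)"
proof -
  note J = juxt_lin1[OF K(1) idt_kmods(4)] juxt_lin2[OF K(1) idt_kmods(4)] juxt_lin1[OF K(2,4)] juxt_lin2[OF K(2,4)]
    juxt_closed[OF K(2,4)]
  note J' = juxt_lin1[OF K(1) idt_kmods(3)] juxt_lin2[OF K(1) idt_kmods(3)] juxt_lin1[OF K(3,4)] juxt_lin2[OF K(3,4)]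
    juxt_closed[OF K(3,4)]
  note W = ctensor_complete[OF idt_kmods(2)]
  note fc = lin_closed[OF f]
  show ?thesis
  proof (rule ctensor_ext[OF K(1) W lin_comp[OF J(1)[OF J(5)[OF y z]] idt_lin] J'(1)[OF J'(5)[OF fc[OF y] z]] _ x])
    fix as assume as: "as \<in> tuples As"
    note pa = pure_closed[OF K(1) as]
    show "idt As Bs Bs' Cs f (juxtapose As (Bs @ Cs) (pure As as) (juxtapose Bs Cs y z)) =
      juxtapose As (Bs' @ Cs) (pure As as) (juxtapose Bs' Cs (f y) z)"
    proof (rule ctensor_ext[OF K(2) W lin_comp[OF lin_comp[OF J(3)[OF z] J(2)[OF pa]] idt_lin]
          lin_comp[OF lin_comp[OF f J'(3)[OF z]] J'(2)[OF pa]] _ y])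
      fix bs assume bs: "bs \<in> tuples Bs"
      note pb = pure_closed[OF K(2) bs]
      show "idt As Bs Bs' Cs f (juxtapose As (Bs @ Cs) (pure As as) (juxtapose Bs Cs (pure Bs bs) z)) =
        juxtapose As (Bs' @ Cs) (pure As as) (juxtapose Bs' Cs (f (pure Bs bs)) z)"
      proof (rule ctensor_ext[OF K(4) W lin_comp[OF lin_comp[OF J(4)[OF pb] J(2)[OF pa]] idt_lin]
          lin_comp[OF J'(4)[OF fc[OF pb]] J'(2)[OF pa]] _ z])
        fix cs assume cs: "cs \<in> tuples Cs"
        show "idt As Bs Bs' Cs f (juxtapose As (Bs @ Cs) (pure As as) (juxtapose Bs Cs (pure Bs bs) (pure Cs cs))) =
          juxtapose As (Bs' @ Cs) (pure As as) (juxtapose Bs' Cs (f (pure Bs bs)) (pure Cs cs))"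
          unfolding juxt_pure[OF K(2,4) bs cs] juxt_pure[OF K(1) idt_kmods(4) as tuples_append[OF bs cs]]
          by (rule idt_pure[OF as bs cs])
      qed
    qed
  qed
qed

end
end

lemma idt_cong:
  assumes "kmods Bs" "\<And>y. y \<in> tensors Bs \<Longrightarrow> f y = g y"
  shows "idt As Bs Bs' Cs f = idt As Bs Bs' Cs g"
  unfolding id_tensor_id_def
proof (rule lift_cong)
  fix xs assume "xs \<in> tuples (As @ Bs @ Cs)"
  then obtain as bs cs where xs: "xs = as @ bs @ cs" "as \<in> tuples As" "bs \<in> tuples Bs"
    unfolding tuples_append_iff by blast
  then have "take (length Bs) (drop (length As) xs) = bs" using xs(2,3)[THEN tuples_length] by simp
  then show "juxtapose As (Bs' @ Cs) (pure As (take (length As) xs))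
          (juxtapose Bs' Cs (f (pure Bs (take (length Bs) (drop (length As) xs))))
            (pure Cs (drop (length As + length Bs) xs))) =
         juxtapose As (Bs' @ Cs) (pure As (take (length As) xs))
          (juxtapose Bs' Cs (g (pure Bs (take (length Bs) (drop (length As) xs))))
            (pure Cs (drop (length As + length Bs) xs)))"
    using assms(2)[OF pure_closed[OF assms(1) xs(3)]] by simp
qed

lemma idt_comp:
  assumes K: "kmods As" "kmods Bs" "kmods Bs'" "kmods Bs''" "kmods Cs"
    and f: "f \<in> tlin Bs Bs'" and g: "g \<in> tlin Bs' Bs''"
    and w: "w \<in> tensors (As @ Bs @ Cs)"
  shows "idt As Bs' Bs'' Cs g (idt As Bs Bs' Cs f w) =
    idt As Bs Bs'' Cs (\<lambda>y. g (f y)) w"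
proof -
  note fg = lin_comp[OF f g]
  show ?thesis
    by (rule juxt_ext3[OF K(1,2,5) ctensor_complete[OF idt_kmods(1)[OF K(1,4,2,5)]]
          lin_comp[OF idt_lin[OF K(1,2,3,5) f] idt_lin[OF K(1,3,4,5) g]]
          idt_lin[OF K(1,2,4,5) fg] _ w])
      (simp add: idt_juxt[OF K(1,2,3,5) f] idt_juxt[OF K(1,3,4,5) g] idt_juxt[OF K(1,2,4,5) fg] lin_closed[OF f])
qed

lemma idt_ident:
  assumes K: "kmods As" "kmods Bs" "kmods Cs"
    and w: "w \<in> tensors (As @ Bs @ Cs)"
  shows "idt As Bs Bs Cs (\<lambda>y. y) w = w"
  by (rule juxt_ext3[OF K ctensor_complete[OF idt_kmods(1)[OF K(1,2,2,3)]]
        idt_lin[OF K(1,2,2,3) lin_ident] lin_ident _ w])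
    (rule idt_juxt[OF K(1,2,2,3) lin_ident])

lemma juxt_ext5:
  assumes K: "kmods As" "kmods Bs" "kmods Cs" "kmods Ds" "kmods Es"
    and W: "complete_kmod W" and f: "f \<in> lin (ctensor (As @ Bs @ Cs @ Ds @ Es)) W"
    and g: "g \<in> lin (ctensor (As @ Bs @ Cs @ Ds @ Es)) W"
    and eq: "\<And>a b c d e. a \<in> tensors As \<Longrightarrow> b \<in> tensors Bs \<Longrightarrow> c \<in> tensors Cs \<Longrightarrow>
      d \<in> tensors Ds \<Longrightarrow> e \<in> tensors Es \<Longrightarrow>
      f (juxtapose As (Bs @ Cs @ Ds @ Es) a (juxtapose Bs (Cs @ Ds @ Es) b
        (juxtapose Cs (Ds @ Es) c (juxtapose Ds Es d e)))) =
      g (juxtapose As (Bs @ Cs @ Ds @ Es) a (juxtapose Bs (Cs @ Ds @ Es) b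
        (juxtapose Cs (Ds @ Es) c (juxtapose Ds Es d e))))"
    and w: "w \<in> tensors (As @ Bs @ Cs @ Ds @ Es)"
  shows "f w = g w"
proof -
  have K2: "kmods (Cs @ Ds @ Es)" using K by auto
  show ?thesis
  proof (rule juxt_ext3[OF K(1,2) K2 W f g _ w])
    fix a b z
    assume a: "a \<in> tensors As" and b: "b \<in> tensors Bs"
      and z: "z \<in> tensors (Cs @ Ds @ Es)"
    have K3: "kmods (Bs @ Cs @ Ds @ Es)" using K by auto
    note L = lin_comp[OF lin_comp[OF juxt_lin2[OF K(2) K2 b] juxt_lin2[OF K(1) K3 a]]]
    show "f (juxtapose As (Bs @ Cs @ Ds @ Es) a (juxtapose Bs (Cs @ Ds @ Es) b z)) =
      g (juxtapose As (Bs @ Cs @ Ds @ Es) a (juxtapose Bs (Cs @ Ds @ Es) b z))"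
      by (rule juxt_ext3[OF K(3-5) W L[OF f] L[OF g] eq[OF a b] z])
  qed
qed

text \<open>Operators on disjoint blocks of factors commute; the relations between distant generators are
  instances.\<close>

lemma idt_commute:
  assumes K: "kmods As" "kmods Bs" "kmods Cs" "kmods Ds" "kmods Es"
    and f: "f \<in> tlin Bs Bs" and g: "g \<in> tlin Ds Ds"
    and w: "w \<in> tensors (As @ Bs @ Cs @ Ds @ Es)"
  shows "idt As Bs Bs (Cs @ Ds @ Es) f (idt (As @ Bs @ Cs) Ds Ds Es g w) =
    idt (As @ Bs @ Cs) Ds Ds Es g (idt As Bs Bs (Cs @ Ds @ Es) f w)"
proof -
  have K2: "kmods (Cs @ Ds @ Es)" "kmods (As @ Bs @ Cs)" "kmods (As @ Bs @ Cs @ Ds @ Es)"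
    "kmods (Ds @ Es)" "kmods (Bs @ Cs)" using K by auto
  have lf: "idt As Bs Bs (Cs @ Ds @ Es) f \<in>
      tlin (As @ Bs @ Cs @ Ds @ Es) (As @ Bs @ Cs @ Ds @ Es)"
    by (rule idt_lin[OF K(1,2,2) K2(1) f])
  have lg: "idt (As @ Bs @ Cs) Ds Ds Es g \<in>
      tlin (As @ Bs @ Cs @ Ds @ Es) (As @ Bs @ Cs @ Ds @ Es)"
    using idt_lin[OF K2(2) K(4,4,5) g] by simp
  have re: "juxtapose As (Bs @ Cs @ Ds @ Es) a (juxtapose Bs (Cs @ Ds @ Es) b (juxtapose Cs (Ds @ Es) c z)) =
      juxtapose (As @ Bs @ Cs) (Ds @ Es) (juxtapose As (Bs @ Cs) a (juxtapose Bs Cs b c)) z"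
    if "a \<in> tensors As" "b \<in> tensors Bs" "c \<in> tensors Cs"
      "z \<in> tensors (Ds @ Es)" for a b c z
    using juxt_assoc[OF K(1) K2(5,4) that(1) juxt_closed[OF K(2,3) that(2,3)] that(4)]
      juxt_assoc[OF K(2,3) K2(4) that(2-4)] by simp
  show ?thesis
  proof (rule juxt_ext5[OF K ctensor_complete[OF K2(3)] lin_comp[OF lg lf] lin_comp[OF lf lg] _ w])
    fix a b c d e
    assume C: "a \<in> tensors As" "b \<in> tensors Bs" "c \<in> tensors Cs"
      "d \<in> tensors Ds" "e \<in> tensors Es"
    note de = juxt_closed[OF K(4,5) C(4,5)] juxt_closed[OF K(4,5) lin_closed[OF g C(4)] C(5)]
    have F: "idt As Bs Bs (Cs @ Ds @ Es) f
        (juxtapose As (Bs @ Cs @ Ds @ Es) a (juxtapose Bs (Cs @ Ds @ Es) b (juxtapose Cs (Ds @ Es) c z))) =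
      juxtapose As (Bs @ Cs @ Ds @ Es) a (juxtapose Bs (Cs @ Ds @ Es) (f b) (juxtapose Cs (Ds @ Es) c z))"
      if "z \<in> tensors (Ds @ Es)" for z
      by (rule idt_juxt[OF K(1,2,2) K2(1) f C(1,2) juxt_closed[OF K(3) K2(4) C(3) that]])
    have G: "idt (As @ Bs @ Cs) Ds Ds Es g
        (juxtapose As (Bs @ Cs @ Ds @ Es) a (juxtapose Bs (Cs @ Ds @ Es) b (juxtapose Cs (Ds @ Es) c (juxtapose Ds Es d e)))) =
      juxtapose As (Bs @ Cs @ Ds @ Es) a (juxtapose Bs (Cs @ Ds @ Es) b (juxtapose Cs (Ds @ Es) c (juxtapose Ds Es (g d) e)))"
      if b: "b \<in> tensors Bs" for b
      unfolding re[OF C(1) b C(3) de(1)] re[OF C(1) b C(3) de(2)]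
      by (rule idt_juxt[OF K2(2) K(4,4,5) g juxt_closed[OF K(1) K2(5) C(1) juxt_closed[OF K(2,3) b C(3)]] C(4,5)])
    show "idt As Bs Bs (Cs @ Ds @ Es) f (idt (As @ Bs @ Cs) Ds Ds Es g
        (juxtapose As (Bs @ Cs @ Ds @ Es) a (juxtapose Bs (Cs @ Ds @ Es) b (juxtapose Cs (Ds @ Es) c (juxtapose Ds Es d e))))) =
      idt (As @ Bs @ Cs) Ds Ds Es g (idt As Bs Bs (Cs @ Ds @ Es) f
        (juxtapose As (Bs @ Cs @ Ds @ Es) a (juxtapose Bs (Cs @ Ds @ Es) b (juxtapose Cs (Ds @ Es) c (juxtapose Ds Es d e)))))"
      unfolding G[OF C(2)] F[OF de(2)] F[OF de(1)] G[OF lin_closed[OF f C(2)]] ..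
  qed
qed

text \<open>Carries an identity that was verified on two or three neighbouring factors to their place in a
  longer tensor product.\<close>

lemma idt_nest:
  assumes K: "kmods As" "kmods Ps" "kmods Bs" "kmods Bs'" "kmods Qs" "kmods Cs"
    and f: "f \<in> tlin Bs Bs'"
    and w: "w \<in> tensors (As @ Ps @ Bs @ Qs @ Cs)"
  shows "idt As (Ps @ Bs @ Qs) (Ps @ Bs' @ Qs) Cs (idt Ps Bs Bs' Qs f) w =
    idt (As @ Ps) Bs Bs' (Qs @ Cs) f w"
proof -
  have K2: "kmods (As @ Ps)" "kmods (Qs @ Cs)" "kmods (Ps @ Bs @ Qs)" "kmods (Ps @ Bs' @ Qs)"
    "kmods (As @ Ps @ Bs' @ Qs @ Cs)" "kmods (Bs @ Qs)" "kmods (Bs' @ Qs)"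
    "kmods (Bs @ Qs @ Cs)" "kmods (Bs' @ Qs @ Cs)" using K by auto
  note li = idt_lin[OF K(2,3,4,5) f]
  have l1: "idt As (Ps @ Bs @ Qs) (Ps @ Bs' @ Qs) Cs (idt Ps Bs Bs' Qs f) \<in>
      tlin (As @ Ps @ Bs @ Qs @ Cs) (As @ Ps @ Bs' @ Qs @ Cs)"
    using idt_lin[OF K(1) K2(3,4) K(6) li] by simp
  have l2: "idt (As @ Ps) Bs Bs' (Qs @ Cs) f \<in>
      tlin (As @ Ps @ Bs @ Qs @ Cs) (As @ Ps @ Bs' @ Qs @ Cs)"
    using idt_lin[OF K2(1) K(3,4) K2(2) f] by simp
  have e1: "juxtapose (Ps @ Bs @ Qs) Cs (juxtapose Ps (Bs @ Qs) p (juxtapose Bs Qs b q)) c =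
      juxtapose Ps (Bs @ Qs @ Cs) p (juxtapose Bs (Qs @ Cs) b (juxtapose Qs Cs q c))"
    if "kmods Bs" "p \<in> tensors Ps" "b \<in> tensors Bs" "q \<in> tensors Qs"
      "c \<in> tensors Cs" for Bs p b q c
  proof -
    have Q: "kmods (Bs @ Qs)" using that K by auto
    show ?thesis
      using juxt_assoc[OF K(2) Q K(6) that(2) juxt_closed[OF that(1) K(5) that(3,4)] that(5)]
        juxt_assoc[OF that(1) K(5,6) that(3-5)] by simp
  qed
  show ?thesis
  proof (rule juxt_ext5[OF K(1,2,3,5,6) ctensor_complete[OF K2(5)] l1 l2 _ w])
    fix a p b q c
    assume C: "a \<in> tensors As" "p \<in> tensors Ps" "b \<in> tensors Bs"
      "q \<in> tensors Qs" "c \<in> tensors Cs"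
    note fb = lin_closed[OF f C(3)]
    have A1: "idt As (Ps @ Bs @ Qs) (Ps @ Bs' @ Qs) Cs (idt Ps Bs Bs' Qs f)
        (juxtapose As (Ps @ Bs @ Qs @ Cs) a (juxtapose Ps (Bs @ Qs @ Cs) p (juxtapose Bs (Qs @ Cs) b (juxtapose Qs Cs q c)))) =
      juxtapose As (Ps @ Bs' @ Qs @ Cs) a (juxtapose Ps (Bs' @ Qs @ Cs) p (juxtapose Bs' (Qs @ Cs) (f b) (juxtapose Qs Cs q c)))"
      using idt_juxt[OF K(1) K2(3,4) K(6) li C(1) juxt_closed[OF K(2) K2(6) C(2) juxt_closed[OF K(3,5) C(3,4)]] C(5)]
        idt_juxt[OF K(2,3,4,5) f C(2-4)]
      by (simp add: e1[OF K(3) C(2-5)] e1[OF K(4) C(2) fb C(4,5)])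
    have A2: "idt (As @ Ps) Bs Bs' (Qs @ Cs) f
        (juxtapose As (Ps @ Bs @ Qs @ Cs) a (juxtapose Ps (Bs @ Qs @ Cs) p (juxtapose Bs (Qs @ Cs) b (juxtapose Qs Cs q c)))) =
      juxtapose As (Ps @ Bs' @ Qs @ Cs) a (juxtapose Ps (Bs' @ Qs @ Cs) p (juxtapose Bs' (Qs @ Cs) (f b) (juxtapose Qs Cs q c)))"
    proof -
      note qc = juxt_closed[OF K(5,6) C(4,5)]
      note as1 = juxt_assoc[OF K(1,2) K2(8) C(1,2) juxt_closed[OF K(3) K2(2) C(3) qc]]
      note as2 = juxt_assoc[OF K(1,2) K2(9) C(1,2) juxt_closed[OF K(4) K2(2) fb qc]]
      show ?thesis
        using idt_juxt[OF K2(1) K(3,4) K2(2) f juxt_closed[OF K(1,2) C(1,2)] C(3) qc] as1 as2 by simp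
    qed
    show "idt As (Ps @ Bs @ Qs) (Ps @ Bs' @ Qs) Cs (idt Ps Bs Bs' Qs f)
        (juxtapose As (Ps @ Bs @ Qs @ Cs) a (juxtapose Ps (Bs @ Qs @ Cs) p (juxtapose Bs (Qs @ Cs) b (juxtapose Qs Cs q c)))) =
      idt (As @ Ps) Bs Bs' (Qs @ Cs) f
        (juxtapose As (Ps @ Bs @ Qs @ Cs) a (juxtapose Ps (Bs @ Qs @ Cs) p (juxtapose Bs (Qs @ Cs) b (juxtapose Qs Cs q c))))"
      unfolding A1 A2 ..
  qed
qed

section \<open>Multilinear maps of few arguments\<close>

lemma ball_tuples_Cons:
  "(\<forall>xs\<in>listset (A # As). P xs) \<longleftrightarrow> (\<forall>x\<in>A. \<forall>xs\<in>listset As. P (x # xs))"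
  by (auto simp: set_Cons_def)

lemma ball_tuples_Nil: "(\<forall>xs\<in>listset []. P xs) \<longleftrightarrow> P []"
  by simp

lemma multilin_Nil: "multilin [] W f \<longleftrightarrow> f [] \<in> carrier W"
  by (simp add: multilin_def)

lemma lin_closed_absorb: "(\<forall>x\<in>carrier N. g x \<in> carrier W) \<and> g \<in> lin N W \<longleftrightarrow> g \<in> lin N W"
  by (auto intro: lin_closed)

lemma multilin_single:
  assumes "kmod N"
  shows "multilin [N] W f \<longleftrightarrow> (\<lambda>x. f [x]) \<in> lin N W"
proof -
  have "carrier N \<noteq> {}" using kmod_zero[OF assms] by blast
  then have "multilin [N] W f \<longleftrightarrow> (\<forall>x\<in>carrier N. f [x] \<in> carrier W) \<and> (\<lambda>x. f [x]) \<in> lin N W"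
    unfolding multilin_def list.map ball_tuples_Cons ball_tuples_Nil by auto
  then show ?thesis unfolding lin_closed_absorb .
qed

lemma multilin_Cons:
  assumes "kmod N"
  shows "multilin (N # Ns) W f \<longleftrightarrow>
    (\<forall>x\<in>carrier N. multilin Ns W (\<lambda>xs. f (x # xs))) \<and> (\<forall>xs\<in>tuples Ns. (\<lambda>x. f (x # xs)) \<in> lin N W)"
  using multilin_append[of "[N]" Ns W f]
  unfolding multilin_single[OF assms] list.map ball_tuples_Cons ball_tuples_Nil append_Cons append_Nil .

lemmas multilin_simps = multilin_Cons multilin_Nil ball_tuples_Cons ball_tuples_Nil

lemma pure1_lin: "kmod A \<Longrightarrow> (\<lambda>x. pure [A] [x]) \<in> lin A (ctensor [A])"
  using pure_multilin[of "[A]"] by (simp add: multilin_simps del: listset.simps)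

lemma pure2_lin:
  assumes "kmod A" "kmod B"
  shows "y \<in> carrier B \<Longrightarrow> (\<lambda>x. pure [A, B] [x, y]) \<in> lin A (ctensor [A, B])"
    and "x \<in> carrier A \<Longrightarrow> (\<lambda>y. pure [A, B] [x, y]) \<in> lin B (ctensor [A, B])"
  using pure_multilin[of "[A, B]"] assms by (simp_all add: multilin_simps del: listset.simps)

lemma pure3_lin:
  assumes "kmod A" "kmod B" "kmod C"
  shows "y \<in> carrier B \<Longrightarrow> z \<in> carrier C \<Longrightarrow> (\<lambda>x. pure [A, B, C] [x, y, z]) \<in> lin A (ctensor [A, B, C])"
    and "x \<in> carrier A \<Longrightarrow> z \<in> carrier C \<Longrightarrow> (\<lambda>y. pure [A, B, C] [x, y, z]) \<in> lin B (ctensor [A, B, C])"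
    and "x \<in> carrier A \<Longrightarrow> y \<in> carrier B \<Longrightarrow> (\<lambda>z. pure [A, B, C] [x, y, z]) \<in> lin C (ctensor [A, B, C])"
  using pure_multilin[of "[A, B, C]"] assms by (simp_all add: multilin_simps del: listset.simps)

lemma multilin2I:
  assumes "kmod A" "kmod B"
    and "\<And>y. y \<in> carrier B \<Longrightarrow> (\<lambda>x. f [x, y]) \<in> lin A W"
    and "\<And>x. x \<in> carrier A \<Longrightarrow> (\<lambda>y. f [x, y]) \<in> lin B W"
  shows "multilin [A, B] W f"
  using assms by (auto simp add: multilin_simps simp del: listset.simps intro: lin_closed[OF assms(3)])

lemma multilin3I:
  assumes "kmod A" "kmod B" "kmod C"
    and "\<And>y z. y \<in> carrier B \<Longrightarrow> z \<in> carrier C \<Longrightarrow> (\<lambda>x. f [x, y, z]) \<in> lin A W"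
    and "\<And>x z. x \<in> carrier A \<Longrightarrow> z \<in> carrier C \<Longrightarrow> (\<lambda>y. f [x, y, z]) \<in> lin B W"
    and "\<And>x y. x \<in> carrier A \<Longrightarrow> y \<in> carrier B \<Longrightarrow> (\<lambda>z. f [x, y, z]) \<in> lin C W"
  shows "multilin [A, B, C] W f"
  using assms by (auto simp add: multilin_simps simp del: listset.simps intro: lin_closed[OF assms(4)])

lemma tuples_singleD: "xs \<in> tuples [A] \<Longrightarrow> \<exists>x. xs = [x] \<and> x \<in> carrier A"
  and tuples2D: "xs \<in> tuples [A, B] \<Longrightarrow> \<exists>x y. xs = [x, y] \<and> x \<in> carrier A \<and> y \<in> carrier B"
  by (auto simp: set_Cons_def)

lemma tuples_smallI:
  "x \<in> carrier A \<Longrightarrow> [x] \<in> tuples [A]"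
  "x \<in> carrier A \<Longrightarrow> y \<in> carrier B \<Longrightarrow> [x, y] \<in> tuples [A, B]"
  "x \<in> carrier A \<Longrightarrow> y \<in> carrier B \<Longrightarrow> z \<in> carrier C \<Longrightarrow> [x, y, z] \<in> tuples [A, B, C]"
  by (auto simp: set_Cons_def)

lemma multilin_map:
  assumes f: "multilin Ws W f" and l: "length Ks = length Ws"
    and \<phi>: "\<And>i. i < length Ws \<Longrightarrow> \<phi> i \<in> lin (Ks ! i) (Ws ! i)"
  shows "multilin Ks W (\<lambda>xs. f (map (\<lambda>i. \<phi> i (xs ! i)) [0..<length Ws]))"
proof -
  let ?m = "\<lambda>xs. map (\<lambda>i. \<phi> i (xs ! i)) [0..<length Ws]"
  have t: "?m xs \<in> tuples Ws" if "xs \<in> tuples Ks" for xs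
    using that l lin_closed[OF \<phi>] by (auto simp: tuples_iff list_all2_conv_all_nth)
  have u: "?m (xs[i := x]) = (?m xs)[i := \<phi> i x]" if "xs \<in> tuples Ks" "i < length Ks" for xs i x
    using that l by (auto intro!: nth_equalityI simp: nth_list_update tuples_length)
  show ?thesis unfolding multilin_def
  proof (intro conjI ballI allI impI)
    fix xs assume xs: "xs \<in> tuples Ks"
    show "f (?m xs) \<in> carrier W" by (rule multilin_closed[OF f t[OF xs]])
    fix i assume i: "i < length Ks"
    have "(\<lambda>x. f ((?m xs)[i := \<phi> i x])) \<in> lin (Ks ! i) W"
      by (rule lin_comp[OF \<phi> multilin_lin[OF f t[OF xs]]]) (use i l in auto)
    then show "(\<lambda>x. f (?m (xs[i := x]))) \<in> lin (Ks ! i) W" unfolding u[OF xs i] .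
  qed
qed

section \<open>Modules over an h-adic algebra and the factorwise action\<close>

context h_algebra
begin

abbreviation rs where "rs \<equiv> restrict_scalars U"

lemma U_complete: "complete_kmod U"
  using kmodule complete by (simp add: complete_kmod_def)

lemma U_kmod [simp]: "kmod U"
  by (rule kmodule)

lemma one_closed [simp]: "\<one>\<^bsub>U\<^esub> \<in> carrier U"
  by (rule ring.ring_simprules(6)[OF ring])

lemma mult_closed [simp]: "a \<in> carrier U \<Longrightarrow> b \<in> carrier U \<Longrightarrow> a \<otimes>\<^bsub>U\<^esub> b \<in> carrier U"
  by (rule ring.ring_simprules(5)[OF ring])

lemma mult_lin1: "b \<in> carrier U \<Longrightarrow> (\<lambda>a. a \<otimes>\<^bsub>U\<^esub> b) \<in> lin U U"
  by (rule linI) (simp_all add: smult_mult_left ring.ring_simprules[OF ring])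

lemma mult_lin2: "a \<in> carrier U \<Longrightarrow> (\<lambda>b. a \<otimes>\<^bsub>U\<^esub> b) \<in> lin U U"
  by (rule linI) (simp_all add: smult_mult_right ring.ring_simprules(23)[OF ring])

lemma rs_simps [simp]:
  "carrier (rs N) = carrier N" "\<zero>\<^bsub>rs N\<^esub> = \<zero>\<^bsub>N\<^esub>" "x \<oplus>\<^bsub>rs N\<^esub> y = x \<oplus>\<^bsub>N\<^esub> y"
  "c \<odot>\<^bsub>rs N\<^esub> x = (c \<odot>\<^bsub>U\<^esub> \<one>\<^bsub>U\<^esub>) \<odot>\<^bsub>N\<^esub> x"
  by (simp_all add: restrict_scalars_def with_action_def)

lemma scalar_closed [simp]: "c \<odot>\<^bsub>U\<^esub> \<one>\<^bsub>U\<^esub> \<in> carrier U"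
  by (rule kmod_smult[OF U_kmod one_closed])

context
  fixes N :: "('u, 'a) module"
  assumes N: "left_module U N"
begin

lemma um_simps:
  "a \<in> carrier U \<Longrightarrow> x \<in> carrier N \<Longrightarrow> a \<odot>\<^bsub>N\<^esub> x \<in> carrier N"
  "a \<in> carrier U \<Longrightarrow> b \<in> carrier U \<Longrightarrow> x \<in> carrier N \<Longrightarrow> (a \<oplus>\<^bsub>U\<^esub> b) \<odot>\<^bsub>N\<^esub> x = a \<odot>\<^bsub>N\<^esub> x \<oplus>\<^bsub>N\<^esub> b \<odot>\<^bsub>N\<^esub> x"
  "a \<in> carrier U \<Longrightarrow> x \<in> carrier N \<Longrightarrow> y \<in> carrier N \<Longrightarrow> a \<odot>\<^bsub>N\<^esub> (x \<oplus>\<^bsub>N\<^esub> y) = a \<odot>\<^bsub>N\<^esub> x \<oplus>\<^bsub>N\<^esub> a \<odot>\<^bsub>N\<^esub> y"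
  "a \<in> carrier U \<Longrightarrow> b \<in> carrier U \<Longrightarrow> x \<in> carrier N \<Longrightarrow> (a \<otimes>\<^bsub>U\<^esub> b) \<odot>\<^bsub>N\<^esub> x = a \<odot>\<^bsub>N\<^esub> (b \<odot>\<^bsub>N\<^esub> x)"
  "x \<in> carrier N \<Longrightarrow> \<one>\<^bsub>U\<^esub> \<odot>\<^bsub>N\<^esub> x = x"
  using left_module.act_closed[OF N] left_module.act_add_left[OF N] left_module.act_add_right[OF N]
    left_module.act_mult[OF N] left_module.act_one[OF N] by auto

lemma scalar_mult:
  assumes a: "a \<in> carrier U"
  shows "(c \<odot>\<^bsub>U\<^esub> \<one>\<^bsub>U\<^esub>) \<otimes>\<^bsub>U\<^esub> a = c \<odot>\<^bsub>U\<^esub> a" "a \<otimes>\<^bsub>U\<^esub> (c \<odot>\<^bsub>U\<^esub> \<one>\<^bsub>U\<^esub>) = c \<odot>\<^bsub>U\<^esub> a"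
  unfolding smult_mult_left[OF one_closed a] smult_mult_right[OF a one_closed]
  using a by (simp_all add: ring.ring_simprules(12) ring ring.ring_simprules(6) monoid.l_one
      monoid.r_one ring.is_monoid)

lemma rs_kmod: "kmod (rs N)"
proof (rule kmodI)
  have "abelian_group N" using N by (simp add: left_module_def)
  then interpret N: abelian_group N .
  show "abelian_group (rs N)"
    by (rule abelian_groupI) (auto simp: N.a_ac intro: N.l_neg bexI[of _ "\<ominus>\<^bsub>N\<^esub> _"])
qed (simp_all add: um_simps kmod_distr_left[OF U_kmod] um_simps(4)[symmetric] scalar_mult kmod_assoc[OF U_kmod] mult.commute)

lemma act_lin: "a \<in> carrier U \<Longrightarrow> (\<lambda>x. a \<odot>\<^bsub>N\<^esub> x) \<in> lin (rs N) (rs N)"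
  by (rule linI) (simp_all add: um_simps um_simps(4)[symmetric] scalar_mult)

lemma act_scalar_lin: "x \<in> carrier N \<Longrightarrow> (\<lambda>a. a \<odot>\<^bsub>N\<^esub> x) \<in> lin U (rs N)"
  by (rule linI) (simp_all add: um_simps um_simps(4)[symmetric] scalar_mult)

end

definition umods :: "('u, 'a) module list \<Rightarrow> bool" where
  "umods Ns \<longleftrightarrow> (\<forall>N\<in>set Ns. left_module U N)"

abbreviation ks where "ks Ns \<equiv> map rs Ns"
abbreviation "fw \<equiv> factorwise_action U"
abbreviation "Rc \<equiv> R_check U"
abbreviation rep where "rep n \<equiv> replicate n U"

lemma umods_kmods: "umods Ns \<Longrightarrow> kmods (ks Ns)"
  by (auto simp: umods_def intro: rs_kmod)

lemma rep_kmods: "kmods (rep n)"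
  by auto

abbreviation act_tuple :: "'u list \<Rightarrow> ('u, 'a) module list \<Rightarrow> 'a list \<Rightarrow> 'a list" where
  "act_tuple us Ns xs \<equiv> map (\<lambda>i. (us ! i) \<odot>\<^bsub>Ns ! i\<^esub> (xs ! i)) [0..<length Ns]"

lemma tuples_rep: "us \<in> tuples (rep n) \<longleftrightarrow> length us = n \<and> (\<forall>i<n. us ! i \<in> carrier U)"
  unfolding tuples_iff by (auto simp: list_all2_conv_all_nth)

lemma tuples_ks: "xs \<in> tuples (ks Ns) \<longleftrightarrow> length xs = length Ns \<and> (\<forall>i<length Ns. xs ! i \<in> carrier (Ns ! i))"
  unfolding tuples_iff by (auto simp: list_all2_conv_all_nth)

lemma act_tuple_closed:
  "umods Ns \<Longrightarrow> us \<in> tuples (rep (length Ns)) \<Longrightarrow> xs \<in> tuples (ks Ns) \<Longrightarrow> act_tuple us Ns xs \<in> tuples (ks Ns)"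
  unfolding tuples_rep tuples_ks by (auto simp: umods_def um_simps(1))

context
  fixes Ns :: "('u, 'a) module list"
  assumes Ns: "umods Ns"
begin

lemma fw_bimultilin:
  "bimultilin (rep (length Ns)) (ks Ns) (ctensor (ks Ns)) (\<lambda>us xs. pure (ks Ns) (act_tuple us Ns xs))"
  unfolding bimultilin_def
proof (intro conjI ballI)
  note P = pure_multilin[OF umods_kmods[OF Ns]]
  have M: "left_module U (Ns ! i)" if "i < length Ns" for i using Ns that by (simp add: umods_def)
  fix us assume us: "us \<in> tuples (rep (length Ns))"
  show "multilin (ks Ns) (ctensor (ks Ns)) (\<lambda>xs. pure (ks Ns) (act_tuple us Ns xs))"
    using multilin_map[OF P, of "ks Ns" "\<lambda>i x. (us ! i) \<odot>\<^bsub>Ns ! i\<^esub> x"] act_lin[OF M] us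
    unfolding tuples_rep by simp
next
  note P = pure_multilin[OF umods_kmods[OF Ns]]
  have M: "left_module U (Ns ! i)" if "i < length Ns" for i using Ns that by (simp add: umods_def)
  fix xs assume xs: "xs \<in> tuples (ks Ns)"
  show "multilin (rep (length Ns)) (ctensor (ks Ns)) (\<lambda>us. pure (ks Ns) (act_tuple us Ns xs))"
    using multilin_map[OF P, of "rep (length Ns)" "\<lambda>i u. u \<odot>\<^bsub>Ns ! i\<^esub> (xs ! i)"] act_scalar_lin[OF M] xs
    unfolding tuples_ks by simp
qed

lemma fw_bilin:
  "bilin (ctensor (rep (length Ns))) (ctensor (ks Ns)) (ctensor (ks Ns)) (fw Ns)"
  using bilift_bilin[OF rep_kmods umods_kmods[OF Ns] ctensor_complete[OF umods_kmods[OF Ns]] fw_bimultilin]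
  unfolding factorwise_action_def[abs_def] Let_def .

lemma fw_pure:
  "us \<in> tuples (rep (length Ns)) \<Longrightarrow> xs \<in> tuples (ks Ns) \<Longrightarrow>
    fw Ns (pure (rep (length Ns)) us) (pure (ks Ns) xs) = pure (ks Ns) (act_tuple us Ns xs)"
  using bilift_pure[OF rep_kmods umods_kmods[OF Ns] ctensor_complete[OF umods_kmods[OF Ns]] fw_bimultilin]
  unfolding factorwise_action_def[abs_def] Let_def .

lemma fw_lin1: "w \<in> tensors (ks Ns) \<Longrightarrow>
    (\<lambda>t. fw Ns t w) \<in> tlin (rep (length Ns)) (ks Ns)"
  by (rule bilinD1[OF fw_bilin])

lemma fw_lin2: "t \<in> tensors (rep (length Ns)) \<Longrightarrow>
    fw Ns t \<in> tlin (ks Ns) (ks Ns)"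
  using bilinD2[OF fw_bilin] by simp

lemma fw_closed: "t \<in> tensors (rep (length Ns)) \<Longrightarrow> w \<in> tensors (ks Ns) \<Longrightarrow>
    fw Ns t w \<in> tensors (ks Ns)"
  by (rule bilin_closed[OF fw_bilin])

lemma fw_one:
  assumes w: "w \<in> tensors (ks Ns)"
  shows "fw Ns (pure (rep (length Ns)) (replicate (length Ns) \<one>\<^bsub>U\<^esub>)) w = w"
proof -
  have o: "replicate (length Ns) \<one>\<^bsub>U\<^esub> \<in> tuples (rep (length Ns))" unfolding tuples_rep by simp
  note K = umods_kmods[OF Ns]
  show ?thesis
  proof (rule ctensor_ext[OF K ctensor_complete[OF K] fw_lin2[OF pure_closed[OF rep_kmods o]] lin_ident _ w])
    fix xs assume xs: "xs \<in> tuples (ks Ns)"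
    then have "act_tuple (replicate (length Ns) \<one>\<^bsub>U\<^esub>) Ns xs = xs"
      using Ns unfolding tuples_ks by (auto simp: umods_def um_simps(5) intro!: nth_equalityI)
    then show "fw Ns (pure (rep (length Ns)) (replicate (length Ns) \<one>\<^bsub>U\<^esub>)) (pure (ks Ns) xs) =
        pure (ks Ns) xs"
      unfolding fw_pure[OF o xs] by simp
  qed
qed

end

text \<open>Both sides are linear in each of \<open>s, t, x, y\<close>, so all four may be taken to be pure; then the
  two sides are the same list of vectors.\<close>

lemma fw_juxt:
  assumes As: "umods As" and Bs: "umods Bs"
    and s: "s \<in> tensors (rep (length As))" and t: "t \<in> tensors (rep (length Bs))"
    and x: "x \<in> tensors (ks As)" and y: "y \<in> tensors (ks Bs)"
  shows "fw (As @ Bs) (juxtapose (rep (length As)) (rep (length Bs)) s t)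
      (juxtapose (ks As) (ks Bs) x y) =
    juxtapose (ks As) (ks Bs) (fw As s x) (fw Bs t y)"
proof -
  have AB: "umods (As @ Bs)" using As Bs by (auto simp: umods_def)
  note KA = umods_kmods[OF As] and KB = umods_kmods[OF Bs]
  note KAB = umods_kmods[OF AB, simplified map_append]
  note W = ctensor_complete[OF KAB]
  have rep: "rep (length (As @ Bs)) = rep (length As) @ rep (length Bs)" by (simp add: replicate_add)
  note F1 = fw_lin1[OF AB, unfolded rep map_append] and F2 = fw_lin2[OF AB, unfolded rep map_append]
  note JU1 = juxt_lin1[OF rep_kmods rep_kmods] and JU2 = juxt_lin2[OF rep_kmods rep_kmods]
    and JUc = juxt_closed[OF rep_kmods rep_kmods]
  note J1 = juxt_lin1[OF KA KB] and J2 = juxt_lin2[OF KA KB] and Jc = juxt_closed[OF KA KB]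
  show ?thesis
  proof (rule ctensor_ext[OF rep_kmods W lin_comp[OF JU1[OF t] F1[OF Jc[OF x y]]]
        lin_comp[OF fw_lin1[OF As x] J1[OF fw_closed[OF Bs t y]]] _ s])
    fix us assume us: "us \<in> tuples (rep (length As))"
    note pu = pure_closed[OF rep_kmods us]
    show "fw (As @ Bs) (juxtapose (rep (length As)) (rep (length Bs)) (pure (rep (length As)) us) t)
        (juxtapose (ks As) (ks Bs) x y) =
      juxtapose (ks As) (ks Bs) (fw As (pure (rep (length As)) us) x) (fw Bs t y)"
    proof (rule ctensor_ext[OF rep_kmods W lin_comp[OF JU2[OF pu] F1[OF Jc[OF x y]]]
          lin_comp[OF fw_lin1[OF Bs y] J2[OF fw_closed[OF As pu x]]] _ t])
      fix vs assume vs: "vs \<in> tuples (rep (length Bs))"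
      note pv = pure_closed[OF rep_kmods vs]
      show "fw (As @ Bs) (juxtapose (rep (length As)) (rep (length Bs)) (pure (rep (length As)) us)
          (pure (rep (length Bs)) vs)) (juxtapose (ks As) (ks Bs) x y) =
        juxtapose (ks As) (ks Bs) (fw As (pure (rep (length As)) us) x)
          (fw Bs (pure (rep (length Bs)) vs) y)"
      proof (rule ctensor_ext[OF KA W lin_comp[OF J1[OF y] F2[OF JUc[OF pu pv]]]
            lin_comp[OF fw_lin2[OF As pu] J1[OF fw_closed[OF Bs pv y]]] _ x])
        fix xs assume xs: "xs \<in> tuples (ks As)"
        note px = pure_closed[OF KA xs]
        show "fw (As @ Bs) (juxtapose (rep (length As)) (rep (length Bs)) (pure (rep (length As)) us)
            (pure (rep (length Bs)) vs)) (juxtapose (ks As) (ks Bs) (pure (ks As) xs) y) =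
          juxtapose (ks As) (ks Bs) (fw As (pure (rep (length As)) us) (pure (ks As) xs))
            (fw Bs (pure (rep (length Bs)) vs) y)"
        proof (rule ctensor_ext[OF KB W lin_comp[OF J2[OF px] F2[OF JUc[OF pu pv]]]
              lin_comp[OF fw_lin2[OF Bs pv] J2[OF fw_closed[OF As pu px]]] _ y])
          fix ys assume ys: "ys \<in> tuples (ks Bs)"
          have m: "act_tuple (us @ vs) (As @ Bs) (xs @ ys) = act_tuple us As xs @ act_tuple vs Bs ys"
            using us vs xs ys
            unfolding tuples_rep tuples_ks by (intro nth_equalityI) (auto simp: nth_append)
          have fp: "fw (As @ Bs) (pure (rep (length As) @ rep (length Bs)) (us @ vs))
              (pure (ks As @ ks Bs) (xs @ ys)) = pure (ks As @ ks Bs) (act_tuple (us @ vs) (As @ Bs) (xs @ ys))"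
            using fw_pure[OF AB, of "us @ vs" "xs @ ys"] tuples_append[OF us vs] tuples_append[OF xs ys]
            unfolding rep by simp
          show "fw (As @ Bs) (juxtapose (rep (length As)) (rep (length Bs)) (pure (rep (length As)) us)
              (pure (rep (length Bs)) vs)) (juxtapose (ks As) (ks Bs) (pure (ks As) xs) (pure (ks Bs) ys)) =
            juxtapose (ks As) (ks Bs) (fw As (pure (rep (length As)) us) (pure (ks As) xs))
              (fw Bs (pure (rep (length Bs)) vs) (pure (ks Bs) ys))"
            unfolding juxt_pure[OF rep_kmods rep_kmods us vs] juxt_pure[OF KA KB xs ys] fp m
              fw_pure[OF As us xs] fw_pure[OF Bs vs ys]
              juxt_pure[OF KA KB act_tuple_closed[OF As us xs] act_tuple_closed[OF Bs vs ys]] ..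
        qed
      qed
    qed
  qed
qed

lemma tmult_bimultilin:
  "bimultilin (rep n) (rep n) (ctensor (rep n)) (\<lambda>as bs. pure (rep n) (map2 (monoid.mult U) as bs))"
proof -
  have e: "map2 (monoid.mult U) as bs = map (\<lambda>i. as ! i \<otimes>\<^bsub>U\<^esub> bs ! i) [0..<n]"
    if "as \<in> tuples (rep n)" "bs \<in> tuples (rep n)" for as bs
    using that unfolding tuples_rep by (intro nth_equalityI) auto
  note P = pure_multilin[OF rep_kmods[of n]]
  show ?thesis unfolding bimultilin_def
  proof (intro conjI ballI)
    fix as assume as: "as \<in> tuples (rep n)"
    have "multilin (rep n) (ctensor (rep n)) (\<lambda>bs. pure (rep n) (map (\<lambda>i. as ! i \<otimes>\<^bsub>U\<^esub> bs ! i) [0..<n]))"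
      using multilin_map[OF P, of "rep n" "\<lambda>i x. (as ! i) \<otimes>\<^bsub>U\<^esub> x"] mult_lin2 as
      unfolding tuples_rep by simp
    then show "multilin (rep n) (ctensor (rep n)) (\<lambda>bs. pure (rep n) (map2 (monoid.mult U) as bs))"
      by (rule multilin_cong[OF _ rep_kmods]) (simp add: e[OF as])
  next
    fix bs assume bs: "bs \<in> tuples (rep n)"
    have "multilin (rep n) (ctensor (rep n)) (\<lambda>as. pure (rep n) (map (\<lambda>i. as ! i \<otimes>\<^bsub>U\<^esub> bs ! i) [0..<n]))"
      using multilin_map[OF P, of "rep n" "\<lambda>i x. x \<otimes>\<^bsub>U\<^esub> (bs ! i)"] mult_lin1 bs
      unfolding tuples_rep by simp
    then show "multilin (rep n) (ctensor (rep n)) (\<lambda>as. pure (rep n) (map2 (monoid.mult U) as bs))"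
      by (rule multilin_cong[OF _ rep_kmods]) (simp add: e[OF _ bs])
  qed
qed

lemma tmult_bilin: "bilin (ctensor (rep n)) (ctensor (rep n)) (ctensor (rep n)) (tensor_mult U n)"
  using bilift_bilin[OF rep_kmods rep_kmods ctensor_complete[OF rep_kmods] tmult_bimultilin]
  unfolding tensor_mult_def[abs_def] Let_def .

lemma tmult_pure: "as \<in> tuples (rep n) \<Longrightarrow> bs \<in> tuples (rep n) \<Longrightarrow>
    tensor_mult U n (pure (rep n) as) (pure (rep n) bs) = pure (rep n) (map2 (monoid.mult U) as bs)"
  using bilift_pure[OF rep_kmods rep_kmods ctensor_complete[OF rep_kmods] tmult_bimultilin]
  unfolding tensor_mult_def[abs_def] Let_def .

lemma fw_mult:
  assumes Ns: "umods Ns" and s: "s \<in> tensors (rep (length Ns))" and t: "t \<in> tensors (rep (length Ns))"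
    and w: "w \<in> tensors (ks Ns)"
  shows "fw Ns (tensor_mult U (length Ns) s t) w = fw Ns s (fw Ns t w)"
proof -
  note K = umods_kmods[OF Ns]
  note W = ctensor_complete[OF K]
  note m1 = bilinD1[OF tmult_bilin] and m2 = bilinD2[OF tmult_bilin] and mc = bilin_closed[OF tmult_bilin]
  show ?thesis
  proof (rule ctensor_ext[OF rep_kmods W lin_comp[OF m1[OF t] fw_lin1[OF Ns w]] fw_lin1[OF Ns fw_closed[OF Ns t w]] _ s])
    fix us assume us: "us \<in> tuples (rep (length Ns))"
    note pu = pure_closed[OF rep_kmods us]
    show "fw Ns (tensor_mult U (length Ns) (pure (rep (length Ns)) us) t) w =
      fw Ns (pure (rep (length Ns)) us) (fw Ns t w)"
    proof (rule ctensor_ext[OF rep_kmods W lin_comp[OF m2[OF pu] fw_lin1[OF Ns w]]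
          lin_comp[OF fw_lin1[OF Ns w] fw_lin2[OF Ns pu]] _ t])
      fix vs assume vs: "vs \<in> tuples (rep (length Ns))"
      note pv = pure_closed[OF rep_kmods vs]
      show "fw Ns (tensor_mult U (length Ns) (pure (rep (length Ns)) us) (pure (rep (length Ns)) vs)) w =
        fw Ns (pure (rep (length Ns)) us) (fw Ns (pure (rep (length Ns)) vs) w)"
      proof (rule ctensor_ext[OF K W fw_lin2[OF Ns mc[OF pu pv]] lin_comp[OF fw_lin2[OF Ns pv] fw_lin2[OF Ns pu]] _ w])
        fix xs assume xs: "xs \<in> tuples (ks Ns)"
        have uv: "map2 (monoid.mult U) us vs \<in> tuples (rep (length Ns))"
          using us vs unfolding tuples_rep by auto
        have "act_tuple (map2 (monoid.mult U) us vs) Ns xs = act_tuple us Ns (act_tuple vs Ns xs)"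
          using us vs xs Ns unfolding tuples_rep tuples_ks
          by (intro nth_equalityI) (auto simp: umods_def um_simps(4))
        then show "fw Ns (tensor_mult U (length Ns) (pure (rep (length Ns)) us) (pure (rep (length Ns)) vs)) (pure (ks Ns) xs) =
          fw Ns (pure (rep (length Ns)) us) (fw Ns (pure (rep (length Ns)) vs) (pure (ks Ns) xs))"
          unfolding tmult_pure[OF us vs] fw_pure[OF Ns vs xs] fw_pure[OF Ns uv xs]
            fw_pure[OF Ns us act_tuple_closed[OF Ns vs xs]] by (simp only:)
      qed
    qed
  qed
qed

section \<open>The operator of an element of \<open>U \<otimes> U\<close>\<close>

context
  fixes A B :: "('u, 'a) module"
  assumes A: "left_module U A" and B: "left_module U B"
begin

lemma Rc_kmods: "kmods [rs A, rs B]" "kmods [rs B, rs A]" "kmods [U, U]"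
  using rs_kmod[OF A] rs_kmod[OF B] by auto

lemma Rc_bimultilin: "bimultilin [rs A, rs B] [U, U] (ctensor [rs B, rs A])
    (\<lambda>xs bs. pure [rs B, rs A] [(bs ! 1) \<odot>\<^bsub>B\<^esub> (xs ! 1), (bs ! 0) \<odot>\<^bsub>A\<^esub> (xs ! 0)])"
proof -
  note KA = rs_kmod[OF A] and KB = rs_kmod[OF B]
  note cA = um_simps(1)[OF A] and cB = um_simps(1)[OF B]
  note p = pure2_lin[OF KB KA, simplified]
  show ?thesis unfolding bimultilin_def
  proof (intro conjI ballI)
    fix xs assume "xs \<in> tuples [rs A, rs B]"
    then obtain a b where xs: "xs = [a, b]" "a \<in> carrier A" "b \<in> carrier B" using tuples2D by fastforce
    show "multilin [U, U] (ctensor [rs B, rs A])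
        (\<lambda>bs. pure [rs B, rs A] [(bs ! 1) \<odot>\<^bsub>B\<^esub> (xs ! 1), (bs ! 0) \<odot>\<^bsub>A\<^esub> (xs ! 0)])"
      by (rule multilin2I)
        (use xs in \<open>simp_all add: lin_comp[OF act_scalar_lin[OF A] p(2)] lin_comp[OF act_scalar_lin[OF B] p(1)] cA cB\<close>)
  next
    fix bs assume "bs \<in> tuples [U, U]"
    then obtain s t where bs: "bs = [s, t]" "s \<in> carrier U" "t \<in> carrier U" using tuples2D by fastforce
    show "multilin [rs A, rs B] (ctensor [rs B, rs A])
        (\<lambda>xs. pure [rs B, rs A] [(bs ! 1) \<odot>\<^bsub>B\<^esub> (xs ! 1), (bs ! 0) \<odot>\<^bsub>A\<^esub> (xs ! 0)])"
      by (rule multilin2I[OF KA KB])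
        (use bs in \<open>simp_all add: lin_comp[OF act_lin[OF A] p(2)] lin_comp[OF act_lin[OF B] p(1)] cA cB\<close>)
  qed
qed

lemma Rc_bilin: "bilin (ctensor [rs A, rs B]) (ctensor [U, U]) (ctensor [rs B, rs A]) (\<lambda>w S. Rc S A B w)"
  using bilift_bilin[OF Rc_kmods(1,3) ctensor_complete[OF Rc_kmods(2)] Rc_bimultilin]
  unfolding R_check_def Let_def .

lemma Rc_pure:
  assumes "a \<in> carrier A" "b \<in> carrier B" "s \<in> carrier U" "t \<in> carrier U"
  shows "Rc (pure [U, U] [s, t]) A B (pure [rs A, rs B] [a, b]) = pure [rs B, rs A] [t \<odot>\<^bsub>B\<^esub> b, s \<odot>\<^bsub>A\<^esub> a]"
proof -
  have t: "[a, b] \<in> tuples [rs A, rs B]" "[s, t] \<in> tuples [U, U]"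
    using assms by (auto simp: set_Cons_def)
  show ?thesis
    using bilift_pure[OF Rc_kmods(1,3) ctensor_complete[OF Rc_kmods(2)] Rc_bimultilin t]
    unfolding R_check_def Let_def by simp
qed

end

end

section \<open>Two and three tensor factors\<close>

context h_algebra
begin

lemma rep_simps: "rep 2 = [U, U]" "rep 3 = [U, U, U]"
  by (simp_all add: numeral_2_eq_2 numeral_3_eq_3)

lemma umods_simps: "umods []" "umods (N # Ns) \<longleftrightarrow> left_module U N \<and> umods Ns"
  "umods (As @ Bs) \<longleftrightarrow> umods As \<and> umods Bs"
  by (auto simp: umods_def)

lemma UU_kmods: "kmods [U]" "kmods [U, U]" "kmods [U, U, U]"
  by auto

lemma pureU_closed: "s \<in> carrier U \<Longrightarrow> pure [U] [s] \<in> tensors [U]"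
  by (rule pure_closed) (auto simp: set_Cons_def)

lemma lin_multilin2:
  assumes "\<And>y. y \<in> carrier U \<Longrightarrow> (\<lambda>x. f x y) \<in> lin U W" "\<And>x. x \<in> carrier U \<Longrightarrow> (\<lambda>y. f x y) \<in> lin U W"
  shows "multilin [U, U] W (\<lambda>bs. f (bs ! 0) (bs ! 1))"
  by (rule multilin2I) (use assms in simp_all)

lemma UU_ext:
  assumes W: "complete_kmod W" and f: "f \<in> lin (ctensor [U, U]) W" and g: "g \<in> lin (ctensor [U, U]) W"
    and eq: "\<And>s t. s \<in> carrier U \<Longrightarrow> t \<in> carrier U \<Longrightarrow> f (pure [U, U] [s, t]) = g (pure [U, U] [s, t])"
    and w: "w \<in> tensors [U, U]"
  shows "f w = g w"
proof (rule ctensor_ext[OF UU_kmods(2) W f g _ w])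
  fix xs assume "xs \<in> tuples [U, U]"
  then obtain s t where "xs = [s, t]" "s \<in> carrier U" "t \<in> carrier U" using tuples2D by blast
  then show "f (pure [U, U] xs) = g (pure [U, U] xs)" using eq by simp
qed

context
  fixes A :: "('u, 'a) module"
  assumes A: "left_module U A"
begin

lemma fw1_lin2: "t \<in> tensors [U] \<Longrightarrow> fw [A] t \<in> tlin [rs A] [rs A]"
  using fw_lin2[of "[A]" t] A by (simp add: umods_simps)

end

context
  fixes A B :: "('u, 'a) module"
  assumes A: "left_module U A" and B: "left_module U B"
begin

lemma AB_kmods: "kmods [rs A, rs B]" "complete_kmod (ctensor [rs A, rs B])" "umods [A, B]"
proof -
  show K: "kmods [rs A, rs B]" using rs_kmod A B by auto
  show "complete_kmod (ctensor [rs A, rs B])" by (rule ctensor_complete[OF K])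
  show "umods [A, B]" using A B by (simp add: umods_simps)
qed

lemma fw2_lin2: "t \<in> tensors [U, U] \<Longrightarrow>
    fw [A, B] t \<in> tlin [rs A, rs B] [rs A, rs B]"
  using fw_lin2[OF AB_kmods(3)] by simp

lemma fw2_lin1: "w \<in> tensors [rs A, rs B] \<Longrightarrow>
    (\<lambda>t. fw [A, B] t w) \<in> tlin [U, U] [rs A, rs B]"
  using fw_lin1[OF AB_kmods(3)] by simp

lemma fw2_closed: "t \<in> tensors [U, U] \<Longrightarrow> w \<in> tensors [rs A, rs B] \<Longrightarrow>
    fw [A, B] t w \<in> tensors [rs A, rs B]"
  by (rule lin_closed[OF fw2_lin2])

lemma fw2_pure:
  "s \<in> carrier U \<Longrightarrow> t \<in> carrier U \<Longrightarrow> a \<in> carrier A \<Longrightarrow> b \<in> carrier B \<Longrightarrow>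
    fw [A, B] (pure [U, U] [s, t]) (pure [rs A, rs B] [a, b]) =
    pure [rs A, rs B] [s \<odot>\<^bsub>A\<^esub> a, t \<odot>\<^bsub>B\<^esub> b]"
  using fw_pure[OF AB_kmods(3), of "[s, t]" "[a, b]"] by (simp add: set_Cons_def)

lemma fw2_mult:
  "s \<in> tensors [U, U] \<Longrightarrow> t \<in> tensors [U, U] \<Longrightarrow> w \<in> tensors [rs A, rs B] \<Longrightarrow>
    fw [A, B] (tensor_mult U 2 s t) w = fw [A, B] s (fw [A, B] t w)"
  using fw_mult[OF AB_kmods(3), of s t w] by (simp add: numeral_2_eq_2)

lemma fw2_one:
  "w \<in> tensors [rs A, rs B] \<Longrightarrow>
    fw [A, B] (pure [U, U] [\<one>\<^bsub>U\<^esub>, \<one>\<^bsub>U\<^esub>]) w = w"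
  using fw_one[OF AB_kmods(3), of w] by simp

lemma AB_ext:
  assumes W: "complete_kmod W" and f: "f \<in> lin (ctensor [rs A, rs B]) W" and g: "g \<in> lin (ctensor [rs A, rs B]) W"
    and eq: "\<And>a b. a \<in> carrier A \<Longrightarrow> b \<in> carrier B \<Longrightarrow> f (pure [rs A, rs B] [a, b]) = g (pure [rs A, rs B] [a, b])"
    and w: "w \<in> tensors [rs A, rs B]"
  shows "f w = g w"
proof (rule ctensor_ext[OF AB_kmods(1) W f g _ w])
  fix xs assume "xs \<in> tuples [rs A, rs B]"
  then obtain a b where "xs = [a, b]" "a \<in> carrier A" "b \<in> carrier B" using tuples2D[of xs "rs A" "rs B"] by auto
  then show "f (pure [rs A, rs B] xs) = g (pure [rs A, rs B] xs)" using eq by simp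
qed

lemma pureAB_closed: "a \<in> carrier A \<Longrightarrow> b \<in> carrier B \<Longrightarrow> pure [rs A, rs B] [a, b] \<in> tensors [rs A, rs B]"
  by (rule pure_closed[OF AB_kmods(1)]) (auto simp: set_Cons_def)

lemma Rc_lin: "s \<in> tensors [U, U] \<Longrightarrow> Rc s A B \<in> tlin [rs A, rs B] [rs B, rs A]"
  using bilinD1[OF Rc_bilin[OF A B]] by simp

lemma Rc_lin_param: "w \<in> tensors [rs A, rs B] \<Longrightarrow>
    (\<lambda>s. Rc s A B w) \<in> tlin [U, U] [rs B, rs A]"
  using bilinD2[OF Rc_bilin[OF A B]] by simp

lemma Rc_closed: "s \<in> tensors [U, U] \<Longrightarrow> w \<in> tensors [rs A, rs B] \<Longrightarrow>
    Rc s A B w \<in> tensors [rs B, rs A]"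
  by (rule lin_closed[OF Rc_lin])

end

lemma pureUU_closed: "s \<in> carrier U \<Longrightarrow> t \<in> carrier U \<Longrightarrow> pure [U, U] [s, t] \<in> tensors [U, U]"
  by (rule pure_closed) (auto simp: set_Cons_def)

lemma tm2: "bilin (ctensor [U, U]) (ctensor [U, U]) (ctensor [U, U]) (tensor_mult U 2)"
  using tmult_bilin[of 2] by (simp add: rep_simps)

lemma tm3: "bilin (ctensor [U, U, U]) (ctensor [U, U, U]) (ctensor [U, U, U]) (tensor_mult U 3)"
  using tmult_bilin[of 3] by (simp add: rep_simps)

lemma tm3_pure:
  "s \<in> carrier U \<Longrightarrow> t \<in> carrier U \<Longrightarrow> r \<in> carrier U \<Longrightarrow> s' \<in> carrier U \<Longrightarrow> t' \<in> carrier U \<Longrightarrow> r' \<in> carrier U \<Longrightarrow>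
    tensor_mult U 3 (pure [U, U, U] [s, t, r]) (pure [U, U, U] [s', t', r']) =
    pure [U, U, U] [s \<otimes>\<^bsub>U\<^esub> s', t \<otimes>\<^bsub>U\<^esub> t', r \<otimes>\<^bsub>U\<^esub> r']"
  using tmult_pure[of "[s, t, r]" 3 "[s', t', r']"] by (simp add: rep_simps set_Cons_def)

lemma flip_lin: "flip U \<in> tlin [U, U] [U, U]"
  and flip_pure: "s \<in> carrier U \<Longrightarrow> t \<in> carrier U \<Longrightarrow> flip U (pure [U, U] [s, t]) = pure [U, U] [t, s]"
proof -
  have m: "multilin [U, U] (ctensor [U, U]) (\<lambda>bs. pure [U, U] [bs ! 1, bs ! 0])"
    by (rule lin_multilin2) (simp_all add: pure2_lin)
  show "flip U \<in> tlin [U, U] [U, U]"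
    unfolding flip_def by (rule lift_lin[OF UU_kmods(2) ctensor_complete[OF UU_kmods(2)] m])
  show "flip U (pure [U, U] [s, t]) = pure [U, U] [t, s]" if "s \<in> carrier U" "t \<in> carrier U"
    unfolding flip_def
    using lift_pure[OF UU_kmods(2) ctensor_complete[OF UU_kmods(2)] m, of "[s, t]"] that by (simp add: set_Cons_def)
qed

lemma flip_flip: "t \<in> tensors [U, U] \<Longrightarrow> flip U (flip U t) = t"
  by (rule UU_ext[OF ctensor_complete[OF UU_kmods(2)] lin_comp[OF flip_lin flip_lin] lin_ident])
    (simp_all add: flip_pure)

lemma leg13: "leg13 U \<in> tlin [U, U] [U, U, U]"
  "s \<in> carrier U \<Longrightarrow> t \<in> carrier U \<Longrightarrow> leg13 U (pure [U, U] [s, t]) = pure [U, U, U] [s, \<one>\<^bsub>U\<^esub>, t]"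
proof -
  have m: "multilin [U, U] (ctensor [U, U, U]) (\<lambda>bs. pure [U, U, U] [bs ! 0, \<one>\<^bsub>U\<^esub>, bs ! 1])"
    by (rule lin_multilin2) (simp_all add: pure3_lin)
  show "leg13 U \<in> tlin [U, U] [U, U, U]"
    unfolding leg13_def by (rule lift_lin[OF UU_kmods(2) ctensor_complete[OF UU_kmods(3)] m])
  show "leg13 U (pure [U, U] [s, t]) = pure [U, U, U] [s, \<one>\<^bsub>U\<^esub>, t]" if "s \<in> carrier U" "t \<in> carrier U"
    unfolding leg13_def
    using lift_pure[OF UU_kmods(2) ctensor_complete[OF UU_kmods(3)] m, of "[s, t]"] that by (simp add: set_Cons_def)
qed

lemma leg23: "leg23 U \<in> tlin [U, U] [U, U, U]"
  "s \<in> carrier U \<Longrightarrow> t \<in> carrier U \<Longrightarrow> leg23 U (pure [U, U] [s, t]) = pure [U, U, U] [\<one>\<^bsub>U\<^esub>, s, t]"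
proof -
  have m: "multilin [U, U] (ctensor [U, U, U]) (\<lambda>bs. pure [U, U, U] [\<one>\<^bsub>U\<^esub>, bs ! 0, bs ! 1])"
    by (rule lin_multilin2) (simp_all add: pure3_lin)
  show "leg23 U \<in> tlin [U, U] [U, U, U]"
    unfolding leg23_def by (rule lift_lin[OF UU_kmods(2) ctensor_complete[OF UU_kmods(3)] m])
  show "leg23 U (pure [U, U] [s, t]) = pure [U, U, U] [\<one>\<^bsub>U\<^esub>, s, t]" if "s \<in> carrier U" "t \<in> carrier U"
    unfolding leg23_def
    using lift_pure[OF UU_kmods(2) ctensor_complete[OF UU_kmods(3)] m, of "[s, t]"] that by (simp add: set_Cons_def)
qed

text \<open>The flip \<open>a \<otimes> b \<mapsto> b \<otimes> a\<close> of two modules. Writing \<open>R_check\<close> as the flip after the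
  factorwise action (\<open>Rc_tau\<close>) separates what depends on the element of \<open>U \<otimes> U\<close> from what does
  not.\<close>

definition tau :: "('u, 'a) module \<Rightarrow> ('u, 'a) module \<Rightarrow> 'a tensor \<Rightarrow> 'a tensor" where
  "tau A B = lift [rs A, rs B] (ctensor [rs B, rs A]) (\<lambda>xs. pure [rs B, rs A] [xs ! 1, xs ! 0])"

context
  fixes A B :: "('u, 'a) module"
  assumes A: "left_module U A" and B: "left_module U B"
begin

lemma tau_multilin:
  "multilin [rs A, rs B] (ctensor [rs B, rs A]) (\<lambda>xs. pure [rs B, rs A] [xs ! 1, xs ! 0])"
  by (rule multilin2I) (simp_all add: rs_kmod[OF A] rs_kmod[OF B] pure2_lin[of "rs B" "rs A", simplified])

lemma tau_lin: "tau A B \<in> tlin [rs A, rs B] [rs B, rs A]"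
  unfolding tau_def by (rule lift_lin[OF AB_kmods(1)[OF A B] AB_kmods(2)[OF B A] tau_multilin])

lemma tau_pure: "a \<in> carrier A \<Longrightarrow> b \<in> carrier B \<Longrightarrow> tau A B (pure [rs A, rs B] [a, b]) = pure [rs B, rs A] [b, a]"
  unfolding tau_def using lift_pure[OF AB_kmods(1)[OF A B] AB_kmods(2)[OF B A] tau_multilin, of "[a, b]"]
  by (simp add: set_Cons_def)

lemma Rc_tau:
  assumes t: "t \<in> tensors [U, U]" and w: "w \<in> tensors [rs A, rs B]"
  shows "Rc t A B w = tau A B (fw [A, B] t w)"
proof (rule UU_ext[OF AB_kmods(2)[OF B A] Rc_lin_param[OF A B w] lin_comp[OF fw2_lin1[OF A B w] tau_lin] _ t])
  fix t1 t2 assume t12: "t1 \<in> carrier U" "t2 \<in> carrier U"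
  note q = pureUU_closed[OF t12]
  show "Rc (pure [U, U] [t1, t2]) A B w = tau A B (fw [A, B] (pure [U, U] [t1, t2]) w)"
    by (rule AB_ext[OF A B AB_kmods(2)[OF B A] Rc_lin[OF A B q] lin_comp[OF fw2_lin2[OF A B q] tau_lin] _ w])
      (use t12 in \<open>simp add: fw2_pure[OF A B] Rc_pure[OF A B] tau_pure um_simps[OF A] um_simps[OF B]\<close>)
qed

lemma Rc_mult_right:
  assumes s: "s \<in> tensors [U, U]" and t: "t \<in> tensors [U, U]"
    and w: "w \<in> tensors [rs A, rs B]"
  shows "Rc (tensor_mult U 2 s t) A B w = Rc s A B (fw [A, B] t w)"
  unfolding Rc_tau[OF bilin_closed[OF tm2 s t] w] Rc_tau[OF s fw2_closed[OF A B t w]] fw2_mult[OF A B s t w] ..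

end

context
  fixes A B :: "('u, 'a) module"
  assumes A: "left_module U A" and B: "left_module U B"
begin

lemma tau_tau: "w \<in> tensors [rs A, rs B] \<Longrightarrow> tau B A (tau A B w) = w"
  by (rule AB_ext[OF A B AB_kmods(2)[OF A B] lin_comp[OF tau_lin[OF A B] tau_lin[OF B A]] lin_ident])
    (simp_all add: tau_pure[OF A B] tau_pure[OF B A])

lemma tau_fw:
  assumes t: "t \<in> tensors [U, U]" and w: "w \<in> tensors [rs A, rs B]"
  shows "tau A B (fw [A, B] t w) = fw [B, A] (flip U t) (tau A B w)"
proof (rule UU_ext[OF AB_kmods(2)[OF B A] lin_comp[OF fw2_lin1[OF A B w] tau_lin[OF A B]]
      lin_comp[OF flip_lin fw2_lin1[OF B A lin_closed[OF tau_lin[OF A B] w]]] _ t])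
  fix t1 t2 assume t12: "t1 \<in> carrier U" "t2 \<in> carrier U"
  note q = pureUU_closed[OF t12] pureUU_closed[OF t12(2,1)]
  show "tau A B (fw [A, B] (pure [U, U] [t1, t2]) w) =
    fw [B, A] (flip U (pure [U, U] [t1, t2])) (tau A B w)"
    unfolding flip_pure[OF t12]
    by (rule AB_ext[OF A B AB_kmods(2)[OF B A] lin_comp[OF fw2_lin2[OF A B q(1)] tau_lin[OF A B]]
          lin_comp[OF tau_lin[OF A B] fw2_lin2[OF B A q(2)]] _ w])
      (use t12 in \<open>simp add: fw2_pure[OF A B] fw2_pure[OF B A] tau_pure[OF A B] um_simps[OF A] um_simps[OF B]\<close>)
qed

text \<open>A left factor acts after a right one, hence next to the flip, which it passes at the cost of
  exchanging its legs.\<close>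

lemma Rc_mult_left:
  assumes s: "s \<in> tensors [U, U]" and t: "t \<in> tensors [U, U]"
    and w: "w \<in> tensors [rs A, rs B]"
  shows "Rc (tensor_mult U 2 s t) A B w = fw [B, A] (flip U s) (Rc t A B w)"
  unfolding Rc_tau[OF A B bilin_closed[OF tm2 s t] w] Rc_tau[OF A B t w] fw2_mult[OF A B s t w]
  by (rule tau_fw[OF s fw2_closed[OF A B t w]])

end

end

section \<open>The iterated comultiplication\<close>

context hopf_algebra
begin

lemma eps_lin:
  assumes W: "kmod W" and w: "w \<in> carrier W"
  shows "(\<lambda>a. \<epsilon> a \<odot>\<^bsub>W\<^esub> w) \<in> lin U W"
  by (rule linI)
    (use W w ring_hom_add[OF counit_hom] in \<open>simp_all add: counit_linear kmod_distr_left kmod_assoc\<close>)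

abbreviation itc where "itc \<equiv> iterated_comult U \<Delta> \<epsilon>"

lemma itc_step_multilin:
  assumes l: "itc r \<in> lin U (ctensor (rep r))"
  shows "multilin [U, U] (ctensor (rep (Suc r)))
    (\<lambda>bs. juxtapose [U] (rep r) (pure [U] [bs ! 0]) (itc r (bs ! 1)))"
proof (rule lin_multilin2)
  fix x assume x: "x \<in> carrier U"
  show "(\<lambda>y. juxtapose [U] (rep r) (pure [U] [x]) (itc r y)) \<in> lin U (ctensor (rep (Suc r)))"
    using lin_comp[OF l juxt_lin2[OF UU_kmods(1) rep_kmods pure_closed[OF UU_kmods(1) tuples_smallI(1)[OF x]]]]
    by simp
  show "(\<lambda>y. juxtapose [U] (rep r) (pure [U] [y]) (itc r x)) \<in> lin U (ctensor (rep (Suc r)))"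
    using lin_comp[OF pure1_lin[OF U_kmod] juxt_lin1[OF UU_kmods(1) rep_kmods lin_closed[OF l x]]]
    by simp
qed

lemma itc_lin: "itc r \<in> lin U (ctensor (rep r))"
proof (induction r)
  case 0
  have "(\<lambda>a. \<epsilon> a \<odot>\<^bsub>ctensor []\<^esub> pure [] []) \<in> lin U (ctensor [])"
    by (rule eps_lin) (auto intro: pure_closed)
  then show ?case by simp
next
  case (Suc r)
  show ?case
    using lin_comp[OF comult_linear lift_lin[OF UU_kmods(2) ctensor_complete[OF rep_kmods] itc_step_multilin[OF Suc]]]
    by simp
qed

lemma itc_closed: "a \<in> carrier U \<Longrightarrow> itc r a \<in> tensors (rep r)"
  by (rule lin_closed[OF itc_lin])

lemma Delta_closed: "a \<in> carrier U \<Longrightarrow> \<Delta> a \<in> tensors [U, U]"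
  by (rule lin_closed[OF comult_linear])

lemma itc_juxt_multilin:
  "multilin [U, U] (ctensor (rep m @ rep n)) (\<lambda>bs. juxtapose (rep m) (rep n) (itc m (bs ! 0)) (itc n (bs ! 1)))"
  by (rule lin_multilin2)
    (intro lin_comp[OF itc_lin juxt_lin2[OF rep_kmods rep_kmods]] lin_comp[OF itc_lin juxt_lin1[OF rep_kmods rep_kmods]]
      itc_closed; assumption)+

text \<open>The recursion for the iterated comultiplication splits off the leftmost leg. That any other
  splitting gives the same result is coassociativity: in the induction step both sides are images of
  \<open>(\<Delta> \<otimes> id)(\<Delta> a) = (id \<otimes> \<Delta>)(\<Delta> a)\<close> under one linear map \<open>\<Psi>\<close> on \<open>U \<otimes> U \<otimes> U\<close>. In the base
  case the left block is empty and its leg is absorbed by the counit.\<close>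

lemma itc_add:
  assumes a: "a \<in> carrier U"
  shows "itc (m + n) a = lift [U, U] (ctensor (rep m @ rep n))
    (\<lambda>bs. juxtapose (rep m) (rep n) (itc m (bs ! 0)) (itc n (bs ! 1))) (\<Delta> a)"
  using a
proof (induction m arbitrary: a)
  case 0
  note D = Delta_closed[OF 0]
  have m: "multilin [U, U] U (\<lambda>bs. \<epsilon> (bs ! 0) \<odot>\<^bsub>U\<^esub> bs ! 1)"
    by (rule lin_multilin2) (simp_all add: eps_lin lin_scale lin_ident)
  have p: "pure [] [] \<in> tensors []" by (rule pure_closed) auto
  have "itc n a = itc n (lift [U, U] U (\<lambda>bs. \<epsilon> (bs ! 0) \<odot>\<^bsub>U\<^esub> bs ! 1) (\<Delta> a))" by (simp only: counit_left[OF 0])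
  also have "\<dots> = lift [U, U] (ctensor (rep n)) (\<lambda>bs. itc n (\<epsilon> (bs ! 0) \<odot>\<^bsub>U\<^esub> bs ! 1)) (\<Delta> a)"
    by (rule lift_comp[OF UU_kmods(2) U_complete m ctensor_complete[OF rep_kmods] itc_lin D])
  also have "\<dots> = lift [U, U] (ctensor (rep n)) (\<lambda>bs. juxtapose [] (rep n) (itc 0 (bs ! 0)) (itc n (bs ! 1))) (\<Delta> a)"
  proof (rule fun_cong[of _ _ "\<Delta> a"], rule lift_cong)
    fix bs assume "bs \<in> tuples [U, U]"
    then obtain s t where bs: "bs = [s, t]" "s \<in> carrier U" "t \<in> carrier U" using tuples2D by blast
    show "itc n (\<epsilon> (bs ! 0) \<odot>\<^bsub>U\<^esub> bs ! 1) = juxtapose [] (rep n) (itc 0 (bs ! 0)) (itc n (bs ! 1))"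
      using bs lin_smult[OF juxt_lin1[OF _ rep_kmods itc_closed[OF bs(3)], of "[]" n] p]
        juxt_Nil_left[OF rep_kmods itc_closed[OF bs(3)]] lin_smult[OF itc_lin[of n] bs(3)] by simp
  qed
  finally show ?case by simp
next
  case (Suc m)
  let ?W = "ctensor (U # rep m @ rep n)"
  let ?j = "juxtapose (rep m) (rep n)" and ?J = "juxtapose [U] (rep m @ rep n)"
  have Kmn: "kmods (rep m @ rep n)" and KW: "kmods (U # rep m @ rep n)" by auto
  note W = ctensor_complete[OF KW] and U2 = UU_kmods(1,2) and D = Delta_closed
  have pU: "pure [U] [x] \<in> tensors [U]" if "x \<in> carrier U" for x
    by (rule pure_closed[OF U2(1) tuples_smallI(1)[OF that]])
  note JJ = juxt_lin1[OF U2(2,1), simplified] juxt_lin2[OF U2(1,2), simplified]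
    and Jl = juxt_lin1[OF U2(1) Kmn, simplified] juxt_lin2[OF U2(1) Kmn, simplified]
    and jl = juxt_lin1[OF rep_kmods rep_kmods] juxt_lin2[OF rep_kmods rep_kmods] and jc = juxt_closed[OF rep_kmods rep_kmods]
  let ?f = "\<lambda>xs. ?J (pure [U] [xs ! 0]) (?j (itc m (xs ! 1)) (itc n (xs ! 2)))"
  define \<Psi> where "\<Psi> = lift [U, U, U] ?W ?f"
  have m: "multilin [U, U, U] ?W ?f"
  proof (rule multilin3I)
    fix x y assume x: "x \<in> carrier U" and y: "y \<in> carrier U"
    note c = itc_closed[OF x] itc_closed[OF y]
    show "(\<lambda>z. ?f [z, x, y]) \<in> lin U ?W" using lin_comp[OF pure1_lin[OF U_kmod] Jl(1)[OF jc[OF c]]] by simp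
    show "(\<lambda>z. ?f [x, z, y]) \<in> lin U ?W" using lin_comp[OF lin_comp[OF itc_lin jl(1)[OF c(2)]] Jl(2)[OF pU[OF x]]] by simp
    show "(\<lambda>z. ?f [x, y, z]) \<in> lin U ?W" using lin_comp[OF lin_comp[OF itc_lin jl(2)[OF c(2)]] Jl(2)[OF pU[OF x]]] by simp
  qed auto
  note \<Psi>l = lift_lin[OF UU_kmods(3) W m, folded \<Psi>_def]
  have \<Psi>p: "\<Psi> (pure [U, U, U] [x, y, z]) = ?f [x, y, z]"
    if "x \<in> carrier U" "y \<in> carrier U" "z \<in> carrier U" for x y z
    unfolding \<Psi>_def by (rule lift_pure[OF UU_kmods(3) W m tuples_smallI(3)[OF that]])
  have p12: "juxtapose [U] [U, U] (pure [U] [x]) (pure [U, U] [y, z]) = pure [U, U, U] [x, y, z]"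
    "juxtapose [U, U] [U] (pure [U, U] [x, y]) (pure [U] [z]) = pure [U, U, U] [x, y, z]"
    if "x \<in> carrier U" "y \<in> carrier U" "z \<in> carrier U" for x y z
    using that juxt_pure[OF U2, of "[x]" "[y, z]"] juxt_pure[OF U2(2,1), of "[x, y]" "[z]"] by (simp_all add: set_Cons_def)
  let ?R = "\<lambda>t. lift [U, U] (ctensor (rep m @ rep n)) (\<lambda>cs. ?j (itc m (cs ! 0)) (itc n (cs ! 1))) t"
  note Rl = lift_lin[OF U2(2) ctensor_complete[OF Kmn] itc_juxt_multilin]
    and Rp = lift_pure[OF U2(2) ctensor_complete[OF Kmn] itc_juxt_multilin tuples_smallI(2)]
  have R: "?J (pure [U] [u]) (?R t) = \<Psi> (juxtapose [U] [U, U] (pure [U] [u]) t)"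
    if u: "u \<in> carrier U" and t: "t \<in> tensors [U, U]" for t u
  proof (rule UU_ext[OF W lin_comp[OF Rl Jl(2)[OF pU[OF u]]] lin_comp[OF JJ(2)[OF pU[OF u]] \<Psi>l] _ t])
    fix y z assume y: "y \<in> carrier U" and z: "z \<in> carrier U"
    show "?J (pure [U] [u]) (?R (pure [U, U] [y, z])) = \<Psi> (juxtapose [U] [U, U] (pure [U] [u]) (pure [U, U] [y, z]))"
      unfolding Rp[OF y z] p12(1)[OF u y z] \<Psi>p[OF u y z] by (simp add: numeral_2_eq_2)
  qed
  let ?L = "\<lambda>t. lift [U, U] (ctensor (U # rep m)) (\<lambda>cs. juxtapose [U] (rep m) (pure [U] [cs ! 0]) (itc m (cs ! 1))) t"
  have KU: "kmods (U # rep m)" by auto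
  note mm = itc_step_multilin[OF itc_lin, of m, unfolded replicate_Suc]
  note Ll = lift_lin[OF U2(2) ctensor_complete[OF KU] mm] and Lp = lift_pure[OF U2(2) ctensor_complete[OF KU] mm tuples_smallI(2)]
  have L: "\<Psi> (juxtapose [U, U] [U] t (pure [U] [u])) = juxtapose (U # rep m) (rep n) (?L t) (itc n u)"
    if u: "u \<in> carrier U" and t: "t \<in> tensors [U, U]" for t u
  proof (rule UU_ext[OF W lin_comp[OF JJ(1)[OF pU[OF u]] \<Psi>l]
        lin_comp[OF Ll juxt_lin1[OF KU rep_kmods itc_closed[OF u], simplified]] _ t])
    fix x y assume x: "x \<in> carrier U" and y: "y \<in> carrier U"
    show "\<Psi> (juxtapose [U, U] [U] (pure [U, U] [x, y]) (pure [U] [u])) =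
      juxtapose (U # rep m) (rep n) (?L (pure [U, U] [x, y])) (itc n u)"
      unfolding Lp[OF x y] p12(2)[OF x y u] \<Psi>p[OF x y u]
      using juxt_assoc[OF U2(1) rep_kmods rep_kmods pU[OF x] itc_closed[OF y] itc_closed[OF u]] by (simp add: numeral_2_eq_2)
  qed
  have mL: "multilin [U, U] (ctensor [U, U, U]) (\<lambda>bs. juxtapose [U, U] [U] (\<Delta> (bs ! 0)) (pure [U] [bs ! 1]))"
    by (rule lin_multilin2)
      (use lin_comp[OF comult_linear JJ(1)[OF pU]]
        lin_comp[OF pure1_lin[OF U_kmod] juxt_lin2[OF U2(2,1) D, simplified]] in auto)
  have mR: "multilin [U, U] (ctensor [U, U, U]) (\<lambda>bs. juxtapose [U] [U, U] (pure [U] [bs ! 0]) (\<Delta> (bs ! 1)))"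
    by (rule lin_multilin2)
      (use lin_comp[OF comult_linear JJ(2)[OF pU]]
        lin_comp[OF pure1_lin[OF U_kmod] juxt_lin1[OF U2(1,2) D, simplified]] in auto)
  note comp = lift_comp[OF UU_kmods(2) ctensor_complete[OF UU_kmods(3)] _ W \<Psi>l D[OF Suc.prems]]
  have "itc (Suc m + n) a = lift [U, U] ?W (\<lambda>bs. \<Psi> (juxtapose [U] [U, U] (pure [U] [bs ! 0]) (\<Delta> (bs ! 1)))) (\<Delta> a)"
    unfolding add_Suc iterated_comult.simps replicate_Suc replicate_add
  proof (rule fun_cong[of _ _ "\<Delta> a"], rule lift_cong)
    fix bs assume "bs \<in> tuples [U, U]"
    then obtain s t where bs: "bs = [s, t]" "s \<in> carrier U" "t \<in> carrier U" using tuples2D by blast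
    show "?J (pure [U] [bs ! 0]) (itc (m + n) (bs ! 1)) = \<Psi> (juxtapose [U] [U, U] (pure [U] [bs ! 0]) (\<Delta> (bs ! 1)))"
      using R[OF bs(2) D[OF bs(3)]] Suc.IH[OF bs(3)] bs by simp
  qed
  also have "\<dots> = lift [U, U] ?W (\<lambda>bs. \<Psi> (juxtapose [U, U] [U] (\<Delta> (bs ! 0)) (pure [U] [bs ! 1]))) (\<Delta> a)"
    unfolding comp[OF mR, symmetric] comp[OF mL, symmetric] coassoc[OF Suc.prems] ..
  also have "\<dots> = lift [U, U] ?W (\<lambda>bs. juxtapose (U # rep m) (rep n) (itc (Suc m) (bs ! 0)) (itc n (bs ! 1))) (\<Delta> a)"
  proof (rule fun_cong[of _ _ "\<Delta> a"], rule lift_cong)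
    fix bs assume "bs \<in> tuples [U, U]"
    then obtain s t where bs: "bs = [s, t]" "s \<in> carrier U" "t \<in> carrier U" using tuples2D by blast
    show "\<Psi> (juxtapose [U, U] [U] (\<Delta> (bs ! 0)) (pure [U] [bs ! 1])) =
      juxtapose (U # rep m) (rep n) (itc (Suc m) (bs ! 0)) (itc n (bs ! 1))"
      using L[OF bs(3) D[OF bs(2)]] bs by simp
  qed
  finally show ?case by simp
qed

lemma itc_1: "a \<in> carrier U \<Longrightarrow> itc (Suc 0) a = pure [U] [a]"
proof -
  assume a: "a \<in> carrier U"
  have m: "multilin [U, U] U (\<lambda>bs. \<epsilon> (bs ! 1) \<odot>\<^bsub>U\<^esub> bs ! 0)"
    by (rule lin_multilin2) (simp_all add: eps_lin lin_scale lin_ident)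
  have p: "pure [] [] \<in> tensors []" and N: "kmods []" by (rule pure_closed) auto
  have pU: "pure [U] [x] \<in> tensors [U]" if "x \<in> carrier U" for x
    by (rule pure_closed[OF UU_kmods(1) tuples_smallI(1)[OF that]])
  have "itc (Suc 0) a = lift [U, U] (ctensor [U]) (\<lambda>bs. pure [U] [\<epsilon> (bs ! 1) \<odot>\<^bsub>U\<^esub> bs ! 0]) (\<Delta> a)"
    unfolding iterated_comult.simps replicate_Suc replicate_0
  proof (rule fun_cong[of _ _ "\<Delta> a"], rule lift_cong)
    fix bs assume "bs \<in> tuples [U, U]"
    then obtain s t where bs: "bs = [s, t]" "s \<in> carrier U" "t \<in> carrier U" using tuples2D by blast
    show "juxtapose [U] [] (pure [U] [bs ! 0]) (\<epsilon> (bs ! 1) \<odot>\<^bsub>ctensor []\<^esub> pure [] []) = pure [U] [\<epsilon> (bs ! 1) \<odot>\<^bsub>U\<^esub> bs ! 0]"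
      using bs lin_smult[OF juxt_lin2[OF UU_kmods(1) N pU[OF bs(2)]] p] juxt_Nil_right[OF UU_kmods(1) pU[OF bs(2)]]
        lin_smult[OF pure1_lin[OF U_kmod] bs(2)] by simp
  qed
  also have "\<dots> = pure [U] [lift [U, U] U (\<lambda>bs. \<epsilon> (bs ! 1) \<odot>\<^bsub>U\<^esub> bs ! 0) (\<Delta> a)]"
    by (rule lift_comp[OF UU_kmods(2) U_complete m ctensor_complete[OF UU_kmods(1)] pure1_lin[OF U_kmod] Delta_closed[OF a], symmetric])
  finally show ?thesis by (simp only: counit_right[OF a])
qed

lemma itc_2:
  assumes a: "a \<in> carrier U"
  shows "itc (Suc (Suc 0)) a = \<Delta> a"
proof -
  have "itc (Suc (Suc 0)) a = lift [U, U] (ctensor [U, U]) (pure [U, U]) (\<Delta> a)"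
    unfolding iterated_comult.simps(2)[of _ _ _ "Suc 0"] replicate_Suc replicate_0
  proof (rule fun_cong[of _ _ "\<Delta> a"], rule lift_cong)
    fix bs assume "bs \<in> tuples [U, U]"
    then obtain s t where bs: "bs = [s, t]" "s \<in> carrier U" "t \<in> carrier U" using tuples2D by blast
    show "juxtapose [U] [U] (pure [U] [bs ! 0]) (itc (Suc 0) (bs ! 1)) = pure [U, U] bs"
      using juxt_pure[OF UU_kmods(1,1), of "[s]" "[t]"] bs by (simp add: itc_1 set_Cons_def del: iterated_comult.simps)
  qed
  also have "\<dots> = \<Delta> a"
    by (rule ctensor_ext[OF UU_kmods(2) ctensor_complete[OF UU_kmods(2)]
          lift_lin[OF UU_kmods(2) ctensor_complete[OF UU_kmods(2)] pure_multilin[OF UU_kmods(2)]] lin_ident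
          lift_pure[OF UU_kmods(2) ctensor_complete[OF UU_kmods(2)] pure_multilin[OF UU_kmods(2)]] Delta_closed[OF a]])
  finally show ?thesis .
qed

end

section \<open>U-linear maps between tensor products\<close>

lemma idt_juxt_left:
  assumes K: "kmods As" "kmods Bs" "kmods Bs'" and f: "f \<in> tlin Bs Bs'"
    and x: "x \<in> tensors As" and y: "y \<in> tensors Bs"
  shows "idt As Bs Bs' [] f (juxtapose As Bs x y) = juxtapose As Bs' x (f y)"
proof -
  have N: "kmods []" by simp
  have p: "pure [] [] \<in> tensors []" by (rule pure_closed) auto
  show ?thesis
    using idt_juxt[OF K N f x y p]
    by (simp add: juxt_Nil_right[OF K(2)] juxt_Nil_right[OF K(3)] y lin_closed[OF f y])
qed

lemma idt_juxt_right:
  assumes K: "kmods Bs" "kmods Bs'" "kmods Cs" and f: "f \<in> tlin Bs Bs'"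
    and y: "y \<in> tensors Bs" and z: "z \<in> tensors Cs"
  shows "idt [] Bs Bs' Cs f (juxtapose Bs Cs y z) = juxtapose Bs' Cs (f y) z"
proof -
  have N: "kmods []" by simp
  have p: "pure [] [] \<in> tensors []" by (rule pure_closed) auto
  have K2: "kmods (Bs @ Cs)" "kmods (Bs' @ Cs)" using K by auto
  show ?thesis
    using idt_juxt[OF N K f p y z]
    by (simp add: juxt_Nil_left[OF K2(1)] juxt_Nil_left[OF K2(2)] juxt_closed[OF K(1,3) y z]
        juxt_closed[OF K(2,3) lin_closed[OF f y] z])
qed

lemma idt_lin_left:
  assumes K: "kmods As" "kmods Bs" "kmods Bs'" and f: "f \<in> tlin Bs Bs'"
  shows "idt As Bs Bs' [] f \<in> tlin (As @ Bs) (As @ Bs')"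
  using idt_lin[OF K _ f, of "[]"] by simp

lemma idt_lin_right:
  assumes K: "kmods Bs" "kmods Bs'" "kmods Cs" and f: "f \<in> tlin Bs Bs'"
  shows "idt [] Bs Bs' Cs f \<in> tlin (Bs @ Cs) (Bs' @ Cs)"
  using idt_lin[OF _ K f, of "[]"] by simp

context hopf_algebra
begin

definition act :: "('u, 'a) module list \<Rightarrow> 'u \<Rightarrow> 'a tensor \<Rightarrow> 'a tensor" where
  "act Ns a = fw Ns (itc (length Ns) a)"

definition ulin :: "('u, 'a) module list \<Rightarrow> ('u, 'a) module list \<Rightarrow> ('a tensor \<Rightarrow> 'a tensor) \<Rightarrow> bool" where
  "ulin Ns Ns' f \<longleftrightarrow> f \<in> tlin (ks Ns) (ks Ns') \<and>
     (\<forall>a\<in>carrier U. \<forall>w\<in>tensors (ks Ns). f (act Ns a w) = act Ns' a (f w))"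

lemma ulin_lin: "ulin Ns Ns' f \<Longrightarrow> f \<in> tlin (ks Ns) (ks Ns')"
  by (simp add: ulin_def)

lemma ulin_comm: "ulin Ns Ns' f \<Longrightarrow> a \<in> carrier U \<Longrightarrow> w \<in> tensors (ks Ns) \<Longrightarrow>
    f (act Ns a w) = act Ns' a (f w)"
  by (simp add: ulin_def)

lemma act_lin2: "umods Ns \<Longrightarrow> a \<in> carrier U \<Longrightarrow> act Ns a \<in> tlin (ks Ns) (ks Ns)"
  unfolding act_def by (rule fw_lin2[OF _ itc_closed])

lemma act_lin1: "umods Ns \<Longrightarrow> w \<in> tensors (ks Ns) \<Longrightarrow> (\<lambda>a. act Ns a w) \<in> lin U (ctensor (ks Ns))"
  unfolding act_def by (rule lin_comp[OF itc_lin fw_lin1])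

lemma act_closed: "umods Ns \<Longrightarrow> a \<in> carrier U \<Longrightarrow> w \<in> tensors (ks Ns) \<Longrightarrow> act Ns a w \<in> tensors (ks Ns)"
  by (rule lin_closed[OF act_lin2])

lemma ulin_cong:
  assumes f: "ulin Ns Ns' f" and Ns: "umods Ns" and eq: "\<And>w. w \<in> tensors (ks Ns) \<Longrightarrow> f w = g w"
  shows "ulin Ns Ns' g"
  unfolding ulin_def
proof (intro conjI ballI)
  show "g \<in> tlin (ks Ns) (ks Ns')"
    by (rule lin_cong[OF ulin_lin[OF f] complete_kmod_kmod[OF ctensor_complete[OF umods_kmods[OF Ns]]] eq])
  fix a w assume "a \<in> carrier U" "w \<in> tensors (ks Ns)"
  then show "g (act Ns a w) = act Ns' a (g w)"
    using ulin_comm[OF f] eq act_closed[OF Ns] by metis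
qed

lemma act_pair: "a \<in> carrier U \<Longrightarrow> act [A, B] a = fw [A, B] (\<Delta> a)"
  by (simp add: act_def itc_2 del: iterated_comult.simps)

lemma ulin_ident: "ulin Ns Ns (\<lambda>w. w)"
  by (simp add: ulin_def lin_ident)

context
  fixes As Bs :: "('u, 'a) module list"
  assumes As: "umods As" and Bs: "umods Bs"
begin

lemma act_juxt_multilin:
  assumes x: "x \<in> tensors (ks As)" and y: "y \<in> tensors (ks Bs)"
  shows "multilin [U, U] (ctensor (ks As @ ks Bs)) (\<lambda>bs. juxtapose (ks As) (ks Bs) (act As (bs ! 0) x) (act Bs (bs ! 1) y))"
  by (rule lin_multilin2)
    (intro lin_comp[OF act_lin1[OF As x] juxt_lin1] lin_comp[OF act_lin1[OF Bs y] juxt_lin2] umods_kmods As Bs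
      act_closed x y; assumption)+

text \<open>The action on a tensor product of two blocks of modules is the action on the blocks through the
  two legs of \<open>\<Delta> a\<close>.\<close>

lemma act_append_juxt:
  assumes a: "a \<in> carrier U" and x: "x \<in> tensors (ks As)" and y: "y \<in> tensors (ks Bs)"
  shows "act (As @ Bs) a (juxtapose (ks As) (ks Bs) x y) = lift [U, U] (ctensor (ks As @ ks Bs))
    (\<lambda>bs. juxtapose (ks As) (ks Bs) (act As (bs ! 0) x) (act Bs (bs ! 1) y)) (\<Delta> a)"
proof -
  let ?m = "length As" and ?n = "length Bs"
  note K = umods_kmods[OF As] umods_kmods[OF Bs]
  have K2: "kmods (ks As @ ks Bs)" "kmods (rep ?m @ rep ?n)" using K by auto
  have AB: "umods (As @ Bs)" using As Bs by (simp add: umods_simps)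
  let ?xy = "juxtapose (ks As) (ks Bs) x y"
  have G: "(\<lambda>t. fw (As @ Bs) t ?xy) \<in> tlin (rep ?m @ rep ?n) (ks As @ ks Bs)"
    using fw_lin1[OF AB, of ?xy] juxt_closed[OF K x y] by (simp add: replicate_add)
  have "act (As @ Bs) a ?xy = fw (As @ Bs)
      (lift [U, U] (ctensor (rep ?m @ rep ?n)) (\<lambda>bs. juxtapose (rep ?m) (rep ?n) (itc ?m (bs ! 0)) (itc ?n (bs ! 1))) (\<Delta> a)) ?xy"
    unfolding act_def length_append itc_add[OF a] ..
  also have "\<dots> = lift [U, U] (ctensor (ks As @ ks Bs)) (\<lambda>bs. fw (As @ Bs)
      (juxtapose (rep ?m) (rep ?n) (itc ?m (bs ! 0)) (itc ?n (bs ! 1))) ?xy) (\<Delta> a)"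
    by (rule lift_comp[OF UU_kmods(2) ctensor_complete[OF K2(2)] itc_juxt_multilin ctensor_complete[OF K2(1)] G Delta_closed[OF a]])
  also have "\<dots> = lift [U, U] (ctensor (ks As @ ks Bs))
    (\<lambda>bs. juxtapose (ks As) (ks Bs) (act As (bs ! 0) x) (act Bs (bs ! 1) y)) (\<Delta> a)"
  proof (rule fun_cong[of _ _ "\<Delta> a"], rule lift_cong)
    fix bs assume "bs \<in> tuples [U, U]"
    then obtain s t where bs: "bs = [s, t]" "s \<in> carrier U" "t \<in> carrier U" using tuples2D by blast
    show "fw (As @ Bs) (juxtapose (rep ?m) (rep ?n) (itc ?m (bs ! 0)) (itc ?n (bs ! 1))) ?xy =
      juxtapose (ks As) (ks Bs) (act As (bs ! 0) x) (act Bs (bs ! 1) y)"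
      using fw_juxt[OF As Bs itc_closed[OF bs(2)] itc_closed[OF bs(3)] x y] bs by (simp add: act_def)
  qed
  finally show ?thesis .
qed

end

text \<open>Stated for any map that decomposes on juxtapositions, so that it serves for \<open>id \<otimes> f\<close> and
  \<open>f \<otimes> id\<close> alike. By \<open>act_append_juxt\<close>, \<open>a\<close> acts on the two blocks separately once \<open>\<Delta> a\<close> is
  replaced by a pure tensor.\<close>

lemma ulin_juxt:
  assumes As: "umods As" and Bs: "umods Bs" and As': "umods As'" and Bs': "umods Bs'"
    and f: "ulin As As' f" and g: "ulin Bs Bs' g"
    and F: "F \<in> tlin (ks As @ ks Bs) (ks As' @ ks Bs')"
    and FJ: "\<And>x y. x \<in> tensors (ks As) \<Longrightarrow> y \<in> tensors (ks Bs) \<Longrightarrow>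
      F (juxtapose (ks As) (ks Bs) x y) = juxtapose (ks As') (ks Bs') (f x) (g y)"
  shows "ulin (As @ Bs) (As' @ Bs') F"
proof -
  note K = umods_kmods[OF As] umods_kmods[OF Bs] and K' = umods_kmods[OF As'] umods_kmods[OF Bs']
  have "kmods (ks As @ ks Bs)" "kmods (ks As' @ ks Bs')" using K K' by auto
  note W = this[THEN ctensor_complete]
  have UU: "umods (As @ Bs)" "umods (As' @ Bs')" using assms(1-4) by (simp_all add: umods_simps)
  have "F (act (As @ Bs) a w) = act (As' @ Bs') a (F w)"
    if a: "a \<in> carrier U" and w: "w \<in> tensors (ks As @ ks Bs)" for a w
  proof (rule juxt_ext[OF K W(2) _ _ _ w, where f = "\<lambda>w. F (act (As @ Bs) a w)" and g = "\<lambda>w. act (As' @ Bs') a (F w)"])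
    show "(\<lambda>w. F (act (As @ Bs) a w)) \<in> tlin (ks As @ ks Bs) (ks As' @ ks Bs')"
      by (rule lin_comp[OF act_lin2[OF UU(1) a, simplified] F])
    show "(\<lambda>w. act (As' @ Bs') a (F w)) \<in> tlin (ks As @ ks Bs) (ks As' @ ks Bs')"
      by (rule lin_comp[OF F act_lin2[OF UU(2) a, simplified]])
    fix as bs assume as: "as \<in> tuples (ks As)" and bs: "bs \<in> tuples (ks Bs)"
    let ?x = "pure (ks As) as" and ?y = "pure (ks Bs) bs"
    note x = pure_closed[OF K(1) as] and y = pure_closed[OF K(2) bs]
    have "F (act (As @ Bs) a (juxtapose (ks As) (ks Bs) ?x ?y)) = lift [U, U] (ctensor (ks As' @ ks Bs'))
        (\<lambda>bs. F (juxtapose (ks As) (ks Bs) (act As (bs ! 0) ?x) (act Bs (bs ! 1) ?y))) (\<Delta> a)"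
      unfolding act_append_juxt[OF As Bs a x y]
      by (rule lift_comp[OF UU_kmods(2) W(1) act_juxt_multilin[OF As Bs x y] W(2) F Delta_closed[OF a]])
    also have "\<dots> = lift [U, U] (ctensor (ks As' @ ks Bs'))
        (\<lambda>bs. juxtapose (ks As') (ks Bs') (act As' (bs ! 0) (f ?x)) (act Bs' (bs ! 1) (g ?y))) (\<Delta> a)"
    proof (rule fun_cong[of _ _ "\<Delta> a"], rule lift_cong)
      fix bs assume "bs \<in> tuples [U, U]"
      then obtain s t where st: "bs = [s, t]" "s \<in> carrier U" "t \<in> carrier U" using tuples2D by blast
      show "F (juxtapose (ks As) (ks Bs) (act As (bs ! 0) ?x) (act Bs (bs ! 1) ?y)) =
        juxtapose (ks As') (ks Bs') (act As' (bs ! 0) (f ?x)) (act Bs' (bs ! 1) (g ?y))"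
        using FJ[OF act_closed[OF As st(2) x] act_closed[OF Bs st(3) y]] ulin_comm[OF f st(2) x] ulin_comm[OF g st(3) y] st
        by simp
    qed
    also have "\<dots> = act (As' @ Bs') a (F (juxtapose (ks As) (ks Bs) ?x ?y))"
      unfolding FJ[OF x y]
        act_append_juxt[OF As' Bs' a lin_closed[OF ulin_lin[OF f] x] lin_closed[OF ulin_lin[OF g] y]] ..
    finally show "F (act (As @ Bs) a (juxtapose (ks As) (ks Bs) ?x ?y)) =
      act (As' @ Bs') a (F (juxtapose (ks As) (ks Bs) ?x ?y))" .
  qed
  then show ?thesis using F unfolding ulin_def by simp
qed

lemma ulin_idt:
  assumes As: "umods As" and Bs: "umods Bs" and Bs': "umods Bs'" and Cs: "umods Cs" and f: "ulin Bs Bs' f"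
  shows "ulin (As @ Bs @ Cs) (As @ Bs' @ Cs) (idt (ks As) (ks Bs) (ks Bs') (ks Cs) f)"
proof -
  note K = umods_kmods[OF As] umods_kmods[OF Bs] umods_kmods[OF Bs'] umods_kmods[OF Cs]
  have U: "umods (Bs @ Cs)" "umods (Bs' @ Cs)" "umods (As @ Bs @ Cs)" using As Bs Bs' Cs by (simp_all add: umods_simps)
  let ?G = "idt [] (ks Bs) (ks Bs') (ks Cs) f"
  have G: "ulin (Bs @ Cs) (Bs' @ Cs) ?G"
    by (rule ulin_juxt[OF Bs Cs Bs' Cs f ulin_ident idt_lin_right[OF K(2-4) ulin_lin[OF f]]
          idt_juxt_right[OF K(2-4) ulin_lin[OF f]]])
  note k = U(1,2)[THEN umods_kmods] and g = ulin_lin[OF G]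
  let ?F = "idt (ks As) (ks (Bs @ Cs)) (ks (Bs' @ Cs)) [] ?G"
  have F: "ulin (As @ Bs @ Cs) (As @ Bs' @ Cs) ?F"
    by (rule ulin_juxt[OF As U(1) As U(2) ulin_ident G idt_lin_left[OF K(1) k g] idt_juxt_left[OF K(1) k g]])
  show ?thesis
    by (rule ulin_cong[OF F U(3)])
      (use idt_nest[OF K(1) _ K(2-4) _ ulin_lin[OF f], of "[]" "[]"] in simp_all)
qed

end

section \<open>The hexagon and the Yang-Baxter equation\<close>

context quasitriangular_hopf_algebra
begin

lemma tap_simps:
  "carrier (tensor_algebra_power U 2) = tensors [U, U]"
  "\<one>\<^bsub>tensor_algebra_power U 2\<^esub> = pure [U, U] [\<one>\<^bsub>U\<^esub>, \<one>\<^bsub>U\<^esub>]"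
  "s \<otimes>\<^bsub>tensor_algebra_power U n\<^esub> t = tensor_mult U n s t"
  by (simp_all add: tensor_algebra_power_def numeral_2_eq_2)

lemma R_closed: "R \<in> tensors [U, U]"
  using R_unit unfolding Units_def tap_simps by blast

context
  fixes A B :: "('u, 'a) module"
  assumes A: "left_module U A" and B: "left_module U B"
begin

text \<open>In \<open>R \<Delta>(a) = \<Delta>\<^sup>o\<^sup>p(a) R\<close> the factor \<open>\<Delta>\<^sup>o\<^sup>p(a)\<close> passes the flip and becomes
  \<open>\<Delta>(a)\<close>.\<close>

lemma Rc_intertwines:
  assumes a: "a \<in> carrier U" and w: "w \<in> tensors [rs A, rs B]"
  shows "Rc R A B (fw [A, B] (\<Delta> a) w) = fw [B, A] (\<Delta> a) (Rc R A B w)"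
proof -
  note D = Delta_closed[OF a]
  note F = lin_closed[OF flip_lin D]
  have "Rc R A B (fw [A, B] (\<Delta> a) w) = Rc (tensor_mult U 2 R (\<Delta> a)) A B w"
    by (rule Rc_mult_right[OF A B R_closed D w, THEN HOL.sym])
  also have "\<dots> = Rc (tensor_mult U 2 (flip U (\<Delta> a)) R) A B w"
    using R_intertwines[OF a] unfolding tap_simps by simp
  also have "\<dots> = fw [B, A] (flip U (flip U (\<Delta> a))) (Rc R A B w)"
    by (rule Rc_mult_left[OF A B F R_closed w])
  finally show ?thesis unfolding flip_flip[OF D] .
qed

text \<open>The inverse undoes the flip and then acts by the inverse of \<open>R\<close>.\<close>

lemma Rc_inverse:
  obtains g where "g \<in> tlin [rs B, rs A] [rs A, rs B]"
    "\<And>w. w \<in> tensors [rs A, rs B] \<Longrightarrow> g (Rc R A B w) = w"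
    "\<And>v. v \<in> tensors [rs B, rs A] \<Longrightarrow> Rc R A B (g v) = v"
proof -
  let ?o = "pure [U, U] [\<one>\<^bsub>U\<^esub>, \<one>\<^bsub>U\<^esub>]"
  have o: "?o \<in> tensors [U, U]" by (rule pureUU_closed[OF one_closed one_closed])
  obtain Q where Q: "Q \<in> tensors [U, U]" "tensor_mult U 2 Q R = ?o" "tensor_mult U 2 R Q = ?o"
    using R_unit unfolding Units_def tap_simps by blast
  let ?g = "\<lambda>v. fw [A, B] Q (tau B A v)"
  show thesis
  proof (rule that[of ?g])
    show "?g \<in> tlin [rs B, rs A] [rs A, rs B]"
      by (rule lin_comp[OF tau_lin[OF B A] fw2_lin2[OF A B Q(1)]])
    show "?g (Rc R A B w) = w" if w: "w \<in> tensors [rs A, rs B]" for w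
      unfolding Rc_tau[OF A B R_closed w] tau_tau[OF A B fw2_closed[OF A B R_closed w]]
        fw2_mult[OF A B Q(1) R_closed w, THEN HOL.sym] Q(2) by (rule fw2_one[OF A B w])
    show "Rc R A B (?g v) = v" if v: "v \<in> tensors [rs B, rs A]" for v
    proof -
      note tv = lin_closed[OF tau_lin[OF B A] v]
      show ?thesis
        unfolding Rc_tau[OF A B R_closed fw2_closed[OF A B Q(1) tv]]
          fw2_mult[OF A B R_closed Q(1) tv, THEN HOL.sym] Q(3) fw2_one[OF A B tv] by (rule tau_tau[OF B A v])
    qed
  qed
qed

end

context
  fixes A B C :: "('u, 'a) module"
  assumes A: "left_module U A" and B: "left_module U B" and C: "left_module U C"
begin

lemma ABC_kmods: "kmods [rs A]" "kmods [rs B]" "kmods [rs C]" "kmods [rs C, rs A, rs B]"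
  "complete_kmod (ctensor [rs C, rs A, rs B])"
proof -
  show "kmods [rs A]" "kmods [rs B]" "kmods [rs C]" "kmods [rs C, rs A, rs B]"
    using rs_kmod A B C by auto
  then show "complete_kmod (ctensor [rs C, rs A, rs B])" by (intro ctensor_complete)
qed

text \<open>The map that moves the vector \<open>c\<close> of \<open>C\<close> past the tensor \<open>w\<close> in \<open>A \<otimes> B\<close>: with
  \<open>R = \<Sum> s \<otimes> t\<close> it is \<open>\<Sum> t c \<otimes> \<Delta>(s) w\<close>. In this form \<open>A \<otimes> B\<close> enters through the action of
  \<open>\<Delta>\<close> only.\<close>

definition hexmap :: "'a tensor \<Rightarrow> 'a \<Rightarrow> 'a tensor" where
  "hexmap w c = lift [U, U] (ctensor [rs C, rs A, rs B])
     (\<lambda>bs. juxtapose [rs C] [rs A, rs B] (pure [rs C] [(bs ! 1) \<odot>\<^bsub>C\<^esub> c]) (fw [A, B] (\<Delta> (bs ! 0)) w)) R"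

lemma pc_closed: "c \<in> carrier C \<Longrightarrow> pure [rs C] [c] \<in> tensors [rs C]"
  by (rule pure_closed[OF ABC_kmods(3)]) (simp add: set_Cons_def)

lemma hexmap_multilin:
  assumes w: "w \<in> tensors [rs A, rs B]" and c: "c \<in> carrier C"
  shows "multilin [U, U] (ctensor [rs C, rs A, rs B]) (\<lambda>bs. juxtapose [rs C] [rs A, rs B]
    (pure [rs C] [(bs ! 1) \<odot>\<^bsub>C\<^esub> c]) (fw [A, B] (\<Delta> (bs ! 0)) w))"
proof (rule lin_multilin2)
  note KAB = AB_kmods(1)[OF A B]
  fix u assume u: "u \<in> carrier U"
  have uc: "u \<odot>\<^bsub>C\<^esub> c \<in> carrier C" by (rule um_simps(1)[OF C u c])
  show "(\<lambda>y. juxtapose [rs C] [rs A, rs B] (pure [rs C] [u \<odot>\<^bsub>C\<^esub> c]) (fw [A, B] (\<Delta> y) w))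
      \<in> lin U (ctensor [rs C, rs A, rs B])"
    using lin_comp[OF lin_comp[OF comult_linear fw2_lin1[OF A B w]] juxt_lin2[OF ABC_kmods(3) KAB pc_closed[OF uc]]] by simp
  show "(\<lambda>y. juxtapose [rs C] [rs A, rs B] (pure [rs C] [y \<odot>\<^bsub>C\<^esub> c]) (fw [A, B] (\<Delta> u) w))
      \<in> lin U (ctensor [rs C, rs A, rs B])"
    using lin_comp[OF lin_comp[OF act_scalar_lin[OF C c] pure1_lin[OF rs_kmod[OF C]]]
        juxt_lin1[OF ABC_kmods(3) KAB fw2_closed[OF A B Delta_closed[OF u] w]]] by simp
qed

lemma hexmap_lin: "c \<in> carrier C \<Longrightarrow> (\<lambda>w. hexmap w c) \<in> tlin [rs A, rs B] [rs C, rs A, rs B]"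
  unfolding hexmap_def
proof (rule lift_param[OF UU_kmods(2) ABC_kmods(5) _ hexmap_multilin _ R_closed])
  note KAB = AB_kmods(1)[OF A B]
  show "kmod (ctensor [rs A, rs B])" using AB_kmods(2)[OF A B] by simp
  assume c: "c \<in> carrier C"
  fix bs assume "bs \<in> tuples [U, U]"
  then obtain s t where st: "bs = [s, t]" "s \<in> carrier U" "t \<in> carrier U" using tuples2D by blast
  show "(\<lambda>w. juxtapose [rs C] [rs A, rs B] (pure [rs C] [(bs ! 1) \<odot>\<^bsub>C\<^esub> c]) (fw [A, B] (\<Delta> (bs ! 0)) w)) \<in>
      tlin [rs A, rs B] [rs C, rs A, rs B]"
    using lin_comp[OF fw2_lin2[OF A B Delta_closed[OF st(2)]]
        juxt_lin2[OF ABC_kmods(3) KAB pc_closed[OF um_simps(1)[OF C st(3) c]]]] st by simp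
qed

text \<open>The identity \<open>(\<Delta> \<otimes> id)(R) = R\<^sub>1\<^sub>3 R\<^sub>2\<^sub>3\<close> evaluated at \<open>a, b, c\<close>. The second factor moves
  \<open>c\<close> past \<open>b\<close>, the first moves the result past \<open>a\<close>.\<close>

lemma hexmap_pure:
  assumes a: "a \<in> carrier A" and b: "b \<in> carrier B" and c: "c \<in> carrier C"
  shows "hexmap (pure [rs A, rs B] [a, b]) c =
    idt [] [rs A, rs C] [rs C, rs A] [rs B] (Rc R A C)
      (juxtapose [rs A] [rs C, rs B] (pure [rs A] [a]) (Rc R B C (pure [rs B, rs C] [b, c])))"
proof -
  let ?W = "ctensor [rs C, rs A, rs B]"
  note W = ABC_kmods(5)
  note KA = ABC_kmods(1) and KB = ABC_kmods(2) and KC = ABC_kmods(3)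
  note kA = rs_kmod[OF A] and kB = rs_kmod[OF B] and kC = rs_kmod[OF C]
  note KAB = AB_kmods(1)[OF A B] and KAC = AB_kmods(1)[OF A C] and KCA = AB_kmods(1)[OF C A]
    and KBC = AB_kmods(1)[OF B C] and KCB = AB_kmods(1)[OF C B]
  have pA: "pure [rs A] [x] \<in> tensors [rs A]" if "x \<in> carrier A" for x
    by (rule pure_closed[OF KA]) (use that in \<open>simp add: set_Cons_def\<close>)
  have pB: "pure [rs B] [x] \<in> tensors [rs B]" if "x \<in> carrier B" for x
    by (rule pure_closed[OF KB]) (use that in \<open>simp add: set_Cons_def\<close>)
  \<comment> \<open>evaluation at \<open>a, b, c\<close> with the result of \<open>c\<close> moved to the front\<close>
  define G where "G = lift [U, U, U] ?W (\<lambda>us. pure [rs C, rs A, rs B] [(us ! 2) \<odot>\<^bsub>C\<^esub> c, (us ! 0) \<odot>\<^bsub>A\<^esub> a, (us ! 1) \<odot>\<^bsub>B\<^esub> b])"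
  note um = um_simps[OF A] um_simps[OF B] um_simps[OF C]
  note p3 = pure3_lin[OF kC kA kB, simplified]
  have m: "multilin [U, U, U] ?W (\<lambda>us. pure [rs C, rs A, rs B] [(us ! 2) \<odot>\<^bsub>C\<^esub> c, (us ! 0) \<odot>\<^bsub>A\<^esub> a, (us ! 1) \<odot>\<^bsub>B\<^esub> b])"
  proof (rule multilin3I)
    fix s t assume st: "s \<in> carrier U" "t \<in> carrier U"
    show "(\<lambda>x. pure [rs C, rs A, rs B] [([x, s, t] ! 2) \<odot>\<^bsub>C\<^esub> c, ([x, s, t] ! 0) \<odot>\<^bsub>A\<^esub> a, ([x, s, t] ! 1) \<odot>\<^bsub>B\<^esub> b]) \<in> lin U ?W"
      using lin_comp[OF act_scalar_lin[OF A a] p3(2)[OF um(11)[OF st(2) c] um(6)[OF st(1) b]]] by simp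
    show "(\<lambda>x. pure [rs C, rs A, rs B] [([s, x, t] ! 2) \<odot>\<^bsub>C\<^esub> c, ([s, x, t] ! 0) \<odot>\<^bsub>A\<^esub> a, ([s, x, t] ! 1) \<odot>\<^bsub>B\<^esub> b]) \<in> lin U ?W"
      using lin_comp[OF act_scalar_lin[OF B b] p3(3)[OF um(11)[OF st(2) c] um(1)[OF st(1) a]]] by simp
    show "(\<lambda>x. pure [rs C, rs A, rs B] [([s, t, x] ! 2) \<odot>\<^bsub>C\<^esub> c, ([s, t, x] ! 0) \<odot>\<^bsub>A\<^esub> a, ([s, t, x] ! 1) \<odot>\<^bsub>B\<^esub> b]) \<in> lin U ?W"
      using lin_comp[OF act_scalar_lin[OF C c] p3(1)[OF um(1)[OF st(1) a] um(6)[OF st(2) b]]] by simp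
  qed auto
  have Gl: "G \<in> lin (ctensor [U, U, U]) ?W" unfolding G_def by (rule lift_lin[OF UU_kmods(3) W m])
  have Gp: "G (pure [U, U, U] [r, s, t]) = pure [rs C, rs A, rs B] [t \<odot>\<^bsub>C\<^esub> c, r \<odot>\<^bsub>A\<^esub> a, s \<odot>\<^bsub>B\<^esub> b]"
    if "r \<in> carrier U" "s \<in> carrier U" "t \<in> carrier U" for r s t
    unfolding G_def using lift_pure[OF UU_kmods(3) W m tuples_smallI(3)[OF that]] by simp
  have j21: "juxtapose [U, U] [U] (pure [U, U] [x, y]) (pure [U] [z]) = pure [U, U, U] [x, y, z]"
    if "x \<in> carrier U" "y \<in> carrier U" "z \<in> carrier U" for x y z
    using that juxt_pure[OF UU_kmods(2,1), of "[x, y]" "[z]"] by (simp add: set_Cons_def)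
  have pU: "pure [U] [x] \<in> tensors [U]" if "x \<in> carrier U" for x
    by (rule pure_closed[OF UU_kmods(1) tuples_smallI(1)[OF that]])
  have jC: "juxtapose [rs C] [rs A, rs B] (pure [rs C] [z]) (pure [rs A, rs B] [x, y]) = pure [rs C, rs A, rs B] [z, x, y]"
    if "x \<in> carrier A" "y \<in> carrier B" "z \<in> carrier C" for x y z
    using that juxt_pure[OF KC KAB, of "[z]" "[x, y]"] by (simp add: set_Cons_def)
  have G1: "juxtapose [rs C] [rs A, rs B] (pure [rs C] [u \<odot>\<^bsub>C\<^esub> c]) (fw [A, B] t (pure [rs A, rs B] [a, b])) =
      G (juxtapose [U, U] [U] t (pure [U] [u]))" if u: "u \<in> carrier U" and t: "t \<in> tensors [U, U]" for t u
    by (rule UU_ext[OF W lin_comp[OF fw2_lin1[OF A B pureAB_closed[OF A B a b]]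
            juxt_lin2[OF KC KAB pc_closed[OF um(11)[OF u c]], simplified]]
          lin_comp[OF juxt_lin1[OF UU_kmods(2,1) pU[OF u], simplified] Gl] _ t])
      (simp add: fw2_pure[OF A B] j21 jC Gp u a b c um)
  have mL: "multilin [U, U] (ctensor [U, U, U]) (\<lambda>bs. juxtapose [U, U] [U] (\<Delta> (bs ! 0)) (pure [U] [bs ! 1]))"
    by (rule lin_multilin2)
      (use lin_comp[OF comult_linear juxt_lin1[OF UU_kmods(2,1) pU, simplified]]
        lin_comp[OF pure1_lin[OF U_kmod] juxt_lin2[OF UU_kmods(2,1) Delta_closed, simplified]] in auto)
  have "hexmap (pure [rs A, rs B] [a, b]) c =
      lift [U, U] ?W (\<lambda>bs. G (juxtapose [U, U] [U] (\<Delta> (bs ! 0)) (pure [U] [bs ! 1]))) R"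
    unfolding hexmap_def
  proof (rule fun_cong[of _ _ R], rule lift_cong)
    fix bs assume "bs \<in> tuples [U, U]"
    then obtain s t where st: "bs = [s, t]" "s \<in> carrier U" "t \<in> carrier U" using tuples2D by blast
    show "juxtapose [rs C] [rs A, rs B] (pure [rs C] [(bs ! 1) \<odot>\<^bsub>C\<^esub> c]) (fw [A, B] (\<Delta> (bs ! 0)) (pure [rs A, rs B] [a, b])) =
      G (juxtapose [U, U] [U] (\<Delta> (bs ! 0)) (pure [U] [bs ! 1]))"
      using G1[OF st(3) Delta_closed[OF st(2)]] st by simp
  qed
  also have "\<dots> = G (lift [U, U] (ctensor [U, U, U]) (\<lambda>bs. juxtapose [U, U] [U] (\<Delta> (bs ! 0)) (pure [U] [bs ! 1])) R)"
    by (rule lift_comp[OF UU_kmods(2) ctensor_complete[OF UU_kmods(3)] mL W Gl R_closed, THEN HOL.sym])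
  also have "\<dots> = G (tensor_mult U 3 (leg13 U R) (leg23 U R))"
    unfolding hexagon_left tap_simps ..
  also have "\<dots> = idt [] [rs A, rs C] [rs C, rs A] [rs B] (Rc R A C)
      (juxtapose [rs A] [rs C, rs B] (pure [rs A] [a]) (Rc R B C (pure [rs B, rs C] [b, c])))"
  proof -
    note bc = pureAB_closed[OF B C b c]
    note l13 = lin_closed[OF leg13(1)] and l23 = lin_closed[OF leg23(1)]
    have IL: "idt [] [rs A, rs C] [rs C, rs A] [rs B] (Rc s A C) \<in> lin (ctensor [rs A, rs C, rs B]) ?W"
      if "s \<in> tensors [U, U]" for s
      using idt_lin_right[OF KAC KCA KB Rc_lin[OF A C that]] by simp
    have jAC: "juxtapose [rs A] [rs C, rs B] (pure [rs A] [x]) (pure [rs C, rs B] [z, y]) =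
        juxtapose [rs A, rs C] [rs B] (pure [rs A, rs C] [x, z]) (pure [rs B] [y])"
      if "x \<in> carrier A" "y \<in> carrier B" "z \<in> carrier C" for x y z
      using that juxt_pure[OF KA KCB, of "[x]" "[z, y]"] juxt_pure[OF KAC KB, of "[x, z]" "[y]"]
      by (simp add: set_Cons_def)
    have jCA: "juxtapose [rs C, rs A] [rs B] (pure [rs C, rs A] [z, x]) (pure [rs B] [y]) = pure [rs C, rs A, rs B] [z, x, y]"
      if "x \<in> carrier A" "y \<in> carrier B" "z \<in> carrier C" for x y z
      using that juxt_pure[OF KCA KB, of "[z, x]" "[y]"] by (simp add: set_Cons_def)
    have main: "G (tensor_mult U 3 (leg13 U s) (leg23 U t)) =
      idt [] [rs A, rs C] [rs C, rs A] [rs B] (Rc s A C)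
        (juxtapose [rs A] [rs C, rs B] (pure [rs A] [a]) (Rc t B C (pure [rs B, rs C] [b, c])))"
      if s: "s \<in> tensors [U, U]" and t: "t \<in> tensors [U, U]" for s t
    proof (rule UU_ext[OF W lin_comp[OF lin_comp[OF leg23(1) bilinD2[OF tm3 l13[OF s]]] Gl]
          lin_comp[OF lin_comp[OF Rc_lin_param[OF B C bc] juxt_lin2[OF KA KCB pA[OF a], simplified]] IL[OF s]] _ t])
      fix t1 t2 assume t12: "t1 \<in> carrier U" "t2 \<in> carrier U"
      have y: "t1 \<odot>\<^bsub>B\<^esub> b \<in> carrier B" and z: "t2 \<odot>\<^bsub>C\<^esub> c \<in> carrier C" using t12 b c um by auto
      have e: "idt [] [rs A, rs C] [rs C, rs A] [rs B] (Rc s A C)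
          (juxtapose [rs A] [rs C, rs B] (pure [rs A] [a]) (Rc (pure [U, U] [t1, t2]) B C (pure [rs B, rs C] [b, c]))) =
        juxtapose [rs C, rs A] [rs B] (Rc s A C (pure [rs A, rs C] [a, t2 \<odot>\<^bsub>C\<^esub> c])) (pure [rs B] [t1 \<odot>\<^bsub>B\<^esub> b])"
        if s: "s \<in> tensors [U, U]" for s
        unfolding Rc_pure[OF B C b c t12] jAC[OF a y z]
        by (rule idt_juxt_right[OF KAC KCA KB Rc_lin[OF A C s] pureAB_closed[OF A C a z] pB[OF y]])
      show "G (tensor_mult U 3 (leg13 U s) (leg23 U (pure [U, U] [t1, t2]))) =
        idt [] [rs A, rs C] [rs C, rs A] [rs B] (Rc s A C)
          (juxtapose [rs A] [rs C, rs B] (pure [rs A] [a]) (Rc (pure [U, U] [t1, t2]) B C (pure [rs B, rs C] [b, c])))"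
        unfolding e[OF s]
      proof (rule UU_ext[OF W lin_comp[OF lin_comp[OF leg13(1) bilinD1[OF tm3 l23[OF pureUU_closed[OF t12]]]] Gl]
            lin_comp[OF Rc_lin_param[OF A C pureAB_closed[OF A C a z]] juxt_lin1[OF KCA KB pB[OF y], simplified]] _ s])
        fix s1 s2 assume s12: "s1 \<in> carrier U" "s2 \<in> carrier U"
        have "G (tensor_mult U 3 (leg13 U (pure [U, U] [s1, s2])) (leg23 U (pure [U, U] [t1, t2]))) =
            pure [rs C, rs A, rs B] [(s2 \<otimes>\<^bsub>U\<^esub> t2) \<odot>\<^bsub>C\<^esub> c, (s1 \<otimes>\<^bsub>U\<^esub> \<one>\<^bsub>U\<^esub>) \<odot>\<^bsub>A\<^esub> a, (\<one>\<^bsub>U\<^esub> \<otimes>\<^bsub>U\<^esub> t1) \<odot>\<^bsub>B\<^esub> b]"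
          using s12 t12 by (simp add: leg13(2) leg23(2) tm3_pure Gp)
        also have "\<dots> = pure [rs C, rs A, rs B] [s2 \<odot>\<^bsub>C\<^esub> (t2 \<odot>\<^bsub>C\<^esub> c), s1 \<odot>\<^bsub>A\<^esub> a, t1 \<odot>\<^bsub>B\<^esub> b]"
          using s12 t12 a b c by (simp add: um)
        also have "\<dots> = juxtapose [rs C, rs A] [rs B] (Rc (pure [U, U] [s1, s2]) A C (pure [rs A, rs C] [a, t2 \<odot>\<^bsub>C\<^esub> c]))
            (pure [rs B] [t1 \<odot>\<^bsub>B\<^esub> b])"
          unfolding Rc_pure[OF A C a z s12] using jCA[of "s1 \<odot>\<^bsub>A\<^esub> a" "t1 \<odot>\<^bsub>B\<^esub> b" "s2 \<odot>\<^bsub>C\<^esub> (t2 \<odot>\<^bsub>C\<^esub> c)"] s12 a y z um by simp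
        finally show "G (tensor_mult U 3 (leg13 U (pure [U, U] [s1, s2])) (leg23 U (pure [U, U] [t1, t2]))) =
          juxtapose [rs C, rs A] [rs B] (Rc (pure [U, U] [s1, s2]) A C (pure [rs A, rs C] [a, t2 \<odot>\<^bsub>C\<^esub> c]))
            (pure [rs B] [t1 \<odot>\<^bsub>B\<^esub> b])" .
      qed
    qed
    show ?thesis by (rule main[OF R_closed R_closed])
  qed
  finally show ?thesis .
qed

lemma hexagon:
  assumes w: "w \<in> tensors [rs A, rs B]" and c: "c \<in> carrier C"
  shows "idt [] [rs A, rs C] [rs C, rs A] [rs B] (Rc R A C)
      (idt [rs A] [rs B, rs C] [rs C, rs B] [] (Rc R B C)
        (juxtapose [rs A, rs B] [rs C] w (pure [rs C] [c]))) = hexmap w c"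
proof -
  note W = ABC_kmods(5)
  note KA = ABC_kmods(1) and KB = ABC_kmods(2) and KC = ABC_kmods(3)
  note KAB = AB_kmods(1)[OF A B] and KAC = AB_kmods(1)[OF A C] and KCA = AB_kmods(1)[OF C A]
    and KBC = AB_kmods(1)[OF B C] and KCB = AB_kmods(1)[OF C B]
  note l1 = idt_lin_right[OF KAC KCA KB Rc_lin[OF A C R_closed], simplified]
  note l2 = idt_lin_left[OF KA KBC KCB Rc_lin[OF B C R_closed], simplified]
  show ?thesis
  proof (rule AB_ext[OF A B W lin_comp[OF lin_comp[OF juxt_lin1[OF KAB KC pc_closed[OF c], simplified] l2] l1] hexmap_lin[OF c] _ w])
    fix a b assume ab: "a \<in> carrier A" "b \<in> carrier B"
    have pA: "pure [rs A] [a] \<in> tensors [rs A]"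
      by (rule pure_closed[OF KA]) (use ab in \<open>simp add: set_Cons_def\<close>)
    have j: "juxtapose [rs A, rs B] [rs C] (pure [rs A, rs B] [a, b]) (pure [rs C] [c]) =
      juxtapose [rs A] [rs B, rs C] (pure [rs A] [a]) (pure [rs B, rs C] [b, c])"
      using ab c juxt_pure[OF KAB KC, of "[a, b]" "[c]"] juxt_pure[OF KA KBC, of "[a]" "[b, c]"]
      by (simp add: set_Cons_def)
    show "idt [] [rs A, rs C] [rs C, rs A] [rs B] (Rc R A C)
      (idt [rs A] [rs B, rs C] [rs C, rs B] [] (Rc R B C)
        (juxtapose [rs A, rs B] [rs C] (pure [rs A, rs B] [a, b]) (pure [rs C] [c]))) = hexmap (pure [rs A, rs B] [a, b]) c"
      unfolding j hexmap_pure[OF ab c]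
        idt_juxt_left[OF KA KBC KCB Rc_lin[OF B C R_closed] pA pureAB_closed[OF B C ab(2) c]] ..
  qed
qed

end

text \<open>The operator of \<open>R\<close> on \<open>A \<otimes> B\<close> commutes with the action of \<open>\<Delta>(s)\<close>, which is all that
  \<open>hexmap\<close> knows of \<open>A \<otimes> B\<close>.\<close>

lemma hexmap_natural:
  assumes A: "left_module U A" and B: "left_module U B" and C: "left_module U C"
    and w: "w \<in> tensors [rs A, rs B]" and c: "c \<in> carrier C"
  shows "idt [rs C] [rs A, rs B] [rs B, rs A] [] (Rc R A B) (hexmap A B C w c) =
    hexmap B A C (Rc R A B w) c"
proof -
  note KAB = AB_kmods(1)[OF A B] and KBA = AB_kmods(1)[OF B A] and KC = ABC_kmods(3)[OF A B C]
  note l = Rc_lin[OF A B R_closed]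
  note L = idt_lin_left[OF KC KAB KBA l, simplified]
  let ?F = "idt [rs C] [rs A, rs B] [rs B, rs A] [] (Rc R A B)"
  have "?F (hexmap A B C w c) = lift [U, U] (ctensor [rs C, rs B, rs A])
     (\<lambda>bs. ?F (juxtapose [rs C] [rs A, rs B] (pure [rs C] [(bs ! 1) \<odot>\<^bsub>C\<^esub> c]) (fw [A, B] (\<Delta> (bs ! 0)) w))) R"
    unfolding hexmap_def[OF A B C]
    by (rule lift_comp[OF UU_kmods(2) ABC_kmods(5)[OF A B C] hexmap_multilin[OF A B C w c] ABC_kmods(5)[OF B A C] L R_closed])
  also have "\<dots> = hexmap B A C (Rc R A B w) c"
    unfolding hexmap_def[OF B A C]
  proof (rule fun_cong[of _ _ R], rule lift_cong)
    fix bs assume "bs \<in> tuples [U, U]"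
    then obtain s t where st: "bs = [s, t]" "s \<in> carrier U" "t \<in> carrier U" using tuples2D by blast
    show "?F (juxtapose [rs C] [rs A, rs B] (pure [rs C] [(bs ! 1) \<odot>\<^bsub>C\<^esub> c]) (fw [A, B] (\<Delta> (bs ! 0)) w)) =
      juxtapose [rs C] [rs B, rs A] (pure [rs C] [(bs ! 1) \<odot>\<^bsub>C\<^esub> c]) (fw [B, A] (\<Delta> (bs ! 0)) (Rc R A B w))"
      using idt_juxt_left[OF KC KAB KBA l pc_closed[OF A B C um_simps(1)[OF C st(3) c]] fw2_closed[OF A B Delta_closed[OF st(2)] w]]
        Rc_intertwines[OF A B st(2) w] st by simp
  qed
  finally show ?thesis .
qed

text \<open>On both sides \<open>C\<close> is moved past the two other modules, which are braided before or after the
  move. The hexagon rewrites the move as \<open>hexmap\<close>, whose naturality exchanges the two steps.\<close>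

theorem yang_baxter:
  assumes A: "left_module U A" and B: "left_module U B" and C: "left_module U C"
    and x: "x \<in> tensors [rs A, rs B, rs C]"
  shows "idt [] [rs B, rs C] [rs C, rs B] [rs A] (Rc R B C)
      (idt [rs B] [rs A, rs C] [rs C, rs A] [] (Rc R A C)
        (idt [] [rs A, rs B] [rs B, rs A] [rs C] (Rc R A B) x)) =
    idt [rs C] [rs A, rs B] [rs B, rs A] [] (Rc R A B)
      (idt [] [rs A, rs C] [rs C, rs A] [rs B] (Rc R A C)
        (idt [rs A] [rs B, rs C] [rs C, rs B] [] (Rc R B C) x))"
    (is "?L x = ?R x")
proof -
  note KA = ABC_kmods(1)[OF A B C] and KB = ABC_kmods(2)[OF A B C] and KC = ABC_kmods(3)[OF A B C]
  note KAB = AB_kmods(1)[OF A B] and KBA = AB_kmods(1)[OF B A] and KAC = AB_kmods(1)[OF A C]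
    and KCA = AB_kmods(1)[OF C A] and KBC = AB_kmods(1)[OF B C] and KCB = AB_kmods(1)[OF C B]
  note l = Rc_lin[OF _ _ R_closed]
  have Ll: "?L \<in> tlin [rs A, rs B, rs C] [rs C, rs B, rs A]"
    by (rule lin_comp[OF lin_comp[OF idt_lin_right[OF KAB KBA KC l[OF A B], simplified]
            idt_lin_left[OF KB KAC KCA l[OF A C], simplified]] idt_lin_right[OF KBC KCB KA l[OF B C], simplified]])
  have Rl: "?R \<in> tlin [rs A, rs B, rs C] [rs C, rs B, rs A]"
    by (rule lin_comp[OF lin_comp[OF idt_lin_left[OF KA KBC KCB l[OF B C], simplified]
            idt_lin_right[OF KAC KCA KB l[OF A C], simplified]] idt_lin_left[OF KC KAB KBA l[OF A B], simplified]])
  show ?thesis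
  proof (rule juxt_ext[OF KAB KC ABC_kmods(5)[OF B A C], where f = ?L and g = ?R and w = x])
    show "?L \<in> tlin ([rs A, rs B] @ [rs C]) [rs C, rs B, rs A]" using Ll by simp
    show "?R \<in> tlin ([rs A, rs B] @ [rs C]) [rs C, rs B, rs A]" using Rl by simp
    show "x \<in> tensors ([rs A, rs B] @ [rs C])" using x by simp
    fix as bs assume as: "as \<in> tuples [rs A, rs B]" and "bs \<in> tuples [rs C]"
    then obtain c where bs: "bs = [c]" and c: "c \<in> carrier C" using tuples_singleD[of bs "rs C"] by auto
    note w = pure_closed[OF KAB as]
    let ?w = "pure [rs A, rs B] as"
    show "?L (juxtapose [rs A, rs B] [rs C] ?w (pure [rs C] bs)) = ?R (juxtapose [rs A, rs B] [rs C] ?w (pure [rs C] bs))"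
      unfolding bs hexagon[OF A B C w c] hexmap_natural[OF A B C w c]
        idt_juxt_right[OF KAB KBA KC l[OF A B] w pc_closed[OF A B C c]]
        hexagon[OF B A C Rc_closed[OF A B R_closed w] c] ..
  qed
qed

end

section \<open>Presented groups and their representations\<close>

locale presentation =
  fixes S :: "'s set" and Rel :: "('s list \<times> 's list) set"
  assumes rel_words: "(u, w) \<in> Rel \<Longrightarrow> set u \<subseteq> S \<and> set w \<subseteq> S"
begin

abbreviation words :: "('s \<times> bool) list set" where "words \<equiv> lists (S \<times> UNIV)"

abbreviation peq where "peq \<equiv> presented_eq S Rel"
abbreviation cls where "cls \<equiv> word_class S Rel"
abbreviation P where "P \<equiv> presented_group S Rel"

lemma peq_words: "peq u w \<Longrightarrow> u \<in> words \<and> w \<in> words"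
  by (induction rule: presented_eq.induct) (auto dest!: rel_words)

lemma cls_eq_iff: "u \<in> words \<Longrightarrow> cls u = cls w \<longleftrightarrow> peq u w"
  unfolding word_class_def
  by (auto intro: presented_eq.refl presented_eq.sym presented_eq.trans)

lemma cls_mult:
  assumes u: "u \<in> words" and w: "w \<in> words"
  shows "cls u \<otimes>\<^bsub>P\<^esub> cls w = cls (u @ w)"
proof -
  have *: "cls (u' @ w') = cls (u @ w)" if "u' \<in> cls u" "w' \<in> cls w" for u' w'
  proof -
    have "peq u u'" "peq w w'" using that by (simp_all add: word_class_def)
    then have "peq (u @ w) (u' @ w')" by (rule presented_eq.append)
    then show ?thesis using cls_eq_iff[of "u @ w" "u' @ w'"] u w by simp
  qed
  have m: "u \<in> cls u" "w \<in> cls w" using u w by (auto simp: word_class_def intro: presented_eq.refl)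
  have **: "(\<Union>w'\<in>cls w. cls (u' @ w')) = cls (u @ w)" if "u' \<in> cls u" for u'
    by (rule UN_constant_eq[OF m(2)]) (use *[OF that] in blast)
  have "(\<Union>u'\<in>cls u. \<Union>w'\<in>cls w. cls (u' @ w')) = cls (u @ w)"
    by (rule UN_constant_eq[OF m(1)]) (use ** in blast)
  then show ?thesis by (simp only: presented_group_def monoid.select_convs partial_object.select_convs)
qed

lemma P_carrier: "carrier P = cls ` words" and P_one: "\<one>\<^bsub>P\<^esub> = cls []"
  by (simp_all add: presented_group_def)

definition winv :: "('s \<times> bool) list \<Rightarrow> ('s \<times> bool) list" where
  "winv w = rev (map (\<lambda>(s, b). (s, \<not> b)) w)"

lemma winv_words: "w \<in> words \<Longrightarrow> winv w \<in> words"
  by (auto simp: winv_def)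

lemma winv_cancel: "w \<in> words \<Longrightarrow> peq (winv w @ w) []"
proof (induction w)
  case Nil then show ?case by (simp add: winv_def presented_eq.refl)
next
  case (Cons l w)
  obtain s b where l: "l = (s, b)" by force
  have w: "w \<in> words" and s: "s \<in> S" using Cons.prems l by auto
  have "peq [(s, \<not> b), (s, b)] []" using presented_eq.cancel[OF s, of Rel "\<not> b"] by simp
  then have "peq ([(s, \<not> b), (s, b)] @ w) ([] @ w)"
    by (rule presented_eq.append[OF _ presented_eq.refl[OF w]])
  then have "peq (winv w @ ([(s, \<not> b), (s, b)] @ w)) (winv w @ ([] @ w))"
    by (rule presented_eq.append[OF presented_eq.refl[OF winv_words[OF w]]])
  then have "peq (winv w @ ([(s, \<not> b), (s, b)] @ w)) []"
    using Cons.IH[OF w] by (auto intro: presented_eq.trans)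
  then show ?case by (simp add: winv_def l)
qed

lemma P_group: "group P"
proof (rule groupI)
  fix x y z assume "x \<in> carrier P" "y \<in> carrier P" "z \<in> carrier P"
  then obtain u v w where x: "x = cls u" "u \<in> words" and y: "y = cls v" "v \<in> words"
    and z: "z = cls w" "w \<in> words" unfolding P_carrier by blast
  have uv: "u @ v \<in> words" "v @ w \<in> words" using x y z by auto
  show "x \<otimes>\<^bsub>P\<^esub> y \<in> carrier P" unfolding x(1) y(1) cls_mult[OF x(2) y(2)] P_carrier using uv by blast
  show "x \<otimes>\<^bsub>P\<^esub> y \<otimes>\<^bsub>P\<^esub> z = x \<otimes>\<^bsub>P\<^esub> (y \<otimes>\<^bsub>P\<^esub> z)"
    unfolding x(1) y(1) z(1) cls_mult[OF x(2) y(2)] cls_mult[OF y(2) z(2)]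
      cls_mult[OF uv(1) z(2)] cls_mult[OF x(2) uv(2)] by simp
next
  show "\<one>\<^bsub>P\<^esub> \<in> carrier P" unfolding P_one P_carrier by blast
  fix x assume "x \<in> carrier P"
  then obtain u where x: "x = cls u" "u \<in> words" unfolding P_carrier by blast
  show "\<one>\<^bsub>P\<^esub> \<otimes>\<^bsub>P\<^esub> x = x" using cls_mult[of "[]" u] x by (simp add: P_one)
  have "cls (winv u) \<otimes>\<^bsub>P\<^esub> x = \<one>\<^bsub>P\<^esub>"
    unfolding x(1) P_one cls_mult[OF winv_words[OF x(2)] x(2)]
    using cls_eq_iff[of "winv u @ u" "[]"] winv_cancel[OF x(2)] winv_words[OF x(2)] x(2) by simp
  then show "\<exists>y\<in>carrier P. y \<otimes>\<^bsub>P\<^esub> x = \<one>\<^bsub>P\<^esub>"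
    using winv_words[OF x(2)] unfolding P_carrier by blast
qed

end

text \<open>A formal inverse letter is sent to the inverse of a unit. The product over a word is then
  invariant under free cancellation, under the relations and under concatenation, so it is a function
  of the class of the word.\<close>

locale presentation_rep = presentation S Rel + E: Group.monoid E
  for S :: "'s set" and Rel and E :: "('e, 'm) monoid_scheme" +
  fixes \<phi> :: "'s \<Rightarrow> 'e"
  assumes \<phi>_unit: "s \<in> S \<Longrightarrow> \<phi> s \<in> Units E"
    and \<phi>_rel: "(u, w) \<in> Rel \<Longrightarrow>
      foldr (\<lambda>s x. \<phi> s \<otimes>\<^bsub>E\<^esub> x) u \<one>\<^bsub>E\<^esub> = foldr (\<lambda>s x. \<phi> s \<otimes>\<^bsub>E\<^esub> x) w \<one>\<^bsub>E\<^esub>"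
begin

definition letter :: "'s \<times> bool \<Rightarrow> 'e" where
  "letter l = (if snd l then \<phi> (fst l) else inv\<^bsub>E\<^esub> (\<phi> (fst l)))"

definition wprod :: "('s \<times> bool) list \<Rightarrow> 'e" where
  "wprod w = foldr (\<lambda>l x. letter l \<otimes>\<^bsub>E\<^esub> x) w \<one>\<^bsub>E\<^esub>"

lemma wprod_simps: "wprod [] = \<one>\<^bsub>E\<^esub>" "wprod (l # w) = letter l \<otimes>\<^bsub>E\<^esub> wprod w"
  by (simp_all add: wprod_def)

lemma letter_unit: "fst l \<in> S \<Longrightarrow> letter l \<in> Units E"
  by (simp add: letter_def \<phi>_unit)

lemma wprod_unit: "w \<in> words \<Longrightarrow> wprod w \<in> Units E"
  by (induction w) (auto simp: wprod_simps letter_unit)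

lemma wprod_append: "u \<in> words \<Longrightarrow> w \<in> words \<Longrightarrow> wprod (u @ w) = wprod u \<otimes>\<^bsub>E\<^esub> wprod w"
proof (induction u)
  case Nil
  then show ?case using wprod_unit by (simp add: wprod_simps E.Units_closed)
next
  case (Cons l u)
  have "l \<in> S \<times> UNIV" "u \<in> words" using Cons.prems(1) by auto
  then have "letter l \<in> carrier E" "wprod u \<in> carrier E" "wprod w \<in> carrier E"
    using letter_unit[of l] wprod_unit[of u] wprod_unit[OF Cons.prems(2)] by (auto simp: E.Units_closed)
  then show ?case using Cons.IH[OF \<open>u \<in> words\<close> Cons.prems(2)] by (simp add: wprod_simps E.m_assoc)
qed

lemma wprod_True: "wprod (map (\<lambda>s. (s, True)) u) = foldr (\<lambda>s x. \<phi> s \<otimes>\<^bsub>E\<^esub> x) u \<one>\<^bsub>E\<^esub>"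
  by (induction u) (simp_all add: wprod_simps letter_def)

lemma wprod_peq: "peq u w \<Longrightarrow> wprod u = wprod w"
proof (induction rule: presented_eq.induct)
  case (append u u' w w')
  then show ?case using peq_words[OF append(1)] peq_words[OF append(2)] by (simp add: wprod_append)
next
  case (cancel s b)
  then show ?case using \<phi>_unit[OF cancel] by (cases b) (simp_all add: wprod_simps letter_def E.Units_closed)
next
  case (rel u w)
  then show ?case by (simp add: wprod_True \<phi>_rel)
qed auto

definition group_rep :: "('s \<times> bool) list set \<Rightarrow> 'e" where
  "group_rep A = wprod (SOME w. w \<in> words \<and> A = cls w)"

lemma group_rep_cls:
  assumes w: "w \<in> words"
  shows "group_rep (cls w) = wprod w"
proof -
  define v where "v = (SOME v. v \<in> words \<and> cls w = cls v)"
  have "v \<in> words \<and> cls w = cls v" unfolding v_def by (rule someI[of _ w]) (simp add: w)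
  then have "wprod w = wprod v" using cls_eq_iff[OF w] wprod_peq by blast
  then show ?thesis by (simp add: group_rep_def v_def)
qed

lemma P_cases:
  assumes "g \<in> carrier P"
  obtains w where "g = cls w" "w \<in> words"
  using assms unfolding P_carrier by blast

lemma group_rep_closed:
  assumes "g \<in> carrier P"
  shows "group_rep g \<in> carrier E"
proof -
  obtain w where w: "g = cls w" "w \<in> words" by (rule P_cases[OF assms])
  show ?thesis unfolding w(1) group_rep_cls[OF w(2)] by (rule E.Units_closed[OF wprod_unit[OF w(2)]])
qed

lemma group_rep_mult:
  assumes "g \<in> carrier P" "h \<in> carrier P"
  shows "group_rep (g \<otimes>\<^bsub>P\<^esub> h) = group_rep g \<otimes>\<^bsub>E\<^esub> group_rep h"
proof -
  obtain u where u: "g = cls u" "u \<in> words" by (rule P_cases[OF assms(1)])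
  obtain w where w: "h = cls w" "w \<in> words" by (rule P_cases[OF assms(2)])
  have uw: "u @ w \<in> words" using u(2) w(2) by (rule append_in_lists_conv[THEN iffD2, OF conjI])
  show ?thesis
    unfolding u(1) w(1) cls_mult[OF u(2) w(2)] group_rep_cls[OF u(2)] group_rep_cls[OF w(2)] group_rep_cls[OF uw]
    by (rule wprod_append[OF u(2) w(2)])
qed

lemma group_rep_one: "group_rep \<one>\<^bsub>P\<^esub> = \<one>\<^bsub>E\<^esub>"
  unfolding P_one using group_rep_cls[of "[]"] by (simp add: wprod_simps)

lemma group_rep_gen: "s \<in> S \<Longrightarrow> group_rep (cls [(s, True)]) = \<phi> s"
  using group_rep_cls[of "[(s, True)]"] \<phi>_unit[of s] by (simp add: wprod_simps letter_def E.Units_closed)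

text \<open>Commuting with a unit implies commuting with its inverse.\<close>

lemma group_rep_commute:
  assumes z: "z \<in> carrier E" and c: "\<And>s. s \<in> S \<Longrightarrow> z \<otimes>\<^bsub>E\<^esub> \<phi> s = \<phi> s \<otimes>\<^bsub>E\<^esub> z" and g: "g \<in> carrier P"
  shows "z \<otimes>\<^bsub>E\<^esub> group_rep g = group_rep g \<otimes>\<^bsub>E\<^esub> z"
proof -
  have l: "z \<otimes>\<^bsub>E\<^esub> letter l = letter l \<otimes>\<^bsub>E\<^esub> z" if l: "fst l \<in> S" for l
  proof (cases "snd l")
    case True then show ?thesis using c[OF l] by (simp add: letter_def)
  next
    case False
    let ?f = "\<phi> (fst l)" let ?i = "inv\<^bsub>E\<^esub> ?f"
    note u = \<phi>_unit[OF l]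
    have cl: "?f \<in> carrier E" "?i \<in> carrier E" using u by (simp_all add: E.Units_closed)
    have "?i \<otimes>\<^bsub>E\<^esub> z = ?i \<otimes>\<^bsub>E\<^esub> (z \<otimes>\<^bsub>E\<^esub> ?f) \<otimes>\<^bsub>E\<^esub> ?i"
      using u cl z by (simp add: E.m_assoc)
    also have "\<dots> = ?i \<otimes>\<^bsub>E\<^esub> (?f \<otimes>\<^bsub>E\<^esub> z) \<otimes>\<^bsub>E\<^esub> ?i" using c[OF l] by simp
    also have "\<dots> = (?i \<otimes>\<^bsub>E\<^esub> ?f) \<otimes>\<^bsub>E\<^esub> (z \<otimes>\<^bsub>E\<^esub> ?i)" using cl z by (simp add: E.m_assoc)
    also have "\<dots> = z \<otimes>\<^bsub>E\<^esub> ?i" using u cl z by simp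
    finally show ?thesis using False by (simp add: letter_def)
  qed
  have "z \<otimes>\<^bsub>E\<^esub> wprod w = wprod w \<otimes>\<^bsub>E\<^esub> z" if "w \<in> words" for w using that
  proof (induction rule: lists.induct)
    case Nil then show ?case using z by (simp add: wprod_simps)
  next
    case (Cons a w)
    have w: "w \<in> words" and a: "fst a \<in> S" using Cons.hyps by auto
    have cl: "letter a \<in> carrier E" "wprod w \<in> carrier E" using letter_unit[OF a] wprod_unit[OF w] by auto
    have "z \<otimes>\<^bsub>E\<^esub> wprod (a # w) = (z \<otimes>\<^bsub>E\<^esub> letter a) \<otimes>\<^bsub>E\<^esub> wprod w" using cl z by (simp add: wprod_simps E.m_assoc)
    also have "\<dots> = letter a \<otimes>\<^bsub>E\<^esub> (z \<otimes>\<^bsub>E\<^esub> wprod w)" unfolding l[OF a] using cl z by (simp add: E.m_assoc)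
    also have "\<dots> = wprod (a # w) \<otimes>\<^bsub>E\<^esub> z" unfolding Cons.IH using cl z by (simp add: wprod_simps E.m_assoc)
    finally show ?case .
  qed
  note main = this
  obtain w where w: "g = cls w" "w \<in> words" by (rule P_cases[OF g])
  show ?thesis unfolding w(1) group_rep_cls[OF w(2)] by (rule main[OF w(2)])
qed

end

section \<open>Group algebras\<close>

locale group_ring = C: ring C + G: group G
  for C :: "('c, 'b) ring_scheme" and G :: "'g monoid"
begin

abbreviation GA where "GA \<equiv> group_algebra C G"
abbreviation monom where "monom \<equiv> group_algebra_monom C G"
abbreviation supp where "supp x \<equiv> {h \<in> carrier G. x h \<noteq> \<zero>\<^bsub>C\<^esub>}"

lemma GA_carrier: "x \<in> carrier GA \<longleftrightarrow> x \<in> carrier G \<rightarrow>\<^sub>E carrier C \<and> finite (supp x)"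
  by (simp add: group_algebra_def)

lemma GA_val: "x \<in> carrier GA \<Longrightarrow> g \<in> carrier G \<Longrightarrow> x g \<in> carrier C"
  by (auto simp: GA_carrier)

lemma GA_fin: "x \<in> carrier GA \<Longrightarrow> finite (supp x)"
  by (simp add: GA_carrier)

lemmas GA_eqI = extensionalityI[where A = "carrier G"]

lemma GA_ext: "x \<in> carrier GA \<Longrightarrow> x \<in> extensional (carrier G)"
  by (auto simp: GA_carrier PiE_def)

lemma GA_add: "x \<oplus>\<^bsub>GA\<^esub> y = (\<lambda>g\<in>carrier G. x g \<oplus>\<^bsub>C\<^esub> y g)"
  by (simp add: group_algebra_def)

lemma GA_zero: "\<zero>\<^bsub>GA\<^esub> = (\<lambda>g\<in>carrier G. \<zero>\<^bsub>C\<^esub>)"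
  by (simp add: group_algebra_def)

lemma GA_add_closed:
  assumes x: "x \<in> carrier GA" and y: "y \<in> carrier GA"
  shows "x \<oplus>\<^bsub>GA\<^esub> y \<in> carrier GA"
proof -
  have "supp (x \<oplus>\<^bsub>GA\<^esub> y) \<subseteq> supp x \<union> supp y"
    using GA_val[OF x] GA_val[OF y] by (auto simp: GA_add)
  then have "finite (supp (x \<oplus>\<^bsub>GA\<^esub> y))" using GA_fin[OF x] GA_fin[OF y] by (meson finite_UnI finite_subset)
  then show ?thesis using GA_val[OF x] GA_val[OF y] unfolding GA_carrier by (auto simp: GA_add)
qed

lemma monom_closed: "c \<in> carrier C \<Longrightarrow> g \<in> carrier G \<Longrightarrow> monom c g \<in> carrier GA"
proof -
  assume c: "c \<in> carrier C" "g \<in> carrier G"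
  have "supp (monom c g) \<subseteq> {g}" by (auto simp: group_algebra_monom_def)
  then have "finite (supp (monom c g))" by (rule finite_subset) simp
  then show ?thesis using c unfolding GA_carrier by (auto simp: group_algebra_monom_def)
qed

lemma monom_val: "h \<in> carrier G \<Longrightarrow> monom c g h = (if h = g then c else \<zero>\<^bsub>C\<^esub>)"
  by (simp add: group_algebra_monom_def)

lemma GA_zero_monom: "\<zero>\<^bsub>GA\<^esub> = monom \<zero>\<^bsub>C\<^esub> \<one>\<^bsub>G\<^esub>"
  by (auto simp: GA_zero group_algebra_monom_def)

lemma GA_one_monom: "\<one>\<^bsub>GA\<^esub> = monom \<one>\<^bsub>C\<^esub> \<one>\<^bsub>G\<^esub>"
  by (simp add: group_algebra_def group_algebra_monom_def)

lemma GA_abelian: "abelian_group GA"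
proof (rule abelian_groupI)
  show "\<zero>\<^bsub>GA\<^esub> \<in> carrier GA" unfolding GA_zero_monom by (rule monom_closed) auto
  fix x assume x: "x \<in> carrier GA"
  note X = GA_val[OF x]
  show "\<zero>\<^bsub>GA\<^esub> \<oplus>\<^bsub>GA\<^esub> x = x"
    by (rule GA_eqI) (use X GA_ext[OF x] in \<open>auto simp: GA_add GA_zero\<close>)
  let ?m = "\<lambda>g\<in>carrier G. \<ominus>\<^bsub>C\<^esub> x g"
  have "supp ?m \<subseteq> supp x" using X by auto
  then have "finite (supp ?m)" using GA_fin[OF x] by (rule finite_subset)
  then have "?m \<in> carrier GA" using X unfolding GA_carrier by auto
  moreover have "?m \<oplus>\<^bsub>GA\<^esub> x = \<zero>\<^bsub>GA\<^esub>"
    by (rule GA_eqI) (use X in \<open>auto simp: GA_add GA_zero C.l_neg\<close>)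
  ultimately show "\<exists>y\<in>carrier GA. y \<oplus>\<^bsub>GA\<^esub> x = \<zero>\<^bsub>GA\<^esub>" by blast
  fix y assume y: "y \<in> carrier GA"
  note Y = GA_val[OF y]
  show "x \<oplus>\<^bsub>GA\<^esub> y \<in> carrier GA" by (rule GA_add_closed[OF x y])
  show "x \<oplus>\<^bsub>GA\<^esub> y = y \<oplus>\<^bsub>GA\<^esub> x"
    by (rule GA_eqI) (use X Y in \<open>auto simp: GA_add C.a_comm\<close>)
  fix z assume z: "z \<in> carrier GA"
  show "x \<oplus>\<^bsub>GA\<^esub> y \<oplus>\<^bsub>GA\<^esub> z = x \<oplus>\<^bsub>GA\<^esub> (y \<oplus>\<^bsub>GA\<^esub> z)"
    by (rule GA_eqI) (use X Y GA_val[OF z] in \<open>auto simp: GA_add C.a_assoc\<close>)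
qed

text \<open>By induction on the support, from which one point is removed at a time. Associativity, the
  homomorphism property and uniqueness of extensions then need to be checked on monomials only.\<close>

lemma GA_induct [consumes 1, case_names monom plus]:
  assumes x: "x \<in> carrier GA"
    and m: "\<And>c g. c \<in> carrier C \<Longrightarrow> g \<in> carrier G \<Longrightarrow> Q (monom c g)"
    and p: "\<And>x y. x \<in> carrier GA \<Longrightarrow> y \<in> carrier GA \<Longrightarrow> Q x \<Longrightarrow> Q y \<Longrightarrow> Q (x \<oplus>\<^bsub>GA\<^esub> y)"
  shows "Q x"
proof -
  have "x \<in> carrier GA \<Longrightarrow> supp x \<subseteq> A \<Longrightarrow> Q x" if "finite A" for A x
    using that
  proof (induction A arbitrary: x rule: finite_induct)
    case empty
    have "x = monom \<zero>\<^bsub>C\<^esub> \<one>\<^bsub>G\<^esub>"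
      by (rule GA_eqI) (use empty GA_ext in \<open>auto simp: group_algebra_monom_def\<close>)
    then show ?case using m[of "\<zero>\<^bsub>C\<^esub>" "\<one>\<^bsub>G\<^esub>"] by simp
  next
    case (insert a A)
    show ?case
    proof (cases "a \<in> carrier G")
      case False
      then show ?thesis using insert by blast
    next
      case True
      let ?y = "\<lambda>g\<in>carrier G. if g = a then \<zero>\<^bsub>C\<^esub> else x g"
      note X = GA_val[OF insert.prems(1)]
      have s: "supp ?y \<subseteq> A" using insert.prems(2) by auto
      have y: "?y \<in> carrier GA"
        unfolding GA_carrier using finite_subset[OF s insert.hyps(1)] X by auto
      have e: "x = ?y \<oplus>\<^bsub>GA\<^esub> monom (x a) a"
        by (rule GA_eqI) (use X True GA_ext[OF insert.prems(1)] in \<open>auto simp: GA_add group_algebra_monom_def\<close>)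
      show ?thesis
        using p[OF y monom_closed[OF X[OF True] True] insert.IH[OF y s] m[OF X[OF True] True]]
        by (simp only: e[symmetric])
    qed
  qed
  then show ?thesis using x GA_fin by blast
qed

text \<open>The sum may run over any finite set containing the support, so that products with different
  left factors can be compared over a common index set.\<close>

lemma GA_mult:
  assumes x: "x \<in> carrier GA" and y: "y \<in> carrier GA" and g: "g \<in> carrier G"
    and A: "finite A" "A \<subseteq> carrier G" "supp x \<subseteq> A"
  shows "(x \<otimes>\<^bsub>GA\<^esub> y) g = (\<Oplus>\<^bsub>C\<^esub>h\<in>A. x h \<otimes>\<^bsub>C\<^esub> y (inv\<^bsub>G\<^esub> h \<otimes>\<^bsub>G\<^esub> g))"
proof -
  have Y: "y (inv\<^bsub>G\<^esub> h \<otimes>\<^bsub>G\<^esub> g) \<in> carrier C" if "h \<in> carrier G" for h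
    using GA_val[OF y] g that by simp
  have "(x \<otimes>\<^bsub>GA\<^esub> y) g = (\<Oplus>\<^bsub>C\<^esub>h\<in>supp x. x h \<otimes>\<^bsub>C\<^esub> y (inv\<^bsub>G\<^esub> h \<otimes>\<^bsub>G\<^esub> g))"
    using g by (simp add: group_algebra_def)
  also have "\<dots> = (\<Oplus>\<^bsub>C\<^esub>h\<in>A. x h \<otimes>\<^bsub>C\<^esub> y (inv\<^bsub>G\<^esub> h \<otimes>\<^bsub>G\<^esub> g))"
    by (rule C.add.finprod_mono_neutral_cong_left) (use A GA_val[OF x] Y in \<open>auto simp: subset_iff\<close>)
  finally show ?thesis .
qed

lemma GA_mult_ext: "x \<otimes>\<^bsub>GA\<^esub> y \<in> extensional (carrier G)"
  by (simp add: group_algebra_def)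

lemma GA_distr_left:
  assumes x: "x \<in> carrier GA" and x': "x' \<in> carrier GA" and y: "y \<in> carrier GA"
  shows "(x \<oplus>\<^bsub>GA\<^esub> x') \<otimes>\<^bsub>GA\<^esub> y = x \<otimes>\<^bsub>GA\<^esub> y \<oplus>\<^bsub>GA\<^esub> x' \<otimes>\<^bsub>GA\<^esub> y"
proof (rule GA_eqI)
  show "x \<otimes>\<^bsub>GA\<^esub> y \<oplus>\<^bsub>GA\<^esub> x' \<otimes>\<^bsub>GA\<^esub> y \<in> extensional (carrier G)" by (simp add: GA_add)
  fix g assume g: "g \<in> carrier G"
  let ?A = "supp x \<union> supp x'"
  have A: "finite ?A" "?A \<subseteq> carrier G" "supp x \<subseteq> ?A" "supp x' \<subseteq> ?A"
    using GA_fin[OF x] GA_fin[OF x'] by auto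
  have s: "supp (x \<oplus>\<^bsub>GA\<^esub> x') \<subseteq> ?A" by (auto simp: GA_add)
  have Y: "y (inv\<^bsub>G\<^esub> h \<otimes>\<^bsub>G\<^esub> g) \<in> carrier C" if "h \<in> carrier G" for h
    using GA_val[OF y] g that by simp
  have "((x \<oplus>\<^bsub>GA\<^esub> x') \<otimes>\<^bsub>GA\<^esub> y) g = (\<Oplus>\<^bsub>C\<^esub>h\<in>?A. (x \<oplus>\<^bsub>GA\<^esub> x') h \<otimes>\<^bsub>C\<^esub> y (inv\<^bsub>G\<^esub> h \<otimes>\<^bsub>G\<^esub> g))"
    by (rule GA_mult[OF GA_add_closed[OF x x'] y g A(1,2) s])
  also have "\<dots> = (\<Oplus>\<^bsub>C\<^esub>h\<in>?A. x h \<otimes>\<^bsub>C\<^esub> y (inv\<^bsub>G\<^esub> h \<otimes>\<^bsub>G\<^esub> g) \<oplus>\<^bsub>C\<^esub> x' h \<otimes>\<^bsub>C\<^esub> y (inv\<^bsub>G\<^esub> h \<otimes>\<^bsub>G\<^esub> g))"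
    by (rule C.finsum_cong') (use GA_val[OF x] GA_val[OF x'] Y in \<open>auto simp: GA_add C.l_distr\<close>)
  also have "\<dots> = (\<Oplus>\<^bsub>C\<^esub>h\<in>?A. x h \<otimes>\<^bsub>C\<^esub> y (inv\<^bsub>G\<^esub> h \<otimes>\<^bsub>G\<^esub> g)) \<oplus>\<^bsub>C\<^esub> (\<Oplus>\<^bsub>C\<^esub>h\<in>?A. x' h \<otimes>\<^bsub>C\<^esub> y (inv\<^bsub>G\<^esub> h \<otimes>\<^bsub>G\<^esub> g))"
    by (rule C.finsum_addf) (use GA_val[OF x] GA_val[OF x'] Y in auto)
  also have "\<dots> = (x \<otimes>\<^bsub>GA\<^esub> y \<oplus>\<^bsub>GA\<^esub> x' \<otimes>\<^bsub>GA\<^esub> y) g"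
    using g by (simp add: GA_add GA_mult[OF x y g A(1,2,3)] GA_mult[OF x' y g A(1,2,4)])
  finally show "((x \<oplus>\<^bsub>GA\<^esub> x') \<otimes>\<^bsub>GA\<^esub> y) g = (x \<otimes>\<^bsub>GA\<^esub> y \<oplus>\<^bsub>GA\<^esub> x' \<otimes>\<^bsub>GA\<^esub> y) g" .
qed (rule GA_mult_ext)

lemma GA_distr_right:
  assumes x: "x \<in> carrier GA" and y: "y \<in> carrier GA" and y': "y' \<in> carrier GA"
  shows "x \<otimes>\<^bsub>GA\<^esub> (y \<oplus>\<^bsub>GA\<^esub> y') = x \<otimes>\<^bsub>GA\<^esub> y \<oplus>\<^bsub>GA\<^esub> x \<otimes>\<^bsub>GA\<^esub> y'"
proof (rule GA_eqI)
  show "x \<otimes>\<^bsub>GA\<^esub> y \<oplus>\<^bsub>GA\<^esub> x \<otimes>\<^bsub>GA\<^esub> y' \<in> extensional (carrier G)" by (simp add: GA_add)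
  fix g assume g: "g \<in> carrier G"
  let ?A = "supp x"
  have A: "finite ?A" "?A \<subseteq> carrier G" "supp x \<subseteq> ?A" using GA_fin[OF x] by auto
  have Y: "y (inv\<^bsub>G\<^esub> h \<otimes>\<^bsub>G\<^esub> g) \<in> carrier C" "y' (inv\<^bsub>G\<^esub> h \<otimes>\<^bsub>G\<^esub> g) \<in> carrier C" if "h \<in> carrier G" for h
    using GA_val[OF y] GA_val[OF y'] g that by simp_all
  have "(x \<otimes>\<^bsub>GA\<^esub> (y \<oplus>\<^bsub>GA\<^esub> y')) g = (\<Oplus>\<^bsub>C\<^esub>h\<in>?A. x h \<otimes>\<^bsub>C\<^esub> (y \<oplus>\<^bsub>GA\<^esub> y') (inv\<^bsub>G\<^esub> h \<otimes>\<^bsub>G\<^esub> g))"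
    by (rule GA_mult[OF x GA_add_closed[OF y y'] g A])
  also have "\<dots> = (\<Oplus>\<^bsub>C\<^esub>h\<in>?A. x h \<otimes>\<^bsub>C\<^esub> y (inv\<^bsub>G\<^esub> h \<otimes>\<^bsub>G\<^esub> g) \<oplus>\<^bsub>C\<^esub> x h \<otimes>\<^bsub>C\<^esub> y' (inv\<^bsub>G\<^esub> h \<otimes>\<^bsub>G\<^esub> g))"
    by (rule C.finsum_cong') (use GA_val[OF x] Y g in \<open>auto simp: GA_add C.r_distr\<close>)
  also have "\<dots> = (\<Oplus>\<^bsub>C\<^esub>h\<in>?A. x h \<otimes>\<^bsub>C\<^esub> y (inv\<^bsub>G\<^esub> h \<otimes>\<^bsub>G\<^esub> g)) \<oplus>\<^bsub>C\<^esub> (\<Oplus>\<^bsub>C\<^esub>h\<in>?A. x h \<otimes>\<^bsub>C\<^esub> y' (inv\<^bsub>G\<^esub> h \<otimes>\<^bsub>G\<^esub> g))"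
    by (rule C.finsum_addf) (use GA_val[OF x] Y in auto)
  also have "\<dots> = (x \<otimes>\<^bsub>GA\<^esub> y \<oplus>\<^bsub>GA\<^esub> x \<otimes>\<^bsub>GA\<^esub> y') g"
    using g by (simp add: GA_add GA_mult[OF x y g A] GA_mult[OF x y' g A])
  finally show "(x \<otimes>\<^bsub>GA\<^esub> (y \<oplus>\<^bsub>GA\<^esub> y')) g = (x \<otimes>\<^bsub>GA\<^esub> y \<oplus>\<^bsub>GA\<^esub> x \<otimes>\<^bsub>GA\<^esub> y') g" .
qed (rule GA_mult_ext)

lemma monom_mult:
  assumes c: "c \<in> carrier C" and d: "d \<in> carrier C" and g: "g \<in> carrier G" and h: "h \<in> carrier G"
  shows "monom c g \<otimes>\<^bsub>GA\<^esub> monom d h = monom (c \<otimes>\<^bsub>C\<^esub> d) (g \<otimes>\<^bsub>G\<^esub> h)"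
proof (rule GA_eqI[OF GA_mult_ext])
  show "monom (c \<otimes>\<^bsub>C\<^esub> d) (g \<otimes>\<^bsub>G\<^esub> h) \<in> extensional (carrier G)" by (simp add: group_algebra_monom_def)
  fix k assume k: "k \<in> carrier G"
  have "supp (monom c g) \<subseteq> {g}" by (auto simp: group_algebra_monom_def)
  then have "(monom c g \<otimes>\<^bsub>GA\<^esub> monom d h) k = (\<Oplus>\<^bsub>C\<^esub>g'\<in>{g}. monom c g g' \<otimes>\<^bsub>C\<^esub> monom d h (inv\<^bsub>G\<^esub> g' \<otimes>\<^bsub>G\<^esub> k))"
    by (intro GA_mult monom_closed) (use c d g h k in auto)
  also have "\<dots> = c \<otimes>\<^bsub>C\<^esub> monom d h (inv\<^bsub>G\<^esub> g \<otimes>\<^bsub>G\<^esub> k)"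
    using GA_val[OF monom_closed[OF d h], of "inv\<^bsub>G\<^esub> g \<otimes>\<^bsub>G\<^esub> k"] c g k by (simp add: monom_val)
  also have "\<dots> = monom (c \<otimes>\<^bsub>C\<^esub> d) (g \<otimes>\<^bsub>G\<^esub> h) k"
  proof -
    have "inv\<^bsub>G\<^esub> g \<otimes>\<^bsub>G\<^esub> k = h \<longleftrightarrow> k = g \<otimes>\<^bsub>G\<^esub> h" using g h k by (metis G.inv_solve_left)
    then show ?thesis using c g h k by (simp add: monom_val)
  qed
  finally show "(monom c g \<otimes>\<^bsub>GA\<^esub> monom d h) k = monom (c \<otimes>\<^bsub>C\<^esub> d) (g \<otimes>\<^bsub>G\<^esub> h) k" .
qed

lemma GA_mult_closed:
  assumes x: "x \<in> carrier GA" and y: "y \<in> carrier GA"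
  shows "x \<otimes>\<^bsub>GA\<^esub> y \<in> carrier GA"
  using x
proof (induction rule: GA_induct)
  case (monom c g)
  note m = monom
  show ?case using y
  proof (induction rule: GA_induct)
    case (monom d h)
    then show ?case using m by (simp add: monom_mult monom_closed)
  next
    case (plus y y')
    then show ?case using m by (simp add: GA_distr_right monom_closed GA_add_closed)
  qed
next
  case (plus x x')
  then show ?case using y by (simp add: GA_distr_left GA_add_closed)
qed

lemma GA_assoc:
  assumes x: "x \<in> carrier GA" and y: "y \<in> carrier GA" and z: "z \<in> carrier GA"
  shows "x \<otimes>\<^bsub>GA\<^esub> y \<otimes>\<^bsub>GA\<^esub> z = x \<otimes>\<^bsub>GA\<^esub> (y \<otimes>\<^bsub>GA\<^esub> z)"
  using x
proof (induction rule: GA_induct)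
  case (monom c g)
  note m = monom
  show ?case using y
  proof (induction rule: GA_induct)
    case (monom d h)
    note n = monom
    show ?case using z
    proof (induction rule: GA_induct)
      case (monom e k)
      then show ?case using m n by (simp add: monom_mult C.m_assoc G.m_assoc)
    next
      case (plus z z')
      then show ?case using m n by (simp add: GA_distr_right monom_closed GA_mult_closed)
    qed
  next
    case (plus y y')
    then show ?case using m z by (simp add: GA_distr_right GA_distr_left monom_closed GA_mult_closed)
  qed
next
  case (plus x x')
  then show ?case using y z by (simp add: GA_distr_left GA_mult_closed)
qed

lemma GA_ring: "ring GA"
proof (rule ringI[OF GA_abelian])
  have one: "\<one>\<^bsub>GA\<^esub> \<in> carrier GA" unfolding GA_one_monom by (rule monom_closed) auto
  show "Group.monoid GA"
  proof (rule monoidI)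
    fix x assume x: "x \<in> carrier GA"
    show "\<one>\<^bsub>GA\<^esub> \<otimes>\<^bsub>GA\<^esub> x = x" using x
    proof (induction rule: GA_induct)
      case (monom c g) then show ?case by (simp add: GA_one_monom monom_mult)
    next
      case (plus x y) then show ?case by (simp add: GA_distr_right one)
    qed
    show "x \<otimes>\<^bsub>GA\<^esub> \<one>\<^bsub>GA\<^esub> = x" using x
    proof (induction rule: GA_induct)
      case (monom c g) then show ?case by (simp add: GA_one_monom monom_mult)
    next
      case (plus x y) then show ?case by (simp add: GA_distr_left one)
    qed
  qed (simp_all add: one GA_mult_closed GA_assoc)
qed (simp_all add: GA_distr_left GA_distr_right)

text \<open>The extension maps \<open>x\<close> to the sum of \<open>\<zeta> (x g) \<rho> g\<close>. It is multiplicative on monomials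
  because \<open>\<zeta>\<close> and \<open>\<rho>\<close> commute, and hence everywhere.\<close>

lemma GA_extend:
  assumes E: "ring E" and \<zeta>: "\<zeta> \<in> ring_hom C E" and \<rho>c: "\<And>g. g \<in> carrier G \<Longrightarrow> \<rho> g \<in> carrier E"
    and \<rho>m: "\<And>g h. g \<in> carrier G \<Longrightarrow> h \<in> carrier G \<Longrightarrow> \<rho> (g \<otimes>\<^bsub>G\<^esub> h) = \<rho> g \<otimes>\<^bsub>E\<^esub> \<rho> h"
    and \<rho>1: "\<rho> \<one>\<^bsub>G\<^esub> = \<one>\<^bsub>E\<^esub>"
    and comm: "\<And>c g. c \<in> carrier C \<Longrightarrow> g \<in> carrier G \<Longrightarrow> \<zeta> c \<otimes>\<^bsub>E\<^esub> \<rho> g = \<rho> g \<otimes>\<^bsub>E\<^esub> \<zeta> c"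
  obtains \<Phi> where "\<Phi> \<in> extensional (carrier GA)" "\<Phi> \<in> ring_hom GA E"
    "\<And>c g. c \<in> carrier C \<Longrightarrow> g \<in> carrier G \<Longrightarrow> \<Phi> (monom c g) = \<zeta> c \<otimes>\<^bsub>E\<^esub> \<rho> g"
proof -
  interpret E: ring E by (rule E)
  note \<zeta>c = ring_hom_closed[OF \<zeta>]
  have \<zeta>0: "\<zeta> \<zero>\<^bsub>C\<^esub> = \<zero>\<^bsub>E\<^esub>"
    by (rule ring_hom_zero[OF \<zeta> C.ring_axioms E])
  define f where "f x = (\<Oplus>\<^bsub>E\<^esub>g\<in>supp x. \<zeta> (x g) \<otimes>\<^bsub>E\<^esub> \<rho> g)" for x
  have f: "f x = (\<Oplus>\<^bsub>E\<^esub>g\<in>A. \<zeta> (x g) \<otimes>\<^bsub>E\<^esub> \<rho> g)"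
    if x: "x \<in> carrier GA" and A: "finite A" "A \<subseteq> carrier G" "supp x \<subseteq> A" for x A
    unfolding f_def
    by (rule E.add.finprod_mono_neutral_cong_left)
      (use A GA_val[OF x] \<zeta>c \<rho>c \<zeta>0 in \<open>auto simp: subset_iff\<close>)
  have f_closed: "f x \<in> carrier E" if x: "x \<in> carrier GA" for x
    unfolding f_def by (rule E.finsum_closed) (use GA_val[OF x] \<zeta>c \<rho>c in auto)
  have f_add: "f (x \<oplus>\<^bsub>GA\<^esub> y) = f x \<oplus>\<^bsub>E\<^esub> f y" if x: "x \<in> carrier GA" and y: "y \<in> carrier GA" for x y
  proof -
    let ?A = "supp x \<union> supp y"
    have A: "finite ?A" "?A \<subseteq> carrier G" "supp x \<subseteq> ?A" "supp y \<subseteq> ?A" using GA_fin[OF x] GA_fin[OF y] by auto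
    have s: "supp (x \<oplus>\<^bsub>GA\<^esub> y) \<subseteq> ?A" by (auto simp: GA_add)
    have "f (x \<oplus>\<^bsub>GA\<^esub> y) = (\<Oplus>\<^bsub>E\<^esub>g\<in>?A. \<zeta> ((x \<oplus>\<^bsub>GA\<^esub> y) g) \<otimes>\<^bsub>E\<^esub> \<rho> g)"
      by (rule f[OF GA_add_closed[OF x y] A(1,2) s])
    also have "\<dots> = (\<Oplus>\<^bsub>E\<^esub>g\<in>?A. \<zeta> (x g) \<otimes>\<^bsub>E\<^esub> \<rho> g \<oplus>\<^bsub>E\<^esub> \<zeta> (y g) \<otimes>\<^bsub>E\<^esub> \<rho> g)"
      by (rule E.finsum_cong')
        (use GA_val[OF x] GA_val[OF y] \<zeta>c \<rho>c ring_hom_add[OF \<zeta>] in \<open>auto simp: GA_add E.l_distr\<close>)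
    also have "\<dots> = (\<Oplus>\<^bsub>E\<^esub>g\<in>?A. \<zeta> (x g) \<otimes>\<^bsub>E\<^esub> \<rho> g) \<oplus>\<^bsub>E\<^esub> (\<Oplus>\<^bsub>E\<^esub>g\<in>?A. \<zeta> (y g) \<otimes>\<^bsub>E\<^esub> \<rho> g)"
      by (rule E.finsum_addf) (use GA_val[OF x] GA_val[OF y] \<zeta>c \<rho>c in auto)
    also have "\<dots> = f x \<oplus>\<^bsub>E\<^esub> f y" using f[OF x A(1-3)] f[OF y A(1,2,4)] by simp
    finally show ?thesis .
  qed
  have f_monom: "f (monom c g) = \<zeta> c \<otimes>\<^bsub>E\<^esub> \<rho> g" if c: "c \<in> carrier C" and g: "g \<in> carrier G" for c g
  proof -
    have "f (monom c g) = (\<Oplus>\<^bsub>E\<^esub>h\<in>{g}. \<zeta> (monom c g h) \<otimes>\<^bsub>E\<^esub> \<rho> h)"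
      by (rule f[OF monom_closed[OF c g]]) (use g in \<open>auto simp: group_algebra_monom_def\<close>)
    then show ?thesis using \<zeta>c[OF c] \<rho>c[OF g] g by (simp add: monom_val)
  qed
  have f_mult: "f (x \<otimes>\<^bsub>GA\<^esub> y) = f x \<otimes>\<^bsub>E\<^esub> f y" if x: "x \<in> carrier GA" and y: "y \<in> carrier GA" for x y
    using x
  proof (induction rule: GA_induct)
    case (monom c g)
    note m = monom
    show ?case using y
    proof (induction rule: GA_induct)
      case (monom d h)
      have "\<zeta> c \<otimes>\<^bsub>E\<^esub> \<zeta> d \<otimes>\<^bsub>E\<^esub> (\<rho> g \<otimes>\<^bsub>E\<^esub> \<rho> h) = \<zeta> c \<otimes>\<^bsub>E\<^esub> (\<zeta> d \<otimes>\<^bsub>E\<^esub> \<rho> g) \<otimes>\<^bsub>E\<^esub> \<rho> h"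
        using m monom \<zeta>c \<rho>c by (simp add: E.m_assoc)
      also have "\<dots> = \<zeta> c \<otimes>\<^bsub>E\<^esub> \<rho> g \<otimes>\<^bsub>E\<^esub> (\<zeta> d \<otimes>\<^bsub>E\<^esub> \<rho> h)"
        unfolding comm[OF monom(1) m(2)] using m monom \<zeta>c \<rho>c by (simp add: E.m_assoc)
      finally show ?case using m monom
        by (simp add: monom_mult f_monom \<rho>m ring_hom_mult[OF \<zeta>])
    next
      case (plus y y')
      then show ?case using m
        by (simp add: GA_distr_right monom_closed f_add GA_mult_closed f_closed E.r_distr)
    qed
  next
    case (plus x x')
    then show ?case using y by (simp add: GA_distr_left f_add GA_mult_closed f_closed E.l_distr)
  qed
  have f_one: "f \<one>\<^bsub>GA\<^esub> = \<one>\<^bsub>E\<^esub>"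
    unfolding GA_one_monom by (simp add: f_monom \<rho>1 ring_hom_one[OF \<zeta>])
  interpret A: ring GA by (rule GA_ring)
  show thesis
  proof (rule that[of "restrict f (carrier GA)"])
    show "restrict f (carrier GA) \<in> ring_hom GA E"
      by (rule ring_hom_memI) (simp_all add: f_closed f_mult f_add f_one)
  qed (simp_all add: f_monom monom_closed)
qed

lemma GA_hom_eqI:
  assumes E: "ring E" and f: "f \<in> ring_hom GA E" "f \<in> extensional (carrier GA)"
    and g: "g \<in> ring_hom GA E" "g \<in> extensional (carrier GA)"
    and eq: "\<And>c x. c \<in> carrier C \<Longrightarrow> x \<in> carrier G \<Longrightarrow> f (monom c x) = g (monom c x)"
  shows "f = g"
proof (rule extensionalityI[OF f(2) g(2)])
  fix x assume "x \<in> carrier GA"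
  then show "f x = g x"
    by (induction rule: GA_induct) (simp_all add: eq ring_hom_add[OF f(1)] ring_hom_add[OF g(1)])
qed

end

section \<open>The group algebra of a presented group\<close>

text \<open>For uniqueness, the values on the generators and on the coefficients determine those on
  inverse generators, hence on words, hence on monomials.\<close>

lemma presented_group_algebra_hom:
  fixes C :: "('c, 'b) ring_scheme" and E :: "('e, 'm) ring_scheme"
  assumes pr: "presentation_rep S Rel E \<phi>" and C: "ring C" and E: "ring E" and \<zeta>: "\<zeta> \<in> ring_hom C E"
    and comm: "\<And>c s. c \<in> carrier C \<Longrightarrow> s \<in> S \<Longrightarrow> \<zeta> c \<otimes>\<^bsub>E\<^esub> \<phi> s = \<phi> s \<otimes>\<^bsub>E\<^esub> \<zeta> c"
  defines "G \<equiv> presented_group S Rel"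
  shows "\<exists>!\<Phi>. \<Phi> \<in> extensional (carrier (group_algebra C G)) \<and> \<Phi> \<in> ring_hom (group_algebra C G) E \<and>
    (\<forall>s\<in>S. \<Phi> (group_algebra_monom C G \<one>\<^bsub>C\<^esub> (word_class S Rel [(s, True)])) = \<phi> s) \<and>
    (\<forall>c\<in>carrier C. \<Phi> (group_algebra_monom C G c \<one>\<^bsub>G\<^esub>) = \<zeta> c)"
proof -
  interpret pr: presentation_rep S Rel E \<phi> by (rule pr)
  interpret C: ring C by (rule C)
  interpret E: ring E by (rule E)
  interpret G: group G unfolding G_def by (rule pr.P_group)
  interpret GR: group_ring C G by unfold_locales
  note \<zeta>c = ring_hom_closed[OF \<zeta>]
  note r = pr.group_rep_closed[folded G_def] pr.group_rep_mult[folded G_def] pr.group_rep_one[folded G_def]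
  have gen: "word_class S Rel [(s, b)] \<in> carrier G" if "s \<in> S" for s b
    unfolding G_def pr.P_carrier by (rule imageI) (use that in auto)
  obtain \<Phi> where \<Phi>: "\<Phi> \<in> extensional (carrier GR.GA)" "\<Phi> \<in> ring_hom GR.GA E"
    "\<And>c g. c \<in> carrier C \<Longrightarrow> g \<in> carrier G \<Longrightarrow> \<Phi> (GR.monom c g) = \<zeta> c \<otimes>\<^bsub>E\<^esub> pr.group_rep g"
    by (rule GR.GA_extend[OF E \<zeta> r])
      (assumption | rule pr.group_rep_commute[folded G_def] \<zeta>c comm | rule that)+
  show ?thesis
  proof (rule ex1I[of _ \<Phi>])
    show "\<Phi> \<in> extensional (carrier GR.GA) \<and> \<Phi> \<in> ring_hom GR.GA E \<and>
        (\<forall>s\<in>S. \<Phi> (GR.monom \<one>\<^bsub>C\<^esub> (word_class S Rel [(s, True)])) = \<phi> s) \<and>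
        (\<forall>c\<in>carrier C. \<Phi> (GR.monom c \<one>\<^bsub>G\<^esub>) = \<zeta> c)"
      using \<Phi>(1,2) \<zeta>c pr.\<phi>_unit
      by (simp add: \<Phi>(3) gen pr.group_rep_gen ring_hom_one[OF \<zeta>] r(3) pr.E.Units_closed)
    fix \<Psi> assume \<Psi>: "\<Psi> \<in> extensional (carrier GR.GA) \<and> \<Psi> \<in> ring_hom GR.GA E \<and>
        (\<forall>s\<in>S. \<Psi> (GR.monom \<one>\<^bsub>C\<^esub> (word_class S Rel [(s, True)])) = \<phi> s) \<and>
        (\<forall>c\<in>carrier C. \<Psi> (GR.monom c \<one>\<^bsub>G\<^esub>) = \<zeta> c)"
    then have \<Psi>h: "\<Psi> \<in> ring_hom GR.GA E" by blast
    note \<Psi>m = ring_hom_mult[OF \<Psi>h] and \<Psi>c = ring_hom_closed[OF \<Psi>h]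
    note mc = GR.monom_closed[OF C.one_closed]
    have \<Psi>w: "\<Psi> (GR.monom \<one>\<^bsub>C\<^esub> (word_class S Rel w)) = pr.wprod w" if "w \<in> lists (S \<times> UNIV)" for w
      using that
    proof (induction rule: lists.induct)
      case Nil
      show ?case using ring_hom_one[OF \<Psi>h]
        unfolding GR.GA_one_monom pr.P_one[folded G_def] by (simp add: pr.wprod_simps)
    next
      case (Cons l w)
      obtain s b where l: "l = (s, b)" by force
      have s: "s \<in> S" and w: "w \<in> lists (S \<times> UNIV)" using Cons.hyps l by auto
      have wc: "word_class S Rel w \<in> carrier G" unfolding G_def pr.P_carrier using w by (rule imageI)
      let ?g = "\<lambda>b. word_class S Rel [(s, b)]"
      have T: "\<Psi> (GR.monom \<one>\<^bsub>C\<^esub> (?g True)) = \<phi> s" using \<Psi> s by blast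
      \<comment> \<open>the image of the inverse letter is a two-sided inverse of the image of the letter\<close>
      have F: "\<Psi> (GR.monom \<one>\<^bsub>C\<^esub> (?g False)) = inv\<^bsub>E\<^esub> (\<phi> s)"
      proof -
        have "?g b \<otimes>\<^bsub>G\<^esub> ?g (\<not> b) = \<one>\<^bsub>G\<^esub>" for b
          unfolding G_def pr.P_one
          using pr.cls_mult[of "[(s, b)]" "[(s, \<not> b)]"] pr.cls_eq_iff[of "[(s, b), (s, \<not> b)]" "[]"]
            presented_eq.cancel[OF s, of Rel b] s by simp
        then have "GR.monom \<one>\<^bsub>C\<^esub> (?g b) \<otimes>\<^bsub>GR.GA\<^esub> GR.monom \<one>\<^bsub>C\<^esub> (?g (\<not> b)) = \<one>\<^bsub>GR.GA\<^esub>" for b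
          using gen[OF s] by (simp add: GR.monom_mult GR.GA_one_monom)
        from arg_cong[OF this, of \<Psi>]
        have "\<Psi> (GR.monom \<one>\<^bsub>C\<^esub> (?g b)) \<otimes>\<^bsub>E\<^esub> \<Psi> (GR.monom \<one>\<^bsub>C\<^esub> (?g (\<not> b))) = \<one>\<^bsub>E\<^esub>" for b
          using \<Psi>m[OF mc[OF gen[OF s]] mc[OF gen[OF s]]] by (simp add: ring_hom_one[OF \<Psi>h])
        from this[of False] this[of True]
        show ?thesis using T \<Psi>c[OF mc[OF gen[OF s, of False]]] pr.E.Units_closed[OF pr.\<phi>_unit[OF s]]
          by (intro pr.E.inv_char[THEN HOL.sym]) auto
      qed
      have "\<Psi> (GR.monom \<one>\<^bsub>C\<^esub> (word_class S Rel (l # w))) =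
          \<Psi> (GR.monom \<one>\<^bsub>C\<^esub> (?g b) \<otimes>\<^bsub>GR.GA\<^esub> GR.monom \<one>\<^bsub>C\<^esub> (word_class S Rel w))"
        using pr.cls_mult[of "[(s, b)]" w] s w gen[OF s] wc
        by (simp add: GR.monom_mult l G_def[symmetric])
      also have "\<dots> = pr.letter l \<otimes>\<^bsub>E\<^esub> pr.wprod w"
        using \<Psi>m[OF mc[OF gen[OF s]] mc[OF wc]] Cons.IH T F by (cases b) (simp_all add: l pr.letter_def)
      finally show ?case by (simp add: pr.wprod_simps)
    qed
    show "\<Psi> = \<Phi>"
    proof (rule GR.GA_hom_eqI[OF E])
      fix c g assume c: "c \<in> carrier C" and g: "g \<in> carrier G"
      obtain w where w: "w \<in> lists (S \<times> UNIV)" "g = word_class S Rel w"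
        using g unfolding G_def pr.P_carrier by blast
      have "\<Psi> (GR.monom c g) = \<Psi> (GR.monom c \<one>\<^bsub>G\<^esub> \<otimes>\<^bsub>GR.GA\<^esub> GR.monom \<one>\<^bsub>C\<^esub> g)"
        using c g by (simp add: GR.monom_mult)
      also have "\<dots> = \<zeta> c \<otimes>\<^bsub>E\<^esub> pr.wprod w"
        using \<Psi>m[OF GR.monom_closed[OF c G.one_closed] mc[OF g]] \<Psi> c \<Psi>w[OF w(1)] w(2) by simp
      also have "\<dots> = \<Phi> (GR.monom c g)"
        unfolding \<Phi>(3)[OF c g] using pr.group_rep_cls[OF w(1)] by (simp only: w(2))
      finally show "\<Psi> (GR.monom c g) = \<Phi> (GR.monom c g)" .
    qed (use \<Phi> \<Psi> in auto)
  qed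
qed

section \<open>Endomorphism rings\<close>

text \<open>The operations are pointwise. Zero and negatives are linear because every scalar acts
  additively.\<close>

lemma End_ring_ring:
  fixes A :: "('u, 'b) ring_scheme" and W :: "('u, 'w) module"
  assumes W: "abelian_group W"
    and sc: "\<And>a x. a \<in> carrier A \<Longrightarrow> x \<in> carrier W \<Longrightarrow> a \<odot>\<^bsub>W\<^esub> x \<in> carrier W"
    and sa: "\<And>a x y. a \<in> carrier A \<Longrightarrow> x \<in> carrier W \<Longrightarrow> y \<in> carrier W \<Longrightarrow>
      a \<odot>\<^bsub>W\<^esub> (x \<oplus>\<^bsub>W\<^esub> y) = a \<odot>\<^bsub>W\<^esub> x \<oplus>\<^bsub>W\<^esub> a \<odot>\<^bsub>W\<^esub> y"
  shows "ring (End_ring A W)"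
proof -
  interpret W: abelian_group W by (rule W)
  let ?E = "End_ring A W"
  have C: "f \<in> carrier ?E \<longleftrightarrow> f \<in> extensional (carrier W) \<and> (\<forall>x\<in>carrier W. f x \<in> carrier W) \<and>
      (\<forall>x\<in>carrier W. \<forall>y\<in>carrier W. f (x \<oplus>\<^bsub>W\<^esub> y) = f x \<oplus>\<^bsub>W\<^esub> f y) \<and>
      (\<forall>a\<in>carrier A. \<forall>x\<in>carrier W. f (a \<odot>\<^bsub>W\<^esub> x) = a \<odot>\<^bsub>W\<^esub> f x)" for f
    by (auto simp: End_ring_def linear_maps_def)
  have s: "f \<otimes>\<^bsub>?E\<^esub> g = compose (carrier W) f g" "\<one>\<^bsub>?E\<^esub> = (\<lambda>x\<in>carrier W. x)"
    "\<zero>\<^bsub>?E\<^esub> = (\<lambda>x\<in>carrier W. \<zero>\<^bsub>W\<^esub>)" "f \<oplus>\<^bsub>?E\<^esub> g = (\<lambda>x\<in>carrier W. f x \<oplus>\<^bsub>W\<^esub> g x)" for f g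
    by (simp_all add: End_ring_def)
  \<comment> \<open>an additive operator fixes zero and respects negatives\<close>
  have s0: "a \<odot>\<^bsub>W\<^esub> \<zero>\<^bsub>W\<^esub> = \<zero>\<^bsub>W\<^esub>" if a: "a \<in> carrier A" for a
    using sa[OF a W.zero_closed W.zero_closed] sc[OF a W.zero_closed] by (metis W.add.r_cancel_one' W.r_zero W.zero_closed)
  have sm: "a \<odot>\<^bsub>W\<^esub> (\<ominus>\<^bsub>W\<^esub> x) = \<ominus>\<^bsub>W\<^esub> (a \<odot>\<^bsub>W\<^esub> x)" if a: "a \<in> carrier A" and x: "x \<in> carrier W" for a x
    using sa[OF a W.a_inv_closed[OF x] x] s0[OF a] sc[OF a] x by (metis W.a_inv_closed W.l_neg W.minus_equality)
  have ext: "f = g" if "f \<in> carrier ?E" "g \<in> carrier ?E" "\<And>x. x \<in> carrier W \<Longrightarrow> f x = g x" for f g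
    using that C by (meson extensionalityI)
  have addc: "f \<oplus>\<^bsub>?E\<^esub> g \<in> carrier ?E" if "f \<in> carrier ?E" "g \<in> carrier ?E" for f g
    using that unfolding C s by (auto simp: sc sa W.a_ac)
  have mulc: "f \<otimes>\<^bsub>?E\<^esub> g \<in> carrier ?E" if "f \<in> carrier ?E" "g \<in> carrier ?E" for f g
    using that unfolding C s by (auto simp: compose_def sc)
  have zc: "\<zero>\<^bsub>?E\<^esub> \<in> carrier ?E" unfolding C s by (auto simp: s0 sc)
  have oc: "\<one>\<^bsub>?E\<^esub> \<in> carrier ?E" unfolding C s by (auto simp: sc)
  show ?thesis
  proof (rule ringI)
    show "abelian_group ?E"
    proof (rule abelian_groupI)
      fix f assume f: "f \<in> carrier ?E"
      let ?m = "\<lambda>x\<in>carrier W. \<ominus>\<^bsub>W\<^esub> f x"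
      have m: "?m \<in> carrier ?E" using f unfolding C by (auto simp: sc sm W.minus_add)
      have "?m \<oplus>\<^bsub>?E\<^esub> f = \<zero>\<^bsub>?E\<^esub>"
        by (rule ext[OF addc[OF m f] zc]) (use f in \<open>auto simp: s C W.l_neg\<close>)
      then show "\<exists>g\<in>carrier ?E. g \<oplus>\<^bsub>?E\<^esub> f = \<zero>\<^bsub>?E\<^esub>" using m by blast
      show "\<zero>\<^bsub>?E\<^esub> \<oplus>\<^bsub>?E\<^esub> f = f" by (rule ext[OF addc[OF zc f] f]) (use f in \<open>auto simp: s C\<close>)
      fix g assume g: "g \<in> carrier ?E"
      show "f \<oplus>\<^bsub>?E\<^esub> g = g \<oplus>\<^bsub>?E\<^esub> f"
        by (rule ext[OF addc[OF f g] addc[OF g f]]) (use f g in \<open>auto simp: s C W.a_comm\<close>)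
      fix h assume h: "h \<in> carrier ?E"
      show "f \<oplus>\<^bsub>?E\<^esub> g \<oplus>\<^bsub>?E\<^esub> h = f \<oplus>\<^bsub>?E\<^esub> (g \<oplus>\<^bsub>?E\<^esub> h)"
        by (rule ext[OF addc[OF addc[OF f g] h] addc[OF f addc[OF g h]]])
          (use f g h in \<open>auto simp: s C W.a_assoc\<close>)
    qed (simp_all add: addc zc)
    show "Group.monoid ?E"
    proof (rule monoidI)
      fix f assume f: "f \<in> carrier ?E"
      show "\<one>\<^bsub>?E\<^esub> \<otimes>\<^bsub>?E\<^esub> f = f"
        by (rule ext[OF mulc[OF oc f] f]) (use f in \<open>auto simp: s C compose_def\<close>)
      show "f \<otimes>\<^bsub>?E\<^esub> \<one>\<^bsub>?E\<^esub> = f"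
        by (rule ext[OF mulc[OF f oc] f]) (use f in \<open>auto simp: s C compose_def\<close>)
      fix g h assume g: "g \<in> carrier ?E" and h: "h \<in> carrier ?E"
      show "f \<otimes>\<^bsub>?E\<^esub> g \<otimes>\<^bsub>?E\<^esub> h = f \<otimes>\<^bsub>?E\<^esub> (g \<otimes>\<^bsub>?E\<^esub> h)"
        by (rule ext[OF mulc[OF mulc[OF f g] h] mulc[OF f mulc[OF g h]]])
          (use f g h in \<open>auto simp: s C compose_def\<close>)
    qed (simp_all add: mulc oc)
    fix f g h assume f: "f \<in> carrier ?E" and g: "g \<in> carrier ?E" and h: "h \<in> carrier ?E"
    show "(f \<oplus>\<^bsub>?E\<^esub> g) \<otimes>\<^bsub>?E\<^esub> h = f \<otimes>\<^bsub>?E\<^esub> h \<oplus>\<^bsub>?E\<^esub> g \<otimes>\<^bsub>?E\<^esub> h"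
      by (rule ext[OF mulc[OF addc[OF f g] h] addc[OF mulc[OF f h] mulc[OF g h]]])
        (use f g h in \<open>auto simp: s C compose_def\<close>)
    show "h \<otimes>\<^bsub>?E\<^esub> (f \<oplus>\<^bsub>?E\<^esub> g) = h \<otimes>\<^bsub>?E\<^esub> f \<oplus>\<^bsub>?E\<^esub> h \<otimes>\<^bsub>?E\<^esub> g"
      by (rule ext[OF mulc[OF h addc[OF f g]] addc[OF mulc[OF h f] mulc[OF h g]]])
        (use f g h in \<open>auto simp: s C compose_def\<close>)
  qed
qed

lemma with_action_abelian_group:
  fixes W :: "('u, 'w) module" and act :: "'v \<Rightarrow> 'w \<Rightarrow> 'w"
  assumes "abelian_group W"
  shows "abelian_group (with_action W act)"
proof -
  interpret W: abelian_group W by (rule assms)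
  show ?thesis
    by (rule abelian_groupI)
      (auto simp: with_action_def W.a_ac intro: W.l_neg bexI[of _ "\<ominus>\<^bsub>W\<^esub> _"])
qed

lemma End_ring_left_module:
  fixes A :: "('u, 'b) ring_scheme" and W :: "('u, 'w) module"
  assumes W: "abelian_group W" and Q: "ring Q" and \<Phi>: "\<Phi> \<in> ring_hom Q (End_ring A W)"
  shows "left_module Q (with_action W \<Phi>)"
proof -
  interpret W: abelian_group W by (rule W)
  interpret Q: ring Q by (rule Q)
  have c: "\<Phi> q x \<in> carrier W" if "q \<in> carrier Q" "x \<in> carrier W" for q x
    using ring_hom_closed[OF \<Phi> that(1)] that(2) by (auto simp: End_ring_def linear_maps_def)
  have a: "\<Phi> q (x \<oplus>\<^bsub>W\<^esub> y) = \<Phi> q x \<oplus>\<^bsub>W\<^esub> \<Phi> q y" if "q \<in> carrier Q" "x \<in> carrier W" "y \<in> carrier W" for q x y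
    using ring_hom_closed[OF \<Phi> that(1)] that(2,3) by (auto simp: End_ring_def linear_maps_def)
  have ag: "abelian_group (with_action W \<Phi>)" by (rule with_action_abelian_group[OF W])
  show ?thesis
    unfolding left_module_def left_module_axioms_def
    using Q ag c a ring_hom_add[OF \<Phi>] ring_hom_mult[OF \<Phi>] ring_hom_one[OF \<Phi>]
    by (auto simp: with_action_def End_ring_def compose_def)
qed

section \<open>The centre and the endomorphisms of a tensor product\<close>

context h_algebra
begin

lemma center_iff: "z \<in> carrier (center U) \<longleftrightarrow> z \<in> carrier U \<and> (\<forall>a\<in>carrier U. z \<otimes>\<^bsub>U\<^esub> a = a \<otimes>\<^bsub>U\<^esub> z)"
  by (simp add: center_def)

lemma center_simps:
  "\<one>\<^bsub>center U\<^esub> = \<one>\<^bsub>U\<^esub>" "\<zero>\<^bsub>center U\<^esub> = \<zero>\<^bsub>U\<^esub>" "x \<oplus>\<^bsub>center U\<^esub> y = x \<oplus>\<^bsub>U\<^esub> y" "x \<otimes>\<^bsub>center U\<^esub> y = x \<otimes>\<^bsub>U\<^esub> y"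
  by (simp_all add: center_def)

lemma center_ring: "ring (center U)"
proof -
  interpret U: ring U by (rule ring)
  let ?Z = "{z \<in> carrier U. \<forall>a\<in>carrier U. z \<otimes>\<^bsub>U\<^esub> a = a \<otimes>\<^bsub>U\<^esub> z}"
  have "subring ?Z U"
  proof (rule U.subringI)
    fix x y assume x: "x \<in> ?Z" and y: "y \<in> ?Z"
    then have c: "x \<in> carrier U" "y \<in> carrier U" by auto
    have xc: "x \<otimes>\<^bsub>U\<^esub> a = a \<otimes>\<^bsub>U\<^esub> x" and yc: "y \<otimes>\<^bsub>U\<^esub> a = a \<otimes>\<^bsub>U\<^esub> y" if "a \<in> carrier U" for a
      using x y that by blast+
    have "x \<otimes>\<^bsub>U\<^esub> y \<otimes>\<^bsub>U\<^esub> a = a \<otimes>\<^bsub>U\<^esub> (x \<otimes>\<^bsub>U\<^esub> y)" if a: "a \<in> carrier U" for a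
      using U.m_assoc[OF c a] U.m_assoc[OF c(1) a c(2)] U.m_assoc[OF a c] xc[OF a] yc[OF a] by simp
    then show "x \<otimes>\<^bsub>U\<^esub> y \<in> ?Z" using c by simp
    have "(x \<oplus>\<^bsub>U\<^esub> y) \<otimes>\<^bsub>U\<^esub> a = a \<otimes>\<^bsub>U\<^esub> (x \<oplus>\<^bsub>U\<^esub> y)" if a: "a \<in> carrier U" for a
      unfolding U.l_distr[OF c a] U.r_distr[OF c a] xc[OF a] yc[OF a] ..
    then show "x \<oplus>\<^bsub>U\<^esub> y \<in> ?Z" using c by simp
    have "\<ominus>\<^bsub>U\<^esub> x \<otimes>\<^bsub>U\<^esub> a = a \<otimes>\<^bsub>U\<^esub> \<ominus>\<^bsub>U\<^esub> x" if a: "a \<in> carrier U" for a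
      using xc[OF a] c a by (simp only: U.l_minus U.r_minus)
    then show "\<ominus>\<^bsub>U\<^esub> x \<in> ?Z" using c by simp
  qed auto
  then show ?thesis unfolding center_def by (rule U.subring_is_ring)
qed

end

context hopf_algebra
begin

abbreviation EndU where "EndU Ns \<equiv> End_ring U (tensor_umodule U \<Delta> \<epsilon> Ns)"

lemma tensor_umodule_simps:
  "carrier (tensor_umodule U \<Delta> \<epsilon> Ns) = tensors (ks Ns)"
  "x \<oplus>\<^bsub>tensor_umodule U \<Delta> \<epsilon> Ns\<^esub> y = x \<oplus>\<^bsub>ctensor (ks Ns)\<^esub> y"
  "a \<odot>\<^bsub>tensor_umodule U \<Delta> \<epsilon> Ns\<^esub> x = act Ns a x"
  by (simp_all add: tensor_umodule_def with_action_def act_def)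

lemma tensor_umodule_abelian_group: "umods Ns \<Longrightarrow> abelian_group (tensor_umodule U \<Delta> \<epsilon> Ns)"
  unfolding tensor_umodule_def
  by (rule with_action_abelian_group[OF kmod_abelian_group[OF complete_kmod_kmod[OF ctensor_complete[OF umods_kmods]]]])

lemma EndU_ring: "umods Ns \<Longrightarrow> ring (EndU Ns)"
  by (rule End_ring_ring[OF tensor_umodule_abelian_group])
    (simp_all add: tensor_umodule_simps act_closed lin_add[OF act_lin2])

lemma EndU_mem: "ulin Ns Ns f \<Longrightarrow> f \<in> extensional (tensors (ks Ns)) \<Longrightarrow> f \<in> carrier (EndU Ns)"
  by (auto simp: End_ring_def linear_maps_def tensor_umodule_simps ulin_def)

lemma EndU_simps:
  "f \<otimes>\<^bsub>EndU Ns\<^esub> g = compose (tensors (ks Ns)) f g"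
  "\<one>\<^bsub>EndU Ns\<^esub> = (\<lambda>x\<in>tensors (ks Ns). x)"
  "f \<oplus>\<^bsub>EndU Ns\<^esub> g = (\<lambda>x\<in>tensors (ks Ns). f x \<oplus>\<^bsub>ctensor (ks Ns)\<^esub> g x)"
  by (simp_all add: End_ring_def tensor_umodule_simps)

lemma EndU_closed: "f \<in> carrier (EndU Ns) \<Longrightarrow> w \<in> tensors (ks Ns) \<Longrightarrow> f w \<in> tensors (ks Ns)"
  by (auto simp: End_ring_def linear_maps_def tensor_umodule_simps)

lemma EndU_ext: "f \<in> carrier (EndU Ns) \<Longrightarrow> f \<in> extensional (tensors (ks Ns))"
  by (auto simp: End_ring_def tensor_umodule_simps)

lemma EndU_eqI:
  assumes "f \<in> carrier (EndU Ns)" "g \<in> carrier (EndU Ns)" "\<And>w. w \<in> tensors (ks Ns) \<Longrightarrow> f w = g w"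
  shows "f = g"
  by (rule extensionalityI[OF EndU_ext[OF assms(1)] EndU_ext[OF assms(2)] assms(3)])

lemma EndU_mult_apply: "w \<in> tensors (ks Ns) \<Longrightarrow> (f \<otimes>\<^bsub>EndU Ns\<^esub> g) w = f (g w)"
  by (simp add: EndU_simps compose_def)

lemma EndU_foldr:
  assumes Ns: "umods Ns" and \<phi>: "\<And>s. s \<in> set u \<Longrightarrow> \<phi> s \<in> carrier (EndU Ns)"
  shows "foldr (\<lambda>s x. \<phi> s \<otimes>\<^bsub>EndU Ns\<^esub> x) u \<one>\<^bsub>EndU Ns\<^esub> \<in> carrier (EndU Ns) \<and>
    (\<forall>w\<in>tensors (ks Ns). foldr (\<lambda>s x. \<phi> s \<otimes>\<^bsub>EndU Ns\<^esub> x) u \<one>\<^bsub>EndU Ns\<^esub> w = foldr \<phi> u w)"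
  using \<phi>
proof (induction u)
  case Nil
  interpret E: ring "EndU Ns" by (rule EndU_ring[OF Ns])
  show ?case
  proof (intro conjI ballI)
    show "foldr (\<lambda>s x. \<phi> s \<otimes>\<^bsub>EndU Ns\<^esub> x) [] \<one>\<^bsub>EndU Ns\<^esub> \<in> carrier (EndU Ns)"
      using E.one_closed by simp
  qed (simp add: EndU_simps)
next
  case (Cons s u)
  interpret E: ring "EndU Ns" by (rule EndU_ring[OF Ns])
  have IH: "foldr (\<lambda>s x. \<phi> s \<otimes>\<^bsub>EndU Ns\<^esub> x) u \<one>\<^bsub>EndU Ns\<^esub> \<in> carrier (EndU Ns)"
    "\<forall>w\<in>tensors (ks Ns). foldr (\<lambda>s x. \<phi> s \<otimes>\<^bsub>EndU Ns\<^esub> x) u \<one>\<^bsub>EndU Ns\<^esub> w = foldr \<phi> u w"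
    using Cons.IH Cons.prems by simp_all
  have s: "\<phi> s \<in> carrier (EndU Ns)" using Cons.prems by simp
  show ?case using E.m_closed[OF s IH(1)] IH(2) by (simp add: EndU_mult_apply)
qed

text \<open>The inverse of a \<open>U\<close>-linear bijection is again \<open>U\<close>-linear, and \<open>id \<otimes> _ \<otimes> id\<close> preserves
  composition.\<close>

lemma idt_Units:
  assumes A: "left_module U A" and B: "left_module U B" and As: "umods As" and Cs: "umods Cs"
    and f: "f \<in> tlin [rs A, rs B] [rs A, rs B]"
    and c: "\<And>a w. a \<in> carrier U \<Longrightarrow> w \<in> tensors [rs A, rs B] \<Longrightarrow>
      f (fw [A, B] (\<Delta> a) w) = fw [A, B] (\<Delta> a) (f w)"
    and g: "g \<in> tlin [rs A, rs B] [rs A, rs B]"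
    and fg: "\<And>w. w \<in> tensors [rs A, rs B] \<Longrightarrow> f (g w) = w"
    and gf: "\<And>w. w \<in> tensors [rs A, rs B] \<Longrightarrow> g (f w) = w"
    and Ns: "Ns = As @ A # B # Cs"
  shows "idt (ks As) [rs A, rs B] [rs A, rs B] (ks Cs) f \<in> Units (EndU Ns)"
proof -
  note KA = umods_kmods[OF As] and KC = umods_kmods[OF Cs] and KAB = AB_kmods(1)[OF A B]
  have U: "umods Ns" using As A B Cs by (simp add: Ns umods_simps)
  have W: "ctensor (ks Ns) = ctensor (ks As @ [rs A, rs B] @ ks Cs)" by (simp add: Ns)
  let ?F = "idt (ks As) [rs A, rs B] [rs A, rs B] (ks Cs)"
  have mem: "?F f \<in> carrier (EndU Ns)"
    if "f \<in> tlin [rs A, rs B] [rs A, rs B]"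
      "\<And>a w. a \<in> carrier U \<Longrightarrow> w \<in> tensors [rs A, rs B] \<Longrightarrow>
      f (fw [A, B] (\<Delta> a) w) = fw [A, B] (\<Delta> a) (f w)" for f
  proof (rule EndU_mem)
    have "ulin [A, B] [A, B] f" using that by (simp add: ulin_def act_pair)
    then show "ulin Ns Ns (?F f)" using ulin_idt[OF As AB_kmods(3,3)[OF A B] Cs, of f] by (simp add: Ns)
  qed (use idt_extensional[OF KA KAB KAB KC that(1)] in \<open>simp add: Ns\<close>)
  have cg: "g (fw [A, B] (\<Delta> a) w) = fw [A, B] (\<Delta> a) (g w)"
    if a: "a \<in> carrier U" and w: "w \<in> tensors [rs A, rs B]" for a w
  proof -
    note gw = lin_closed[OF g w]
    have "g (fw [A, B] (\<Delta> a) w) = g (f (fw [A, B] (\<Delta> a) (g w)))"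
      using c[OF a gw] fg[OF w] by simp
    also have "\<dots> = fw [A, B] (\<Delta> a) (g w)"
      by (rule gf[OF fw2_closed[OF A B Delta_closed[OF a] gw]])
    finally show ?thesis .
  qed
  interpret E: ring "EndU Ns" by (rule EndU_ring[OF U])
  have inv: "?F f \<otimes>\<^bsub>EndU Ns\<^esub> ?F g = \<one>\<^bsub>EndU Ns\<^esub>"
    if f: "f \<in> tlin [rs A, rs B] [rs A, rs B]" and g: "g \<in> tlin [rs A, rs B] [rs A, rs B]"
      and m: "?F f \<in> carrier (EndU Ns)" "?F g \<in> carrier (EndU Ns)"
      and fg: "\<And>w. w \<in> tensors [rs A, rs B] \<Longrightarrow> f (g w) = w" for f g
  proof (rule EndU_eqI[OF E.m_closed[OF m] E.one_closed])
    fix w assume w: "w \<in> tensors (ks Ns)"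
    note w' = w[unfolded W]
    have "?F f (?F g w) = ?F (\<lambda>y. f (g y)) w" by (rule idt_comp[OF KA KAB KAB KAB KC g f w'])
    also have "\<dots> = ?F (\<lambda>y. y) w" by (rule fun_cong[OF idt_cong[OF KAB fg]])
    also have "\<dots> = w" by (rule idt_ident[OF KA KAB KC w'])
    finally show "(?F f \<otimes>\<^bsub>EndU Ns\<^esub> ?F g) w = \<one>\<^bsub>EndU Ns\<^esub> w" using w by (simp add: EndU_simps compose_def)
  qed
  note mf = mem[OF f c] and mg = mem[OF g cg]
  show ?thesis unfolding Units_def
    using mf mg inv[OF f g mf mg fg] inv[OF g f mg mf gf] by blast
qed

text \<open>Acting by \<open>u\<close> on the first factor alone is the factorwise action of \<open>u \<otimes> 1 \<otimes> \<dots> \<otimes> 1\<close>. The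
  properties of the central operators thereby become statements about multiplication in the tensor
  power of \<open>U\<close>.\<close>

lemma idt_fw_first:
  assumes N: "left_module U N" and Cs: "umods Cs" and u: "u \<in> carrier U" and w: "w \<in> tensors (rs N # ks Cs)"
  shows "idt [] [rs N] [rs N] (ks Cs) (fw [N] (pure [U] [u])) w =
    fw (N # Cs) (pure (U # rep (length Cs)) (u # replicate (length Cs) \<one>\<^bsub>U\<^esub>)) w"
proof -
  have K: "kmods [rs N]" and N1: "umods [N]" and NC: "umods (N # Cs)" using rs_kmod[OF N] N Cs by (simp_all add: umods_simps)
  note KC = umods_kmods[OF Cs]
  have KNC: "kmods (rs N # ks Cs)" using K KC by simp
  note p = pureU_closed[OF u]
  let ?o = "replicate (length Cs) \<one>\<^bsub>U\<^esub>"
  have o: "?o \<in> tuples (rep (length Cs))" unfolding tuples_rep by simp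
  have uo: "u # ?o \<in> tuples (U # rep (length Cs))" using u o by (simp add: set_Cons_def)
  have "kmods (U # rep (length Cs))" by simp
  note po = pure_closed[OF this uo]
  have l: "fw [N] (pure [U] [u]) \<in> tlin [rs N] [rs N]"
    using fw_lin2[OF N1, of "pure [U] [u]"] p by simp
  show ?thesis
  proof (rule juxt_ext[where As = "[rs N]" and Bs = "ks Cs", unfolded append_Cons append_Nil, OF K KC ctensor_complete[OF KNC]
        idt_lin_right[OF K K KC l, simplified]])
    show "fw (N # Cs) (pure (U # rep (length Cs)) (u # ?o)) \<in> tlin (rs N # ks Cs) (rs N # ks Cs)"
      using fw_lin2[OF NC, simplified] po by simp
    fix as cs assume as: "as \<in> tuples [rs N]" and cs: "cs \<in> tuples (ks Cs)"
    note x = pure_closed[OF K as] and y = pure_closed[OF KC cs]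
    show "idt [] [rs N] [rs N] (ks Cs) (fw [N] (pure [U] [u]))
        (juxtapose [rs N] (ks Cs) (pure [rs N] as) (pure (ks Cs) cs)) =
      fw (N # Cs) (pure (U # rep (length Cs)) (u # ?o)) (juxtapose [rs N] (ks Cs) (pure [rs N] as) (pure (ks Cs) cs))"
      unfolding idt_juxt_right[OF K K KC l x y]
      using fw_juxt[OF N1 Cs, of "pure [U] [u]" "pure (rep (length Cs)) ?o"] x y p pure_closed[OF rep_kmods o] fw_one[OF Cs y]
        juxt_pure[OF UU_kmods(1) rep_kmods tuples_smallI(1)[OF u] o]
      by (simp del: listset.simps)
  qed (use w in simp)
qed

lemma idt_fw_last:
  assumes A: "left_module U A" and N: "left_module U N" and u: "u \<in> carrier U" and w: "w \<in> tensors [rs A, rs N]"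
  shows "idt [rs A] [rs N] [rs N] [] (fw [N] (pure [U] [u])) w =
    fw [A, N] (pure [U, U] [\<one>\<^bsub>U\<^esub>, u]) w"
proof -
  have K: "kmods [rs A]" "kmods [rs N]" "umods [A]" "umods [N]" using rs_kmod A N by (auto simp: umods_simps)
  note p = pureU_closed[OF u] pureU_closed[OF one_closed]
  have l: "fw [N] (pure [U] [u]) \<in> tlin [rs N] [rs N]"
    using fw_lin2[OF K(4), of "pure [U] [u]"] p by simp
  show ?thesis
  proof (rule juxt_ext[where As = "[rs A]" and Bs = "[rs N]", unfolded append_Cons append_Nil, OF K(1,2) AB_kmods(2)[OF A N]
        idt_lin_left[OF K(1,2,2) l, simplified] fw2_lin2[OF A N pureUU_closed[OF one_closed u]]])
    fix as bs assume as: "as \<in> tuples [rs A]" and bs: "bs \<in> tuples [rs N]"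
    note x = pure_closed[OF K(1) as] and y = pure_closed[OF K(2) bs]
    show "idt [rs A] [rs N] [rs N] [] (fw [N] (pure [U] [u]))
        (juxtapose [rs A] [rs N] (pure [rs A] as) (pure [rs N] bs)) =
      fw [A, N] (pure [U, U] [\<one>\<^bsub>U\<^esub>, u]) (juxtapose [rs A] [rs N] (pure [rs A] as) (pure [rs N] bs))"
      unfolding idt_juxt_left[OF K(1,2,2) l x y]
      using fw_juxt[OF K(3,4), of "pure [U] [\<one>\<^bsub>U\<^esub>]" "pure [U] [u]"] x y p fw_one[OF K(3), of "pure [rs A] as"]
        juxt_pure[OF UU_kmods(1,1) tuples_smallI(1)[OF one_closed] tuples_smallI(1)[OF u]]
      by (simp del: listset.simps)
  qed (use w in simp)
qed

lemma tmult_central: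
  assumes us: "us \<in> tuples (rep n)" and c: "\<And>u. u \<in> set us \<Longrightarrow> u \<in> carrier (center U)" and t: "t \<in> tensors (rep n)"
  shows "tensor_mult U n (pure (rep n) us) t = tensor_mult U n t (pure (rep n) us)"
proof (rule ctensor_ext[OF rep_kmods ctensor_complete[OF rep_kmods] bilinD2[OF tmult_bilin pure_closed[OF rep_kmods us]]
      bilinD1[OF tmult_bilin pure_closed[OF rep_kmods us]] _ t])
  fix vs assume vs: "vs \<in> tuples (rep n)"
  have "us ! i \<otimes>\<^bsub>U\<^esub> a = a \<otimes>\<^bsub>U\<^esub> us ! i" if "i < length us" "a \<in> carrier U" for i a
    using c[OF nth_mem[OF that(1)]] that(2) by (simp add: center_iff)
  then have "map2 (monoid.mult U) us vs = map2 (monoid.mult U) vs us"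
    using us vs unfolding tuples_rep by (intro nth_equalityI) auto
  then show "tensor_mult U n (pure (rep n) us) (pure (rep n) vs) = tensor_mult U n (pure (rep n) vs) (pure (rep n) us)"
    unfolding tmult_pure[OF us vs] tmult_pure[OF vs us] by (simp only:)
qed

lemma one_central: "\<one>\<^bsub>U\<^esub> \<in> carrier (center U)"
  using ring.ring_simprules(6)[OF center_ring] by (simp add: center_simps)

lemma central_hom:
  fixes M :: "('u, 'a) module"
  assumes M: "left_module U M" and Vs: "umods Vs"
  shows "(\<lambda>z. idt [] [rs M] [rs M] (ks Vs) (fw [M] (pure [U] [z])))
    \<in> ring_hom (center U) (EndU (M # Vs))" (is "?F \<in> _")
proof -
  let ?Ns = "M # Vs" and ?n = "length Vs"
  let ?T = "ctensor (ks ?Ns)"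
  define o' where "o' = replicate ?n \<one>\<^bsub>U\<^esub>"
  let ?p = "\<lambda>z. pure (rep (Suc ?n)) (z # o')"
  have o': "o' \<in> tuples (rep ?n)" unfolding tuples_rep o'_def by simp
  have K: "kmods [rs M]" "kmods []" and Ns: "umods ?Ns" and M1: "umods [M]"
    using rs_kmod[OF M] M Vs by (simp_all add: umods_simps)
  note KV = umods_kmods[OF Vs]
  interpret E: ring "EndU ?Ns" by (rule EndU_ring[OF Ns])
  interpret C: ring "center U" by (rule center_ring)
  have U: "z \<in> carrier U" if "z \<in> carrier (center U)" for z using that by (simp add: center_iff)
  have F: "?F z w = fw ?Ns (?p z) w" if "z \<in> carrier (center U)" "w \<in> carrier ?T" for z w
    using idt_fw_first[OF M Vs U[OF that(1)]] that(2) by (simp add: o'_def)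
  have t: "z # o' \<in> tuples (rep (Suc ?n))" if "z \<in> carrier (center U)" for z
    using U[OF that] o' by (simp add: set_Cons_def)
  note p = pure_closed[OF rep_kmods t]
  have mult: "tensor_mult U (Suc ?n) (?p z) (?p y) = ?p (z \<otimes>\<^bsub>U\<^esub> y)" if "z \<in> carrier (center U)" "y \<in> carrier (center U)" for z y
    using tmult_pure[OF t[OF that(1)] t[OF that(2)]] by (simp add: o'_def zip_replicate monoid.l_one[OF ring.is_monoid[OF ring]])
  note fm = fw_mult[OF Ns, unfolded list.size add_0_right add_Suc_right]
  have mem: "?F z \<in> carrier (EndU ?Ns)" if z: "z \<in> carrier (center U)" for z
  proof (rule EndU_mem)
    have l: "fw [M] (pure [U] [z]) \<in> tlin [rs M] [rs M]"
      using fw_lin2[OF M1, of "pure [U] [z]"] pureU_closed[OF U[OF z]] by simp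
    have c: "fw ?Ns (?p z) (act ?Ns a w) = act ?Ns a (fw ?Ns (?p z) w)"
      if a: "a \<in> carrier U" and w: "w \<in> carrier ?T" for a w
      unfolding act_def list.size add_0_right add_Suc_right
        fm[OF p[OF z] itc_closed[OF a] w, symmetric] fm[OF itc_closed[OF a] p[OF z] w, symmetric]
      by (subst tmult_central[OF t[OF z] _ itc_closed[OF a]]) (use z one_central in \<open>auto simp: o'_def\<close>)
    show "ulin ?Ns ?Ns (?F z)"
      using idt_lin_right[OF K(1,1) KV l] c act_closed[OF Ns] by (simp add: ulin_def F z)
    show "?F z \<in> extensional (carrier ?T)" using idt_extensional[OF K(2,1,1) KV l] by simp
  qed
  show ?thesis
  proof (rule ring_hom_memI)
    fix z y assume z: "z \<in> carrier (center U)" and y: "y \<in> carrier (center U)"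
    show "?F z \<in> carrier (EndU ?Ns)" by (rule mem[OF z])
    note zy = C.m_closed[OF z y, unfolded center_simps] C.a_closed[OF z y, unfolded center_simps]
    note Fc = EndU_closed[OF mem]
    show "?F (z \<otimes>\<^bsub>center U\<^esub> y) = ?F z \<otimes>\<^bsub>EndU ?Ns\<^esub> ?F y"
      unfolding center_simps
    proof (rule EndU_eqI[OF mem[OF zy(1)] E.m_closed[OF mem[OF z] mem[OF y]]])
      fix w assume w: "w \<in> carrier ?T"
      show "?F (z \<otimes>\<^bsub>U\<^esub> y) w = (?F z \<otimes>\<^bsub>EndU ?Ns\<^esub> ?F y) w"
        unfolding EndU_mult_apply[OF w] F[OF z Fc[OF y w]]
        unfolding F[OF y w] F[OF zy(1) w] mult[OF z y, symmetric]
        by (rule fm[OF p[OF z] p[OF y] w])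
    qed
    show "?F (z \<oplus>\<^bsub>center U\<^esub> y) = ?F z \<oplus>\<^bsub>EndU ?Ns\<^esub> ?F y"
      unfolding center_simps
    proof (rule EndU_eqI[OF mem[OF zy(2)] E.a_closed[OF mem[OF z] mem[OF y]]])
      fix w assume w: "w \<in> carrier ?T"
      have "multilin (U # rep ?n) (ctensor (U # rep ?n)) (pure (U # rep ?n))" by (rule pure_multilin) simp
      then have "?p \<in> lin U (ctensor (rep (Suc ?n)))"
        using o' unfolding multilin_Cons[OF U_kmod] replicate_Suc by blast
      from lin_add[OF lin_comp[OF this fw_lin1[OF Ns w, unfolded list.size add_0_right add_Suc_right]] U[OF z] U[OF y]]
      show "?F (z \<oplus>\<^bsub>U\<^esub> y) w = (?F z \<oplus>\<^bsub>EndU ?Ns\<^esub> ?F y) w"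
        using w by (simp add: EndU_simps F z y zy)
    qed
  next
    show "?F \<one>\<^bsub>center U\<^esub> = \<one>\<^bsub>EndU ?Ns\<^esub>"
      unfolding center_simps
    proof (rule EndU_eqI[OF mem[OF one_central] E.one_closed])
      fix w assume w: "w \<in> carrier ?T"
      show "?F \<one>\<^bsub>U\<^esub> w = \<one>\<^bsub>EndU ?Ns\<^esub> w"
        using fw_one[OF Ns w] w by (simp add: F[OF one_central w] o'_def EndU_simps)
    qed
  qed
qed

end

section \<open>Relations between braidings\<close>

context quasitriangular_hopf_algebra
begin

text \<open>The elements \<open>z \<otimes> 1\<close> and \<open>1 \<otimes> z\<close> commute with \<open>R\<close>, and the flip exchanges them. So the
  action of \<open>z\<close> on a module follows that module through the braiding.\<close>

lemma braiding_center:
  assumes A: "left_module U A" and B: "left_module U B" and z: "z \<in> carrier (center U)"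
    and w: "w \<in> tensors [rs A, rs B]"
  shows "Rc R A B (idt [] [rs A] [rs A] [rs B] (fw [A] (pure [U] [z])) w) =
      idt [rs B] [rs A] [rs A] [] (fw [A] (pure [U] [z])) (Rc R A B w)"
    and "Rc R A B (idt [rs A] [rs B] [rs B] [] (fw [B] (pure [U] [z])) w) =
      idt [] [rs B] [rs B] [rs A] (fw [B] (pure [U] [z])) (Rc R A B w)"
proof -
  have zU: "z \<in> carrier U" using z by (simp add: center_iff)
  note Rw = Rc_closed[OF A B R_closed w]
  have slide: "Rc R A B (fw [A, B] (pure [U, U] [s, t]) w) =
      fw [B, A] (pure [U, U] [t, s]) (Rc R A B w)"
    if s: "s \<in> carrier (center U)" and t: "t \<in> carrier (center U)" for s t
  proof -
    have st: "s \<in> carrier U" "t \<in> carrier U" using s t by (simp_all add: center_iff)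
    have "tensor_mult U 2 (pure (rep 2) [s, t]) R = tensor_mult U 2 R (pure (rep 2) [s, t])"
      by (rule tmult_central) (use s t st R_closed in \<open>auto simp: rep_simps set_Cons_def\<close>)
    then show ?thesis
      using Rc_mult_right[OF A B R_closed pureUU_closed[OF st] w] Rc_mult_left[OF A B pureUU_closed[OF st] R_closed w]
      by (simp add: rep_simps flip_pure[OF st])
  qed
  have Cs: "umods [A]" "umods [B]" using A B by (simp_all add: umods_simps)
  show "Rc R A B (idt [] [rs A] [rs A] [rs B] (fw [A] (pure [U] [z])) w) =
      idt [rs B] [rs A] [rs A] [] (fw [A] (pure [U] [z])) (Rc R A B w)"
    using idt_fw_first[OF A Cs(2) zU] idt_fw_last[OF B A zU Rw] slide[OF z one_central] w by simp
  show "Rc R A B (idt [rs A] [rs B] [rs B] [] (fw [B] (pure [U] [z])) w) =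
      idt [] [rs B] [rs B] [rs A] (fw [B] (pure [U] [z])) (Rc R A B w)"
    using idt_fw_first[OF B Cs(1) zU] idt_fw_last[OF A B zU w] slide[OF one_central z] Rw by simp
qed

text \<open>Let \<open>a1, a2\<close> move \<open>V\<close> before \<open>M\<close> in the two places, let \<open>b1, b2\<close> move it back, and let
  \<open>t'\<close> be the braiding of the two copies of \<open>V\<close> once both precede \<open>M\<close>. Then \<open>x = b1 \<circ> a1\<close>, and the
  Yang-Baxter equations for the three positions of \<open>M\<close> bring both sides to
  \<open>b1 \<circ> b2 \<circ> t' \<circ> t' \<circ> a2 \<circ> a1\<close>.\<close>

lemma reflection_equation:
  assumes M: "left_module U M" and V: "left_module U V" and w: "w \<in> tensors [rs M, rs V, rs V]"
  defines "x \<equiv> idt [] [rs M, rs V] [rs M, rs V] [rs V] (\<lambda>y. Rc R V M (Rc R M V y))"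
    and "t \<equiv> idt [rs M] [rs V, rs V] [rs V, rs V] [] (Rc R V V)"
  shows "x (t (x (t w))) = t (x (t (x w)))"
proof -
  note l = Rc_lin[OF _ _ R_closed]
  have K: "kmods [rs M]" "kmods [rs V]" "kmods []" using rs_kmod M V by auto
  note KMV = AB_kmods(1)[OF M V] and KVM = AB_kmods(1)[OF V M] and KVV = AB_kmods(1)[OF V V]
  define a1 where "a1 = idt [] [rs M, rs V] [rs V, rs M] [rs V] (Rc R M V)"
  define b1 where "b1 = idt [] [rs V, rs M] [rs M, rs V] [rs V] (Rc R V M)"
  define a2 where "a2 = idt [rs V] [rs M, rs V] [rs V, rs M] [] (Rc R M V)"
  define b2 where "b2 = idt [rs V] [rs V, rs M] [rs M, rs V] [] (Rc R V M)"
  define t' where "t' = idt [] [rs V, rs V] [rs V, rs V] [rs M] (Rc R V V)"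
  have a1l: "a1 \<in> tlin [rs M, rs V, rs V] [rs V, rs M, rs V]"
    unfolding a1_def using idt_lin_right[OF KMV KVM K(2) l[OF M V]] by simp
  have b1l: "b1 \<in> tlin [rs V, rs M, rs V] [rs M, rs V, rs V]"
    unfolding b1_def using idt_lin_right[OF KVM KMV K(2) l[OF V M]] by simp
  have a2l: "a2 \<in> tlin [rs V, rs M, rs V] [rs V, rs V, rs M]"
    unfolding a2_def using idt_lin_left[OF K(2) KMV KVM l[OF M V]] by simp
  have tl: "t \<in> tlin [rs M, rs V, rs V] [rs M, rs V, rs V]"
    unfolding t_def using idt_lin_left[OF K(1) KVV KVV l[OF V V]] by simp
  have t'l: "t' \<in> tlin [rs V, rs V, rs M] [rs V, rs V, rs M]"
    unfolding t'_def using idt_lin_right[OF KVV KVV K(1) l[OF V V]] by simp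
  have x: "x y = b1 (a1 y)" if "y \<in> tensors [rs M, rs V, rs V]" for y
    unfolding x_def a1_def b1_def
    by (rule idt_comp[OF K(3) KMV KVM KMV K(2) l[OF M V] l[OF V M], THEN HOL.sym]) (use that in simp)
  have Y1: "t' (a2 (a1 y)) = a2 (a1 (t y))" if "y \<in> tensors [rs M, rs V, rs V]" for y
    unfolding t'_def a2_def a1_def t_def by (rule yang_baxter[OF M V V that])
  have Y2: "a1 (t (b1 y)) = b2 (t' (a2 y))" if "y \<in> tensors [rs V, rs M, rs V]" for y
    unfolding t'_def a2_def a1_def t_def b1_def b2_def by (rule yang_baxter[OF V M V that])
  have Y3: "b1 (b2 (t' y)) = t (b1 (b2 y))" if "y \<in> tensors [rs V, rs V, rs M]" for y
    unfolding t'_def t_def b1_def b2_def by (rule yang_baxter[OF V V M that])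
  note c = lin_closed[OF a1l] lin_closed[OF b1l] lin_closed[OF a2l] lin_closed[OF tl] lin_closed[OF t'l]
  have L: "x (t (x (t w))) = b1 (b2 (t' (t' (a2 (a1 w)))))"
    using w by (simp add: x c Y2 Y1)
  have "t (x (t (x w))) = t (b1 (b2 (t' (a2 (a1 w)))))"
    using w by (simp add: x c Y2)
  also have "\<dots> = b1 (b2 (t' (t' (a2 (a1 w)))))"
    using w by (simp add: c Y3)
  finally show ?thesis using L by simp
qed

end

section \<open>The action of the affine braid group\<close>

context quasitriangular_hopf_algebra
begin

lemma umods_replicate: "left_module U V \<Longrightarrow> umods (replicate n V)"
  by (simp add: umods_def)

lemma replicate_pair: "n = a + b + 2 \<Longrightarrow> replicate a x @ [x, x] @ replicate b x = replicate n x"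
  using replicate_add[of a "b + 2" x] by (simp add: numeral_2_eq_2)

lemma replicate_triple: "n = a + b + 3 \<Longrightarrow> replicate a x @ [x, x, x] @ replicate b x = replicate n x"
  using replicate_add[of a "b + 3" x] by (simp add: numeral_3_eq_3)

context
  fixes M V :: "('u, 'a) module" and k :: nat
  assumes M: "left_module U M" and V: "left_module U V" and k: "k \<ge> 1"
begin

abbreviation (input) Ns where "Ns \<equiv> M # replicate k V"
abbreviation (input) M' where "M' \<equiv> rs M"
abbreviation (input) V' where "V' \<equiv> rs V"
abbreviation (input) \<sigma> where "\<sigma> \<equiv> Rc R V V"
abbreviation (input) \<kappa> where "\<kappa> \<equiv> \<lambda>x. Rc R V M (Rc R M V x)"

definition braid_op :: "braid_gen \<Rightarrow> 'a tensor \<Rightarrow> 'a tensor" where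
  "braid_op s = (case s of
     T i \<Rightarrow> idt (M' # replicate (i - 1) V') [V', V'] [V', V'] (replicate (k - i - 1) V') \<sigma>
   | X1 \<Rightarrow> idt [] [M', V'] [M', V'] (replicate (k - 1) V') \<kappa>)"

definition central_op :: "'u \<Rightarrow> 'a tensor \<Rightarrow> 'a tensor" where
  "central_op z = idt [] [M'] [M'] (replicate k V') (fw [M] (pure [U] [z]))"

lemma MV_kmods: "kmods [M']" "kmods [V']" "kmods (replicate n V')" "kmods (M' # replicate n V')"
    "kmods [M', V']" "kmods [V', M']" "kmods [V', V']" "kmods []" "kmods [V', V', V']" "kmods [M', V', V']"
  using rs_kmod[OF M] rs_kmod[OF V] by auto

lemma \<sigma>_lin: "\<sigma> \<in> tlin [V', V'] [V', V']"
  by (rule Rc_lin[OF V V R_closed])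

lemma \<kappa>_lin: "\<kappa> \<in> tlin [M', V'] [M', V']"
  by (rule lin_comp[OF Rc_lin[OF M V R_closed] Rc_lin[OF V M R_closed]])

lemma umods_Ns: "umods Ns"
  using M umods_replicate[OF V] by (simp add: umods_simps)

lemma split_Ns:
  assumes "i \<in> {1..k - 1}"
  shows "Ns = (M # replicate (i - 1) V) @ V # V # replicate (k - i - 1) V"
proof -
  have "k = (i - 1) + (k - i - 1) + 2" using assms by auto
  from replicate_pair[OF this, of V] show ?thesis by simp
qed

lemma split_Ns1: "Ns = [] @ M # V # replicate (k - 1) V"
  using k by (cases k) auto

lemma braid_op_Units:
  assumes "s \<in> affine_braid_gens k"
  shows "braid_op s \<in> Units (EndU Ns)"
proof (cases s)
  case X1
  obtain g where g: "g \<in> tlin [V', M'] [M', V']"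
    "\<And>w. w \<in> tensors [M', V'] \<Longrightarrow> g (Rc R M V w) = w"
    "\<And>v. v \<in> tensors [V', M'] \<Longrightarrow> Rc R M V (g v) = v"
    by (rule Rc_inverse[OF M V]) (rule that)
  obtain h where h: "h \<in> tlin [M', V'] [V', M']"
    "\<And>w. w \<in> tensors [V', M'] \<Longrightarrow> h (Rc R V M w) = w"
    "\<And>v. v \<in> tensors [M', V'] \<Longrightarrow> Rc R V M (h v) = v"
    by (rule Rc_inverse[OF V M]) (rule that)
  have U0: "umods ([] :: ('u, 'a) module list)" by (simp add: umods_simps)
  have "idt (ks []) [M', V'] [M', V'] (ks (replicate (k - 1) V)) \<kappa> \<in> Units (EndU Ns)"
  proof (rule idt_Units[OF M V U0 umods_replicate[OF V] \<kappa>_lin _ lin_comp[OF h(1) g(1)] _ _ split_Ns1])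
    fix a w assume a: "a \<in> carrier U" and w: "w \<in> tensors [M', V']"
    show "\<kappa> (fw [M, V] (\<Delta> a) w) = fw [M, V] (\<Delta> a) (\<kappa> w)"
      unfolding Rc_intertwines[OF M V a w] Rc_intertwines[OF V M a Rc_closed[OF M V R_closed w]] ..
  next
    fix w assume w: "w \<in> tensors [M', V']"
    show "\<kappa> (g (h w)) = w" unfolding g(3)[OF lin_closed[OF h(1) w]] by (rule h(3)[OF w])
    show "g (h (\<kappa> w)) = w" unfolding h(2)[OF Rc_closed[OF M V R_closed w]] by (rule g(2)[OF w])
  qed
  then show ?thesis by (simp add: braid_op_def X1)
next
  case (T i)
  then have i: "i \<in> {1..k - 1}" using assms by (auto simp: affine_braid_gens_def)
  obtain g where g: "g \<in> tlin [V', V'] [V', V']"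
    "\<And>w. w \<in> tensors [V', V'] \<Longrightarrow> g (\<sigma> w) = w"
    "\<And>v. v \<in> tensors [V', V'] \<Longrightarrow> \<sigma> (g v) = v"
    by (rule Rc_inverse[OF V V]) (rule that)
  have U1: "umods (M # replicate (i - 1) V)" using M umods_replicate[OF V] by (simp add: umods_simps)
  have "idt (ks (M # replicate (i - 1) V)) [V', V'] [V', V'] (ks (replicate (k - i - 1) V)) \<sigma> \<in> Units (EndU Ns)"
    by (rule idt_Units[OF V V U1 umods_replicate[OF V] \<sigma>_lin Rc_intertwines[OF V V] g(1,3,2) split_Ns[OF i]])
  then show ?thesis by (simp add: braid_op_def T)
qed

lemma braid_op_closed:
  assumes "s \<in> affine_braid_gens k" "w \<in> tensors (M' # replicate k V')"
  shows "braid_op s w \<in> tensors (M' # replicate k V')"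
proof -
  interpret E: ring "EndU Ns" by (rule EndU_ring[OF umods_Ns])
  show ?thesis using EndU_closed[OF E.Units_closed[OF braid_op_Units[OF assms(1)]]] assms(2) by simp
qed

text \<open>Neighbouring generators act on three common factors, to which the Yang-Baxter equation
  applies.\<close>

lemma local_T:
  assumes "1 \<le> i" "i + 2 \<le> k" and w: "w \<in> tensors (M' # replicate k V')"
  shows "braid_op (T i) w = idt (M' # replicate (i - 1) V') [V', V', V'] [V', V', V'] (replicate (k - i - 2) V')
      (idt [] [V', V'] [V', V'] [V'] \<sigma>) w"
    and "braid_op (T (i + 1)) w = idt (M' # replicate (i - 1) V') [V', V', V'] [V', V', V'] (replicate (k - i - 2) V')
      (idt [V'] [V', V'] [V', V'] [] \<sigma>) w"
proof -
  have l: "replicate k V' = replicate (i - 1) V' @ [V', V', V'] @ replicate (k - i - 2) V'"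
    by (rule replicate_triple[symmetric]) (use assms in simp)
  have e1: "V' # replicate (k - i - 2) V' = replicate (k - i - 1) V'"
    using assms replicate_Suc[of "k - i - 2" V'] by (simp add: Suc_diff_Suc numeral_2_eq_2)
  have e2: "replicate (i - 1) V' @ [V'] = replicate i V'"
    using assms replicate_append_same[of "i - 1" V'] by (cases i) simp_all
  have e3: "k - (i + 1) - 1 = k - i - 2" by simp
  have w1: "w \<in> tensors ((M' # replicate (i - 1) V') @ [] @ [V', V'] @ [V'] @ replicate (k - i - 2) V')"
    using w unfolding l by simp
  have w2: "w \<in> tensors ((M' # replicate (i - 1) V') @ [V'] @ [V', V'] @ [] @ replicate (k - i - 2) V')"
    using w unfolding l by simp
  show "braid_op (T i) w = idt (M' # replicate (i - 1) V') [V', V', V'] [V', V', V'] (replicate (k - i - 2) V')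
      (idt [] [V', V'] [V', V'] [V'] \<sigma>) w"
    using idt_nest[OF MV_kmods(4,8,7,7,2,3) \<sigma>_lin w1] e1 by (simp add: braid_op_def)
  show "braid_op (T (i + 1)) w = idt (M' # replicate (i - 1) V') [V', V', V'] [V', V', V'] (replicate (k - i - 2) V')
      (idt [V'] [V', V'] [V', V'] [] \<sigma>) w"
    using idt_nest[OF MV_kmods(4,2,7,7,8,3) \<sigma>_lin w2] e2 by (simp add: braid_op_def)
qed

lemma braid_op_braid:
  assumes i: "1 \<le> i" "i + 2 \<le> k" and w: "w \<in> tensors (M' # replicate k V')"
  shows "braid_op (T i) (braid_op (T (i + 1)) (braid_op (T i) w)) =
    braid_op (T (i + 1)) (braid_op (T i) (braid_op (T (i + 1)) w))"
proof -
  have gens: "T i \<in> affine_braid_gens k" "T (i + 1) \<in> affine_braid_gens k"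
    using i by (auto simp: affine_braid_gens_def)
  note cl = braid_op_closed[OF gens(1)] braid_op_closed[OF gens(2)]
  note lo = local_T[OF i]
  let ?s = "idt [] [V', V'] [V', V'] [V'] \<sigma>" and ?t = "idt [V'] [V', V'] [V', V'] [] \<sigma>"
  have sl: "?s \<in> tlin [V', V', V'] [V', V', V']"
    using idt_lin_right[OF MV_kmods(7,7,2) \<sigma>_lin] by simp
  have tl: "?t \<in> tlin [V', V', V'] [V', V', V']"
    using idt_lin_left[OF MV_kmods(2,7,7) \<sigma>_lin] by simp
  let ?I = "idt (M' # replicate (i - 1) V') [V', V', V'] [V', V', V'] (replicate (k - i - 2) V')"
  have l: "replicate k V' = replicate (i - 1) V' @ [V', V', V'] @ replicate (k - i - 2) V'"
    by (rule replicate_triple[symmetric]) (use i in simp)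
  have w': "w \<in> tensors ((M' # replicate (i - 1) V') @ [V', V', V'] @ replicate (k - i - 2) V')"
    using w unfolding l by simp
  note comp = idt_comp[OF MV_kmods(4,9,9,9,3) _ _ w']
  have "braid_op (T i) (braid_op (T (i + 1)) (braid_op (T i) w)) = ?I ?s (?I ?t (?I ?s w))"
    unfolding lo(1)[OF cl(2)[OF cl(1)[OF w]]] unfolding lo(2)[OF cl(1)[OF w]] unfolding lo(1)[OF w] ..
  also have "\<dots> = ?I (\<lambda>y. ?s (?t (?s y))) w"
    unfolding idt_comp[OF MV_kmods(4,9,9,9,3) sl tl w'] idt_comp[OF MV_kmods(4,9,9,9,3) lin_comp[OF sl tl] sl w'] ..
  also have "\<dots> = ?I (\<lambda>y. ?t (?s (?t y))) w"
    by (rule fun_cong[OF idt_cong[OF MV_kmods(9) yang_baxter[OF V V V]]])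
  also have "\<dots> = ?I ?t (?I ?s (?I ?t w))"
    unfolding idt_comp[OF MV_kmods(4,9,9,9,3) tl sl w'] idt_comp[OF MV_kmods(4,9,9,9,3) lin_comp[OF tl sl] tl w'] ..
  also have "\<dots> = braid_op (T (i + 1)) (braid_op (T i) (braid_op (T (i + 1)) w))"
    unfolding lo(2)[OF cl(1)[OF cl(2)[OF w]]] unfolding lo(1)[OF cl(2)[OF w]] unfolding lo(2)[OF w] ..
  finally show ?thesis .
qed

lemma braid_op_reflection:
  assumes k2: "2 \<le> k" and w: "w \<in> tensors (M' # replicate k V')"
  shows "braid_op X1 (braid_op (T 1) (braid_op X1 (braid_op (T 1) w))) =
    braid_op (T 1) (braid_op X1 (braid_op (T 1) (braid_op X1 w)))"
proof -
  have gens: "X1 \<in> affine_braid_gens k" "T 1 \<in> affine_braid_gens k"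
    using k2 by (auto simp: affine_braid_gens_def)
  note cl = braid_op_closed[OF gens(1)] braid_op_closed[OF gens(2)]
  let ?x = "idt [] [M', V'] [M', V'] [V'] \<kappa>" and ?t = "idt [M'] [V', V'] [V', V'] [] \<sigma>"
  let ?I = "idt [] [M', V', V'] [M', V', V'] (replicate (k - 2) V')"
  have ek: "replicate k V' = V' # V' # replicate (k - 2) V'"
    using replicate_pair[of k 0 "k - 2" V'] k2 by simp
  have ek1: "replicate (k - 1) V' = V' # replicate (k - 2) V'" "replicate (k - Suc 0) V' = V' # replicate (k - 2) V'"
    using replicate_Suc[of "k - 2" V'] k2 by (simp_all add: Suc_diff_Suc numeral_2_eq_2)
  have xl: "?x \<in> tlin [M', V', V'] [M', V', V']"
    using idt_lin_right[OF MV_kmods(5,5,2) \<kappa>_lin] by simp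
  have tl: "?t \<in> tlin [M', V', V'] [M', V', V']"
    using idt_lin_left[OF MV_kmods(1,7,7) \<sigma>_lin] by simp
  have lx: "braid_op X1 y = ?I ?x y" if "y \<in> tensors (M' # replicate k V')" for y
    using idt_nest[OF MV_kmods(8,8,5,5,2) MV_kmods(3)[of "k - 2"] \<kappa>_lin, of y] that by (simp add: braid_op_def ek ek1)
  have lt: "braid_op (T 1) y = ?I ?t y" if "y \<in> tensors (M' # replicate k V')" for y
    using idt_nest[OF MV_kmods(8,1,7,7,8) MV_kmods(3)[of "k - 2"] \<sigma>_lin, of y] that by (simp add: braid_op_def ek ek1 numeral_2_eq_2)
  have w': "w \<in> tensors ([] @ [M', V', V'] @ replicate (k - 2) V')"
    using w by (simp add: ek)
  note comp = idt_comp[OF MV_kmods(8,10,10,10,3) _ _ w']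
  note xt = lin_comp[OF xl tl] and tx = lin_comp[OF tl xl]
  have "braid_op X1 (braid_op (T 1) (braid_op X1 (braid_op (T 1) w))) = ?I ?x (?I ?t (?I ?x (?I ?t w)))"
    unfolding lx[OF cl(2)[OF cl(1)[OF cl(2)[OF w]]]] unfolding lt[OF cl(1)[OF cl(2)[OF w]]]
    unfolding lx[OF cl(2)[OF w]] unfolding lt[OF w] ..
  also have "\<dots> = ?I (\<lambda>y. ?x (?t (?x (?t y)))) w"
    unfolding comp[OF tl xl] comp[OF tx tl] comp[OF lin_comp[OF tx tl] xl] ..
  also have "\<dots> = ?I (\<lambda>y. ?t (?x (?t (?x y)))) w"
    by (rule fun_cong[OF idt_cong[OF MV_kmods(10) reflection_equation[OF M V]]])
  also have "\<dots> = ?I ?t (?I ?x (?I ?t (?I ?x w)))"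
    unfolding comp[OF xl tl] comp[OF xt xl] comp[OF lin_comp[OF xt xl] tl] ..
  also have "\<dots> = braid_op (T 1) (braid_op X1 (braid_op (T 1) (braid_op X1 w)))"
    unfolding lt[OF cl(1)[OF cl(2)[OF cl(1)[OF w]]]] unfolding lx[OF cl(2)[OF cl(1)[OF w]]]
    unfolding lt[OF cl(1)[OF w]] unfolding lx[OF w] ..
  finally show ?thesis .
qed

lemma braid_op_far:
  assumes i: "1 \<le> i" and j: "i + 2 \<le> j" "j \<le> k - 1" and w: "w \<in> tensors (M' # replicate k V')"
  shows "braid_op (T i) (braid_op (T j) w) = braid_op (T j) (braid_op (T i) w)"
proof -
  have e1: "replicate (i - 1) V' @ [V', V'] @ replicate (j - i - 2) V' = replicate (j - 1) V'"
    by (rule replicate_pair) (use i j in linarith)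
  have e2: "replicate (j - i - 2) V' @ [V', V'] @ replicate (k - j - 1) V' = replicate (k - i - 1) V'"
    by (rule replicate_pair) (use i j in linarith)
  have e3: "replicate (i - 1) V' @ [V', V'] @ replicate (k - i - 1) V' = replicate k V'"
    by (rule replicate_pair) (use i j in linarith)
  have E1: "(M' # replicate (i - 1) V') @ [V', V'] @ replicate (j - i - 2) V' = M' # replicate (j - 1) V'"
    using e1 by simp
  have w': "w \<in> tensors ((M' # replicate (i - 1) V') @ [V', V'] @ replicate (j - i - 2) V' @ [V', V'] @ replicate (k - j - 1) V')"
    using w unfolding e2 using e3 by simp
  show ?thesis
    using idt_commute[OF MV_kmods(4,7,3,7,3) \<sigma>_lin \<sigma>_lin w'] unfolding E1 e2 by (simp add: braid_op_def)
qed

lemma braid_op_X1_far: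
  assumes i: "2 \<le> i" "i + 1 \<le> k" and w: "w \<in> tensors (M' # replicate k V')"
  shows "braid_op X1 (braid_op (T i) w) = braid_op (T i) (braid_op X1 w)"
proof -
  have e1: "V' # replicate (i - 2) V' = replicate (i - 1) V'"
    using i replicate_Suc[of "i - 2" V'] by (simp add: Suc_diff_Suc numeral_2_eq_2)
  have e2: "replicate (i - 2) V' @ [V', V'] @ replicate (k - i - 1) V' = replicate (k - 1) V'"
    by (rule replicate_pair) (use i in linarith)
  have e3: "V' # replicate (k - 1) V' = replicate k V'"
    using k by (cases k) simp_all
  have E1: "[] @ [M', V'] @ replicate (i - 2) V' = M' # replicate (i - 1) V'" using e1 by simp
  have w': "w \<in> tensors ([] @ [M', V'] @ replicate (i - 2) V' @ [V', V'] @ replicate (k - i - 1) V')"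
    using w unfolding e2 by (simp add: e3[unfolded One_nat_def])
  show ?thesis
    using idt_commute[OF MV_kmods(8,5,3,7,3) \<kappa>_lin \<sigma>_lin w'] unfolding E1 e2 by (simp add: braid_op_def)
qed

lemma braid_op_rel:
  assumes r: "(u, v) \<in> affine_braid_rels k" and w: "w \<in> tensors (M' # replicate k V')"
  shows "foldr braid_op u w = foldr braid_op v w"
proof -
  from r consider (far) i j where "u = [T i, T j]" "v = [T j, T i]" "i \<in> {1..k - 1}" "j \<in> {1..k - 1}" "j \<noteq> i + 1" "i \<noteq> j + 1"
    | (braid) i where "u = [T i, T (i + 1), T i]" "v = [T (i + 1), T i, T (i + 1)]" "1 \<le> i" "i + 2 \<le> k"
    | (refl) "u = [X1, T 1, X1, T 1]" "v = [T 1, X1, T 1, X1]" "2 \<le> k"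
    | (xfar) i where "u = [X1, T i]" "v = [T i, X1]" "2 \<le> i" "i + 1 \<le> k"
    unfolding affine_braid_rels_def by blast
  then show ?thesis
  proof cases
    case far
    consider "i = j" | "i + 2 \<le> j" | "j + 2 \<le> i" using far(5,6) by linarith
    then show ?thesis
    proof cases
      case 1 then show ?thesis using far by simp
    next
      case 2 then show ?thesis using far braid_op_far[of i j w] w by simp
    next
      case 3 then show ?thesis using far braid_op_far[of j i w] w by simp
    qed
  next
    case braid then show ?thesis using braid_op_braid[OF _ _ w] by simp
  next
    case refl then show ?thesis using braid_op_reflection[OF _ w] by simp
  next
    case xfar then show ?thesis using braid_op_X1_far[OF _ _ w] by simp
  qed
qed

lemma rels_gens: "(u, v) \<in> affine_braid_rels k \<Longrightarrow> set u \<subseteq> affine_braid_gens k \<and> set v \<subseteq> affine_braid_gens k"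
  unfolding affine_braid_rels_def affine_braid_gens_def by auto

lemma braid_op_rep: "presentation_rep (affine_braid_gens k) (affine_braid_rels k) (EndU Ns) braid_op"
proof -
  interpret E: ring "EndU Ns" by (rule EndU_ring[OF umods_Ns])
  show ?thesis
  proof unfold_locales
    fix u v assume r: "(u, v) \<in> affine_braid_rels k"
    show "set u \<subseteq> affine_braid_gens k \<and> set v \<subseteq> affine_braid_gens k" by (rule rels_gens[OF r])
    have m: "braid_op s \<in> carrier (EndU Ns)" if "s \<in> affine_braid_gens k" for s
      by (rule E.Units_closed[OF braid_op_Units[OF that]])
    have mu: "braid_op s \<in> carrier (EndU Ns)" if "s \<in> set u" for s using m rels_gens[OF r] that by blast
    have mv: "braid_op s \<in> carrier (EndU Ns)" if "s \<in> set v" for s using m rels_gens[OF r] that by blast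
    note fu = EndU_foldr[OF umods_Ns, where \<phi> = braid_op and u = u, OF mu]
      and fv = EndU_foldr[OF umods_Ns, where \<phi> = braid_op and u = v, OF mv]
    show "foldr (\<lambda>s x. braid_op s \<otimes>\<^bsub>EndU Ns\<^esub> x) u \<one>\<^bsub>EndU Ns\<^esub> = foldr (\<lambda>s x. braid_op s \<otimes>\<^bsub>EndU Ns\<^esub> x) v \<one>\<^bsub>EndU Ns\<^esub>"
    proof (rule EndU_eqI)
      fix w assume w: "w \<in> tensors (ks Ns)"
      then have w': "w \<in> tensors (M' # replicate k V')" by simp
      show "foldr (\<lambda>s x. braid_op s \<otimes>\<^bsub>EndU Ns\<^esub> x) u \<one>\<^bsub>EndU Ns\<^esub> w = foldr (\<lambda>s x. braid_op s \<otimes>\<^bsub>EndU Ns\<^esub> x) v \<one>\<^bsub>EndU Ns\<^esub> w"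
        using fu fv w braid_op_rel[OF r w'] by simp
    qed (use fu fv in blast)+
  qed (rule braid_op_Units)
qed

text \<open>The operator of \<open>T i\<close> does not touch the factor \<open>M\<close>. The double braiding carries the action of
  \<open>z\<close> on \<open>M\<close> to the other side of \<open>V\<close> and back.\<close>

lemma central_op_commutes:
  assumes z: "z \<in> carrier (center U)" and s: "s \<in> affine_braid_gens k"
    and w: "w \<in> tensors (M' # replicate k V')"
  shows "central_op z (braid_op s w) = braid_op s (central_op z w)"
proof -
  let ?f = "fw [M] (pure [U] [z])"
  have zU: "z \<in> carrier U" using z by (simp add: center_iff)
  have p: "pure [U] [z] \<in> tensors [U]" by (rule pure_closed[OF UU_kmods(1) tuples_smallI(1)[OF zU]])
  note fl = fw1_lin2[OF M p]
  show ?thesis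
  proof (cases s)
    case (T i)
    then have i: "i \<in> {1..k - 1}" using s by (auto simp: affine_braid_gens_def)
    have e: "replicate (i - 1) V' @ [V', V'] @ replicate (k - i - 1) V' = replicate k V'"
      by (rule replicate_pair) (use i in auto)
    have w': "w \<in> tensors ([] @ [M'] @ replicate (i - 1) V' @ [V', V'] @ replicate (k - i - 1) V')"
      using w unfolding e by simp
    show ?thesis
      using idt_commute[OF MV_kmods(8,1,3,7,3) fl \<sigma>_lin w'] unfolding e
      by (simp add: braid_op_def central_op_def T)
  next
    case X1
    let ?g = "idt [] [M'] [M'] [V'] ?f"
    let ?I = "idt [] [M', V'] [M', V'] (replicate (k - 1) V')"
    have ek: "replicate k V' = V' # replicate (k - 1) V'" using k by (cases k) simp_all
    have gl: "?g \<in> tlin [M', V'] [M', V']"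
      using idt_lin_right[OF MV_kmods(1,1,2) fl] by simp
    have c: "central_op z y = ?I ?g y" if "y \<in> tensors (M' # replicate k V')" for y
      using idt_nest[OF MV_kmods(8,8,1,1,2) MV_kmods(3)[of "k - 1"] fl, of y] that by (simp add: central_op_def ek)
    have x: "braid_op X1 = ?I \<kappa>" by (simp add: braid_op_def)
    have w': "w \<in> tensors ([] @ [M', V'] @ replicate (k - 1) V')" using w by (simp add: ek)
    note comp = idt_comp[OF MV_kmods(8,5,5,5,3) _ _ w']
    have loc: "?g (\<kappa> y) = \<kappa> (?g y)" if y: "y \<in> tensors [M', V']" for y
      unfolding braiding_center(1)[OF M V z y] braiding_center(2)[OF V M z Rc_closed[OF M V R_closed y]] ..
    have xw: "braid_op X1 w \<in> tensors (M' # replicate k V')"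
      by (rule braid_op_closed[OF _ w]) (simp add: affine_braid_gens_def)
    have "central_op z (braid_op X1 w) = ?I ?g (?I \<kappa> w)" unfolding c[OF xw] unfolding x ..
    also have "\<dots> = ?I (\<lambda>y. ?g (\<kappa> y)) w" by (rule comp[OF \<kappa>_lin gl])
    also have "\<dots> = ?I (\<lambda>y. \<kappa> (?g y)) w" by (rule fun_cong[OF idt_cong[OF MV_kmods(5) loc]])
    also have "\<dots> = ?I \<kappa> (?I ?g w)" by (rule comp[OF gl \<kappa>_lin, THEN HOL.sym])
    also have "\<dots> = braid_op X1 (central_op z w)" unfolding c[OF w] x ..
    finally show ?thesis unfolding X1 .
  qed
qed

lemma central_op_hom: "central_op \<in> ring_hom (center U) (EndU Ns)"
  using central_hom[OF M umods_replicate[OF V, of k]] unfolding central_op_def[abs_def] by simp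

text \<open>The operators are units of the ring of \<open>U\<close>-endomorphisms that satisfy the defining relations
  and commute with the central operators, so \<open>presented_group_algebra_hom\<close> provides the homomorphism.
  That its values are \<open>U\<close>-linear is membership in the target.\<close>

theorem affine_braid_action:
  defines "C \<equiv> center U" and "B \<equiv> affine_braid_group k" and "MV \<equiv> tensor_umodule U \<Delta> \<epsilon> Ns"
  shows "\<exists>!\<Phi>. \<Phi> \<in> extensional (carrier (group_algebra C B)) \<and>
    \<Phi> \<in> ring_hom (group_algebra C B) (End_ring U MV) \<and>
    (\<forall>i\<in>{1..k - 1}.
       \<Phi> (group_algebra_monom C B \<one>\<^bsub>U\<^esub> (braid_generator k (T i))) =
       idt (M' # replicate (i - 1) V') [V', V'] [V', V'] (replicate (k - i - 1) V') \<sigma>) \<and>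
    \<Phi> (group_algebra_monom C B \<one>\<^bsub>U\<^esub> (braid_generator k X1)) =
      idt [] [M', V'] [M', V'] (replicate (k - 1) V') \<kappa> \<and>
    (\<forall>z\<in>carrier C.
       \<Phi> (group_algebra_monom C B z \<one>\<^bsub>B\<^esub>) =
       idt [] [M'] [M'] (replicate k V') (fw [M] (pure [U] [z]))) \<and>
    left_module (group_algebra C B) (with_action MV \<Phi>) \<and>
    (\<forall>b\<in>carrier (group_algebra C B). \<forall>a\<in>carrier U. \<forall>w\<in>carrier MV.
       \<Phi> b (a \<odot>\<^bsub>MV\<^esub> w) = a \<odot>\<^bsub>MV\<^esub> \<Phi> b w)" (is "\<exists>!\<Phi>. ?P \<Phi>")
proof -
  note E = EndU_ring[OF umods_Ns]
  interpret E: ring "EndU Ns" by (rule E)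
  have comm: "central_op z \<otimes>\<^bsub>EndU Ns\<^esub> braid_op s = braid_op s \<otimes>\<^bsub>EndU Ns\<^esub> central_op z"
    if z: "z \<in> carrier (center U)" and s: "s \<in> affine_braid_gens k" for z s
  proof -
    note c = ring_hom_closed[OF central_op_hom z] E.Units_closed[OF braid_op_Units[OF s]]
    show ?thesis
      by (rule EndU_eqI[OF E.m_closed[OF c] E.m_closed[OF c(2,1)]])
        (simp add: EndU_mult_apply central_op_commutes[OF z s])
  qed
  note ex = presented_group_algebra_hom[OF braid_op_rep center_ring E central_op_hom comm]
  have CB: "ring (group_algebra C B)"
  proof -
    interpret pr: presentation_rep "affine_braid_gens k" "affine_braid_rels k" "EndU Ns" braid_op by (rule braid_op_rep)
    interpret GR: group_ring C B
      unfolding C_def B_def group_ring_def using center_ring pr.P_group by blast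
    show ?thesis by (rule GR.GA_ring)
  qed
  have mod: "left_module (group_algebra C B) (with_action MV \<Phi>)"
    if "\<Phi> \<in> ring_hom (group_algebra C B) (End_ring U MV)" for \<Phi>
    by (rule End_ring_left_module[OF tensor_umodule_abelian_group[OF umods_Ns, folded MV_def] CB that])
  have lin: "\<Phi> b (a \<odot>\<^bsub>MV\<^esub> w) = a \<odot>\<^bsub>MV\<^esub> \<Phi> b w"
    if "\<Phi> \<in> ring_hom (group_algebra C B) (End_ring U MV)" "b \<in> carrier (group_algebra C B)" "a \<in> carrier U" "w \<in> carrier MV"
    for \<Phi> b a w
    using ring_hom_closed[OF that(1,2)] that(3,4) by (simp add: End_ring_def linear_maps_def)
  have gens: "(\<forall>s\<in>affine_braid_gens k. Q s) \<longleftrightarrow> (\<forall>i\<in>{1..k - 1}. Q (T i)) \<and> Q X1" for Q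
    by (auto simp: affine_braid_gens_def)
  have "?P \<Phi> \<longleftrightarrow> \<Phi> \<in> extensional (carrier (group_algebra C B)) \<and> \<Phi> \<in> ring_hom (group_algebra C B) (EndU Ns) \<and>
    (\<forall>s\<in>affine_braid_gens k. \<Phi> (group_algebra_monom C B \<one>\<^bsub>C\<^esub> (word_class (affine_braid_gens k) (affine_braid_rels k) [(s, True)])) = braid_op s) \<and>
    (\<forall>c\<in>carrier C. \<Phi> (group_algebra_monom C B c \<one>\<^bsub>B\<^esub>) = central_op c)" for \<Phi>
    unfolding gens using mod[of \<Phi>] lin[of \<Phi>]
    by (auto simp: braid_op_def central_op_def braid_generator_def C_def center_simps MV_def)
  then show ?thesis using ex unfolding C_def B_def by simp
qed

end

end

theorem theorem1p3:
  fixes sc :: "complex \<Rightarrow> 'g \<Rightarrow> 'g::ab_group_add"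
    and br :: "'g \<Rightarrow> 'g \<Rightarrow> 'g"
    and form :: "'g \<Rightarrow> 'g \<Rightarrow> complex"
    and H :: "'g set" and l :: nat and e f :: "nat \<Rightarrow> 'g" and \<alpha> :: "nat \<Rightarrow> 'g \<Rightarrow> complex"
    and U :: "(complex fps, 'g free_h_alg set) module"
    and \<Delta> \<epsilon> S R v
    and M V :: "('g free_h_alg set, 'a) module"
    and k :: nat
  defines "MV \<equiv> tensor_umodule U \<Delta> \<epsilon> (M # replicate k V)"
    and "M' \<equiv> restrict_scalars U M"
    and "V' \<equiv> restrict_scalars U V"
    and "C \<equiv> center U"
    and "B \<equiv> affine_braid_group k"
  assumes "quadratic_lie_algebra sc br form"
    and "chevalley_generators sc br form H l e f \<alpha>"
    and "U = quantum_group sc br form H l e f \<alpha>"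
    and "quantum_group_comult sc br form H l e f \<alpha> \<Delta>"
    and "ribbon_hopf_algebra U \<Delta> \<epsilon> S R v"
    and "left_module U M"
    and "left_module U V"
    and "k \<ge> 1"
  shows "\<exists>!\<Phi>. \<Phi> \<in> extensional (carrier (group_algebra C B)) \<and>
    \<Phi> \<in> ring_hom (group_algebra C B) (End_ring U MV) \<and>
    (\<forall>i\<in>{1..k - 1}.
       \<Phi> (group_algebra_monom C B \<one>\<^bsub>U\<^esub> (braid_generator k (T i))) =
       id_tensor_id (M' # replicate (i - 1) V') [V', V'] [V', V'] (replicate (k - i - 1) V')
         (R_check U R V V)) \<and>
    \<Phi> (group_algebra_monom C B \<one>\<^bsub>U\<^esub> (braid_generator k X1)) =
      id_tensor_id [] [M', V'] [M', V'] (replicate (k - 1) V')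
        (\<lambda>x. R_check U R V M (R_check U R M V x)) \<and>
    (\<forall>z\<in>carrier C.
       \<Phi> (group_algebra_monom C B z \<one>\<^bsub>B\<^esub>) =
       id_tensor_id [] [M'] [M'] (replicate k V') (factorwise_action U [M] (pure [U] [z]))) \<and>
    left_module (group_algebra C B) (with_action MV \<Phi>) \<and>
    (\<forall>b\<in>carrier (group_algebra C B). \<forall>a\<in>carrier U. \<forall>w\<in>carrier MV.
       \<Phi> b (a \<odot>\<^bsub>MV\<^esub> w) = a \<odot>\<^bsub>MV\<^esub> \<Phi> b w)"
proof -
  have "quasitriangular_hopf_algebra U \<Delta> \<epsilon> S R"
    using \<open>ribbon_hopf_algebra U \<Delta> \<epsilon> S R v\<close> by (simp add: ribbon_hopf_algebra_def)
  from quasitriangular_hopf_algebra.affine_braid_action[OF this \<open>left_module U M\<close> \<open>left_module U V\<close> \<open>k \<ge> 1\<close>]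
  show ?thesis unfolding MV_def M'_def V'_def C_def B_def .
qed

end
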